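(* Let $A$ be a real $n\times n$ matrix whose eigenvalues are all real and positive and let $M=e^{A}$ (so all eigenvalues of $M$ are greater than one). Let $\mathcal{G}$ be a uniform group of $QSim_{D_M}$ maps of $(\mathbb{R}^n,D_M)$ that acts cocompactly. Then there exists a $QSim_{D_M}$ map $F$ such that $$F\,\mathcal{G}\,F^{-1}\subset ASim_{D_M}(\mathbb{R}^n).$$
   Context: Ordered basis $\mathcal{B}$. For each eigenvalue $\alpha$ of $A$ let $V_\alpha$ be the generalized eigenspace and let $\{v_i^\alpha\}_i$ be generators of Jordan chains in $V_\alpha$, with lengths $n_i$, so $(A-\alpha I)^{n_i}v_i^\alpha=0$, $(A-\alpha I)^{n_i-1}v_i^\alpha\neq 0$, and $\mathcal{B}_\alpha=\bigcup_i\{(A-\alpha I)^{n_i-1}v_i^\alpha,\ldots,(A-\alpha I)v_i^\alpha,v_i^\alpha\}$ is a basis of $V_\alpha$. For $\ell\ge 1$ put $\mathcal{B}_{\alpha,\ell}=\mathcal{B}_\alpha\cap(\ker(A-\alpha I)^{\ell}\setminus\ker(A-\alpha I)^{\ell-1})$. Then $\mathcal{B}=\bigcup_{\alpha,\ell}\mathcal{B}_{\alpha,\ell}$ is a basis of $\mathbb{R}^n$. Order the pairs $(\alpha,\ell)$ with $\mathcal{B}_{\alpha,\ell}\ne\emptyset$ by $(\alpha,\ell)>(\beta,\iota)$ iff $\alpha>\beta$, or $\alpha=\beta$ and $\ell>\iota$. Let $\mathbf{x}_{\alpha,\ell}$ be the vector of coefficients with respect to $\mathcal{B}_{\alpha,\ell}$.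 Numbering the pairs in ascending order $1,\ldots,r$, points are written $(\mathbf{x}_1,\ldots,\mathbf{x}_r)$. Boundary metric. Let $\|\cdot\|$ be the coordinate-wise max norm in the coordinates given by $\mathcal{B}$. For $p\ne q$, $D_M(p,q)=e^{t_0}$, where $t_0$ is the smallest $t\in\mathbb{R}$ with $\|e^{-tA}(p-q)\|\le 1$; and $D_M(p,p)=0$. Write $M^s=e^{sA}$. Maps. $F:\mathbb{R}^n\to\mathbb{R}^n$ is a ($K$-)$Bilip_{D_M}$ map if $\frac1K D_M(p,q)\le D_M(F(p),F(q))\le K D_M(p,q)$ for all $p,q$, for some constant $K$. $F$ is a $Sim_{D_M}$ map if there is a constant $c$ with $D_M(p,q)=e^cD_M(F(p),F(q))$ for all $p,q$. A ($K$-)$QSim_{D_M}$ map is a composition of a ($K$-)$Bilip_{D_M}$ map with a $Sim_{D_M}$ map. A group $\mathcal{G}$ of (bijective) $QSim_{D_M}$ maps is uniform if there is one constant $K$ such that every element of $\mathcal{G}$ is a $K$-$QSim_{D_M}$ map. Cocompact action: $\mathcal{G}$ acts cocompactly on the space of distinct pairs of points $\{(a,b)\in\mathbb{R}^n\times\mathbb{R}^n: a\neq b\}$ (diagonal action). Almost similarities. $ASim_{D_M}(\mathbb{R}^n)$ is the set of $QSim_{D_M}$ maps that preserve the flag of foliations by cosets of the spans $U_{\alpha,\ell}=\mathrm{span}\bigcup_{(\beta,j)<(\alpha,\ell)}\mathcal{B}_{\beta,j}$ and induce along the leaves similarities with dilation and rotation constants compatible with $M$; explicitly, the $QSim_{D_M}$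 maps of the form $$(\mathbf{x}_1,\ldots,\mathbf{x}_r)\mapsto M^{s}\bigl(A_1(\mathbf{x}_1+B_1(\mathbf{x}_2,\ldots,\mathbf{x}_r)),\,\ldots,\,A_{r-1}(\mathbf{x}_{r-1}+B_{r-1}(\mathbf{x}_r)),\,A_r(\mathbf{x}_r+B_r)\bigr),$$ where $s\in\mathbb{R}$, each $A_i$ is a constant orthogonal matrix acting on the $\mathbf{x}_i$ coordinates, $B_i$ is a function of $\mathbf{x}_{i+1},\ldots,\mathbf{x}_r$, and $B_r$ is a constant vector. *)

theory Defs
  imports "HOL-Analysis.Analysis" "HOL-Algebra.Bij"
begin

section \<open>Linear algebra of a real square matrix\<close>

definition eigenvalue :: "'a::field^'n^'n \<Rightarrow> 'a \<Rightarrow> bool" where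
  "eigenvalue A \<alpha> \<longleftrightarrow> (\<exists>v. v \<noteq> 0 \<and> A *v v = \<alpha> *s v)"

definition nil_pow :: "real^'n^'n \<Rightarrow> real \<Rightarrow> nat \<Rightarrow> real^'n \<Rightarrow> real^'n" where
  "nil_pow A \<alpha> k = (\<lambda>x. (A - mat \<alpha>) *v x) ^^ k"

definition ker_pow :: "real^'n^'n \<Rightarrow> real \<Rightarrow> nat \<Rightarrow> (real^'n) set" where
  "ker_pow A \<alpha> k = {x. nil_pow A \<alpha> k x = 0}"

definition gen_eigenspace :: "real^'n^'n \<Rightarrow> real \<Rightarrow> (real^'n) set" where
  "gen_eigenspace A \<alpha> = (\<Union>k. ker_pow A \<alpha> k)"

text \<open>The library's power operation on \<open>real^'n^'n\<close> is entrywise, and its \<open>exp\<close> does not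
  cover matrices, so both are defined here from the matrix product.\<close>

definition matrix_power :: "real^'n^'n \<Rightarrow> nat \<Rightarrow> real^'n^'n" where
  "matrix_power A k = ((\<lambda>X. A ** X) ^^ k) (mat 1)"

definition matrix_exp :: "real^'n^'n \<Rightarrow> real^'n^'n" where
  "matrix_exp A = (\<Sum>k. (1 / fact k) *\<^sub>R matrix_power A k)"


section \<open>Jordan bases\<close>

text \<open>A pair \<open>(v, m) \<in> G\<close> is a generator of a Jordan chain together with the length of the chain
  (\<open>m \<ge> 1\<close> is implied). Injectivity says that distinct chains have no vector in common, i.e.
  that the chain vectors form a basis as a family and not merely as a set.\<close>

definition jordan_chain_basis ::
    "real^'n^'n \<Rightarrow> real \<Rightarrow> ((real^'n) \<times> nat) set \<Rightarrow> (real^'n) set \<Rightarrow> bool" where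
  "jordan_chain_basis A \<alpha> G S \<longleftrightarrow>
     (\<forall>(v, m)\<in>G. nil_pow A \<alpha> m v = 0 \<and> nil_pow A \<alpha> (m - 1) v \<noteq> 0) \<and>
     inj_on (\<lambda>((v, m), j). nil_pow A \<alpha> j v) {((v, m), j). (v, m) \<in> G \<and> j < m} \<and>
     S = (\<Union>(v, m)\<in>G. (\<lambda>j. nil_pow A \<alpha> j v) ` {..<m}) \<and>
     independent S \<and> span S = gen_eigenspace A \<alpha>"

definition jordan_basis :: "real^'n^'n \<Rightarrow> (real^'n) set \<Rightarrow> bool" where
  "jordan_basis A B \<longleftrightarrow>
     (\<exists>G S. (\<forall>\<alpha>. eigenvalue A \<alpha> \<longrightarrow> jordan_chain_basis A \<alpha> (G \<alpha>) (S \<alpha>)) \<and>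
            B = (\<Union>\<alpha>\<in>{\<alpha>. eigenvalue A \<alpha>}. S \<alpha>))"

text \<open>For a Jordan basis \<open>B\<close>, the chosen basis of the generalized eigenspace of \<open>\<alpha>\<close> is recovered
  as \<open>B \<inter> gen_eigenspace A \<alpha>\<close>.\<close>

definition block :: "real^'n^'n \<Rightarrow> (real^'n) set \<Rightarrow> real \<times> nat \<Rightarrow> (real^'n) set" where
  "block A B = (\<lambda>(\<alpha>, l). (B \<inter> gen_eigenspace A \<alpha>) \<inter> (ker_pow A \<alpha> l - ker_pow A \<alpha> (l - 1)))"

definition block_indices :: "real^'n^'n \<Rightarrow> (real^'n) set \<Rightarrow> (real \<times> nat) set" where
  "block_indices A B = {(\<alpha>, l). eigenvalue A \<alpha> \<and> 1 \<le> l \<and> block A B (\<alpha>, l) \<noteq> {}}"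

text \<open>The order on pairs provided by the imported theories is componentwise, not lexicographic.\<close>

definition block_less :: "real \<times> nat \<Rightarrow> real \<times> nat \<Rightarrow> bool" where
  "block_less = (\<lambda>(\<beta>, j) (\<alpha>, l). \<beta> < \<alpha> \<or> (\<beta> = \<alpha> \<and> j < l))"


section \<open>The boundary metric and its maps\<close>

definition max_norm :: "(real^'n) set \<Rightarrow> real^'n \<Rightarrow> real" where
  "max_norm B x = Max ((\<lambda>b. \<bar>representation B x b\<bar>) ` B)"

definition D_M :: "real^'n^'n \<Rightarrow> (real^'n) set \<Rightarrow> real^'n \<Rightarrow> real^'n \<Rightarrow> real" where
  "D_M A B p q =
     (if p = q then 0
      else exp (LEAST t::real. max_norm B (matrix_exp ((- t) *\<^sub>R A) *v (p - q)) \<le> 1))"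

text \<open>The constant has to be positive: with \<open>1 / 0 = 0\<close>, a constant map would otherwise satisfy
  the inequalities for \<open>K = 0\<close>. For positive \<open>K\<close> they force \<open>K \<ge> 1\<close>.\<close>

definition Bilip :: "real^'n^'n \<Rightarrow> (real^'n) set \<Rightarrow> real \<Rightarrow> (real^'n \<Rightarrow> real^'n) \<Rightarrow> bool" where
  "Bilip A B K F \<longleftrightarrow> 1 \<le> K \<and>
     (\<forall>p q. (1 / K) * D_M A B p q \<le> D_M A B (F p) (F q) \<and>
            D_M A B (F p) (F q) \<le> K * D_M A B p q)"

definition Sim :: "real^'n^'n \<Rightarrow> (real^'n) set \<Rightarrow> (real^'n \<Rightarrow> real^'n) \<Rightarrow> bool" where
  "Sim A B F \<longleftrightarrow> (\<exists>c. \<forall>p q. D_M A B p q = exp c * D_M A B (F p) (F q))"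

definition KQSim :: "real^'n^'n \<Rightarrow> (real^'n) set \<Rightarrow> real \<Rightarrow> (real^'n \<Rightarrow> real^'n) \<Rightarrow> bool" where
  "KQSim A B K F \<longleftrightarrow> (\<exists>f \<sigma>. Bilip A B K f \<and> Sim A B \<sigma> \<and> F = f \<circ> \<sigma>)"

definition QSim :: "real^'n^'n \<Rightarrow> (real^'n) set \<Rightarrow> (real^'n \<Rightarrow> real^'n) \<Rightarrow> bool" where
  "QSim A B F \<longleftrightarrow> (\<exists>K. KQSim A B K F)"

definition uniform_QSim_group ::
    "real^'n^'n \<Rightarrow> (real^'n) set \<Rightarrow> (real^'n \<Rightarrow> real^'n) set \<Rightarrow> bool" where
  "uniform_QSim_group A B \<G> \<longleftrightarrow>
     subgroup \<G> (BijGroup UNIV) \<and> (\<exists>K. \<forall>g\<in>\<G>. KQSim A B K g)"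

text \<open>The topology on the space of pairs is the Euclidean one, which is also that of \<open>D_M\<close>.\<close>

definition cocompact_on_distinct_pairs :: "(real^'n \<Rightarrow> real^'n) set \<Rightarrow> bool" where
  "cocompact_on_distinct_pairs \<G> \<longleftrightarrow>
     (\<exists>C. compact C \<and> C \<subseteq> {(a, b). a \<noteq> b} \<and>
          (\<Union>g\<in>\<G>. map_prod g g ` C) = {(a, b). a \<noteq> b})"


section \<open>Almost similarities\<close>

definition orthogonal_matrix_on :: "'b set \<Rightarrow> ('b \<Rightarrow> 'b \<Rightarrow> real) \<Rightarrow> bool" where
  "orthogonal_matrix_on S Q \<longleftrightarrow>
     (\<forall>b\<in>S. \<forall>c\<in>S. (\<Sum>d\<in>S. Q d b * Q d c) = (if b = c then 1 else 0))"

text \<open>\<open>Q p\<close> is the matrix \<open>A\<^sub>p\<close> in the coordinates given by the block of \<open>p\<close>, and \<open>T p x c\<close> is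
  the coordinate of \<open>B\<^sub>p\<close> at the basis vector \<open>c\<close>. The value \<open>T p x\<close> may depend only on the
  coordinates of \<open>x\<close> in strictly higher blocks; in particular it is constant for the highest block.\<close>

definition ASim :: "real^'n^'n \<Rightarrow> (real^'n) set \<Rightarrow> (real^'n \<Rightarrow> real^'n) set" where
  "ASim A B = {F. QSim A B F \<and>
     (\<exists>(s::real) (Q :: real \<times> nat \<Rightarrow> real^'n \<Rightarrow> real^'n \<Rightarrow> real)
        (T :: real \<times> nat \<Rightarrow> real^'n \<Rightarrow> real^'n \<Rightarrow> real).
        (\<forall>p\<in>block_indices A B. orthogonal_matrix_on (block A B p) (Q p)) \<and>
        (\<forall>p\<in>block_indices A B. \<forall>x y.
           (\<forall>q\<in>block_indices A B. block_less p q \<longrightarrow>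
              (\<forall>b\<in>block A B q. representation B x b = representation B y b)) \<longrightarrow>
           (\<forall>c\<in>block A B p. T p x c = T p y c)) \<and>
        (\<forall>x. F x = matrix_exp (s *\<^sub>R A) *v
           (\<Sum>p\<in>block_indices A B. \<Sum>b\<in>block A B p.
              (\<Sum>c\<in>block A B p. Q p b c * (representation B x c + T p x c)) *\<^sub>R b)))}"

end

theory Submission
  imports Defs "HOL-Computational_Algebra.Fundamental_Theorem_Algebra"
begin

text \<open>Let \<open>\<Phi> t\<close> be the flow of \<open>A\<close>. Fix an eigenvalue \<open>\<alpha>\<close>. The vectors on which the flow grows at
  most like \<open>exp (\<alpha> * t)\<close> form a subspace \<open>E\<close> that is mapped to itself, coset by coset, and
  they have a leading term in the \<open>\<alpha>\<close>-eigenspace. The ratios of the lengths of these terms,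
  maximized over the group, form an invariant function on pairs of points in one coset of \<open>E\<close>. A finite
  averaging over translations and scales finds places and scales where this function is almost a
  norm; zooming in there and returning to a fixed compact set of pairs by cocompactness, a
  subsequential limit conjugates the group to one that acts on each coset by isometries between
  two translation invariant norms, hence by affine maps (Mazur-Ulam). This is done for one
  eigenvalue after the other, and it persists in later limits.

  The linear part \<open>L\<close> at \<open>\<alpha>\<close> is then the same on all cosets, and it also governs the
  higher blocks of \<open>\<alpha>\<close>: crossing \<open>u\<close> in many small steps at a fine scale shows that the increment of
  a group element along \<open>u\<close> has leading term \<open>L\<close> of the leading term of \<open>u\<close>. The determinant of the linear
  parts yields a homomorphism \<open>\<psi>\<close> that is boundedly close to the logarithmic dilation, so after
  division by \<open>exp (\<alpha> * \<psi>)\<close> the linear parts form a bounded group, which preserves an inner product.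
  Gram-Schmidt along the flag of ends of long Jordan chains gives a linear map commuting with the
  flow that makes the inner product standard; conjugating by it gives almost similarities.\<close>

section \<open>Midpoints of isometries and almost invariant averages\<close>

text \<open>Quasi-similarity constants record only how fast \<open>\<Phi> t (p - q)\<close> grows,
  never a direction. Hence every invariant object is read off from growth: subspaces are growth
  classes, linear parts are limits for large time. The maps come with no differentiability to
  linearize them by; a convexity gap that telescopes over dyadic scales takes the place of a
  derivative. It can be made small only for finitely many test data at a time, while a limit is
  wanted at uncountably many points at once, so limits are taken along filters over the finite sets
  of test data. The dilation exponent of a group element is determined only up to a bounded error
  and is not additive; the logarithm of a determinant is additive, and so it replaces the exponent.
  Finally, the blocks of one eigenvalue cannot be rotated independently: the last change of
  coordinates must commute with the nilpotent part, hence respect which eigenvectors end long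
  chains. This dictates the order of Gram-Schmidt, and the rotation of a higher block is then a
  restriction of the one on the eigenspace.\<close>

lemma pointwise_cluster:
  fixes f :: "'k \<Rightarrow> 'x \<Rightarrow> 'b::euclidean_space"
  assumes F: "F \<noteq> bot" and bd: "\<And>k x. norm (f k x) \<le> bd x"
  obtains F' g where "F' \<le> F" "F' \<noteq> bot" "\<And>x. ((\<lambda>k. f k x) \<longlongrightarrow> g x) F'"
proof -
  \<comment> \<open>Tychonoff: all \<open>f k\<close> lie in one product of balls, so their image
    filter has a cluster point. A subsequence would not be enough, because convergence is wanted at
    every point of an arbitrary index type.\<close>
  let ?P = "PiE UNIV (\<lambda>x. cball (0::'b) (bd x))"
  have "compactin (product_topology (\<lambda>_. euclidean) UNIV) ?P"
    by (subst compactin_PiE) auto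
  then have cpt: "compact ?P"
    by (simp add: euclidean_product_topology flip: compactin_euclidean_iff)
  have "f k \<in> ?P" for k
    using bd by auto
  then have ev: "eventually (\<lambda>h. h \<in> ?P) (filtermap f F)"
    by (auto simp: eventually_filtermap)
  have "filtermap f F \<noteq> bot"
    using F by (simp add: filtermap_bot_iff)
  then obtain g where g: "inf (nhds g) (filtermap f F) \<noteq> bot"
    using cpt ev unfolding compact_filter by metis
  \<comment> \<open>\<open>F\<close> refined by the sets on which \<open>f\<close> is near
    \<open>g\<close>; it is proper exactly because \<open>g\<close> is a cluster point.\<close>
  define F' where "F' = inf F (filtercomap f (nhds g))"
  have "F' \<noteq> bot"
  proof
    assume "F' = bot"
    then have "eventually (\<lambda>_. False) F'" by simp
    then obtain P Q where PQ: "eventually P F" "eventually Q (filtercomap f (nhds g))"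
      "\<And>k. P k \<Longrightarrow> Q k \<Longrightarrow> False"
      unfolding F'_def eventually_inf by auto
    then obtain R where R: "eventually R (nhds g)" "\<And>k. R (f k) \<Longrightarrow> Q k"
      unfolding eventually_filtercomap by auto
    have "eventually (\<lambda>h. \<not> R h) (filtermap f F)"
      unfolding eventually_filtermap using PQ(1) by (rule eventually_mono) (use PQ(3) R(2) in auto)
    then have "eventually (\<lambda>_. False) (inf (nhds g) (filtermap f F))"
      unfolding eventually_inf using R(1) by blast
    then show False using g by (simp add: eventually_False)
  qed
  moreover have "((\<lambda>k. f k x) \<longlongrightarrow> g x) F'" for x
  proof -
    have "filterlim f (nhds g) F'"
      unfolding F'_def by (meson filterlim_filtercomap filterlim_mono inf_le2 order_refl)
    then have lim: "eventually P (nhds g) \<Longrightarrow> eventually (\<lambda>k. P (f k)) F'" for P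
      by (simp add: filterlim_iff)
    show ?thesis
    proof (rule topological_tendstoI)
      fix S :: "'b set" assume S: "open S" "g x \<in> S"
      have "open ((\<lambda>h::'x \<Rightarrow> 'b. h x) -` S)"
        by (rule open_vimage[OF S(1)]) (rule continuous_on_product_coordinates)
      then have "eventually (\<lambda>h. h x \<in> S) (nhds g)"
        using S(2) by (auto simp: eventually_nhds)
      then show "eventually (\<lambda>k. f k x \<in> S) F'" by (rule lim)
    qed
  qed
  moreover have "F' \<le> F" by (simp add: F'_def)
  ultimately show thesis using that by blast
qed

text \<open>Vaisala's argument: among the bijective isometries that fix two points, conjugating by
  the reflection in their midpoint would double the largest displacement of the midpoint.\<close>

lemma isometry_fixes_midpoint:
  fixes N :: "'a::real_vector \<Rightarrow> real"
  assumes K: "subspace K"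
    and tri: "\<And>x y. x \<in> K \<Longrightarrow> y \<in> K \<Longrightarrow> N (x + y) \<le> N x + N y"
    and minus: "\<And>x. x \<in> K \<Longrightarrow> N (- x) = N x"
    and double: "\<And>x. x \<in> K \<Longrightarrow> N (2 *\<^sub>R x) = 2 * N x"
    and def: "\<And>x. x \<in> K \<Longrightarrow> N x = 0 \<longleftrightarrow> x = 0"
    and nonneg: "\<And>x. x \<in> K \<Longrightarrow> 0 \<le> N x"
    and u: "u \<in> K" and v: "v \<in> K"
    and g: "bij_betw g K K" "\<And>x y. x \<in> K \<Longrightarrow> y \<in> K \<Longrightarrow> N (g x - g y) = N (x - y)" "g u = u" "g v = v"
  shows "g ((1/2) *\<^sub>R (u + v)) = (1/2) *\<^sub>R (u + v)"
proof -
  define z where "z = (1/2) *\<^sub>R (u + v)"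
  define W where "W = {g. bij_betw g K K \<and> (\<forall>x\<in>K. \<forall>y\<in>K. N (g x - g y) = N (x - y)) \<and> g u = u \<and> g v = v}"
  have z: "z \<in> K" using K u v by (simp add: z_def subspace_scale subspace_add)
  have bnd: "N (g z - z) \<le> 2 * N (z - u)" if "g \<in> W" for g
  proof -
    have gK: "g z \<in> K" using that z by (auto simp: W_def bij_betw_def)
    have "N (g z - z) \<le> N (g z - u) + N (u - z)"
      using tri[of "g z - u" "u - z"] K gK u z by (simp add: subspace_diff)
    also have "N (g z - u) = N (z - u)"
      using that z u by (auto simp: W_def) metis
    also have "N (u - z) = N (z - u)" using minus[of "z - u"] K z u by (simp add: subspace_diff)
    finally show ?thesis by simp
  qed
  define S where "S = Sup ((\<lambda>g. N (g z - z)) ` W)"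
  have bdd: "bdd_above ((\<lambda>g. N (g z - z)) ` W)"
    using bnd by (auto simp: bdd_above_def)
  have le: "N (g z - z) \<le> S" if "g \<in> W" for g
    unfolding S_def using bdd that by (simp add: cSup_upper)
  have dbl: "2 * N (g z - z) \<le> S" if gW: "g \<in> W" for g
  proof -
    define \<psi> where "\<psi> x = 2 *\<^sub>R z - x" for x
    have \<psi>K: "\<psi> x \<in> K" if "x \<in> K" for x
      using K z that by (simp add: \<psi>_def subspace_diff subspace_scale)
    have \<psi>\<psi>: "\<psi> (\<psi> x) = x" for x by (simp add: \<psi>_def)
    have \<psi>b: "bij_betw \<psi> K K"
      by (rule bij_betw_byWitness[of _ \<psi>]) (auto simp: \<psi>K \<psi>\<psi>)
    have \<psi>i: "N (\<psi> x - \<psi> y) = N (x - y)" if "x \<in> K" "y \<in> K" for x y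
      using minus[of "x - y"] that K by (simp add: \<psi>_def subspace_diff)
    define h where "h = inv_into K g"
    have gb: "bij_betw g K K" and gi: "\<And>x y. x \<in> K \<Longrightarrow> y \<in> K \<Longrightarrow> N (g x - g y) = N (x - y)"
      and gu: "g u = u" and gv: "g v = v" using gW by (auto simp: W_def)
    have hb: "bij_betw h K K" unfolding h_def by (rule bij_betw_inv_into[OF gb])
    have hg: "h (g x) = x" "g (h x) = x" if "x \<in> K" for x
      using gb that by (auto simp: h_def bij_betw_inv_into_left bij_betw_inv_into_right)
    have gK: "g x \<in> K" and hK: "h x \<in> K" if "x \<in> K" for x
      using gb hb that by (auto simp: bij_betw_def)
    have hi: "N (h x - h y) = N (x - y)" if "x \<in> K" "y \<in> K" for x y
      using gi[of "h x" "h y"] hg(2) that hK by simp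
    \<comment> \<open>\<open>\<psi>\<close> exchanges \<open>u\<close> and \<open>v\<close>, so this
      composite of isometries fixes both and competes in the same supremum.\<close>
    define k where "k = \<psi> \<circ> h \<circ> \<psi> \<circ> g"
    have "bij_betw k K K"
      unfolding k_def using gb \<psi>b hb by (metis bij_betw_trans)
    moreover have "N (k x - k y) = N (x - y)" if "x \<in> K" "y \<in> K" for x y
      unfolding k_def comp_def using that by (simp add: \<psi>i hi gi \<psi>K hK gK)
    moreover have "\<psi> u = v" "\<psi> v = u" by (simp_all add: \<psi>_def z_def)
    moreover have "h u = u" "h v = v" using hg(1)[OF u] hg(1)[OF v] gu gv by simp_all
    ultimately have "k \<in> W"
      by (simp add: W_def k_def gu gv)
    then have "N (k z - z) \<le> S" by (rule le)
    moreover have "N (k z - z) = 2 * N (g z - z)"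
    proof -
      have "\<psi> z = z" by (simp add: \<psi>_def scaleR_2)
      then have "N (k z - z) = N (\<psi> (h (\<psi> (g z))) - \<psi> z)" by (simp add: k_def)
      also have "\<dots> = N (h (\<psi> (g z)) - z)" by (simp add: \<psi>i hK \<psi>K gK z)
      also have "\<dots> = N (h (\<psi> (g z)) - h (g z))" by (simp add: hg z)
      also have "\<dots> = N (\<psi> (g z) - g z)" by (simp add: hi \<psi>K gK z)
      also have "\<psi> (g z) - g z = - (2 *\<^sub>R (g z - z))" by (simp add: \<psi>_def algebra_simps scaleR_2)
      also have "N \<dots> = 2 * N (g z - z)"
        using minus[of "2 *\<^sub>R (g z - z)"] double[of "g z - z"] K gK[OF z] z
        by (simp add: subspace_scale subspace_diff)
      finally show ?thesis .
    qed
    ultimately show ?thesis by simp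
  qed
  have gW: "g \<in> W" using g by (simp add: W_def)
  have "S \<le> S / 2"
    unfolding S_def
  proof (rule cSup_least)
    show "(\<lambda>g. N (g z - z)) ` W \<noteq> {}" using gW by auto
    fix x assume "x \<in> (\<lambda>g. N (g z - z)) ` W"
    then show "x \<le> Sup ((\<lambda>g. N (g z - z)) ` W) / 2" using dbl by (fastforce simp: S_def)
  qed
  then have "N (g z - z) \<le> 0" using le[OF gW] by simp
  moreover have "g z \<in> K" using g(1) z by (auto simp: bij_betw_def)
  ultimately have "g z - z = 0"
    using def nonneg K z by (metis antisym subspace_diff)
  then show ?thesis by (simp add: z_def)
qed

text \<open>Going over by \<open>T\<close>, reflecting in the midpoint of \<open>T u\<close> and
  \<open>T v\<close>, coming back and reflecting in the midpoint of \<open>u\<close> and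
  \<open>v\<close> is an isometry of \<open>N\<close> that fixes \<open>u\<close> and
  \<open>v\<close>; the previous lemma applies to it. Homogeneity enters as doubling only, because
  that is what the limit of the zooms supplies.\<close>

lemma Mazur_Ulam_midpoint:
  fixes N N' :: "'a::real_vector \<Rightarrow> real"
  assumes K: "subspace K"
    and N: "\<And>x y. x \<in> K \<Longrightarrow> y \<in> K \<Longrightarrow> N (x + y) \<le> N x + N y"
      "\<And>x. x \<in> K \<Longrightarrow> N (- x) = N x" "\<And>x. x \<in> K \<Longrightarrow> N (2 *\<^sub>R x) = 2 * N x"
      "\<And>x. x \<in> K \<Longrightarrow> N x = 0 \<longleftrightarrow> x = 0" "\<And>x. x \<in> K \<Longrightarrow> 0 \<le> N x"
    and N': "\<And>x. x \<in> K \<Longrightarrow> N' (- x) = N' x"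
    and T: "bij_betw T K K" "\<And>x y. x \<in> K \<Longrightarrow> y \<in> K \<Longrightarrow> N' (T x - T y) = N (x - y)"
    and u: "u \<in> K" and v: "v \<in> K"
  shows "T ((1/2) *\<^sub>R (u + v)) = (1/2) *\<^sub>R (T u + T v)"
proof -
  define h where "h = inv_into K T"
  have hb: "bij_betw h K K" unfolding h_def by (rule bij_betw_inv_into[OF T(1)])
  have hT: "h (T x) = x" "T (h x) = x" if "x \<in> K" for x
    using T(1) that by (auto simp: h_def bij_betw_inv_into_left bij_betw_inv_into_right)
  have TK: "T x \<in> K" and hK: "h x \<in> K" if "x \<in> K" for x
    using T(1) hb that by (auto simp: bij_betw_def)
  define \<psi> where "\<psi> x = u + v - x" for x
  define \<psi>' where "\<psi>' x = T u + T v - x" for x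
  have \<psi>K: "\<psi> x \<in> K" "\<psi>' x \<in> K" if "x \<in> K" for x
    using K u v TK that by (simp_all add: \<psi>_def \<psi>'_def subspace_diff subspace_add)
  have \<psi>b: "bij_betw \<psi> K K" "bij_betw \<psi>' K K"
    by (rule bij_betw_byWitness[of _ \<psi>]; use \<psi>K in \<open>auto simp: \<psi>_def\<close>)
       (rule bij_betw_byWitness[of _ \<psi>']; use \<psi>K in \<open>auto simp: \<psi>'_def\<close>)
  have \<psi>i: "N (\<psi> x - \<psi> y) = N (x - y)" "N' (\<psi>' x - \<psi>' y) = N' (x - y)" if "x \<in> K" "y \<in> K" for x y
    using N(2)[of "x - y"] N'[of "x - y"] that K by (simp_all add: \<psi>_def \<psi>'_def subspace_diff)
  have hi: "N (h x - h y) = N' (x - y)" if "x \<in> K" "y \<in> K" for x y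
    using T(2)[of "h x" "h y"] hT(2) that hK by simp
  define k where "k = \<psi> \<circ> h \<circ> \<psi>' \<circ> T"
  define z where "z = (1/2) *\<^sub>R (u + v)"
  have z: "z \<in> K" using K u v by (simp add: z_def subspace_scale subspace_add)
  have "k z = z"
    unfolding z_def
  proof (rule isometry_fixes_midpoint[OF K N u v])
    show "bij_betw k K K" unfolding k_def using T(1) \<psi>b hb by (metis bij_betw_trans)
    show "N (k x - k y) = N (x - y)" if "x \<in> K" "y \<in> K" for x y
      unfolding k_def comp_def using that by (simp add: \<psi>i hi T \<psi>K hK TK)
    show "k u = u" "k v = v" using hT u v by (simp_all add: k_def \<psi>_def \<psi>'_def)
  qed auto
  then have "h (\<psi>' (T z)) = \<psi> z" by (simp add: k_def \<psi>_def algebra_simps)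
  also have "\<psi> z = z" by (simp add: \<psi>_def z_def algebra_simps flip: scaleR_left.add)
  finally have "\<psi>' (T z) = T z" using hT(2)[of "\<psi>' (T z)"] \<psi>K TK z by simp
  then have "2 *\<^sub>R T z = T u + T v" by (simp add: \<psi>'_def scaleR_2 algebra_simps)
  then have "(1/2) *\<^sub>R (2 *\<^sub>R T z) = (1/2) *\<^sub>R (T u + T v)" by simp
  then show ?thesis by (simp add: z_def)
qed

text \<open>An iterated one-dimensional Folner average: every list entry is an averaging direction
  of its own, so that the mean is almost invariant under all entries at once.\<close>

primrec shift_avg :: "nat \<Rightarrow> 'a::real_vector list \<Rightarrow> ('a \<Rightarrow> real) \<Rightarrow> 'a \<Rightarrow> real" where
  "shift_avg L [] \<phi> p = \<phi> p"
| "shift_avg L (w # ws) \<phi> p = (\<Sum>n<L. shift_avg L ws \<phi> (p + real n *\<^sub>R w)) / real L"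

lemma shift_avg_translate: "shift_avg L ws (\<lambda>p. \<phi> (p + w)) p = shift_avg L ws \<phi> (p + w)"
  by (induction ws arbitrary: p) (simp_all add: algebra_simps)

lemma shift_avg_add:
  "shift_avg L ws (\<lambda>p. \<phi> p + \<psi> p) p = shift_avg L ws \<phi> p + shift_avg L ws \<psi> p"
  by (induction ws arbitrary: p) (simp_all add: sum.distrib add_divide_distrib)

lemma shift_avg_cmult: "shift_avg L ws (\<lambda>p. c * \<phi> p) p = c * shift_avg L ws \<phi> p"
  by (induction ws arbitrary: p) (simp_all flip: sum_distrib_left)

lemma shift_avg_diff:
  "shift_avg L ws (\<lambda>p. \<phi> p - \<psi> p) p = shift_avg L ws \<phi> p - shift_avg L ws \<psi> p"
  using shift_avg_add[of L ws \<phi> "\<lambda>p. (-1) * \<psi> p" p] shift_avg_cmult[of L ws "-1" \<psi> p] by simp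

lemma shift_avg_zero: "shift_avg L ws (\<lambda>p. 0) p = 0"
  using shift_avg_cmult[of L ws 0 "\<lambda>p. 0" p] by simp

lemma shift_avg_sum:
  "finite I \<Longrightarrow> shift_avg L ws (\<lambda>p. \<Sum>i\<in>I. \<phi> i p) p = (\<Sum>i\<in>I. shift_avg L ws (\<phi> i) p)"
  by (induction I rule: finite_induct) (simp_all add: shift_avg_add shift_avg_zero)

lemma shift_avg_abs_le:
  assumes "0 < L" "\<And>p. \<bar>\<phi> p\<bar> \<le> B"
  shows "\<bar>shift_avg L ws \<phi> p\<bar> \<le> B"
proof (induction ws arbitrary: p)
  case (Cons w ws)
  have "\<bar>\<Sum>n<L. shift_avg L ws \<phi> (p + real n *\<^sub>R w)\<bar> \<le> (\<Sum>n<L. B)"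
    by (rule order.trans[OF sum_abs sum_mono]) (rule Cons)
  then show ?case using assms(1) by (simp add: field_simps abs_mult)
qed (simp add: assms)

text \<open>In the direction of \<open>w\<close> itself the average telescopes and leaves two
  boundary terms of size \<open>B\<close>; the averages in the other directions merely average this
  estimate.\<close>

lemma shift_avg_almost_invariant:
  assumes "0 < L" "\<And>p. \<bar>\<phi> p\<bar> \<le> B" "w \<in> set ws"
  shows "\<bar>shift_avg L ws (\<lambda>p. \<phi> (p + w)) p - shift_avg L ws \<phi> p\<bar> \<le> 2 * B / real L"
  using assms(3)
proof (induction ws arbitrary: p)
  case (Cons v ws)
  let ?X = "shift_avg L ws \<phi>"
  show ?case
  proof (cases "w = v")
    case True
    have "shift_avg L (v # ws) (\<lambda>p. \<phi> (p + w)) p - shift_avg L (v # ws) \<phi> p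
        = (\<Sum>n<L. ?X (p + real (Suc n) *\<^sub>R w) - ?X (p + real n *\<^sub>R w)) / real L"
      using True by (simp add: shift_avg_translate sum_subtractf diff_divide_distrib algebra_simps)
    also have "\<dots> = (?X (p + real L *\<^sub>R w) - ?X p) / real L"
      by (subst sum_lessThan_telescope) simp
    finally have eq: "shift_avg L (v # ws) (\<lambda>p. \<phi> (p + w)) p - shift_avg L (v # ws) \<phi> p = \<dots>" .
    have "\<bar>?X (p + real L *\<^sub>R w) - ?X p\<bar> \<le> 2 * B"
      using shift_avg_abs_le[of L \<phi> B ws p, OF assms(1,2)]
        shift_avg_abs_le[of L \<phi> B ws "p + real L *\<^sub>R w", OF assms(1,2)] by linarith
    then show ?thesis unfolding eq using assms(1) by (simp add: divide_right_mono)
  next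
    case False
    then have w: "w \<in> set ws" using Cons by simp
    have "\<bar>shift_avg L (v # ws) (\<lambda>p. \<phi> (p + w)) p - shift_avg L (v # ws) \<phi> p\<bar>
        = \<bar>\<Sum>n<L. shift_avg L ws (\<lambda>p. \<phi> (p + w)) (p + real n *\<^sub>R v) - ?X (p + real n *\<^sub>R v)\<bar> / real L"
      by (simp add: sum_subtractf diff_divide_distrib[symmetric])
    also have "\<dots> \<le> (\<Sum>n<L. 2 * B / real L) / real L"
      by (rule divide_right_mono, rule order.trans[OF sum_abs sum_mono]) (use Cons.IH[OF w] in auto)
    also have "\<dots> = 2 * B / real L" using assms(1) by simp
    finally show ?thesis .
  qed
qed simp

text \<open>Some value is at most the mean. The distance bound keeps the place that is found in a
  bounded region, which matters when the shifts are taken at very fine scales.\<close>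

lemma exists_le_shift_avg:
  fixes ws :: "'a::real_normed_vector list"
  assumes "0 < L"
  shows "\<exists>q. norm (q - p) \<le> real L * (\<Sum>w\<leftarrow>ws. norm w) \<and> \<phi> q \<le> shift_avg L ws \<phi> p"
proof (induction ws arbitrary: p)
  case (Cons w ws)
  let ?X = "shift_avg L ws \<phi>"
  have "\<exists>n<L. ?X (p + real n *\<^sub>R w) \<le> shift_avg L (w # ws) \<phi> p"
  proof (rule ccontr)
    assume "\<not> ?thesis"
    then have "(\<Sum>n<L. shift_avg L (w # ws) \<phi> p) < (\<Sum>n<L. ?X (p + real n *\<^sub>R w))"
      by (intro sum_strict_mono) (use assms in auto)
    then show False using assms by (simp add: field_simps)
  qed
  then obtain n where n: "n < L" "?X (p + real n *\<^sub>R w) \<le> shift_avg L (w # ws) \<phi> p" by auto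
  obtain q where q: "norm (q - (p + real n *\<^sub>R w)) \<le> real L * (\<Sum>w\<leftarrow>ws. norm w)"
    "\<phi> q \<le> ?X (p + real n *\<^sub>R w)" using Cons by blast
  have "norm (q - p) \<le> norm (q - (p + real n *\<^sub>R w)) + norm (real n *\<^sub>R w)"
    using norm_triangle_ineq[of "q - (p + real n *\<^sub>R w)" "real n *\<^sub>R w"] by (simp add: algebra_simps)
  also have "norm (real n *\<^sub>R w) \<le> real L * norm w"
    using n(1) by (simp add: mult_right_mono)
  finally have "norm (q - p) \<le> real L * (\<Sum>w\<leftarrow>w # ws. norm w)"
    using q(1) by (simp add: algebra_simps)
  then show ?case using q(2) n(2) by (meson order.trans)
qed auto

section \<open>Bounded matrix groups\<close>

lemma matrix_add_rdistrib: "(A + B) ** C = A ** C + B ** C"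
  for A B :: "'a::semiring_1^'m^'n"
  by (vector matrix_matrix_mult_def sum.distrib[symmetric] distrib_right)

lemma matrix_mult_scaleR_left: "(k *\<^sub>R A) ** B = k *\<^sub>R (A ** B)" for A :: "real^'m^'n"
  by (simp add: scalar_matrix_assoc)

lemma matrix_mult_scaleR_right: "A ** (k *\<^sub>R B) = k *\<^sub>R (A ** B)" for A :: "real^'m^'n"
  by (simp add: scalar_matrix_assoc matrix_scalar_ac)

lemma matrix_mult_bounded: "\<exists>k>0. \<forall>(g::real^'n^'n) (h::real^'n^'n). norm (g ** h) \<le> norm g * norm h * k"
proof -
  have "bilinear ((**) :: real^'n^'n \<Rightarrow> real^'n^'n \<Rightarrow> real^'n^'n)"
    unfolding bilinear_def
    by (auto intro!: linearI simp: matrix_add_ldistrib matrix_add_rdistrib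
        matrix_mult_scaleR_left matrix_mult_scaleR_right)
  from bounded_bilinear.pos_bounded[OF bilinear_conv_bounded_bilinear[THEN iffD1, OF this]]
  show ?thesis .
qed

text \<open>Kakutani's fixed point argument: the supremum of the squared Euclidean norm over a group
  orbit of forms is invariant and uniformly convex, hence has a unique minimum on the closed
  convex hull of one orbit.\<close>

lemma bounded_group_invariant_form:
  fixes M :: "(real^'n^'n) set"
  assumes one: "mat 1 \<in> M" and mult: "\<And>g h. g \<in> M \<Longrightarrow> h \<in> M \<Longrightarrow> g ** h \<in> M"
    and inverse: "\<And>g. g \<in> M \<Longrightarrow> \<exists>h\<in>M. g ** h = mat 1 \<and> h ** g = mat 1"
    and bd: "\<And>g. g \<in> M \<Longrightarrow> norm g \<le> C"
  obtains q where "transpose q = q" "\<And>x. x \<noteq> 0 \<Longrightarrow> 0 < x \<bullet> (q *v x)"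
    "\<And>g. g \<in> M \<Longrightarrow> transpose g ** q ** g = q"
proof -
  define T where "T g q = transpose g ** q ** g" for g q :: "real^'n^'n"
  have lin: "linear (T g)" for g
    unfolding T_def
    by (rule linearI) (simp_all add: matrix_add_ldistrib matrix_add_rdistrib
        matrix_mult_scaleR_left matrix_mult_scaleR_right)
  have TT: "T g (T h q) = T (h ** g) q" for g h q
    by (simp add: T_def matrix_transpose_mul matrix_mul_assoc)
  have T1: "T (mat 1) q = q" for q by (simp add: T_def)
  obtain k where k: "k > 0" "\<And>(g::real^'n^'n) (h::real^'n^'n). norm (g ** h) \<le> norm g * norm h * k"
    using matrix_mult_bounded by auto
  obtain b where b: "b > 0" "\<And>g::real^'n^'n. norm (transpose g) \<le> norm g * b"
  proof -
    have "bounded_linear (transpose :: real^'n^'n \<Rightarrow> real^'n^'n)"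
      by (intro linear_conv_bounded_linear[THEN iffD1] linearI)
         (simp_all add: transpose_def vec_eq_iff)
    from bounded_linear.pos_bounded[OF this] show thesis using that by metis
  qed
  define D where "D = (\<bar>C\<bar> * b * k) * (\<bar>C\<bar> * k) + 1"
  have D: "D > 0" unfolding D_def using b k by (simp add: add_nonneg_pos)
  have bound: "norm (T g q) \<le> D * norm q" if "g \<in> M" for g q
  proof -
    have gC: "norm g \<le> \<bar>C\<bar>" using bd[OF that] by simp
    have "norm (T g q) \<le> norm (transpose g ** q) * norm g * k" unfolding T_def by (rule k)
    also have "\<dots> \<le> (norm (transpose g) * norm q * k) * norm g * k"
      using k by (intro mult_right_mono) auto
    also have "\<dots> \<le> ((\<bar>C\<bar> * b) * norm q * k) * \<bar>C\<bar> * k"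
      using k b(1) order.trans[OF b(2)[of g] mult_right_mono[OF gC, of b]]
      by (intro mult_mono mult_right_mono gC) auto
    also have "\<dots> = (D - 1) * norm q" unfolding D_def by algebra
    also have "\<dots> \<le> D * norm q" by (simp add: algebra_simps)
    finally show ?thesis .
  qed
  define \<Psi> where "\<Psi> q = (SUP g\<in>M. (norm (T g q))\<^sup>2)" for q
  have bdd: "bdd_above ((\<lambda>g. (norm (T g q))\<^sup>2) ` M)" for q
    by (rule bdd_aboveI2[of _ _ "(D * norm q)\<^sup>2"]) (simp add: bound power_mono)
  have upper: "(norm (T g q))\<^sup>2 \<le> \<Psi> q" if "g \<in> M" for g q
    unfolding \<Psi>_def using bdd that by (rule cSUP_upper2) auto
  have least: "\<Psi> q \<le> r" if "\<And>g. g \<in> M \<Longrightarrow> (norm (T g q))\<^sup>2 \<le> r" for q r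
    unfolding \<Psi>_def using one that by (intro cSUP_least) auto
  have \<Psi>inv: "\<Psi> (T g q) = \<Psi> q" if g: "g \<in> M" for g q
  proof (rule antisym)
    show "\<Psi> (T g q) \<le> \<Psi> q"
      by (rule least) (simp add: TT mult g upper)
    obtain h where h: "h \<in> M" "g ** h = mat 1" using inverse[OF g] by auto
    have "\<Psi> (T h (T g q)) \<le> \<Psi> (T g q)"
      by (rule least) (use h in \<open>simp add: TT[of _ h] mult upper\<close>)
    then show "\<Psi> q \<le> \<Psi> (T g q)" using h by (simp add: TT T1)
  qed
  \<comment> \<open>Parallelogram law for every \<open>T g\<close>; the inverse of \<open>g\<close>
    bounds \<open>norm (T g (p - q))\<close> from below uniformly, which makes the convexity strict
    even after the supremum.\<close>
  have convex: "\<Psi> ((1/2) *\<^sub>R (p + q)) \<le> r - (norm (p - q))\<^sup>2 / (4 * D\<^sup>2)"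
    if "\<Psi> p \<le> r" "\<Psi> q \<le> r" for p q r
  proof (rule least)
    fix g assume g: "g \<in> M"
    obtain h where h: "h \<in> M" "g ** h = mat 1" using inverse[OF g] by auto
    have "norm (p - q) \<le> D * norm (T g (p - q))"
      using bound[OF h(1), of "T g (p - q)"] h by (simp add: TT T1)
    then have "(norm (p - q))\<^sup>2 \<le> D\<^sup>2 * (norm (T g (p - q)))\<^sup>2"
      by (metis norm_ge_zero power_mono power_mult_distrib)
    then have lower: "(norm (p - q))\<^sup>2 / (4 * D\<^sup>2) \<le> (norm (T g (p - q)))\<^sup>2 / 4"
      using D by (simp add: field_simps)
    have par: "(norm ((1/2) *\<^sub>R (x + y)))\<^sup>2 = (norm x)\<^sup>2 / 2 + (norm y)\<^sup>2 / 2 - (norm (x - y))\<^sup>2 / 4"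
      for x y :: "real^'n^'n"
      by (simp add: power2_norm_eq_inner inner_simps inner_commute field_simps)
    have "T g ((1/2) *\<^sub>R (p + q)) = (1/2) *\<^sub>R (T g p + T g q)"
      using lin by (simp add: linear_scale linear_add)
    moreover have "T g (p - q) = T g p - T g q" using lin by (rule linear_diff)
    ultimately have "(norm (T g ((1/2) *\<^sub>R (p + q))))\<^sup>2
        = (norm (T g p))\<^sup>2 / 2 + (norm (T g q))\<^sup>2 / 2 - (norm (T g (p - q)))\<^sup>2 / 4"
      by (simp only: par)
    then show "(norm (T g ((1/2) *\<^sub>R (p + q))))\<^sup>2 \<le> r - (norm (p - q))\<^sup>2 / (4 * D\<^sup>2)"
      using lower upper[OF g, of p] upper[OF g, of q] that by linarith
  qed
  define Q where "Q = closure (convex hull ((\<lambda>g. T g (mat 1)) ` M))"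
  have "bounded ((\<lambda>g. T g (mat 1 :: real^'n^'n)) ` M)"
    using bound by (auto intro: boundedI)
  then have Qc: "compact Q" unfolding Q_def by (simp add: bounded_convex_hull)
  have Qconv: "convex Q" unfolding Q_def by (simp add: convex_closure)
  have "mat 1 \<in> Q" unfolding Q_def using one T1[of "mat 1"]
    by (metis closure_subset hull_inc image_eqI subsetD)
  have TQ: "T g q \<in> Q" if "g \<in> M" "q \<in> Q" for g q
  proof -
    have "T g ` Q \<subseteq> closure (T g ` (convex hull ((\<lambda>g. T g (mat 1)) ` M)))"
      unfolding Q_def using lin
      by (intro closure_linear_image_subset)
    also have "T g ` (convex hull ((\<lambda>g. T g (mat 1)) ` M)) = convex hull (T g ` (\<lambda>g. T g (mat 1)) ` M)"
      using lin by (rule convex_hull_linear_image)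
    also have "closure \<dots> \<subseteq> Q"
      unfolding Q_def using that(1) by (intro closure_mono hull_mono) (auto simp: TT mult)
    finally show ?thesis using that(2) by auto
  qed
  have cont: "continuous_on Q \<Psi>"
  proof -
    obtain R where R: "R > 0" "\<And>q. q \<in> Q \<Longrightarrow> norm q \<le> R"
      using compact_imp_bounded[OF Qc] by (auto simp: bounded_pos)
    have half: "\<Psi> p \<le> \<Psi> q + 2 * D\<^sup>2 * R * norm (p - q)" if "p \<in> Q" "q \<in> Q" for p q
    proof (rule least)
      fix g assume g: "g \<in> M"
      have "norm (T g p) \<le> norm (T g q) + norm (T g (p - q))"
        using lin by (metis add.commute diff_add_cancel linear_diff norm_triangle_ineq)
      then have a: "norm (T g p) - norm (T g q) \<le> D * norm (p - q)" using bound[OF g, of "p - q"] by simp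
      have b: "norm (T g p) + norm (T g q) \<le> 2 * D * R"
        using bound[OF g, of p] bound[OF g, of q] mult_left_mono[OF R(2)[OF that(1)], of D]
          mult_left_mono[OF R(2)[OF that(2)], of D] D by linarith
      have "(norm (T g p))\<^sup>2 - (norm (T g q))\<^sup>2 = (norm (T g p) - norm (T g q)) * (norm (T g p) + norm (T g q))"
        by (simp add: power2_eq_square algebra_simps)
      also have "\<dots> \<le> (D * norm (p - q)) * (norm (T g p) + norm (T g q))"
        by (rule mult_right_mono[OF a]) simp
      also have "\<dots> \<le> (D * norm (p - q)) * (2 * D * R)"
        by (rule mult_left_mono[OF b]) (use D in simp)
      finally show "(norm (T g p))\<^sup>2 \<le> \<Psi> q + 2 * D\<^sup>2 * R * norm (p - q)"
        using upper[OF g, of q] by (simp add: power2_eq_square algebra_simps)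
    qed
    have "(2 * D\<^sup>2 * R)-lipschitz_on Q \<Psi>"
      unfolding lipschitz_on_def
    proof (intro conjI ballI)
      fix p q assume "p \<in> Q" "q \<in> Q"
      then show "dist (\<Psi> p) (\<Psi> q) \<le> 2 * D\<^sup>2 * R * dist p q"
        using half[of p q] half[of q p] by (simp add: dist_norm norm_minus_commute abs_le_iff)
    qed (use R in simp)
    then show ?thesis by (rule lipschitz_on_continuous_on)
  qed
  obtain q where q: "q \<in> Q" "\<And>p. p \<in> Q \<Longrightarrow> \<Psi> q \<le> \<Psi> p"
    using continuous_attains_inf[OF Qc _ cont] \<open>mat 1 \<in> Q\<close> by auto
  \<comment> \<open>\<open>\<Psi>\<close> has the same value at \<open>q\<close> and at
    \<open>T g q\<close>; were these different, their midpoint would have a smaller one.\<close>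
  have fix_q: "T g q = q" if g: "g \<in> M" for g
  proof -
    have "(1/2) *\<^sub>R (T g q + q) \<in> Q"
      using convexD[OF Qconv TQ[OF g q(1)] q(1), of "1/2" "1/2"] by (simp add: scaleR_right_distrib)
    then have "\<Psi> q \<le> \<Psi> q - (norm (T g q - q))\<^sup>2 / (4 * D\<^sup>2)"
      using q(2) convex[of "T g q" "\<Psi> q" q] \<Psi>inv[OF g] by fastforce
    then have "(norm (T g q - q))\<^sup>2 / (4 * D\<^sup>2) \<le> 0" by simp
    then show ?thesis using D by (simp add: divide_le_0_iff)
  qed
  obtain k' where k': "k' > 0" "\<And>(g::real^'n^'n) x. norm (g *v x) \<le> norm g * norm x * k'"
  proof -
    have "bilinear ((*v) :: real^'n^'n \<Rightarrow> real^'n \<Rightarrow> real^'n)"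
      unfolding bilinear_def
      by (auto intro!: linearI simp: matrix_vector_right_distrib matrix_vector_mult_add_rdistrib
          matrix_vector_mult_scaleR simp flip: scaleR_matrix_vector_assoc)
    from bounded_bilinear.pos_bounded[OF bilinear_conv_bounded_bilinear[THEN iffD1, OF this]]
    show thesis using that by metis
  qed
  \<comment> \<open>Positive definiteness is an open condition and could be lost in the closed hull.
    A lower bound with one constant for the whole orbit is closed and convex, hence inherited by
    \<open>q\<close>.\<close>
  define P where "P = {p::real^'n^'n. transpose p = p} \<inter> (\<Inter>x. {p. (norm x)\<^sup>2 \<le> (\<bar>C\<bar> * k' + 1)\<^sup>2 * (x \<bullet> (p *v x))})"
  have "(\<lambda>g. T g (mat 1)) ` M \<subseteq> P"
  proof clarify
    fix g assume g: "g \<in> M"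
    obtain h where h: "h \<in> M" "h ** g = mat 1" using inverse[OF g] by auto
    have "(norm x)\<^sup>2 \<le> (\<bar>C\<bar> * k' + 1)\<^sup>2 * (x \<bullet> (T g (mat 1) *v x))" for x
    proof -
      have "x = h *v (g *v x)" by (simp add: matrix_vector_mul_assoc h)
      then have "norm x \<le> norm h * norm (g *v x) * k'" using k'(2)[of h "g *v x"] by simp
      also have "\<dots> = norm h * k' * norm (g *v x)" by simp
      also have "\<dots> \<le> (\<bar>C\<bar> * k' + 1) * norm (g *v x)"
      proof (rule mult_right_mono)
        have "norm h * k' \<le> \<bar>C\<bar> * k'"
          by (rule mult_right_mono) (use bd[OF h(1)] k'(1) in auto)
        then show "norm h * k' \<le> \<bar>C\<bar> * k' + 1" by simp
      qed simp
      finally have "(norm x)\<^sup>2 \<le> (\<bar>C\<bar> * k' + 1)\<^sup>2 * (norm (g *v x))\<^sup>2"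
        by (metis norm_ge_zero power_mono power_mult_distrib)
      moreover have "x \<bullet> (T g (mat 1) *v x) = (norm (g *v x))\<^sup>2"
        by (simp add: T_def power2_norm_eq_inner flip: matrix_vector_mul_assoc)
           (metis dot_lmul_matrix transpose_matrix_vector inner_commute)
      ultimately show ?thesis by simp
    qed
    then show "T g (mat 1) \<in> P" by (simp add: P_def T_def matrix_transpose_mul)
  qed
  moreover have "convex P"
    unfolding P_def
  proof (intro convex_Int convex_INT)
    show "convex {p::real^'n^'n. transpose p = p}"
      by (auto simp: convex_def vec_eq_iff transpose_def)
    show "convex {p::real^'n^'n. (norm x)\<^sup>2 \<le> (\<bar>C\<bar> * k' + 1)\<^sup>2 * (x \<bullet> (p *v x))}" for x
    proof -
      have "linear (\<lambda>p::real^'n^'n. (\<bar>C\<bar> * k' + 1)\<^sup>2 * (x \<bullet> (p *v x)))"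
        by (rule linearI) (simp_all add: matrix_vector_mult_add_rdistrib inner_right_distrib
            algebra_simps flip: scaleR_matrix_vector_assoc)
      from convex_linear_vimage[OF this, of "{(norm x)\<^sup>2..}"]
      show ?thesis by (simp add: vimage_def)
    qed
  qed
  moreover have "closed P"
    unfolding P_def
  proof (intro closed_Int closed_INT ballI)
    have "linear (transpose :: real^'n^'n \<Rightarrow> real^'n^'n)"
      by (intro linearI) (simp_all add: transpose_def vec_eq_iff)
    then have "continuous_on UNIV (transpose :: real^'n^'n \<Rightarrow> real^'n^'n)"
      by (rule linear_continuous_on[OF linear_conv_bounded_linear[THEN iffD1]])
    then show "closed {p::real^'n^'n. transpose p = p}"
      by (intro closed_Collect_eq continuous_on_id)
    show "closed {p::real^'n^'n. (norm x)\<^sup>2 \<le> (\<bar>C\<bar> * k' + 1)\<^sup>2 * (x \<bullet> (p *v x))}" for x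
    proof -
      have "linear (\<lambda>p::real^'n^'n. (\<bar>C\<bar> * k' + 1)\<^sup>2 * (x \<bullet> (p *v x)))"
        by (rule linearI) (simp_all add: matrix_vector_mult_add_rdistrib inner_right_distrib
            algebra_simps flip: scaleR_matrix_vector_assoc)
      then have "continuous_on UNIV (\<lambda>p::real^'n^'n. (\<bar>C\<bar> * k' + 1)\<^sup>2 * (x \<bullet> (p *v x)))"
        by (rule linear_continuous_on[OF linear_conv_bounded_linear[THEN iffD1]])
      then show ?thesis by (intro closed_Collect_le continuous_on_const)
    qed
  qed
  ultimately have "Q \<subseteq> P" unfolding Q_def by (simp add: closure_minimal hull_minimal)
  then have "q \<in> P" using q(1) by auto
  show thesis
  proof (rule that)
    show "transpose q = q" using \<open>q \<in> P\<close> by (simp add: P_def)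
    show "0 < x \<bullet> (q *v x)" if "x \<noteq> 0" for x
    proof -
      have "(norm x)\<^sup>2 \<le> (\<bar>C\<bar> * k' + 1)\<^sup>2 * (x \<bullet> (q *v x))"
        using \<open>q \<in> P\<close> by (simp add: P_def)
      moreover have "0 < (norm x)\<^sup>2" using that by simp
      ultimately show ?thesis
        by (metis mult_nonneg_nonpos not_le order.strict_trans2 zero_le_power2 linorder_not_less)
    qed
    show "transpose g ** q ** g = q" if "g \<in> M" for g
      using fix_q[OF that] by (simp add: T_def)
  qed
qed

section \<open>Quasi-similarities of an expanding flow\<close>

lemma filterlim_add_const_at_top: "filterlim (\<lambda>x::real. x + c) at_top at_top"
  unfolding filterlim_at_top
proof (intro allI)
  fix Z show "eventually (\<lambda>x. Z \<le> x + c) at_top"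
    using eventually_ge_at_top[of "Z - c"] by eventually_elim simp
qed

text \<open>What the coarse estimates use of the matrix flow: a bound for its operator norm that is
  monotone in time and vanishes at minus infinity. The Jordan structure stays outside.\<close>

locale expanding_flow =
  fixes \<Phi> :: "real \<Rightarrow> 'a::euclidean_space \<Rightarrow> 'a" and \<mu> :: "real \<Rightarrow> real"
  assumes linear_flow: "linear (\<Phi> t)"
    and flow_0 [simp]: "\<Phi> 0 x = x"
    and flow_add: "\<Phi> (s + t) x = \<Phi> s (\<Phi> t x)"
    and flow_bound: "norm (\<Phi> t x) \<le> \<mu> t * norm x"
    and mono_mu: "mono \<mu>"
    and mu_lim: "(\<mu> \<longlongrightarrow> 0) at_bot"
begin

lemma flow_simps [simp]: "\<Phi> t 0 = 0" "\<Phi> t (x + y) = \<Phi> t x + \<Phi> t y"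
  "\<Phi> t (x - y) = \<Phi> t x - \<Phi> t y" "\<Phi> t (c *\<^sub>R x) = c *\<^sub>R \<Phi> t x" "\<Phi> t (- x) = - \<Phi> t x"
  using linear_flow[of t]
  by (simp_all add: linear_0 linear_add linear_diff linear_scale linear_neg)

lemma flow_split: "a = b + c \<Longrightarrow> \<Phi> a x = \<Phi> b (\<Phi> c x)"
  by (simp add: flow_add)

lemma flow_inverse [simp]: "\<Phi> t (\<Phi> (- t) x) = x" "\<Phi> (- t) (\<Phi> t x) = x"
  using flow_add[of t "- t" x] flow_add[of "- t" t x] by simp_all

lemma flow_eq_0_iff [simp]: "\<Phi> t x = 0 \<longleftrightarrow> x = 0"
  by (metis flow_inverse(2) flow_simps(1))

lemma mu_pos: "0 < \<mu> t"
proof -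
  obtain b :: 'a where "b \<in> Basis" using nonempty_Basis by blast
  then have b: "norm b = 1" "b \<noteq> 0" by auto
  have "0 < norm (\<Phi> t b)" using b(2) by simp
  then show ?thesis using order.strict_trans2[OF _ flow_bound[of t b]] b by simp
qed

lemma mu_mono: "s \<le> t \<Longrightarrow> \<mu> s \<le> \<mu> t"
  using mono_mu by (simp add: mono_def)

lemma mu_small: assumes "0 < e" obtains t where "\<mu> t < e" "t \<le> b"
proof -
  have "eventually (\<lambda>t. \<mu> t < e \<and> t \<le> b) at_bot"
    using order_tendstoD(2)[OF mu_lim assms] eventually_le_at_bot by (rule eventually_conj)
  then show thesis using that eventually_happens'[OF trivial_limit_at_bot_linorder] by blast
qed

lemma continuous_flow: "continuous_on S (\<Phi> t)"
  using linear_flow by (simp add: linear_continuous_on linear_conv_bounded_linear[THEN iffD1])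

lemma tendsto_flow [tendsto_intros]: "(f \<longlongrightarrow> l) F \<Longrightarrow> ((\<lambda>x. \<Phi> t (f x)) \<longlongrightarrow> \<Phi> t l) F"
  using continuous_flow[of UNIV t] continuous_on_tendsto_compose[of UNIV "\<Phi> t" f l F] by simp

text \<open>With \<open>\<Phi> t\<close> the flow of \<open>A\<close>, a pair has distance at most \<open>exp (- \<tau>)\<close> up to a factor iff
  \<open>norm (\<Phi> \<tau> (p - q))\<close> is bounded. So \<open>qs C s g\<close> says, without mentioning \<open>D_M\<close>, that \<open>g\<close>
  multiplies distances by \<open>exp s\<close> up to a factor that depends on \<open>C\<close> only.\<close>

definition qs1 :: "real \<Rightarrow> real \<Rightarrow> ('a \<Rightarrow> 'a) \<Rightarrow> bool" where
  "qs1 C s g \<longleftrightarrow> (\<forall>\<tau> p q. norm (\<Phi> \<tau> (p - q)) \<le> 1 \<longrightarrow> norm (\<Phi> (\<tau> - s) (g p - g q)) \<le> C)"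

definition qs :: "real \<Rightarrow> real \<Rightarrow> ('a \<Rightarrow> 'a) \<Rightarrow> bool" where
  "qs C s g \<longleftrightarrow> bij g \<and> qs1 C s g \<and> qs1 C (- s) (inv_into UNIV g)"

lemma qs1D: "qs1 C s g \<Longrightarrow> norm (\<Phi> \<tau> (p - q)) \<le> 1 \<Longrightarrow> norm (\<Phi> (\<tau> - s) (g p - g q)) \<le> C"
  by (simp add: qs1_def)

lemma qs1_nonneg: "qs1 C s g \<Longrightarrow> 0 \<le> C"
  using qs1D[of C s g 0 0 0] by simp

lemma qs1_id: "qs1 1 0 id" by (simp add: qs1_def)

lemma qs1_mono: "qs1 C s g \<Longrightarrow> C \<le> C' \<Longrightarrow> qs1 C' s g"
  by (force simp: qs1_def)

text \<open>Dividing the segment from \<open>q\<close> to \<open>p\<close> into steps of size at most one turns the bound at unit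
  scale into a bound at all scales.\<close>

lemma qs1_chain:
  assumes g: "qs1 C s g"
  shows "norm (\<Phi> (\<tau> - s) (g p - g q)) \<le> C * (1 + norm (\<Phi> \<tau> (p - q)))"
proof -
  define r where "r = norm (\<Phi> \<tau> (p - q))"
  define m where "m = Suc (nat \<lfloor>r\<rfloor>)"
  have r: "0 \<le> r" by (simp add: r_def)
  have m: "r \<le> real m" "real m \<le> 1 + r" unfolding m_def using r by linarith+
  define x where "x j = q + (real j / real m) *\<^sub>R (p - q)" for j
  have x: "x 0 = q" "x m = p" by (simp_all add: x_def m_def)
  have step: "norm (\<Phi> (\<tau> - s) (g (x (Suc j)) - g (x j))) \<le> C" for j
  proof (rule qs1D[OF g])
    have "x (Suc j) - x j = (1 / real m) *\<^sub>R (p - q)"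
      by (simp add: x_def add_divide_distrib flip: scaleR_left_diff_distrib)
    then have "norm (\<Phi> \<tau> (x (Suc j) - x j)) = r / real m"
      by (simp only: flow_simps norm_scaleR r_def) simp
    also have "\<dots> \<le> 1" using m(1) by (simp add: m_def)
    finally show "norm (\<Phi> \<tau> (x (Suc j) - x j)) \<le> 1" .
  qed
  have "g p - g q = (\<Sum>j<m. g (x (Suc j)) - g (x j))"
    by (subst sum_lessThan_telescope) (simp add: x)
  then have "\<Phi> (\<tau> - s) (g p - g q) = (\<Sum>j<m. \<Phi> (\<tau> - s) (g (x (Suc j)) - g (x j)))"
    by (simp only: linear_sum[OF linear_flow])
  then have "norm (\<Phi> (\<tau> - s) (g p - g q)) \<le> (\<Sum>j<m. C)"
    by (simp only:) (rule sum_norm_le, rule step)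
  also have "\<dots> \<le> C * (1 + r)"
    using mult_right_mono[OF m(2) qs1_nonneg[OF g]] by (simp add: mult.commute)
  finally show ?thesis by (simp add: r_def)
qed

lemma qs1_comp:
  assumes g: "qs1 C s g" and f: "qs1 D r f"
  shows "qs1 (C * (1 + D)) (s + r) (g \<circ> f)"
  unfolding qs1_def
proof (intro allI impI)
  fix \<tau> p q assume "norm (\<Phi> \<tau> (p - q)) \<le> 1"
  then have "norm (\<Phi> (\<tau> - r) (f p - f q)) \<le> D" by (rule qs1D[OF f])
  moreover have "norm (\<Phi> (\<tau> - r - s) (g (f p) - g (f q))) \<le> C * (1 + norm (\<Phi> (\<tau> - r) (f p - f q)))"
    by (rule qs1_chain[OF g])
  ultimately have "norm (\<Phi> (\<tau> - r - s) (g (f p) - g (f q))) \<le> C * (1 + D)"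
    using qs1_nonneg[OF g] by (meson add_left_mono mult_left_mono order.trans)
  then show "norm (\<Phi> (\<tau> - (s + r)) ((g \<circ> f) p - (g \<circ> f) q)) \<le> C * (1 + D)"
    by (simp add: algebra_simps)
qed

text \<open>The unit-scale bound at the later time \<open>\<theta> + \<tau>\<close>, followed by
  flowing back for the time \<open>\<theta>\<close>. For large \<open>\<theta>\<close> this is a
  modulus of continuity at every scale, common to all maps with the same \<open>C\<close>.\<close>

lemma qs1_modulus:
  assumes g: "qs1 C s g" and small: "\<mu> \<theta> * norm (\<Phi> \<tau> (p - q)) \<le> 1"
  shows "norm (\<Phi> (\<tau> - s) (g p - g q)) \<le> \<mu> (- \<theta>) * C"
proof -
  have "norm (\<Phi> (\<theta> + \<tau>) (p - q)) \<le> 1"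
    using flow_bound[of \<theta> "\<Phi> \<tau> (p - q)"] small by (simp only: flow_add)
  then have "norm (\<Phi> (\<theta> + \<tau> - s) (g p - g q)) \<le> C" by (rule qs1D[OF g])
  moreover have "\<Phi> (\<tau> - s) (g p - g q) = \<Phi> (- \<theta>) (\<Phi> (\<theta> + \<tau> - s) (g p - g q))"
    by (rule flow_split) simp
  ultimately show ?thesis
    using flow_bound[of "- \<theta>" "\<Phi> (\<theta> + \<tau> - s) (g p - g q)"] mu_pos[of "- \<theta>"]
    by (metis mult_left_mono order.trans less_imp_le)
qed

lemma qs1_continuous_at:
  assumes g: "qs1 C s g" and e: "0 < e"
  obtains d where "0 < d" "\<And>p q :: 'a. norm (p - q) < d \<Longrightarrow> norm (g p - g q) < e"
proof -
  have "0 < e / (C + 1)" using e qs1_nonneg[OF g] by simp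
  then obtain t where t: "\<mu> t < e / (C + 1)" by (rule mu_small)
  show thesis
  proof (rule that[of "1 / \<mu> (s - t)"])
    show "0 < 1 / \<mu> (s - t)" using mu_pos by simp
    fix p q :: 'a assume "norm (p - q) < 1 / \<mu> (s - t)"
    then have "\<mu> (s - t) * norm (p - q) \<le> 1" using mu_pos[of "s - t"] by (simp add: field_simps)
    then have "norm (\<Phi> (s - t) (p - q)) \<le> 1" using flow_bound order.trans by blast
    then have "norm (\<Phi> (s - t - s) (g p - g q)) \<le> C" by (rule qs1D[OF g])
    then have "norm (\<Phi> (- t) (g p - g q)) \<le> C" by simp
    then have "norm (\<Phi> t (\<Phi> (- t) (g p - g q))) \<le> \<mu> t * C"
      using flow_bound[of t "\<Phi> (- t) (g p - g q)"] mu_pos[of t]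
      by (metis mult_left_mono order.trans less_imp_le)
    then have "norm (g p - g q) \<le> \<mu> t * C" by (simp only: flow_inverse)
    also have "\<dots> \<le> \<mu> t * (C + 1)" using mu_pos[of t] by simp
    also have "\<dots> < e" using t qs1_nonneg[OF g] by (simp add: field_simps)
    finally show "norm (g p - g q) < e" .
  qed
qed

lemma qs1_imp_continuous: "qs1 C s g \<Longrightarrow> continuous_on S g"
  unfolding continuous_on_iff dist_norm
  by (metis qs1_continuous_at norm_minus_commute)

text \<open>The additional flow time \<open>s - s'\<close> costs the operator bound, which by
  monotonicity is at most \<open>\<mu> c\<close>. The condition is one-sided, so the exponent may be
  raised by any amount.\<close>

lemma qs1_rescale:
  assumes g: "qs1 C s g" and le: "s - s' \<le> c"
  shows "qs1 (\<mu> c * C) s' g"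
  unfolding qs1_def
proof (intro allI impI)
  fix \<tau> p q assume "norm (\<Phi> \<tau> (p - q)) \<le> 1"
  then have *: "norm (\<Phi> (\<tau> - s) (g p - g q)) \<le> C" by (rule qs1D[OF g])
  have "\<Phi> (\<tau> - s') (g p - g q) = \<Phi> (s - s') (\<Phi> (\<tau> - s) (g p - g q))"
    by (rule flow_split) simp
  then have "norm (\<Phi> (\<tau> - s') (g p - g q)) \<le> \<mu> (s - s') * norm (\<Phi> (\<tau> - s) (g p - g q))"
    using flow_bound by metis
  also have "\<dots> \<le> \<mu> c * C"
    using * mu_mono[OF le] mu_pos[of c] by (intro mult_mono) (auto simp: less_imp_le)
  finally show "norm (\<Phi> (\<tau> - s') (g p - g q)) \<le> \<mu> c * C" .
qed

lemma qs_bij: "qs C s g \<Longrightarrow> bij g" and qs_qs1: "qs C s g \<Longrightarrow> qs1 C s g"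
  and qs_inv1: "qs C s g \<Longrightarrow> qs1 C (- s) (inv_into UNIV g)"
  by (simp_all add: qs_def)

lemma qs_inv: "qs C s g \<Longrightarrow> qs C (- s) (inv_into UNIV g)"
  by (simp add: qs_def bij_imp_bij_inv inv_inv_eq)

lemma qs_comp:
  assumes "qs C s g" "qs D r f"
  shows "qs (max (C * (1 + D)) (D * (1 + C))) (s + r) (g \<circ> f)"
proof -
  have "qs1 (C * (1 + D)) (s + r) (g \<circ> f)"
    using assms by (auto intro!: qs1_comp simp: qs_def)
  moreover have "qs1 (D * (1 + C)) (- (s + r)) (inv_into UNIV f \<circ> inv_into UNIV g)"
    using qs1_comp[OF qs_inv1[OF assms(2)] qs_inv1[OF assms(1)]] by (simp add: add.commute)
  ultimately show ?thesis
    using assms qs1_mono[OF _ max.cobounded1] qs1_mono[OF _ max.cobounded2]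
    by (simp add: qs_def bij_comp o_inv_distrib del: minus_add_distrib)
qed

end

text \<open>\<open>E\<close> is a growth class and \<open>pr\<close> extracts the leading
  coefficient of its members. The summand 1 in the growth bound matches the additive 1 of
  \<open>qs1_chain\<close>; it also leaves room at negative times, where components of smaller
  eigenvalues decay more slowly than \<open>exp (\<alpha> * \<tau>)\<close>.\<close>

locale flow_level = expanding_flow +
  fixes \<alpha> :: real and pr :: "'a \<Rightarrow> 'a" and E :: "'a set"
  assumes alpha_pos: "0 < \<alpha>" and linear_pr: "linear pr"
    and E_def: "E = {v. \<exists>c. \<forall>\<tau>. norm (\<Phi> \<tau> v) \<le> c * (1 + exp (\<alpha> * \<tau>))}"
    and pr_lim: "v \<in> E \<Longrightarrow> ((\<lambda>\<tau>. exp (- \<alpha> * \<tau>) *\<^sub>R \<Phi> \<tau> v) \<longlongrightarrow> pr v) at_top"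
begin

definition U :: "'a set" where "U = {v\<in>E. pr v = 0}"

text \<open>The eigenspace of \<open>\<alpha>\<close>, phrased through the flow because the locale
  has no generator at hand.\<close>

definition K :: "'a set" where "K = {v. \<forall>\<tau>. \<Phi> \<tau> v = exp (\<alpha> * \<tau>) *\<^sub>R v}"

lemma pr_simps [simp]: "pr 0 = 0" "pr (x + y) = pr x + pr y"
  "pr (x - y) = pr x - pr y" "pr (c *\<^sub>R x) = c *\<^sub>R pr x" "pr (- x) = - pr x"
  using linear_pr by (simp_all add: linear_0 linear_add linear_diff linear_scale linear_neg)

lemma E_I: "(\<And>\<tau>. norm (\<Phi> \<tau> v) \<le> c * (1 + exp (\<alpha> * \<tau>))) \<Longrightarrow> v \<in> E"
  unfolding E_def by blast

lemma E_D: assumes "v \<in> E" obtains c where "0 \<le> c" "\<And>\<tau>. norm (\<Phi> \<tau> v) \<le> c * (1 + exp (\<alpha> * \<tau>))"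
proof -
  obtain c where c: "\<And>\<tau>. norm (\<Phi> \<tau> v) \<le> c * (1 + exp (\<alpha> * \<tau>))" using assms E_def by auto
  have "0 \<le> c * (1 + exp (\<alpha> * 0))" using c[of 0] norm_ge_zero order.trans by blast
  then show thesis using c by (intro that) (auto simp: zero_le_mult_iff)
qed

lemma E_subspace: "subspace E"
  unfolding subspace_def
proof (intro conjI ballI allI)
  show "0 \<in> E" by (rule E_I[of _ 0]) simp
  show "x + y \<in> E" if xy: "x \<in> E" "y \<in> E" for x y
  proof -
    obtain c where c: "\<And>\<tau>. norm (\<Phi> \<tau> x) \<le> c * (1 + exp (\<alpha> * \<tau>))" by (rule E_D[OF xy(1)]) blast
    obtain d where d: "\<And>\<tau>. norm (\<Phi> \<tau> y) \<le> d * (1 + exp (\<alpha> * \<tau>))" by (rule E_D[OF xy(2)]) blast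
    show ?thesis
    proof (rule E_I)
      fix \<tau> show "norm (\<Phi> \<tau> (x + y)) \<le> (c + d) * (1 + exp (\<alpha> * \<tau>))"
        using c[of \<tau>] d[of \<tau>] norm_triangle_ineq[of "\<Phi> \<tau> x" "\<Phi> \<tau> y"] by (simp add: algebra_simps)
    qed
  qed
  show "r *\<^sub>R x \<in> E" if x: "x \<in> E" for r x
  proof -
    obtain c where c: "\<And>\<tau>. norm (\<Phi> \<tau> x) \<le> c * (1 + exp (\<alpha> * \<tau>))" by (rule E_D[OF x]) blast
    show ?thesis
    proof (rule E_I)
      fix \<tau> show "norm (\<Phi> \<tau> (r *\<^sub>R x)) \<le> (\<bar>r\<bar> * c) * (1 + exp (\<alpha> * \<tau>))"
        using mult_left_mono[OF c[of \<tau>], of "\<bar>r\<bar>"] by (simp add: algebra_simps)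
    qed
  qed
qed

lemma E_flow: assumes "v \<in> E" shows "\<Phi> t v \<in> E"
proof -
  obtain c where c: "0 \<le> c" "\<And>\<tau>. norm (\<Phi> \<tau> v) \<le> c * (1 + exp (\<alpha> * \<tau>))" using E_D[OF assms] by blast
  show ?thesis
  proof (rule E_I)
    fix \<tau>
    have "norm (\<Phi> \<tau> (\<Phi> t v)) \<le> c * (1 + exp (\<alpha> * \<tau>) * exp (\<alpha> * t))"
      using c(2)[of "\<tau> + t"] by (simp add: flow_add algebra_simps exp_add)
    also have "\<dots> \<le> c * ((1 + exp (\<alpha> * t)) * (1 + exp (\<alpha> * \<tau>)))"
      by (rule mult_left_mono[OF _ c(1)]) (simp add: algebra_simps)
    finally show "norm (\<Phi> \<tau> (\<Phi> t v)) \<le> (c * (1 + exp (\<alpha> * t))) * (1 + exp (\<alpha> * \<tau>))"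
      by (simp add: algebra_simps)
  qed
qed

lemma pr_flow: assumes "v \<in> E" shows "pr (\<Phi> t v) = exp (\<alpha> * t) *\<^sub>R pr v"
proof -
  have "((\<lambda>\<tau>. exp (- \<alpha> * (\<tau> + t)) *\<^sub>R \<Phi> (\<tau> + t) v) \<longlongrightarrow> pr v) at_top"
    by (rule filterlim_compose[OF pr_lim[OF assms] filterlim_add_const_at_top])
  then have "((\<lambda>\<tau>. exp (\<alpha> * t) *\<^sub>R (exp (- \<alpha> * (\<tau> + t)) *\<^sub>R \<Phi> (\<tau> + t) v)) \<longlongrightarrow> exp (\<alpha> * t) *\<^sub>R pr v) at_top"
    by (intro tendsto_intros)
  moreover have "exp (\<alpha> * t) *\<^sub>R (exp (- \<alpha> * (\<tau> + t)) *\<^sub>R \<Phi> (\<tau> + t) v) = exp (- \<alpha> * \<tau>) *\<^sub>R \<Phi> \<tau> (\<Phi> t v)" for \<tau>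
    by (simp add: flow_add algebra_simps flip: exp_add)
  ultimately have "((\<lambda>\<tau>. exp (- \<alpha> * \<tau>) *\<^sub>R \<Phi> \<tau> (\<Phi> t v)) \<longlongrightarrow> exp (\<alpha> * t) *\<^sub>R pr v) at_top"
    by simp
  then show ?thesis
    using tendsto_unique[OF _ pr_lim[OF E_flow[OF assms]]] by (simp add: trivial_limit_at_top_linorder)
qed

lemma pr_eigen: assumes "v \<in> E" shows "\<Phi> t (pr v) = exp (\<alpha> * t) *\<^sub>R pr v"
proof -
  have "((\<lambda>\<tau>. \<Phi> t (exp (- \<alpha> * \<tau>) *\<^sub>R \<Phi> \<tau> v)) \<longlongrightarrow> \<Phi> t (pr v)) at_top"
    by (intro tendsto_intros pr_lim assms)
  moreover have "\<Phi> t (exp (- \<alpha> * \<tau>) *\<^sub>R \<Phi> \<tau> v) = exp (- \<alpha> * \<tau>) *\<^sub>R \<Phi> \<tau> (\<Phi> t v)" for \<tau>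
    by (simp add: add.commute flip: flow_add)
  ultimately have "((\<lambda>\<tau>. exp (- \<alpha> * \<tau>) *\<^sub>R \<Phi> \<tau> (\<Phi> t v)) \<longlongrightarrow> \<Phi> t (pr v)) at_top" by simp
  then have "\<Phi> t (pr v) = pr (\<Phi> t v)"
    using tendsto_unique[OF _ _ pr_lim[OF E_flow[OF assms]]] by (simp add: trivial_limit_at_top_linorder)
  then show ?thesis using pr_flow[OF assms] by simp
qed

lemma pr_in_K: "v \<in> E \<Longrightarrow> pr v \<in> K"
  by (simp add: K_def pr_eigen)

lemma K_in_E: assumes "v \<in> K" shows "v \<in> E"
proof (rule E_I)
  fix \<tau> show "norm (\<Phi> \<tau> v) \<le> norm v * (1 + exp (\<alpha> * \<tau>))"
    using assms by (simp add: K_def algebra_simps)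
qed

lemma K_flow: "v \<in> K \<Longrightarrow> \<Phi> t v = exp (\<alpha> * t) *\<^sub>R v"
  by (simp add: K_def)

lemma K_subspace: "subspace K"
  by (auto simp: subspace_def K_def algebra_simps)

lemma pr_K: assumes "v \<in> K" shows "pr v = v"
proof -
  have "((\<lambda>\<tau>. exp (- \<alpha> * \<tau>) *\<^sub>R \<Phi> \<tau> v) \<longlongrightarrow> v) at_top"
    using assms by (simp add: K_def flip: exp_add)
  then show ?thesis
    using tendsto_unique[OF _ pr_lim[OF K_in_E[OF assms]]] by (simp add: trivial_limit_at_top_linorder)
qed

lemma U_subspace: "subspace U"
  using E_subspace by (auto simp: subspace_def U_def)

lemma U_flow: "v \<in> U \<Longrightarrow> \<Phi> t v \<in> U"
  by (simp add: U_def E_flow pr_flow)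

lemma closed_E: "closed E" and closed_U: "closed U"
  using E_subspace U_subspace by (simp_all add: closed_subspace)

text \<open>Conjugation by the flow spreads the boundedness of \<open>pr\<close> to all scales: a
  difference that is bounded at scale \<open>\<tau>\<close> has a leading term of order
  \<open>exp (- \<alpha> * \<tau>)\<close>.\<close>

lemma pr_le: "\<exists>c>0. \<forall>v\<in>E. \<forall>\<tau>. norm (pr v) \<le> c * exp (- \<alpha> * \<tau>) * norm (\<Phi> \<tau> v)"
proof -
  obtain c where c: "0 < c" "\<And>v. norm (pr v) \<le> c * norm v"
    using linear_bounded_pos[OF linear_pr] by auto
  have "norm (pr v) \<le> c * exp (- \<alpha> * \<tau>) * norm (\<Phi> \<tau> v)" if v: "v \<in> E" for v \<tau>
  proof -
    have "norm (pr v) = exp (- \<alpha> * \<tau>) * norm (pr (\<Phi> \<tau> v))"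
      by (simp add: pr_flow[OF v] flip: exp_add mult.assoc)
    also have "\<dots> \<le> exp (- \<alpha> * \<tau>) * (c * norm (\<Phi> \<tau> v))"
      by (rule mult_left_mono[OF c(2)]) simp
    finally show ?thesis by (simp add: mult_ac)
  qed
  then show ?thesis using c(1) by auto
qed

lemma continuous_pr: "continuous_on S pr"
  using linear_pr by (simp add: linear_continuous_on linear_conv_bounded_linear[THEN iffD1])

lemma tendsto_pr [tendsto_intros]: "(f \<longlongrightarrow> l) F \<Longrightarrow> ((\<lambda>x. pr (f x)) \<longlongrightarrow> pr l) F"
  using continuous_pr[of UNIV] continuous_on_tendsto_compose[of UNIV pr f l F] by simp

text \<open>By \<open>qs1_chain\<close> the image grows at most like the source with time shifted by
  \<open>s\<close>, and a shift of time only changes the constant of the growth class.\<close>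

lemma qs1_E:
  assumes g: "qs1 C s g" and pq: "p - q \<in> E"
  shows "g p - g q \<in> E"
proof -
  obtain c where c: "0 \<le> c" "\<And>\<tau>. norm (\<Phi> \<tau> (p - q)) \<le> c * (1 + exp (\<alpha> * \<tau>))" using E_D[OF pq] by blast
  show ?thesis
  proof (rule E_I)
    fix \<tau>
    have "norm (\<Phi> \<tau> (g p - g q)) \<le> C * (1 + norm (\<Phi> (\<tau> + s) (p - q)))"
      using qs1_chain[OF g, of "\<tau> + s" p q] by simp
    also have "\<dots> \<le> C * (1 + c * (1 + exp (\<alpha> * s) * exp (\<alpha> * \<tau>)))"
      using c(2)[of "\<tau> + s"] qs1_nonneg[OF g]
      by (intro mult_left_mono add_left_mono) (simp_all add: algebra_simps exp_add)
    also have "\<dots> \<le> C * ((1 + c * (1 + exp (\<alpha> * s))) * (1 + exp (\<alpha> * \<tau>)))"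
      using c(1) qs1_nonneg[OF g] by (intro mult_left_mono) (simp_all add: algebra_simps)
    finally show "norm (\<Phi> \<tau> (g p - g q)) \<le> (C * (1 + c * (1 + exp (\<alpha> * s)))) * (1 + exp (\<alpha> * \<tau>))"
      by (simp add: mult.assoc)
  qed
qed

text \<open>Since \<open>\<alpha>\<close> is positive, the additive 1 of \<open>qs1_chain\<close>
  disappears after division by \<open>exp (\<alpha> * \<tau>)\<close> for large times. The coarse
  estimate thus becomes an honest Lipschitz bound for leading terms.\<close>

lemma qs1_pr:
  assumes g: "qs1 C s g" and pq: "p - q \<in> E"
  shows "norm (pr (g p - g q)) \<le> C * exp (\<alpha> * s) * norm (pr (p - q))"
proof (rule tendsto_le[OF trivial_limit_at_top_linorder])
  show "((\<lambda>\<tau>. norm (exp (- \<alpha> * \<tau>) *\<^sub>R \<Phi> \<tau> (g p - g q))) \<longlongrightarrow> norm (pr (g p - g q))) at_top"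
    by (intro tendsto_norm pr_lim qs1_E[OF g pq])
  have "((\<lambda>\<tau>. exp (- \<alpha> * (\<tau> + s)) *\<^sub>R \<Phi> (\<tau> + s) (p - q)) \<longlongrightarrow> pr (p - q)) at_top"
    by (rule filterlim_compose[OF pr_lim[OF pq] filterlim_add_const_at_top])
  then have lim: "((\<lambda>\<tau>. norm (exp (- \<alpha> * (\<tau> + s)) *\<^sub>R \<Phi> (\<tau> + s) (p - q))) \<longlongrightarrow> norm (pr (p - q))) at_top"
    by (rule tendsto_norm)
  have "((\<lambda>\<tau>. exp (- \<alpha> * \<tau>)) \<longlongrightarrow> 0) at_top"
    using alpha_pos
    by (intro filterlim_compose[OF exp_at_bot] filterlim_tendsto_neg_mult_at_bot[OF tendsto_const]) (auto simp: filterlim_ident)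
  then have "((\<lambda>\<tau>. C * (exp (- \<alpha> * \<tau>) + exp (\<alpha> * s) * norm (exp (- \<alpha> * (\<tau> + s)) *\<^sub>R \<Phi> (\<tau> + s) (p - q))))
      \<longlongrightarrow> C * (0 + exp (\<alpha> * s) * norm (pr (p - q)))) at_top"
    by (intro tendsto_intros lim)
  then show "((\<lambda>\<tau>. C * (exp (- \<alpha> * \<tau>) + exp (\<alpha> * s) * norm (exp (- \<alpha> * (\<tau> + s)) *\<^sub>R \<Phi> (\<tau> + s) (p - q))))
      \<longlongrightarrow> C * exp (\<alpha> * s) * norm (pr (p - q))) at_top"
    by (simp add: mult.assoc)
  show "\<forall>\<^sub>F \<tau> in at_top. norm (exp (- \<alpha> * \<tau>) *\<^sub>R \<Phi> \<tau> (g p - g q)) \<le>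
      C * (exp (- \<alpha> * \<tau>) + exp (\<alpha> * s) * norm (exp (- \<alpha> * (\<tau> + s)) *\<^sub>R \<Phi> (\<tau> + s) (p - q)))"
  proof (rule always_eventually, rule allI)
    fix \<tau>
    have "norm (exp (- \<alpha> * \<tau>) *\<^sub>R \<Phi> \<tau> (g p - g q)) = exp (- \<alpha> * \<tau>) * norm (\<Phi> \<tau> (g p - g q))"
      by simp
    also have "\<dots> \<le> exp (- \<alpha> * \<tau>) * (C * (1 + norm (\<Phi> (\<tau> + s) (p - q))))"
      using qs1_chain[OF g, of "\<tau> + s" p q] by (intro mult_left_mono) auto
    also have "\<dots> = C * (exp (- \<alpha> * \<tau>) + exp (- \<alpha> * \<tau>) * norm (\<Phi> (\<tau> + s) (p - q)))"
      by (simp only: algebra_simps)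
    also have "exp (- \<alpha> * \<tau>) * norm (\<Phi> (\<tau> + s) (p - q))
        = exp (\<alpha> * s) * norm (exp (- \<alpha> * (\<tau> + s)) *\<^sub>R \<Phi> (\<tau> + s) (p - q))"
    proof -
      have "exp (- \<alpha> * \<tau>) = exp (\<alpha> * s) * exp (- \<alpha> * (\<tau> + s))"
        by (simp add: algebra_simps flip: exp_add)
      then show ?thesis by (simp only: norm_scaleR abs_exp_cancel mult.assoc)
    qed
    finally show "norm (exp (- \<alpha> * \<tau>) *\<^sub>R \<Phi> \<tau> (g p - g q)) \<le>
      C * (exp (- \<alpha> * \<tau>) + exp (\<alpha> * s) * norm (exp (- \<alpha> * (\<tau> + s)) *\<^sub>R \<Phi> (\<tau> + s) (p - q)))" .
  qed
qed

section \<open>Groups acting at one eigenvalue level\<close>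

text \<open>The difference of two displacements regroups as
  \<open>(g p - g p') - (g q - g q')\<close>, two transverse differences that are bounded at scale
  \<open>\<tau> - s\<close>. So displacements along neighbouring cosets agree up to an error that
  does not depend on their length.\<close>

lemma qs1_transverse:
  "\<exists>c>0. \<forall>C s g \<tau> p q p' q'. qs1 C s g \<longrightarrow> p - q \<in> E \<longrightarrow> p' - q' \<in> E \<longrightarrow>
    norm (\<Phi> \<tau> (p - p')) \<le> 1 \<longrightarrow> norm (\<Phi> \<tau> (q - q')) \<le> 1 \<longrightarrow>
    norm (pr (g p - g q) - pr (g p' - g q')) \<le> c * C * exp (- \<alpha> * (\<tau> - s))"
proof -
  obtain c where c: "0 < c" "\<And>v \<tau>. v \<in> E \<Longrightarrow> norm (pr v) \<le> c * exp (- \<alpha> * \<tau>) * norm (\<Phi> \<tau> v)"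
    using pr_le by auto
  show ?thesis
  proof (rule exI[of _ "2 * c"], intro conjI allI impI)
    fix C s g \<tau> p q p' q'
    assume g: "qs1 C s g" and E: "p - q \<in> E" "p' - q' \<in> E"
      and le: "norm (\<Phi> \<tau> (p - p')) \<le> 1" "norm (\<Phi> \<tau> (q - q')) \<le> 1"
    define v where "v = (g p - g q) - (g p' - g q')"
    have v: "v \<in> E" unfolding v_def using E_subspace qs1_E[OF g E(1)] qs1_E[OF g E(2)]
      by (rule subspace_diff)
    have "v = (g p - g p') - (g q - g q')" by (simp add: v_def)
    then have "\<Phi> (\<tau> - s) v = \<Phi> (\<tau> - s) (g p - g p') - \<Phi> (\<tau> - s) (g q - g q')"
      by (simp only: flow_simps)
    then have "norm (\<Phi> (\<tau> - s) v) \<le> norm (\<Phi> (\<tau> - s) (g p - g p')) + norm (\<Phi> (\<tau> - s) (g q - g q'))"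
      by (simp only: norm_triangle_ineq4)
    also have "\<dots> \<le> C + C" by (rule add_mono) (rule qs1D[OF g le(1)], rule qs1D[OF g le(2)])
    finally have "c * exp (- \<alpha> * (\<tau> - s)) * norm (\<Phi> (\<tau> - s) v) \<le> c * exp (- \<alpha> * (\<tau> - s)) * (C + C)"
      using c(1) by (intro mult_left_mono) auto
    with c(2)[OF v, of "\<tau> - s"] have "norm (pr v) \<le> c * exp (- \<alpha> * (\<tau> - s)) * (C + C)"
      by (rule order.trans)
    moreover have "pr v = pr (g p - g q) - pr (g p' - g q')"
      unfolding v_def by (rule pr_simps(3))
    moreover have "c * e * (C + C) = 2 * c * C * e" for e :: real by algebra
    ultimately show "norm (pr (g p - g q) - pr (g p' - g q')) \<le> 2 * c * C * exp (- \<alpha> * (\<tau> - s))"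
      by (simp only:)
  qed (use c in simp)
qed

text \<open>The convexity gap between the speeds on two adjacent segments and the speed on their
  union. With squares, a vanishing gap forces equality in the triangle inequality and also equal
  lengths of both halves; the gap of the speeds themselves would give only the former.\<close>

definition defect :: "('a \<Rightarrow> 'a \<Rightarrow> real) \<Rightarrow> 'a \<Rightarrow> 'a \<Rightarrow> real \<Rightarrow> real" where
  "defect R q v r = ((R q (q + r *\<^sub>R v) / r)\<^sup>2 + (R (q + r *\<^sub>R v) (q + (2 * r) *\<^sub>R v) / r)\<^sup>2) / 2
     - (R q (q + (2 * r) *\<^sub>R v) / (2 * r))\<^sup>2"

text \<open>Averaged over translations and over dyadic scales, the three squares in the defect have
  almost the same mean, because the means telescope over the scales; the defect is nonnegative
  by convexity, hence small somewhere.\<close>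

lemma exists_small_defect:
  fixes R :: "'i \<Rightarrow> 'a \<Rightarrow> 'a \<Rightarrow> real"
  assumes fin: "finite I" "finite X" "finite V" and VK: "V \<subseteq> K"
    and tri: "\<And>i x y z. i \<in> I \<Longrightarrow> x - y \<in> E \<Longrightarrow> y - z \<in> E \<Longrightarrow> R i x z \<le> R i x y + R i y z"
    and nonneg: "\<And>i x y. i \<in> I \<Longrightarrow> x - y \<in> E \<Longrightarrow> 0 \<le> R i x y"
    and bound: "\<And>i x y. i \<in> I \<Longrightarrow> x - y \<in> E \<Longrightarrow> R i x y \<le> B * norm (pr (x - y))"
    and e: "0 < e"
  shows "\<exists>p s. norm p \<le> 1 \<and> S \<le> s \<and>
    (\<forall>i\<in>I. \<forall>x\<in>X. \<forall>v\<in>V. defect (R i) (p + \<Phi> (- s) x) v (exp (- \<alpha> * s)) \<le> e)"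
proof -
  define M where "M = (\<Sum>v\<in>V. \<bar>B\<bar> * norm v)"
  have M: "B * norm v \<le> M" if "v \<in> V" for v
  proof -
    have "B * norm v \<le> \<bar>B\<bar> * norm v" by (simp add: mult_right_mono)
    also have "\<dots> \<le> M" unfolding M_def using fin that by (intro member_le_sum) auto
    finally show ?thesis .
  qed
  define N where "N = real (card (I \<times> X \<times> V))"
  \<comment> \<open>The number of scales. Each of the \<open>N\<close> triples contributes at most
    \<open>7 * M\<^sup>2\<close> to the total: \<open>M\<^sup>2\<close> from the last scale and six
    times this from three shift errors of size \<open>2 * M\<^sup>2 / T\<close> at each of
    \<open>T\<close> scales. Spread over \<open>T\<close> scales, less than \<open>e\<close> remains
    for one of them.\<close>
  obtain T :: nat where "7 * N * M\<^sup>2 / e < real T" using reals_Archimedean2 by blast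
  then have "7 * N * M\<^sup>2 / e \<le> real (Suc T)" by simp
  then obtain T where T: "0 < T" "7 * N * M\<^sup>2 \<le> e * real T"
    using e by (intro that[of "Suc T"]) (simp_all add: field_simps)
  obtain ys where ys: "set ys = X \<union> V" using fin finite_list by (metis finite_Un)
  define D where "D = (\<Sum>y\<leftarrow>ys. norm y)"
  have D: "norm y \<le> D" if "y \<in> X \<union> V" for y
    unfolding D_def using that ys by (intro member_le_sum_list) auto
  have D0: "0 \<le> D" unfolding D_def by (intro sum_list_nonneg) auto
  \<comment> \<open>In this time the vectors of \<open>K\<close> double under the flow, so
    consecutive scales are dyadic.\<close>
  define \<sigma> where "\<sigma> = ln 2 / \<alpha>"
  have \<sigma>: "0 < \<sigma>" using alpha_pos by (simp add: \<sigma>_def)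
  define cnt where "cnt = real (length [0..<Suc T] * length ys)"
  have "0 < 1 / (real T * cnt * D + 1)" using D0 by (simp add: cnt_def add_nonneg_pos)
  \<comment> \<open>The starting scale is finer than \<open>S\<close> and so fine that all shifts of
    the average together move a point by at most 1.\<close>
  then obtain t where t: "\<mu> t < 1 / (real T * cnt * D + 1)" "t \<le> min (- S) 0" by (rule mu_small)
  define s where "s j = - t + real j * \<sigma>" for j :: nat
  define \<kappa> where "\<kappa> j = exp (- \<alpha> * s j)" for j
  have \<kappa>: "0 < \<kappa> j" "\<kappa> j = 2 * \<kappa> (Suc j)" for j
  proof -
    have "- \<alpha> * s j = ln 2 + - \<alpha> * s (Suc j)"
      using alpha_pos by (simp add: s_def \<sigma>_def field_simps)
    then show "\<kappa> j = 2 * \<kappa> (Suc j)" unfolding \<kappa>_def by (simp only: exp_add) simp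
  qed (simp add: \<kappa>_def)
  \<comment> \<open>Both kinds of translation that occur are covered: the test positions at scale
    \<open>s j\<close>, and the steps \<open>\<kappa> j *\<^sub>R v\<close>, which equal
    \<open>\<Phi> (- s j) v\<close> because \<open>v\<close> is an eigenvector.\<close>
  define ws where "ws = concat (map (\<lambda>j. map (\<lambda>y. \<Phi> (- s j) y) ys) [0..<Suc T])"
  have ws: "\<Phi> (- s j) y \<in> set ws" if "y \<in> X \<union> V" "j \<le> T" for y j
    using that ys by (force simp: ws_def)
  have small: "norm w \<le> \<mu> t * D" if w: "w \<in> set ws" for w
  proof -
    obtain j y where jy: "w = \<Phi> (- s j) y" "y \<in> X \<union> V" using w ys by (auto simp: ws_def)
    have "norm w \<le> \<mu> (- s j) * norm y" using flow_bound jy by simp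
    also have "\<dots> \<le> \<mu> t * D"
      using \<sigma> mu_pos[of t] D[OF jy(2)]
      by (intro mult_mono mu_mono) (auto simp: s_def less_imp_le)
    finally show ?thesis .
  qed
  have "length ws = length [0..<Suc T] * length ys"
    by (simp add: ws_def length_concat comp_def sum_list_triv del: upt_Suc)
  then have len: "real (length ws) = cnt" by (simp add: cnt_def del: upt_Suc)
  have "(\<Sum>w\<leftarrow>ws. norm w) \<le> (\<Sum>w\<leftarrow>ws. \<mu> t * D)" by (rule sum_list_mono) (rule small)
  also have "\<dots> = cnt * (\<mu> t * D)" by (simp add: sum_list_triv len)
  finally have "real T * (\<Sum>w\<leftarrow>ws. norm w) \<le> real T * (cnt * (\<mu> t * D))"
    by (rule mult_left_mono) simp
  also have "\<dots> = (real T * cnt * D) * \<mu> t" by simp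
  also have "\<dots> \<le> (real T * cnt * D + 1) * \<mu> t" using mu_pos[of t] by (simp add: algebra_simps)
  also have "\<dots> \<le> 1"
  proof -
    have "0 < real T * cnt * D + 1" using D0 by (simp add: cnt_def add_nonneg_pos)
    then show ?thesis using t(1) by (simp add: pos_less_divide_eq mult.commute)
  qed
  finally have total: "real T * (\<Sum>w\<leftarrow>ws. norm w) \<le> 1" .
  define f where "f i v j p = (R i p (p + \<kappa> j *\<^sub>R v) / \<kappa> j)\<^sup>2" for i v j p
  have KE: "c *\<^sub>R v \<in> E" "- (c *\<^sub>R v) \<in> E" if "v \<in> V" for v c
    using that VK K_in_E E_subspace by (auto intro!: subspace_scale subspace_neg)
  have le: "R i p (p + c *\<^sub>R v) / c \<le> M" "0 \<le> R i p (p + c *\<^sub>R v) / c" if "i \<in> I" "v \<in> V" "0 < c" for i v c p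
  proof -
    have pE: "p - (p + c *\<^sub>R v) \<in> E" using KE[OF that(2)] by simp
    have "pr v = v" using that VK pr_K by auto
    then have "R i p (p + c *\<^sub>R v) \<le> c * (B * norm v)"
      using bound[OF that(1) pE] that(3) by (simp add: mult_ac)
    also have "\<dots> \<le> c * M" using M[OF that(2)] that(3) by simp
    finally show "R i p (p + c *\<^sub>R v) / c \<le> M" using that(3) by (simp add: field_simps)
    show "0 \<le> R i p (p + c *\<^sub>R v) / c" using nonneg[OF that(1) pE] that(3) by simp
  qed
  have f_abs: "\<bar>f i v j p\<bar> \<le> M\<^sup>2" if "i \<in> I" "v \<in> V" for i v j p
    unfolding f_def using le[OF that \<kappa>(1)] by (simp add: power_mono)
  define dfct where "dfct i x v j p = (f i v (Suc j) (p + \<Phi> (- s (Suc j)) x)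
      + f i v (Suc j) (p + \<Phi> (- s (Suc j)) x + \<kappa> (Suc j) *\<^sub>R v)) / 2 - f i v j (p + \<Phi> (- s (Suc j)) x)"
    for i x v j p
  have two: "q + r *\<^sub>R v + r *\<^sub>R v = q + (2 * r) *\<^sub>R v" for q v :: 'a and r
    by (simp add: add.assoc flip: scaleR_add_left)
  have dfct_eq: "dfct i x v j p = defect (R i) (p + \<Phi> (- s (Suc j)) x) v (\<kappa> (Suc j))" for i x v j p
    by (simp only: dfct_def f_def defect_def \<kappa>(2)[of j] two)
  have dfct_nonneg: "0 \<le> dfct i x v j p" if ixv: "i \<in> I" "v \<in> V" for i x v j p
  proof -
    define q where "q = p + \<Phi> (- s (Suc j)) x"
    define r where "r = \<kappa> (Suc j)"
    have r: "0 < r" using \<kappa>(1) by (simp add: r_def)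
    define a where "a = R i q (q + r *\<^sub>R v) / r"
    define b where "b = R i (q + r *\<^sub>R v) (q + r *\<^sub>R v + r *\<^sub>R v) / r"
    define c where "c = R i q (q + (2 * r) *\<^sub>R v) / (2 * r)"
    have "R i q (q + (2 * r) *\<^sub>R v) \<le> R i q (q + r *\<^sub>R v) + R i (q + r *\<^sub>R v) (q + (2 * r) *\<^sub>R v)"
      using KE[OF ixv(2), of r] unfolding two[symmetric] by (intro tri ixv) simp_all
    then have "c \<le> (a + b) / 2"
      using r unfolding a_def b_def c_def two by (simp add: field_simps del: scaleR_add_right)
    moreover have "0 \<le> c" unfolding c_def using r by (intro le ixv) auto
    ultimately have "c\<^sup>2 \<le> ((a + b) / 2)\<^sup>2" by (rule power_mono)
    also have "\<dots> \<le> (a\<^sup>2 + b\<^sup>2) / 2"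
      using sum_squares_ge_zero[of "a - b" 0] by (simp add: power2_eq_square field_simps)
    finally show ?thesis
      by (simp add: dfct_def f_def q_def[symmetric] r_def[symmetric] \<kappa>(2)[of j] a_def b_def c_def)
  qed
  define Av where "Av \<phi> = shift_avg T ws \<phi> 0" for \<phi> :: "'a \<Rightarrow> real"
  define \<eta> where "\<eta> = 2 * M\<^sup>2 / real T"
  have shift: "\<bar>Av (\<lambda>p. \<phi> (p + w)) - Av \<phi>\<bar> \<le> \<eta>" if "\<And>p. \<bar>\<phi> p\<bar> \<le> M\<^sup>2" "w \<in> set ws" for \<phi> w
    unfolding Av_def \<eta>_def by (rule shift_avg_almost_invariant[OF T(1) that])
  \<comment> \<open>Up to three shift errors, the mean of the defect is the difference of the means
    of \<open>f\<close> at two consecutive scales; this is the term that telescopes.\<close>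
  have step: "Av (dfct i x v j) \<le> Av (f i v (Suc j)) - Av (f i v j) + 3 * \<eta>"
    if ixv: "i \<in> I" "x \<in> X" "v \<in> V" and j: "j < T" for i x v j
  proof -
    define w where "w = \<Phi> (- s (Suc j)) x"
    define u where "u = \<kappa> (Suc j) *\<^sub>R v"
    have w: "w \<in> set ws" unfolding w_def using ixv j by (intro ws) auto
    have "u = \<Phi> (- s (Suc j)) v" using ixv VK by (auto simp: u_def \<kappa>_def K_flow)
    then have u: "u \<in> set ws" using ixv j by (auto intro!: ws)
    have 1: "\<bar>Av (\<lambda>p. f i v (Suc j) (p + w)) - Av (f i v (Suc j))\<bar> \<le> \<eta>"
      by (rule shift[OF f_abs w]) (use ixv in auto)
    have 2: "\<bar>Av (\<lambda>p. f i v (Suc j) (p + u + w)) - Av (\<lambda>p. f i v (Suc j) (p + w))\<bar> \<le> \<eta>"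
      by (rule shift[OF f_abs u]) (use ixv in auto)
    have 3: "\<bar>Av (\<lambda>p. f i v j (p + w)) - Av (f i v j)\<bar> \<le> \<eta>"
      by (rule shift[OF f_abs w]) (use ixv in auto)
    have "dfct i x v j = (\<lambda>p. (1/2) * (f i v (Suc j) (p + w) + f i v (Suc j) (p + u + w)) - f i v j (p + w))"
      by (rule ext) (simp add: dfct_def w_def u_def add_ac)
    then have "Av (dfct i x v j) = (Av (\<lambda>p. f i v (Suc j) (p + w)) + Av (\<lambda>p. f i v (Suc j) (p + u + w))) / 2
        - Av (\<lambda>p. f i v j (p + w))"
      unfolding Av_def by (simp only: shift_avg_diff shift_avg_cmult shift_avg_add)
    moreover have "0 \<le> \<eta>" by (simp add: \<eta>_def)
    ultimately show ?thesis using 1 2 3 unfolding abs_le_iff by argo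
  qed
  define Tot where "Tot p = (\<Sum>(i, x, v)\<in>I \<times> X \<times> V. \<Sum>j<T. dfct i x v j p)" for p
  have fin3: "finite (I \<times> X \<times> V)" using fin by simp
  have "Av Tot = (\<Sum>(i, x, v)\<in>I \<times> X \<times> V. \<Sum>j<T. Av (dfct i x v j))"
    unfolding Tot_def Av_def case_prod_beta
    by (simp add: shift_avg_sum fin3)
  also have "\<dots> \<le> (\<Sum>(i, x, v)\<in>I \<times> X \<times> V. \<Sum>j<T. Av (f i v (Suc j)) - Av (f i v j) + 3 * \<eta>)"
    by (intro sum_mono) (auto intro!: sum_mono step)
  also have "\<dots> = (\<Sum>(i, x, v)\<in>I \<times> X \<times> V. Av (f i v T) - Av (f i v 0) + 3 * \<eta> * real T)"
  proof (intro sum.cong refl, clarify)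
    fix i x v
    show "(\<Sum>j<T. Av (f i v (Suc j)) - Av (f i v j) + 3 * \<eta>) = Av (f i v T) - Av (f i v 0) + 3 * \<eta> * real T"
      using sum_lessThan_telescope[of "\<lambda>j. Av (f i v j)" T] by (simp add: sum.distrib)
  qed
  also have "\<dots> \<le> (\<Sum>(i, x, v)\<in>I \<times> X \<times> V. 7 * M\<^sup>2)"
  proof (intro sum_mono, clarify)
    fix i x v assume ixv: "i \<in> I" "x \<in> X" "v \<in> V"
    have "\<bar>Av (f i v T)\<bar> \<le> M\<^sup>2"
      unfolding Av_def by (rule shift_avg_abs_le[OF T(1) f_abs]) (use ixv in auto)
    moreover have "0 \<le> Av (f i v 0)"
    proof -
      obtain q where "f i v 0 q \<le> Av (f i v 0)" using exists_le_shift_avg[OF T(1)] unfolding Av_def by blast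
      then show ?thesis by (rule order.trans[rotated]) (simp add: f_def)
    qed
    ultimately show "Av (f i v T) - Av (f i v 0) + 3 * \<eta> * real T \<le> 7 * M\<^sup>2"
      using T(1) by (simp add: \<eta>_def)
  qed
  also have "\<dots> = 7 * N * M\<^sup>2" by (simp add: N_def case_prod_beta)
  finally have "Av Tot \<le> e * real T" using T(2) by linarith
  moreover obtain p where p: "norm p \<le> 1" "Tot p \<le> Av Tot"
    using exists_le_shift_avg[OF T(1), of 0 ws Tot] total unfolding Av_def
    by (metis diff_zero order.trans)
  ultimately have "Tot p \<le> (\<Sum>j<T. e)" by (simp add: mult.commute)
  moreover have "Tot p = (\<Sum>j<T. \<Sum>(i, x, v)\<in>I \<times> X \<times> V. dfct i x v j p)"
    unfolding Tot_def case_prod_beta by (rule sum.swap)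
  ultimately have "(\<Sum>j<T. \<Sum>(i, x, v)\<in>I \<times> X \<times> V. dfct i x v j p) \<le> (\<Sum>j<T. e)" by simp
  then have "\<exists>j<T. (\<Sum>(i, x, v)\<in>I \<times> X \<times> V. dfct i x v j p) \<le> e"
  proof (rule contrapos_pp)
    assume "\<not> (\<exists>j<T. (\<Sum>(i, x, v)\<in>I \<times> X \<times> V. dfct i x v j p) \<le> e)"
    then have "(\<Sum>j<T. e) < (\<Sum>j<T. \<Sum>(i, x, v)\<in>I \<times> X \<times> V. dfct i x v j p)"
      using T(1) by (intro sum_strict_mono) auto
    then show "\<not> (\<Sum>j<T. \<Sum>(i, x, v)\<in>I \<times> X \<times> V. dfct i x v j p) \<le> (\<Sum>j<T. e)" by simp
  qed
  then obtain j where j: "j < T" "(\<Sum>(i, x, v)\<in>I \<times> X \<times> V. dfct i x v j p) \<le> e" by blast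
  have "dfct i x v j p \<le> e" if ixv: "i \<in> I" "x \<in> X" "v \<in> V" for i x v
  proof -
    have "(\<lambda>(i, x, v). dfct i x v j p) (i, x, v) \<le> (\<Sum>(i, x, v)\<in>I \<times> X \<times> V. dfct i x v j p)"
      using ixv dfct_nonneg fin3 by (intro member_le_sum) auto
    then show ?thesis using j(2) by simp
  qed
  then have "\<forall>i\<in>I. \<forall>x\<in>X. \<forall>v\<in>V. defect (R i) (p + \<Phi> (- s (Suc j)) x) v (exp (- \<alpha> * s (Suc j))) \<le> e"
    by (simp add: dfct_eq \<kappa>_def)
  moreover have "S \<le> s (Suc j)"
  proof -
    have "0 \<le> real (Suc j) * \<sigma>" using \<sigma> by simp
    then show ?thesis using t(2) unfolding s_def by linarith
  qed
  ultimately show ?thesis using p(1) by blast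
qed

end

definition (in expanding_flow) uniform_group :: "real \<Rightarrow> ('a \<Rightarrow> 'a) set \<Rightarrow> bool" where
  "uniform_group C G \<longleftrightarrow> id \<in> G \<and> (\<forall>g\<in>G. \<forall>h\<in>G. g \<circ> h \<in> G) \<and>
     (\<forall>g\<in>G. inv_into UNIV g \<in> G \<and> (\<exists>s. qs C s g))"

locale level_group = flow_level +
  fixes C :: real and G :: "('a \<Rightarrow> 'a) set"
  assumes group: "uniform_group C G"
begin

lemma group_id: "id \<in> G" and group_comp: "g \<in> G \<Longrightarrow> h \<in> G \<Longrightarrow> g \<circ> h \<in> G"
  and group_inv: "g \<in> G \<Longrightarrow> inv_into UNIV g \<in> G"
  using group by (auto simp: uniform_group_def)

lemma group_qs: assumes "g \<in> G" obtains s where "qs C s g"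
  using assms group by (auto simp: uniform_group_def)

lemma group_bij: "g \<in> G \<Longrightarrow> bij g"
  using group_qs qs_bij by blast

lemma C_nonneg: "0 \<le> C"
proof -
  obtain s where "qs C s id" using group_qs[OF group_id] .
  from qs1_nonneg[OF qs_qs1[OF this]] show ?thesis .
qed

abbreviation nrm :: "'a \<Rightarrow> real" where "nrm v \<equiv> norm (pr v)"

lemma group_stretch:
  assumes "g \<in> G"
  obtains s where "qs1 C s g"
    "\<And>x y. x - y \<in> E \<Longrightarrow> nrm (g x - g y) \<le> C * exp (\<alpha> * s) * nrm (x - y)"
    "\<And>x y. x - y \<in> E \<Longrightarrow> nrm (x - y) \<le> C * exp (- \<alpha> * s) * nrm (g x - g y)"
proof -
  obtain s where s: "qs C s g" using group_qs[OF assms] .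
  have inv: "inv_into UNIV g (g x) = x" for x using qs_bij[OF s] by (simp add: bij_is_inj)
  have 2: "nrm (x - y) \<le> C * exp (- \<alpha> * s) * nrm (g x - g y)" if "x - y \<in> E" for x y
    using qs1_pr[OF qs_inv1[OF s] qs1_E[OF qs_qs1[OF s] that]] by (simp add: inv del: pr_simps)
  show thesis
    by (rule that[OF qs_qs1[OF s] qs1_pr[OF qs_qs1[OF s]] 2])
qed

text \<open>Precomposing with a group element only permutes the index set of the supremum, so \<open>\<rho>\<close> is exactly
  invariant when all four points are moved.\<close>

definition \<rho> :: "'a \<Rightarrow> 'a \<Rightarrow> 'a \<Rightarrow> 'a \<Rightarrow> real" where
  "\<rho> z w x y = (SUP g\<in>G. nrm (g x - g y) / nrm (g z - g w))"

lemma nrm_group_pos: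
  assumes "g \<in> G" "z - w \<in> E" "0 < nrm (z - w)" shows "0 < nrm (g z - g w)"
proof -
  obtain s where s: "\<And>x y. x - y \<in> E \<Longrightarrow> nrm (x - y) \<le> C * exp (- \<alpha> * s) * nrm (g x - g y)"
    using group_stretch[OF assms(1)] by metis
  show ?thesis
  proof (rule ccontr)
    assume "\<not> ?thesis"
    then have "nrm (g z - g w) = 0" using norm_ge_zero[of "pr (g z - g w)"] by linarith
    then show False using s[OF assms(2)] assms(3) by simp
  qed
qed

text \<open>The unknown dilation factor of \<open>g\<close> cancels between numerator and
  denominator. This is the purpose of the base pair: it makes the supremum over the group
  finite.\<close>

lemma ratio_le:
  assumes g: "g \<in> G" and zw: "z - w \<in> E" "0 < nrm (z - w)" and xy: "x - y \<in> E"
  shows "nrm (g x - g y) / nrm (g z - g w) \<le> C\<^sup>2 * nrm (x - y) / nrm (z - w)"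
proof -
  obtain s where s: "\<And>x y. x - y \<in> E \<Longrightarrow> nrm (g x - g y) \<le> C * exp (\<alpha> * s) * nrm (x - y)"
    "\<And>x y. x - y \<in> E \<Longrightarrow> nrm (x - y) \<le> C * exp (- \<alpha> * s) * nrm (g x - g y)"
    using group_stretch[OF g] by metis
  have "nrm (g x - g y) * nrm (z - w) \<le> (C * exp (\<alpha> * s) * nrm (x - y)) * (C * exp (- \<alpha> * s) * nrm (g z - g w))"
    using C_nonneg by (intro mult_mono s xy zw) auto
  also have "\<dots> = C\<^sup>2 * nrm (x - y) * nrm (g z - g w) * (exp (\<alpha> * s) * exp (- \<alpha> * s))"
    by (simp only: power2_eq_square mult_ac)
  also have "exp (\<alpha> * s) * exp (- \<alpha> * s) = 1" by (simp flip: exp_add)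
  finally show ?thesis
    using zw(2) nrm_group_pos[OF g zw] by (simp add: field_simps del: pr_simps)
qed

lemma ratio_le_rho:
  assumes g: "g \<in> G" and zw: "z - w \<in> E" "0 < nrm (z - w)" and xy: "x - y \<in> E"
  shows "nrm (g x - g y) / nrm (g z - g w) \<le> \<rho> z w x y"
  unfolding \<rho>_def
  by (rule cSUP_upper2[OF _ g]) (use ratio_le[OF _ zw xy] in \<open>auto intro!: bdd_aboveI2\<close>)

lemma rho_le:
  assumes "\<And>g. g \<in> G \<Longrightarrow> nrm (g x - g y) / nrm (g z - g w) \<le> r"
  shows "\<rho> z w x y \<le> r"
  unfolding \<rho>_def using group_id assms by (intro cSUP_least) auto

lemma rho_upper:
  assumes "z - w \<in> E" "0 < nrm (z - w)" "x - y \<in> E"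
  shows "\<rho> z w x y \<le> C\<^sup>2 * nrm (x - y) / nrm (z - w)"
  by (rule rho_le) (rule ratio_le[OF _ assms])

lemma rho_lower:
  assumes "z - w \<in> E" "0 < nrm (z - w)" "x - y \<in> E"
  shows "nrm (x - y) / nrm (z - w) \<le> \<rho> z w x y"
  using ratio_le_rho[OF group_id assms] by simp

lemma rho_nonneg:
  assumes "z - w \<in> E" "0 < nrm (z - w)" "x - y \<in> E"
  shows "0 \<le> \<rho> z w x y"
  using rho_lower[OF assms] assms(2) by (meson divide_nonneg_pos norm_ge_zero order.trans)

lemma rho_sym: "\<rho> z w x y = \<rho> z w y x"
  unfolding \<rho>_def by (metis (no_types) norm_minus_commute pr_simps(3))

lemma rho_triangle:
  assumes zw: "z - w \<in> E" "0 < nrm (z - w)" and xy: "x - y \<in> E" "y - u \<in> E"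
  shows "\<rho> z w x u \<le> \<rho> z w x y + \<rho> z w y u"
proof (rule rho_le)
  fix g assume g: "g \<in> G"
  have "pr (g x - g u) = pr (g x - g y) + pr (g y - g u)" by simp
  then have "nrm (g x - g u) \<le> nrm (g x - g y) + nrm (g y - g u)" by (metis norm_triangle_ineq)
  then have "nrm (g x - g u) / nrm (g z - g w)
      \<le> nrm (g x - g y) / nrm (g z - g w) + nrm (g y - g u) / nrm (g z - g w)"
    unfolding add_divide_distrib[symmetric] by (rule divide_right_mono) simp
  also have "\<dots> \<le> \<rho> z w x y + \<rho> z w y u"
    by (intro add_mono ratio_le_rho g zw xy)
  finally show "nrm (g x - g u) / nrm (g z - g w) \<le> \<rho> z w x y + \<rho> z w y u" .
qed

lemma rho_equivariant:
  assumes h: "h \<in> G"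
  shows "\<rho> (h z) (h w) (h x) (h y) = \<rho> z w x y"
proof -
  have "(\<lambda>g. g \<circ> h) ` G = G"
  proof (intro equalityI subsetI)
    fix g assume "g \<in> G"
    then have "g \<circ> inv_into UNIV h \<in> G" "g = (g \<circ> inv_into UNIV h) \<circ> h"
      using h group_bij[OF h] by (auto simp: group_comp group_inv fun_eq_iff bij_is_inj)
    then show "g \<in> (\<lambda>g. g \<circ> h) ` G" by blast
  qed (use h in \<open>auto simp: group_comp\<close>)
  then have "(\<lambda>g. F (g \<circ> h)) ` G = F ` G" for F :: "('a \<Rightarrow> 'a) \<Rightarrow> real"
    by (metis image_image)
  from this[of "\<lambda>g. nrm (g x - g y) / nrm (g z - g w)"] show ?thesis
    by (simp add: \<rho>_def comp_def del: pr_simps)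
qed

text \<open>\<open>qs1_transverse\<close> for each group element, divided by its stretch of the base
  pair; the exponents of \<open>g\<close> cancel again. The result is continuity of
  \<open>\<rho>\<close> across the cosets as well as along them.\<close>

lemma rho_transverse:
  "\<exists>c>0. \<forall>z w x y x' y' \<tau>. z - w \<in> E \<longrightarrow> 0 < nrm (z - w) \<longrightarrow> x - y \<in> E \<longrightarrow> x' - y' \<in> E \<longrightarrow>
    norm (\<Phi> \<tau> (x - x')) \<le> 1 \<longrightarrow> norm (\<Phi> \<tau> (y - y')) \<le> 1 \<longrightarrow>
    \<rho> z w x y \<le> \<rho> z w x' y' + c * exp (- \<alpha> * \<tau>) / nrm (z - w)"
proof -
  obtain c where c: "0 < c" "\<And>D s g \<tau> p q p' q'. qs1 D s g \<Longrightarrow> p - q \<in> E \<Longrightarrow> p' - q' \<in> E \<Longrightarrow>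
    norm (\<Phi> \<tau> (p - p')) \<le> 1 \<Longrightarrow> norm (\<Phi> \<tau> (q - q')) \<le> 1 \<Longrightarrow>
    norm (pr (g p - g q) - pr (g p' - g q')) \<le> c * D * exp (- \<alpha> * (\<tau> - s))"
    using qs1_transverse by metis
  show ?thesis
  proof (rule exI[of _ "c * C\<^sup>2 + 1"], intro conjI allI impI)
    show "0 < c * C\<^sup>2 + 1" using c(1) by (simp add: add_nonneg_pos)
    fix z w x y x' y' \<tau>
    assume zw: "z - w \<in> E" "0 < nrm (z - w)" and xy: "x - y \<in> E" "x' - y' \<in> E"
      and le: "norm (\<Phi> \<tau> (x - x')) \<le> 1" "norm (\<Phi> \<tau> (y - y')) \<le> 1"
    show "\<rho> z w x y \<le> \<rho> z w x' y' + (c * C\<^sup>2 + 1) * exp (- \<alpha> * \<tau>) / nrm (z - w)"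
    proof (rule rho_le)
      fix g assume g: "g \<in> G"
      obtain s where s: "qs1 C s g" "\<And>x y. x - y \<in> E \<Longrightarrow> nrm (x - y) \<le> C * exp (- \<alpha> * s) * nrm (g x - g y)"
        using group_stretch[OF g] by metis
      note pos = nrm_group_pos[OF g zw]
      have "nrm (g x - g y) \<le> nrm (g x' - g y') + c * C * exp (- \<alpha> * (\<tau> - s))"
        using c(2)[OF s(1) xy le] norm_triangle_sub[of "pr (g x - g y)" "pr (g x' - g y')"] by linarith
      then have "nrm (g x - g y) / nrm (g z - g w)
          \<le> nrm (g x' - g y') / nrm (g z - g w) + c * C * exp (- \<alpha> * (\<tau> - s)) / nrm (g z - g w)"
        unfolding add_divide_distrib[symmetric] by (rule divide_right_mono) simp
      also have "c * C * exp (- \<alpha> * (\<tau> - s)) / nrm (g z - g w) \<le> c * C\<^sup>2 * exp (- \<alpha> * \<tau>) / nrm (z - w)"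
      proof -
        have "c * C * exp (- \<alpha> * (\<tau> - s)) * nrm (z - w)
            \<le> c * C * exp (- \<alpha> * (\<tau> - s)) * (C * exp (- \<alpha> * s) * nrm (g z - g w))"
          using c(1) C_nonneg by (intro mult_left_mono s(2) zw) auto
        also have "\<dots> = c * C\<^sup>2 * (exp (- \<alpha> * (\<tau> - s)) * exp (- \<alpha> * s)) * nrm (g z - g w)"
          by (simp only: power2_eq_square mult_ac)
        also have "exp (- \<alpha> * (\<tau> - s)) * exp (- \<alpha> * s) = exp (- \<alpha> * \<tau>)"
          by (simp add: algebra_simps flip: exp_add)
        finally show ?thesis using zw(2) pos by (simp add: field_simps del: pr_simps)
      qed
      also have "c * C\<^sup>2 * exp (- \<alpha> * \<tau>) / nrm (z - w) \<le> (c * C\<^sup>2 + 1) * exp (- \<alpha> * \<tau>) / nrm (z - w)"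
        using zw(2) by (intro divide_right_mono mult_right_mono) auto
      also have "nrm (g x' - g y') / nrm (g z - g w) \<le> \<rho> z w x' y'"
        by (rule ratio_le_rho[OF g zw xy(2)])
      finally show "nrm (g x - g y) / nrm (g z - g w)
          \<le> \<rho> z w x' y' + (c * C\<^sup>2 + 1) * exp (- \<alpha> * \<tau>) / nrm (z - w)" by simp
    qed
  qed
qed

text \<open>Dependence on the base pair; the two denominators, each at least \<open>1 / m\<close>
  before \<open>g\<close> acts, account for the factor \<open>m\<^sup>2\<close>. The error is
  proportional to the leading term of \<open>x - y\<close> and therefore stays small under
  magnification, so that a finite net of base pairs can represent a compact set of them.\<close>

lemma rho_parameter:
  "\<exists>c>0. \<forall>z w z' w' x y m \<tau>. z - w \<in> E \<longrightarrow> z' - w' \<in> E \<longrightarrow> 0 < m \<longrightarrow>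
    1 / m \<le> nrm (z - w) \<longrightarrow> 1 / m \<le> nrm (z' - w') \<longrightarrow> x - y \<in> E \<longrightarrow>
    norm (\<Phi> \<tau> (z - z')) \<le> 1 \<longrightarrow> norm (\<Phi> \<tau> (w - w')) \<le> 1 \<longrightarrow>
    \<rho> z w x y \<le> \<rho> z' w' x y + c * m\<^sup>2 * exp (- \<alpha> * \<tau>) * nrm (x - y)"
proof -
  obtain c where c: "0 < c" "\<And>D s g \<tau> p q p' q'. qs1 D s g \<Longrightarrow> p - q \<in> E \<Longrightarrow> p' - q' \<in> E \<Longrightarrow>
    norm (\<Phi> \<tau> (p - p')) \<le> 1 \<Longrightarrow> norm (\<Phi> \<tau> (q - q')) \<le> 1 \<Longrightarrow>
    norm (pr (g p - g q) - pr (g p' - g q')) \<le> c * D * exp (- \<alpha> * (\<tau> - s))"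
    using qs1_transverse by metis
  show ?thesis
  proof (rule exI[of _ "c * C ^ 4 + 1"], intro conjI allI impI)
    show "0 < c * C ^ 4 + 1" using c(1) by (simp add: add_nonneg_pos)
    fix z w z' w' x y m \<tau>
    assume E: "z - w \<in> E" "z' - w' \<in> E" "x - y \<in> E" and m: "(0::real) < m"
      and ge: "1 / m \<le> nrm (z - w)" "1 / m \<le> nrm (z' - w')"
      and le: "norm (\<Phi> \<tau> (z - z')) \<le> 1" "norm (\<Phi> \<tau> (w - w')) \<le> 1"
    have pos: "0 < nrm (z - w)" "0 < nrm (z' - w')"
      using ge m by (meson order.strict_trans2 zero_less_divide_1_iff)+
    show "\<rho> z w x y \<le> \<rho> z' w' x y + (c * C ^ 4 + 1) * m\<^sup>2 * exp (- \<alpha> * \<tau>) * nrm (x - y)"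
    proof (rule rho_le)
      fix g assume g: "g \<in> G"
      obtain s where s: "qs1 C s g"
        "\<And>x y. x - y \<in> E \<Longrightarrow> nrm (g x - g y) \<le> C * exp (\<alpha> * s) * nrm (x - y)"
        "\<And>x y. x - y \<in> E \<Longrightarrow> nrm (x - y) \<le> C * exp (- \<alpha> * s) * nrm (g x - g y)"
        using group_stretch[OF g] by metis
      define a where "a = nrm (g z - g w)"
      define b where "b = nrm (g z' - g w')"
      define P where "P = nrm (g x - g y)"
      define e where "e = exp (\<alpha> * s)"
      have e: "0 < e" "exp (- \<alpha> * s) = 1 / e" by (simp_all add: e_def exp_minus field_simps)
      have ab: "0 < a" "0 < b" using nrm_group_pos[OF g] E pos by (simp_all add: a_def b_def del: pr_simps)
      have P: "0 \<le> P" "P \<le> C * e * nrm (x - y)" using s(2)[OF E(3)] by (simp_all add: P_def e_def del: pr_simps)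
      have "1 / m \<le> C / e * a" "1 / m \<le> C / e * b"
        using order.trans[OF ge(1) s(3)[OF E(1)]] order.trans[OF ge(2) s(3)[OF E(2)]]
        unfolding e(2) a_def b_def by (simp_all add: mult.commute del: pr_simps)
      then have inv: "1 / a \<le> C * m / e" "1 / b \<le> C * m / e"
        using ab e(1) m by (simp_all add: field_simps)
      have "b - a \<le> norm (pr (g z' - g w') - pr (g z - g w))"
        unfolding a_def b_def by (rule norm_triangle_ineq2)
      also have "\<dots> = norm (pr (g z - g w) - pr (g z' - g w'))" by (rule norm_minus_commute)
      also have "\<dots> \<le> c * C * exp (- \<alpha> * (\<tau> - s))" by (rule c(2)[OF s(1) E(1,2) le])
      also have "exp (- \<alpha> * (\<tau> - s)) = exp (- \<alpha> * \<tau>) * e"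
        by (simp add: e_def algebra_simps flip: exp_add)
      finally have d: "b - a \<le> c * C * (exp (- \<alpha> * \<tau>) * e)" .
      have "P / a - P / b = P * (b - a) * (1 / a) * (1 / b)"
        using ab by (simp add: field_simps)
      also have "\<dots> \<le> P * (c * C * (exp (- \<alpha> * \<tau>) * e)) * (1 / a) * (1 / b)"
        using ab P(1) d by (intro mult_right_mono mult_left_mono) auto
      also have "\<dots> \<le> (C * e * nrm (x - y)) * (c * C * (exp (- \<alpha> * \<tau>) * e)) * (C * m / e) * (C * m / e)"
        using ab P inv c(1) C_nonneg e(1) m by (intro mult_mono) auto
      also have "\<dots> = c * C ^ 4 * m\<^sup>2 * exp (- \<alpha> * \<tau>) * nrm (x - y)"
        using e(1) by (simp add: field_simps power2_eq_square power4_eq_xxxx del: pr_simps)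
      also have "\<dots> \<le> (c * C ^ 4 + 1) * m\<^sup>2 * exp (- \<alpha> * \<tau>) * nrm (x - y)"
        by (intro mult_right_mono) auto
      finally have "P / a \<le> P / b + (c * C ^ 4 + 1) * m\<^sup>2 * exp (- \<alpha> * \<tau>) * nrm (x - y)" by simp
      moreover have "P / b \<le> \<rho> z' w' x y"
        unfolding P_def b_def by (rule ratio_le_rho[OF g E(2) pos(2) E(3)])
      ultimately show "nrm (g x - g y) / nrm (g z - g w)
          \<le> \<rho> z' w' x y + (c * C ^ 4 + 1) * m\<^sup>2 * exp (- \<alpha> * \<tau>) * nrm (x - y)"
        unfolding P_def a_def by linarith
    qed
  qed
qed

end

text \<open>Stated with midpoints modulo \<open>U\<close>, since this is preserved under pointwise
  limits for closed \<open>U\<close> and names no linear part; linear parts are recovered later from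
  boundedness.\<close>

definition midpoint_affine :: "'a::real_vector set \<Rightarrow> 'a set \<Rightarrow> ('a \<Rightarrow> 'a) \<Rightarrow> bool" where
  "midpoint_affine E U H \<longleftrightarrow>
     (\<forall>x y. x - y \<in> E \<longrightarrow> H ((1/2) *\<^sub>R (x + y)) - (1/2) *\<^sub>R (H x + H y) \<in> U)"

section \<open>From limit metrics on the cosets to affine maps\<close>

context flow_level
begin

text \<open>What survives of \<open>\<rho>\<close> in a limit with vanishing defect. Translation
  invariance is absent from the definition; it is a consequence of doubling.\<close>

definition leaf_metric :: "('a \<Rightarrow> 'a \<Rightarrow> real) \<Rightarrow> bool" where
  "leaf_metric \<nu> \<longleftrightarrow>
     (\<forall>x y. x - y \<in> E \<longrightarrow> \<nu> x y = \<nu> y x) \<and>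
     (\<forall>x y z. x - y \<in> E \<longrightarrow> y - z \<in> E \<longrightarrow> \<nu> x z \<le> \<nu> x y + \<nu> y z) \<and>
     (\<exists>c>0. \<forall>x y. x - y \<in> E \<longrightarrow> norm (pr (x - y)) \<le> c * \<nu> x y \<and> \<nu> x y \<le> c * norm (pr (x - y))) \<and>
     (\<forall>x. \<forall>v\<in>K. \<nu> x (x + v) = \<nu> (x + v) (x + 2 *\<^sub>R v) \<and> \<nu> x (x + 2 *\<^sub>R v) = 2 * \<nu> x (x + v))"

lemma pr_diff_in_U: "v \<in> E \<Longrightarrow> v - pr v \<in> U"
  using E_subspace pr_in_K K_in_E pr_K by (auto simp: U_def intro: subspace_diff)

text \<open>Seen from two base points of one coset, the length of a vector differs by a constant
  that does not depend on the vector. Applied to \<open>2 ^ j *\<^sub>R v\<close> and divided by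
  \<open>2 ^ j\<close>, this shows that there is no difference at all, and the metric is a norm on
  \<open>K\<close>.\<close>

lemma leaf_metric_norm:
  assumes \<nu>: "leaf_metric \<nu>"
  defines "N x v \<equiv> \<nu> x (x + v)"
  shows "y - x \<in> E \<Longrightarrow> z - x \<in> E \<Longrightarrow> \<nu> y z = N x (pr (z - y))"
    and "u \<in> K \<Longrightarrow> v \<in> K \<Longrightarrow> N x (u + v) \<le> N x u + N x v"
    and "v \<in> K \<Longrightarrow> N x (- v) = N x v"
    and "v \<in> K \<Longrightarrow> N x (2 *\<^sub>R v) = 2 * N x v"
    and "v \<in> K \<Longrightarrow> N x v = 0 \<longleftrightarrow> v = 0"
    and "v \<in> K \<Longrightarrow> 0 \<le> N x v"
proof -
  have sym: "\<nu> x y = \<nu> y x" if "x - y \<in> E" for x y using \<nu> that unfolding leaf_metric_def by blast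
  have tri: "\<nu> x z \<le> \<nu> x y + \<nu> y z" if "x - y \<in> E" "y - z \<in> E" for x y z
    using \<nu> that unfolding leaf_metric_def by blast
  obtain c where c: "c > 0" "\<And>x y. x - y \<in> E \<Longrightarrow> norm (pr (x - y)) \<le> c * \<nu> x y"
      "\<And>x y. x - y \<in> E \<Longrightarrow> \<nu> x y \<le> c * norm (pr (x - y))"
    using \<nu> unfolding leaf_metric_def by (metis (no_types))
  have dbl: "\<nu> x (x + 2 *\<^sub>R v) = 2 * \<nu> x (x + v)" if "v \<in> K" for x v
    using \<nu> that unfolding leaf_metric_def by blast
  note ES = E_subspace
  have neg: "- v \<in> E" if "v \<in> E" for v using ES that by (rule subspace_neg)
  have KE: "x - (x + v) \<in> E" "(x + v) - x \<in> E" if "v \<in> K" for x v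
    using neg[OF K_in_E[OF that]] K_in_E[OF that] by simp_all
  \<comment> \<open>Points that differ by an element of \<open>U\<close> have distance zero by the
    upper bound, so the metric lives on the quotient of \<open>E\<close> by \<open>U\<close>, which
    \<open>pr\<close> identifies with \<open>K\<close>.\<close>
  have U0: "\<nu> y z = \<nu> y z'" if "y - z \<in> E" "z - z' \<in> U" for y z z'
  proof -
    have E: "z - z' \<in> E" "z' - z \<in> E" and p: "pr (z - z') = 0" "pr (z' - z) = 0"
      using that(2) neg[of "z - z'"] by (auto simp: U_def)
    have E': "y - z' \<in> E" using subspace_add[OF ES that(1) E(1)] by simp
    show ?thesis
      using tri[OF that(1) E(1)] tri[OF E' E(2)] c(3)[OF E(1)] c(3)[OF E(2)] p
      by (simp del: pr_simps)
  qed
  have pow: "N x (2 ^ j *\<^sub>R v) = 2 ^ j * N x v" if "v \<in> K" for x v and j :: nat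
  proof (induction j)
    case (Suc j)
    have "2 ^ Suc j *\<^sub>R v = 2 *\<^sub>R (2 ^ j *\<^sub>R v)" by simp
    then have "N x (2 ^ Suc j *\<^sub>R v) = 2 * N x (2 ^ j *\<^sub>R v)"
      unfolding N_def using dbl[of "2 ^ j *\<^sub>R v" x] that subspace_scale[OF K_subspace] by metis
    then show ?case using Suc by simp
  qed simp
  have trans: "N x v = N y v" if yx: "y - x \<in> E" and v: "v \<in> K" for x y v
  proof -
    have xy: "x - y \<in> E" using neg[OF yx] by simp
    define D where "D = 2 * c * norm (pr (x - y))"
    have bd: "\<bar>N x u - N y u\<bar> \<le> D" if u: "u \<in> K" for u
    proof -
      have D: "\<nu> x y \<le> D / 2" "\<nu> y x \<le> D / 2" "\<nu> (y + u) (x + u) \<le> D / 2" "\<nu> (x + u) (y + u) \<le> D / 2"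
        using c(3)[OF xy] c(3)[of "x + u" "y + u"] sym[OF xy] sym[of "x + u" "y + u"] xy
        by (simp_all add: D_def del: pr_simps)
      have E: "x - (y + u) \<in> E" "y - (x + u) \<in> E" "(y + u) - (x + u) \<in> E" "(x + u) - (y + u) \<in> E"
        using subspace_add[OF ES xy KE(1)[OF u, of y]] subspace_add[OF ES yx KE(1)[OF u, of x]] xy yx
        by (simp_all add: diff_diff_eq)
      have "N x u \<le> \<nu> x y + (N y u + \<nu> (y + u) (x + u))"
        unfolding N_def using tri[OF xy E(2)] tri[OF KE(1)[OF u] E(3)] by linarith
      moreover have "N y u \<le> \<nu> y x + (N x u + \<nu> (x + u) (y + u))"
        unfolding N_def using tri[OF yx E(1)] tri[OF KE(1)[OF u] E(4)] by linarith
      ultimately show ?thesis using D by linarith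
    qed
    have "\<bar>N x v - N y v\<bar> \<le> D / 2 ^ j" for j :: nat
    proof -
      have "\<bar>2 ^ j * N x v - 2 ^ j * N y v\<bar> \<le> D"
        using bd[of "2 ^ j *\<^sub>R v"] subspace_scale[OF K_subspace v] by (simp add: pow[OF v])
      then have "2 ^ j * \<bar>N x v - N y v\<bar> \<le> D"
        by (simp add: abs_mult flip: right_diff_distrib)
      then show ?thesis by (simp add: field_simps)
    qed
    moreover have "(\<lambda>j::nat. D / 2 ^ j) \<longlonglongrightarrow> 0"
      using LIMSEQ_divide_realpow_zero[of 2 D] by simp
    ultimately have "\<bar>N x v - N y v\<bar> \<le> 0"
      using LIMSEQ_le_const by blast
    then show ?thesis by simp
  qed
  have main: "\<nu> y z = N y (pr (z - y))" if "z - y \<in> E" for y z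
  proof -
    have "z - (y + pr (z - y)) \<in> U" using pr_diff_in_U[OF that] by (simp add: algebra_simps)
    then show ?thesis using U0 neg[OF that] unfolding N_def by simp
  qed
  show "\<nu> y z = N x (pr (z - y))" if yz: "y - x \<in> E" "z - x \<in> E"
  proof -
    have zy: "z - y \<in> E" using subspace_diff[OF ES yz(2) yz(1)] by simp
    then have "\<nu> y z = N y (pr (z - y))" by (rule main)
    also have "\<dots> = N x (pr (z - y))" using trans[OF yz(1) pr_in_K[OF zy]] by simp
    finally show ?thesis .
  qed
  show "N x (u + v) \<le> N x u + N x v" if uv: "u \<in> K" "v \<in> K"
  proof -
    have "N x (u + v) \<le> N x u + N (x + u) v"
      unfolding N_def using tri[OF KE(1)[OF uv(1)] KE(1)[OF uv(2)]] by (simp add: add.assoc)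
    also have "N (x + u) v = N x v" using trans[OF KE(2)[OF uv(1)] uv(2)] by simp
    finally show ?thesis .
  qed
  show "N x (- v) = N x v" if v: "v \<in> K"
  proof -
    have mv: "- v \<in> K" using subspace_neg[OF K_subspace v] .
    have "N x (- v) = \<nu> (x + - v) (x + - v + v)" unfolding N_def using sym[OF KE(1)[OF mv]] by simp
    also have "\<dots> = N x v" using trans[OF KE(2)[OF mv] v] by (simp add: N_def)
    finally show ?thesis .
  qed
  show "N x (2 *\<^sub>R v) = 2 * N x v" if "v \<in> K"
    using dbl[OF that] by (simp add: N_def)
  have nv: "norm v \<le> c * N x v" "N x v \<le> c * norm v" if "v \<in> K" for v
  proof -
    have "pr (x - (x + v)) = - v" using pr_K[OF that] by simp
    then show "norm v \<le> c * N x v" "N x v \<le> c * norm v"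
      using c(2,3)[OF KE(1)[OF that, of x]] by (simp_all add: N_def del: pr_simps)
  qed
  then show nn: "0 \<le> N x v" if "v \<in> K" 
    using that c(1) by (meson norm_ge_zero order.trans zero_le_mult_iff not_le)
  show "N x v = 0 \<longleftrightarrow> v = 0" if "v \<in> K"
    using nv[OF that] nn[OF that] by auto
qed

text \<open>Modulo \<open>U\<close> the map becomes a bijection \<open>T\<close> of
  \<open>K\<close>, isometric from the norm of \<open>\<nu>'\<close> at \<open>x\<close> to the norm
  of \<open>\<nu>\<close> at \<open>H x\<close>; the bound on the inverse of \<open>H\<close> is
  what makes \<open>T\<close> surjective. Mazur-Ulam applies to \<open>T\<close>.\<close>

lemma isometry_midpoint_affine:
  assumes \<nu>: "leaf_metric \<nu>" and \<nu>': "leaf_metric \<nu>'" and H: "bij H" "qs1 D s H" "qs1 D' s' (inv_into UNIV H)"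
    and iso: "\<And>x y. x - y \<in> E \<Longrightarrow> \<nu> (H x) (H y) = \<nu>' x y"
  shows "midpoint_affine E U H"
  unfolding midpoint_affine_def
proof (intro allI impI)
  fix x y assume xy: "x - y \<in> E"
  note ES = E_subspace
  have neg: "- v \<in> E" if "v \<in> E" for v using ES that by (rule subspace_neg)
  have yx: "y - x \<in> E" using neg[OF xy] by simp
  define T where "T u = pr (H (x + u) - H x)" for u
  define N where "N v = \<nu> (H x) (H x + v)" for v
  define N' where "N' v = \<nu>' x (x + v)" for v
  note n = leaf_metric_norm[OF \<nu>, where x = "H x", folded N_def]
  note n' = leaf_metric_norm[OF \<nu>', where x = x, folded N'_def]
  have HE: "H (x + u) - H x \<in> E" if "u \<in> E" for u
    using qs1_E[OF H(2), of "x + u" x] that by simp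
  have HU: "H y - H z \<in> U" if "y - z \<in> U" for y z
    using qs1_E[OF H(2), of y z] qs1_pr[OF H(2), of y z] that by (simp add: U_def del: pr_simps)
  have TK: "T u \<in> K" if "u \<in> K" for u
    unfolding T_def by (rule pr_in_K[OF HE[OF K_in_E[OF that]]])
  have iso': "N (T u - T v) = N' (u - v)" if uv: "u \<in> K" "v \<in> K" for u v
  proof -
    have "T u - T v = pr (H (x + u) - H (x + v))" by (simp add: T_def)
    then have "N (T u - T v) = \<nu> (H (x + v)) (H (x + u))"
      using n(1)[OF HE[OF K_in_E[OF uv(2)]] HE[OF K_in_E[OF uv(1)]]] by (simp del: pr_simps)
    also have "\<dots> = \<nu>' (x + v) (x + u)"
      using uv K_in_E subspace_diff[OF ES] by (intro iso) auto
    also have "\<dots> = N' (pr (u - v))"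
      using n'(1)[of "x + v" "x + u"] uv K_in_E by (simp del: pr_simps)
    also have "pr (u - v) = u - v" using uv pr_K subspace_diff[OF K_subspace] by metis
    finally show ?thesis .
  qed
  have bij: "bij_betw T K K"
    unfolding bij_betw_def
  proof
    show "inj_on T K"
    proof (rule inj_onI)
      fix u v assume uv: "u \<in> K" "v \<in> K" "T u = T v"
      have "N' (u - v) = N (0)" using iso'[OF uv(1,2)] uv(3) by simp
      also have "N 0 = 0" using n(5)[of 0] subspace_0[OF K_subspace] by simp
      finally show "u = v" using n'(5)[of "u - v"] subspace_diff[OF K_subspace uv(1,2)] by simp
    qed
    show "T ` K = K"
    proof (intro equalityI subsetI)
      fix w assume w: "w \<in> K"
      define z where "z = inv_into UNIV H (H x + w)"
      have Hz: "H z = H x + w" using H(1) by (simp add: z_def bij_is_surj surj_f_inv_f)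
      have "z - x = inv_into UNIV H (H x + w) - inv_into UNIV H (H x)"
        using H(1) by (simp add: z_def bij_is_inj)
      also have "\<dots> \<in> E" using qs1_E[OF H(3)] w K_in_E by simp
      finally have zx: "z - x \<in> E" .
      have "(x + pr (z - x)) - z \<in> U"
        using subspace_neg[OF U_subspace pr_diff_in_U[OF zx]] by (simp add: algebra_simps)
      then have "pr (H (x + pr (z - x)) - H z) = 0" using HU by (simp add: U_def)
      then have "T (pr (z - x)) = pr w" by (simp add: T_def Hz algebra_simps)
      then have "T (pr (z - x)) = w" using pr_K[OF w] by simp
      then show "w \<in> T ` K" using pr_in_K[OF zx] by blast
    qed (use TK in auto)
  qed
  have mid: "T ((1/2) *\<^sub>R (u + v)) = (1/2) *\<^sub>R (T u + T v)" if "u \<in> K" "v \<in> K" for u v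
    by (rule Mazur_Ulam_midpoint[OF K_subspace, where N = N' and N' = N and T = T];
        (intro n'(2-6) n(3) bij iso' that; assumption)?)
  define v where "v = pr (y - x)"
  have v: "v \<in> K" unfolding v_def by (rule pr_in_K[OF yx])
  have d: "y - x - v \<in> U" unfolding v_def by (rule pr_diff_in_U[OF yx])
  have "T ((1/2) *\<^sub>R v) = (1/2) *\<^sub>R T v"
    using mid[OF v subspace_0[OF K_subspace]] by (simp add: T_def)
  moreover have "T v = pr (H y - H x)"
  proof -
    have "pr (H y - H (x + v)) = 0" using HU[of y "x + v"] d by (simp add: U_def algebra_simps)
    then show ?thesis by (simp add: T_def)
  qed
  moreover have "T ((1/2) *\<^sub>R v) = pr (H ((1/2) *\<^sub>R (x + y)) - H x)"
  proof -
    have "(1/2) *\<^sub>R (x + y) - (x + (1/2) *\<^sub>R v) = (1/2) *\<^sub>R (y - x - v)"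
      by (simp add: algebra_simps flip: scaleR_add_left)
    then have "(1/2) *\<^sub>R (x + y) - (x + (1/2) *\<^sub>R v) \<in> U" using subspace_scale[OF U_subspace d] by simp
    then have "pr (H ((1/2) *\<^sub>R (x + y)) - H (x + (1/2) *\<^sub>R v)) = 0" using HU by (simp add: U_def)
    then show ?thesis by (simp add: T_def)
  qed
  ultimately have eq: "pr (H ((1/2) *\<^sub>R (x + y)) - H x) = (1/2) *\<^sub>R pr (H y - H x)" by simp
  have id: "H ((1/2) *\<^sub>R (x + y)) - (1/2) *\<^sub>R (H x + H y)
      = (H ((1/2) *\<^sub>R (x + y)) - H x) - (1/2) *\<^sub>R (H y - H x)"
    by (simp add: algebra_simps flip: scaleR_add_left)
  have "(1/2) *\<^sub>R (x + y) - x = (1/2) *\<^sub>R (y - x)"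
    by (simp add: algebra_simps flip: scaleR_add_left)
  then have "(1/2) *\<^sub>R (x + y) - x \<in> E" using subspace_scale[OF ES yx] by simp
  then have "(H ((1/2) *\<^sub>R (x + y)) - H x) - (1/2) *\<^sub>R (H y - H x) \<in> E"
    by (intro subspace_diff[OF ES qs1_E[OF H(2)] subspace_scale[OF ES qs1_E[OF H(2) yx]]])
  moreover have "pr ((H ((1/2) *\<^sub>R (x + y)) - H x) - (1/2) *\<^sub>R (H y - H x)) = 0"
    using eq by (simp only: pr_simps) simp
  ultimately show "H ((1/2) *\<^sub>R (x + y)) - (1/2) *\<^sub>R (H x + H y) \<in> U"
    unfolding id by (simp add: U_def)
qed

end

section \<open>Zooming in\<close>

definition cocompact_pairs :: "('a::topological_space \<Rightarrow> 'a) set \<Rightarrow> bool" where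
  "cocompact_pairs G \<longleftrightarrow>
     (\<exists>S. compact S \<and> S \<subseteq> {(a, b). a \<noteq> b} \<and> (\<Union>g\<in>G. map_prod g g ` S) = {(a, b). a \<noteq> b})"

context expanding_flow
begin

definition zoom :: "'a \<Rightarrow> real \<Rightarrow> 'a \<Rightarrow> 'a" where "zoom p s x = \<Phi> s (x - p)"

definition unzoom :: "'a \<Rightarrow> real \<Rightarrow> 'a \<Rightarrow> 'a" where "unzoom p s x = p + \<Phi> (- s) x"

lemma zoom_unzoom [simp]: "zoom p s (unzoom p s x) = x" "unzoom p s (zoom p s x) = x"
  by (simp_all add: zoom_def unzoom_def del: flow_simps)

lemma bij_zoom: "bij (zoom p s)" and inv_zoom: "inv_into UNIV (zoom p s) = unzoom p s"
proof -
  show "bij (zoom p s)" by (rule o_bij[of "unzoom p s"]) (auto simp: fun_eq_iff)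
  show "inv_into UNIV (zoom p s) = unzoom p s" by (rule inv_unique_comp) (auto simp: fun_eq_iff)
qed

lemma flow_unzoom: "\<Phi> \<tau> (unzoom p s x - unzoom p s y) = \<Phi> (\<tau> - s) (x - y)"
proof -
  have "unzoom p s x - unzoom p s y = \<Phi> (- s) (x - y)" by (simp add: unzoom_def)
  then show ?thesis using flow_split[of "\<tau> - s" \<tau> "- s" "x - y"] by simp
qed

lemma flow_zoom: "\<Phi> \<tau> (zoom p s x - zoom p s y) = \<Phi> (\<tau> + s) (x - y)"
  using flow_unzoom[of "\<tau> + s" p s "zoom p s x" "zoom p s y"] by simp

lemma qs_zoom: "qs 1 s (zoom p s)"
  unfolding qs_def inv_zoom by (simp add: bij_zoom qs1_def flow_zoom flow_unzoom del: flow_simps)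

lemma norm_bounded_scale:
  assumes v: "v \<noteq> 0"
  obtains c where "\<And>t. norm v \<le> \<mu> t * b \<Longrightarrow> - c \<le> t"
proof -
  have "0 < norm v / (\<bar>b\<bar> + 1)" using v by (simp add: add_nonneg_pos)
  then obtain t0 where t0: "\<mu> t0 < norm v / (\<bar>b\<bar> + 1)" by (rule mu_small)
  show thesis
  proof (rule that[of "- t0"])
    fix t assume *: "norm v \<le> \<mu> t * b"
    show "- (- t0) \<le> t"
    proof (rule ccontr)
      assume "\<not> ?thesis"
      then have "\<mu> t \<le> \<mu> t0" by (simp add: mu_mono)
      have "\<mu> t * b \<le> \<mu> t * (\<bar>b\<bar> + 1)" using mu_pos[of t] by (intro mult_left_mono) auto
      also have "\<dots> \<le> \<mu> t0 * (\<bar>b\<bar> + 1)" using \<open>\<mu> t \<le> \<mu> t0\<close> by (intro mult_right_mono) auto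
      also have "\<dots> < norm v" using t0 by (simp add: pos_less_divide_eq add_nonneg_pos)
      finally show False using * by simp
    qed
  qed
qed

text \<open>A group element carries a pair of the compact set to the pair that the zoom maps to
  \<open>(0, e)\<close>. Both pairs have sizes bounded above and below, which confines the total
  exponent \<open>s + \<sigma>\<close> to a bounded interval; \<open>qs1_rescale\<close> then
  replaces it by 0. Thus zooms of arbitrary strength are compensated to maps with one
  constant.\<close>

lemma zoomed_group_elements:
  assumes G: "uniform_group C G" and co: "cocompact_pairs G"
  shows "\<exists>D r. \<forall>p s. \<exists>g\<in>G. \<exists>a. norm a \<le> r \<and> zoom p s (g a) = 0 \<and> qs D 0 (zoom p s \<circ> g)"
proof -
  obtain S where S: "compact S" "S \<subseteq> {(a, b). a \<noteq> b}" "(\<Union>g\<in>G. map_prod g g ` S) = {(a, b). a \<noteq> b}"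
    using co by (auto simp: cocompact_pairs_def)
  obtain e :: 'a where "e \<in> Basis" using nonempty_Basis by blast
  then have e: "norm e = 1" by simp
  have nz: "e \<noteq> 0" using e by auto
  have "(0, e) \<in> (\<Union>g\<in>G. map_prod g g ` S)" unfolding S(3) using nz by simp
  then have Sne: "S \<noteq> {}" by auto
  have cont: "continuous_on S (\<lambda>z. norm (fst z - snd z))" by (intro continuous_intros)
  obtain r where r: "0 < r" "\<And>z. z \<in> S \<Longrightarrow> norm z \<le> r"
    using compact_imp_bounded[OF S(1)] by (auto simp: bounded_pos)
  obtain z0 where z0: "z0 \<in> S" "\<And>z. z \<in> S \<Longrightarrow> norm (fst z0 - snd z0) \<le> norm (fst z - snd z)"
    using continuous_attains_inf[OF S(1) Sne cont] by auto
  define v0 where "v0 = fst z0 - snd z0"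
  have v0: "v0 \<noteq> 0" using z0(1) S(2) by (auto simp: v0_def)
  define C1 where "C1 = max (1 * (1 + C)) (C * (1 + 1))"
  have "0 < 1 / (2 * r)" using r by simp
  then obtain t1 where t1: "\<mu> t1 < 1 / (2 * r)" by (rule mu_small)
  obtain c1 where c1: "\<And>t. norm e \<le> \<mu> t * C1 \<Longrightarrow> - c1 \<le> t" using norm_bounded_scale[OF nz] by blast
  obtain c2 where c2: "\<And>t. norm v0 \<le> \<mu> t * C1 \<Longrightarrow> - c2 \<le> t" using norm_bounded_scale[OF v0] by blast
  define c where "c = max c2 (c1 - t1)"
  show ?thesis
  proof (rule exI[of _ "\<mu> c * C1"], rule exI[of _ r], intro allI)
    fix p s
    have "p \<noteq> unzoom p s e" using nz by (simp add: unzoom_def)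
    then have "(p, unzoom p s e) \<in> (\<Union>g\<in>G. map_prod g g ` S)" unfolding S(3) by simp
    then obtain g a b where g: "g \<in> G" and ab: "(a, b) \<in> S" "g a = p" "g b = unzoom p s e" by auto
    obtain \<sigma> where \<sigma>: "qs C \<sigma> g" using G g by (auto simp: uniform_group_def)
    define F where "F = zoom p s \<circ> g"
    define s' where "s' = s + \<sigma>"
    have F: "qs C1 s' F" unfolding F_def s'_def C1_def by (rule qs_comp[OF qs_zoom \<sigma>])
    have Fab: "F a = 0" "F b = e" using ab zoom_unzoom(1)[of p s e] by (simp_all add: F_def) (simp add: zoom_def)
    have inv: "inv_into UNIV F 0 = a" "inv_into UNIV F e = b"
      using qs_bij[OF F] Fab by (metis bij_is_inj inv_f_f)+
    have na: "norm a \<le> r" "norm b \<le> r"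
      using r(2)[OF ab(1)] norm_fst_le[of a b] norm_snd_le[of b a] by auto
    have "norm (\<Phi> t1 (a - b)) \<le> \<mu> t1 * norm (a - b)" by (rule flow_bound)
    also have "\<dots> \<le> (1 / (2 * r)) * (2 * r)"
      using t1 na norm_triangle_ineq4[of a b] mu_pos[of t1] r(1) by (intro mult_mono) auto
    finally have "norm (\<Phi> t1 (a - b)) \<le> 1" using r(1) by simp
    then have "norm (\<Phi> (t1 - s') (F a - F b)) \<le> C1" by (rule qs1D[OF qs_qs1[OF F]])
    then have 1: "norm (\<Phi> (t1 - s') e) \<le> C1" by (simp add: Fab)
    have "\<Phi> (s' - t1) (\<Phi> (t1 - s') e) = e" using flow_split[of 0 "s' - t1" "t1 - s'" e] by simp
    then have "norm e \<le> \<mu> (s' - t1) * norm (\<Phi> (t1 - s') e)" using flow_bound[of "s' - t1" "\<Phi> (t1 - s') e"] by simp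
    also have "\<dots> \<le> \<mu> (s' - t1) * C1" using 1 mu_pos[of "s' - t1"] by (intro mult_left_mono) auto
    finally have "- c1 \<le> s' - t1" by (rule c1)
    then have le1: "- s' \<le> c" by (simp add: c_def)
    have "norm (\<Phi> 0 (0 - e)) \<le> 1" using e by simp
    then have "norm (\<Phi> (0 - (- s')) (inv_into UNIV F 0 - inv_into UNIV F e)) \<le> C1"
      by (rule qs1D[OF qs_inv1[OF F]])
    then have 2: "norm (\<Phi> s' (a - b)) \<le> C1" by (simp add: inv)
    have "norm v0 \<le> norm (a - b)" using z0(2)[OF ab(1)] by (simp add: v0_def)
    also have "\<dots> \<le> \<mu> (- s') * norm (\<Phi> s' (a - b))"
      using flow_bound[of "- s'" "\<Phi> s' (a - b)"] by (simp del: flow_simps)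
    also have "\<dots> \<le> \<mu> (- s') * C1" using 2 mu_pos[of "- s'"] by (intro mult_left_mono) auto
    finally have "- c2 \<le> - s'" by (rule c2)
    then have le2: "s' \<le> c" by (simp add: c_def)
    have "qs (\<mu> c * C1) 0 F"
      using qs_bij[OF F] qs1_rescale[OF qs_qs1[OF F], of 0 c] qs1_rescale[OF qs_inv1[OF F], of 0 c] le1 le2
      by (simp add: qs_def)
    then show "\<exists>g\<in>G. \<exists>a. norm a \<le> r \<and> zoom p s (g a) = 0 \<and> qs (\<mu> c * C1) 0 (zoom p s \<circ> g)"
      using g na(1) Fab(1) by (auto simp: F_def)
  qed
qed

text \<open>The maps share one constant, so \<open>qs1_modulus\<close> makes them equicontinuous and
  a moving argument may be replaced by its limit.\<close>

lemma qs1_tendsto: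
  assumes F: "\<And>k. qs1 D 0 (F k)" and x: "(xs \<longlongrightarrow> x) \<FF>" and y: "((\<lambda>k. F k x) \<longlongrightarrow> y) \<FF>"
  shows "((\<lambda>k. F k (xs k)) \<longlongrightarrow> y) \<FF>"
proof -
  have "((\<lambda>k. F k (xs k) - F k x) \<longlongrightarrow> 0) \<FF>"
    unfolding tendsto_iff dist_norm diff_0_right
  proof (intro allI impI)
    fix e :: real assume e: "0 < e"
    obtain d where d: "0 < d" "\<And>g p q. qs1 D 0 g \<Longrightarrow> norm (p - q :: 'a) < d \<Longrightarrow> norm (g p - g q :: 'a) < e"
    proof -
      have "0 < e / (\<bar>D\<bar> + 1)" using e by (simp add: add_nonneg_pos)
      then obtain t where t: "\<mu> t < e / (\<bar>D\<bar> + 1)" by (rule mu_small)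
      show thesis
      proof (rule that[of "1 / \<mu> (- t)"])
        show "0 < 1 / \<mu> (- t)" using mu_pos by simp
        fix g and p q :: 'a assume g: "qs1 D 0 g" and "norm (p - q) < 1 / \<mu> (- t)"
        then have "\<mu> (- t) * norm (\<Phi> 0 (p - q)) \<le> 1" using mu_pos[of "- t"] by (simp add: field_simps)
        from qs1_modulus[OF g this] have "norm (g p - g q) \<le> \<mu> t * D" by simp
        also have "\<dots> \<le> \<mu> t * (\<bar>D\<bar> + 1)" using mu_pos[of t] by (intro mult_left_mono) auto
        also have "\<dots> < e" using t by (simp add: pos_less_divide_eq add_nonneg_pos)
        finally show "norm (g p - g q) < e" .
      qed
    qed
    have "\<forall>\<^sub>F k in \<FF>. norm (xs k - x) < d" using x d(1) by (simp add: tendsto_iff dist_norm)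
    then show "\<forall>\<^sub>F k in \<FF>. norm (F k (xs k) - F k x) < e"
      by eventually_elim (rule d(2)[OF F])
  qed
  from tendsto_add[OF this y] show ?thesis by simp
qed

text \<open>The points \<open>a k\<close> keep the values from escaping. Taking limits of the maps
  and of their inverses along the same filter, equicontinuity makes the two limits inverse to each
  other, so bijectivity is not lost.\<close>

lemma qs_limit:
  fixes F :: "'k \<Rightarrow> 'a \<Rightarrow> 'a"
  assumes \<FF>: "\<FF> \<noteq> bot" and F: "\<And>k. qs D 0 (F k)" and a: "\<And>k. F k (a k) = 0" "\<And>k. norm (a k) \<le> r"
  obtains \<GG> L where "\<GG> \<le> \<FF>" "\<GG> \<noteq> bot" "qs D 0 L" "\<And>x. ((\<lambda>k. F k x) \<longlongrightarrow> L x) \<GG>"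
    "\<And>x. ((\<lambda>k. inv_into UNIV (F k) x) \<longlongrightarrow> inv_into UNIV L x) \<GG>"
proof -
  have D: "0 \<le> D" using qs1_nonneg[OF qs_qs1[OF F]] .
  have lip: "norm (g p - g q) \<le> D * (1 + norm (p - q))" if "qs1 D 0 g" for g p q
    using qs1_chain[OF that, of 0 p q] by simp
  have q1: "qs1 D 0 (F k)" "qs1 D 0 (inv_into UNIV (F k))" for k
    using F[of k] by (simp_all add: qs_def)
  have b1: "norm (F k x) \<le> D * (1 + (norm x + r))" for k x
  proof -
    have "norm (F k x) \<le> D * (1 + norm (x - a k))" using lip[OF q1(1), of k x "a k"] a(1)[of k] by simp
    also have "\<dots> \<le> D * (1 + (norm x + r))"
      using norm_triangle_ineq4[of x "a k"] a(2)[of k] D by (intro mult_left_mono) auto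
    finally show ?thesis .
  qed
  have b2: "norm (inv_into UNIV (F k) x) \<le> r + D * (1 + norm x)" for k x
  proof -
    have "inv_into UNIV (F k) 0 = a k" using a(1)[of k] qs_bij[OF F[of k]] by (metis bij_is_inj inv_f_f)
    then have "norm (inv_into UNIV (F k) x - a k) \<le> D * (1 + norm x)" using lip[OF q1(2), of k x 0] by simp
    then show ?thesis using norm_triangle_sub[of "inv_into UNIV (F k) x" "a k"] a(2)[of k] by linarith
  qed
  obtain \<FF>1 L where 1: "\<FF>1 \<le> \<FF>" "\<FF>1 \<noteq> bot" "\<And>x. ((\<lambda>k. F k x) \<longlongrightarrow> L x) \<FF>1"
    by (rule pointwise_cluster[OF \<FF>, of F]) (rule b1, blast)
  obtain \<GG> L' where 2: "\<GG> \<le> \<FF>1" "\<GG> \<noteq> bot" "\<And>x. ((\<lambda>k. inv_into UNIV (F k) x) \<longlongrightarrow> L' x) \<GG>"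
    by (rule pointwise_cluster[OF 1(2), of "\<lambda>k. inv_into UNIV (F k)"]) (rule b2, blast)
  have L: "((\<lambda>k. F k x) \<longlongrightarrow> L x) \<GG>" for x using 1(3) 2(1) by (rule tendsto_mono[rotated])
  have "L (L' x) = x" for x
  proof -
    have "((\<lambda>k. F k (inv_into UNIV (F k) x)) \<longlongrightarrow> L (L' x)) \<GG>"
      by (rule qs1_tendsto[OF q1(1) 2(3) L])
    moreover have "F k (inv_into UNIV (F k) x) = x" for k
      using qs_bij[OF F[of k]] by (simp add: bij_is_surj surj_f_inv_f)
    ultimately show ?thesis using 2(2) by (simp add: tendsto_const_iff)
  qed
  moreover have "L' (L x) = x" for x
  proof -
    have "((\<lambda>k. inv_into UNIV (F k) (F k x)) \<longlongrightarrow> L' (L x)) \<GG>"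
      by (rule qs1_tendsto[OF q1(2) L 2(3)])
    moreover have "inv_into UNIV (F k) (F k x) = x" for k
      using qs_bij[OF F[of k]] by (simp add: bij_is_inj)
    ultimately show ?thesis using 2(2) by (simp add: tendsto_const_iff)
  qed
  ultimately have comp: "L \<circ> L' = id" "L' \<circ> L = id" by (simp_all add: fun_eq_iff)
  have bij: "bij L" using comp by (rule o_bij[rotated])
  have inv: "inv_into UNIV L = L'" using comp by (rule inv_unique_comp)
  have closed: "qs1 D 0 g" if f: "\<And>k. qs1 D 0 (f k)" and lim: "\<And>x. ((\<lambda>k. f k x) \<longlongrightarrow> g x) \<GG>" for f g
    unfolding qs1_def
  proof (intro allI impI)
    fix \<tau> p q assume "norm (\<Phi> \<tau> (p - q)) \<le> 1"
    then have "norm (\<Phi> (\<tau> - 0) (f k p - f k q)) \<le> D" for k by (rule qs1D[OF f])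
    then show "norm (\<Phi> (\<tau> - 0) (g p - g q)) \<le> D"
      by (intro tendsto_upperbound[OF tendsto_norm[OF tendsto_flow[OF tendsto_diff[OF lim lim]]] _ 2(2)] always_eventually) auto
  qed
  have "qs D 0 L" unfolding qs_def inv minus_zero
    using bij closed[OF q1(1) L] closed[OF q1(2) 2(3)] by auto
  show thesis
  proof (rule that[OF _ 2(2) \<open>qs D 0 L\<close> L])
    show "\<GG> \<le> \<FF>" using 1(1) 2(1) by simp
  qed (use 2(3) inv in simp)
qed

end

section \<open>Good places and scales, and the limit of the invariant function\<close>

context level_group
begin

text \<open>A compact exhaustion of the pairs with nonzero leading term: as \<open>m\<close> grows,
  points may be farther out and leading terms smaller.\<close>

definition base_pairs :: "real \<Rightarrow> ('a \<times> 'a) set" where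
  "base_pairs m = {(z, w). norm z \<le> m \<and> norm w \<le> m \<and> z - w \<in> E \<and> 1 / m \<le> nrm (z - w)}"

lemma compact_base_pairs: "compact (base_pairs m)"
proof -
  have eq: "base_pairs m = (cball 0 m \<times> cball 0 m) \<inter> {p. fst p - snd p \<in> E} \<inter> {p. 1 / m \<le> nrm (fst p - snd p)}"
    by (auto simp: base_pairs_def)
  have "closed ((\<lambda>p::'a\<times>'a. fst p - snd p) -` E)"
    by (rule continuous_closed_vimage[OF closed_E]) (auto intro!: continuous_intros)
  moreover have "closed {p::'a\<times>'a. 1 / m \<le> nrm (fst p - snd p)}"
    by (intro closed_Collect_le continuous_on_const continuous_on_norm
        continuous_on_compose2[OF continuous_pr[of UNIV]] continuous_intros) auto
  ultimately show ?thesis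
    unfolding eq by (intro compact_Int_closed compact_Times compact_cball) (auto simp: vimage_def)
qed

text \<open>One zoom has to serve all base pairs of level \<open>m\<close>, because the base pair
  will later be moved by group elements that depend on the zoom. The defect is made small for a
  finite net of base pairs, and \<open>rho_parameter\<close> transfers this to the others.\<close>

lemma exists_good_zoom:
  assumes X: "finite (X :: ('a \<times> 'a) set)" "\<And>x v. (x, v) \<in> X \<Longrightarrow> v \<in> K" and m: "0 < m"
  shows "\<exists>p s. norm p \<le> 1 \<and> m \<le> s \<and> (\<forall>z w. (z, w) \<in> base_pairs m \<longrightarrow>
    (\<exists>z' w'. (z', w') \<in> base_pairs m \<and>
      (\<forall>x v. (x, v) \<in> X \<longrightarrow> defect (\<rho> z' w') (unzoom p s x) v (exp (- \<alpha> * s)) \<le> 1 / m) \<and>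
      (\<forall>x y. x - y \<in> E \<longrightarrow> \<bar>\<rho> z w x y - \<rho> z' w' x y\<bar> \<le> 1 / m * nrm (x - y))))"
proof -
  obtain c where c: "c > 0" "\<And>z w z' w' x y m \<tau>. z - w \<in> E \<Longrightarrow> z' - w' \<in> E \<Longrightarrow> 0 < m \<Longrightarrow>
    1 / m \<le> nrm (z - w) \<Longrightarrow> 1 / m \<le> nrm (z' - w') \<Longrightarrow> x - y \<in> E \<Longrightarrow>
    norm (\<Phi> \<tau> (z - z')) \<le> 1 \<Longrightarrow> norm (\<Phi> \<tau> (w - w')) \<le> 1 \<Longrightarrow>
    \<rho> z w x y \<le> \<rho> z' w' x y + c * m\<^sup>2 * exp (- \<alpha> * \<tau>) * nrm (x - y)"
    using rho_parameter by metis
  \<comment> \<open>The scale at which the error of \<open>rho_parameter\<close> becomes exactly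
    \<open>1 / m\<close> times the leading term.\<close>
  define \<tau> where "\<tau> = ln (c * m\<^sup>2 * m) / \<alpha>"
  have "0 < c * m\<^sup>2 * m" using c(1) m by simp
  then have "exp (- \<alpha> * \<tau>) = 1 / (c * m\<^sup>2 * m)"
    using alpha_pos by (simp add: \<tau>_def exp_minus field_simps)
  then have \<tau>: "c * m\<^sup>2 * exp (- \<alpha> * \<tau>) = 1 / m" using c(1) m by (simp add: field_simps)
  define r where "r = 1 / \<mu> \<tau>"
  have r: "0 < r" using mu_pos by (simp add: r_def)
  have near: "norm (\<Phi> \<tau> v) \<le> 1" if "norm v \<le> r" for v
  proof -
    have "norm (\<Phi> \<tau> v) \<le> \<mu> \<tau> * norm v" by (rule flow_bound)
    also have "\<dots> \<le> \<mu> \<tau> * r" using that mu_pos[of \<tau>] by (intro mult_left_mono) auto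
    finally show ?thesis using mu_pos[of \<tau>] by (simp add: r_def)
  qed
  obtain N where N: "finite N" "N \<subseteq> base_pairs m" "base_pairs m \<subseteq> (\<Union>\<zeta>\<in>N. ball \<zeta> r)"
    using seq_compact_imp_totally_bounded[OF compact_imp_seq_compact[OF compact_base_pairs], of m] r by meson
  have Nd: "z - w \<in> E \<and> 1 / m \<le> nrm (z - w) \<and> 0 < nrm (z - w)" if "(z, w) \<in> base_pairs m" for z w
    using that m by (auto simp: base_pairs_def intro: order.strict_trans2[of 0 "1 / m"])
  have "\<exists>p s. norm p \<le> 1 \<and> m \<le> s \<and> (\<forall>i\<in>N. \<forall>x\<in>fst ` X. \<forall>v\<in>snd ` X.
      defect (case i of (z, w) \<Rightarrow> \<rho> z w) (p + \<Phi> (- s) x) v (exp (- \<alpha> * s)) \<le> 1 / m)"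
  \<comment> \<open>Base pairs of level \<open>m\<close> have leading term at least
    \<open>1 / m\<close>, so \<open>rho_upper\<close> holds for all of them with the factor
    \<open>C\<^sup>2 * m\<close>.\<close>
  proof (rule exists_small_defect[where B = "C\<^sup>2 * m"])
    show "snd ` X \<subseteq> K" using X(2) by auto
    fix i x y assume i: "i \<in> N" and xy: "x - y \<in> E"
    obtain z w where zw: "i = (z, w)" "(z, w) \<in> base_pairs m" using i N(2) by (cases i) auto
    have nd: "z - w \<in> E" "0 < nrm (z - w)" "1 / m \<le> nrm (z - w)" using Nd[OF zw(2)] by auto
    show "0 \<le> (case i of (z, w) \<Rightarrow> \<rho> z w) x y" using rho_nonneg[OF nd(1,2) xy] zw(1) by simp
    have "\<rho> z w x y \<le> C\<^sup>2 * nrm (x - y) / nrm (z - w)" by (rule rho_upper[OF nd(1,2) xy])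
    also have "\<dots> \<le> C\<^sup>2 * nrm (x - y) / (1 / m)"
      using nd(2,3) m by (intro divide_left_mono) auto
    finally show "(case i of (z, w) \<Rightarrow> \<rho> z w) x y \<le> C\<^sup>2 * m * nrm (x - y)"
      using zw(1) by (simp add: mult_ac del: pr_simps)
    fix u assume yu: "y - u \<in> E"
    show "(case i of (z, w) \<Rightarrow> \<rho> z w) x u \<le> (case i of (z, w) \<Rightarrow> \<rho> z w) x y + (case i of (z, w) \<Rightarrow> \<rho> z w) y u"
      using rho_triangle[OF nd(1,2) xy yu] zw(1) by simp
  qed (use N X m in auto)
  then obtain p s where ps: "norm p \<le> 1" "m \<le> s"
    "\<And>z w x v. (z, w) \<in> N \<Longrightarrow> (x, v) \<in> X \<Longrightarrow> defect (\<rho> z w) (unzoom p s x) v (exp (- \<alpha> * s)) \<le> 1 / m"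
    unfolding unzoom_def by force
  show ?thesis
  proof (rule exI[of _ p], rule exI[of _ s], intro conjI ps(1,2) allI impI)
    fix z w assume zw: "(z, w) \<in> base_pairs m"
    then obtain z' w' where zw': "(z', w') \<in> N" "dist (z', w') (z, w) < r" using N(3) by auto
    have d: "norm (z - z') \<le> r" "norm (w - w') \<le> r"
      using zw'(2) dist_fst_le[of "(z', w')" "(z, w)"] dist_snd_le[of "(z', w')" "(z, w)"]
      by (auto simp: dist_norm norm_minus_commute)
    have nd: "z - w \<in> E" "1 / m \<le> nrm (z - w)" using Nd[OF zw] by auto
    have nd': "z' - w' \<in> E" "1 / m \<le> nrm (z' - w')" using Nd zw'(1) N(2) by blast+
    have "\<bar>\<rho> z w x y - \<rho> z' w' x y\<bar> \<le> 1 / m * nrm (x - y)" if xy: "x - y \<in> E" for x y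
      using c(2)[OF nd(1) nd'(1) m nd(2) nd'(2) xy near[OF d(1)] near[OF d(2)]]
        c(2)[OF nd'(1) nd(1) m nd'(2) nd(2) xy, of \<tau>] near[of "z' - z"] near[of "w' - w"] d
      unfolding \<tau> by (simp add: norm_minus_commute abs_le_iff del: pr_simps flow_simps) 
    then show "\<exists>z' w'. (z', w') \<in> base_pairs m \<and>
        (\<forall>x v. (x, v) \<in> X \<longrightarrow> defect (\<rho> z' w') (unzoom p s x) v (exp (- \<alpha> * s)) \<le> 1 / m) \<and>
        (\<forall>x y. x - y \<in> E \<longrightarrow> \<bar>\<rho> z w x y - \<rho> z' w' x y\<bar> \<le> 1 / m * nrm (x - y))"
      using zw'(1) N(2) ps(3)[OF zw'(1)] by blast
  qed
qed

lemma convex_equality: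
  fixes a b c :: real
  assumes "(a\<^sup>2 + b\<^sup>2) / 2 \<le> c\<^sup>2" "c \<le> (a + b) / 2" "0 \<le> c"
  shows "a = b" "c = a"
proof -
  have "c\<^sup>2 \<le> ((a + b) / 2)\<^sup>2" using assms(2,3) by (rule power_mono)
  then have "(a - b)\<^sup>2 \<le> 0" using assms(1) by (simp add: power2_eq_square field_simps)
  then show ab: "a = b" by simp
  then have "a\<^sup>2 \<le> c\<^sup>2" "c \<le> a" using assms by (simp_all add: power2_eq_square)
  then show "c = a" using power2_le_imp_le[of a c] assms(3) by simp
qed

text \<open>The base pair is first exchanged for the nearby pair of the net, which does not change
  the limit. Then the defects, at most \<open>1 / m k\<close>, tend to something nonpositive, and
  \<open>convex_equality\<close> determines all three lengths.\<close>

lemma zoom_limit_doubling: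
  fixes p :: "'k \<Rightarrow> 'a" and s m :: "'k \<Rightarrow> real" and X :: "'k \<Rightarrow> ('a \<times> 'a) set"
  assumes \<GG>: "\<GG> \<noteq> bot" and m: "filterlim m at_top \<GG>"
    and X: "\<And>x v. v \<in> K \<Longrightarrow> eventually (\<lambda>k. (x, v) \<in> X k) \<GG>"
    and good: "eventually (\<lambda>k. \<exists>z' w'. (z', w') \<in> base_pairs (m k) \<and>
      (\<forall>x v. (x, v) \<in> X k \<longrightarrow> defect (\<rho> z' w') (unzoom (p k) (s k) x) v (exp (- \<alpha> * s k)) \<le> 1 / m k) \<and>
      (\<forall>x y. x - y \<in> E \<longrightarrow> \<bar>\<rho> (z k) (w k) x y - \<rho> z' w' x y\<bar> \<le> 1 / m k * nrm (x - y))) \<GG>"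
    and lim: "\<And>x y. x - y \<in> E \<Longrightarrow> ((\<lambda>k. exp (\<alpha> * s k) * \<rho> (z k) (w k) (unzoom (p k) (s k) x) (unzoom (p k) (s k) y)) \<longlongrightarrow> \<nu> x y) \<GG>"
    and tri: "\<And>x y z. x - y \<in> E \<Longrightarrow> y - z \<in> E \<Longrightarrow> \<nu> x z \<le> \<nu> x y + \<nu> y z"
    and nonneg: "\<And>x y. x - y \<in> E \<Longrightarrow> 0 \<le> \<nu> x y"
    and v: "v \<in> K"
  shows "\<nu> x (x + v) = \<nu> (x + v) (x + 2 *\<^sub>R v)" "\<nu> x (x + 2 *\<^sub>R v) = 2 * \<nu> x (x + v)"
proof -
  obtain z' w' where ev: "eventually (\<lambda>k. (z' k, w' k) \<in> base_pairs (m k) \<and>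
      (\<forall>x v. (x, v) \<in> X k \<longrightarrow> defect (\<rho> (z' k) (w' k)) (unzoom (p k) (s k) x) v (exp (- \<alpha> * s k)) \<le> 1 / m k) \<and>
      (\<forall>x y. x - y \<in> E \<longrightarrow> \<bar>\<rho> (z k) (w k) x y - \<rho> (z' k) (w' k) x y\<bar> \<le> 1 / m k * nrm (x - y))) \<GG>"
    using good unfolding eventually_ex by blast
  define \<nu>' where "\<nu>' k x y = exp (\<alpha> * s k) * \<rho> (z' k) (w' k) (unzoom (p k) (s k) x) (unzoom (p k) (s k) y)" for k x y
  have m0: "((\<lambda>k. 1 / m k) \<longlongrightarrow> 0) \<GG>"
    using tendsto_inverse_0_at_top[OF m] by (simp add: inverse_eq_divide)
  have lim': "((\<lambda>k. \<nu>' k x y) \<longlongrightarrow> \<nu> x y) \<GG>" if xy: "x - y \<in> E" for x y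
  proof -
    have "((\<lambda>k. \<nu>' k x y - exp (\<alpha> * s k) * \<rho> (z k) (w k) (unzoom (p k) (s k) x) (unzoom (p k) (s k) y)) \<longlongrightarrow> 0) \<GG>"
    proof (rule Lim_null_comparison)
      show "((\<lambda>k. 1 / m k * nrm (x - y)) \<longlongrightarrow> 0) \<GG>" using m0 by (rule tendsto_mult_left_zero)
      show "\<forall>\<^sub>F k in \<GG>. norm (\<nu>' k x y - exp (\<alpha> * s k) * \<rho> (z k) (w k) (unzoom (p k) (s k) x) (unzoom (p k) (s k) y))
          \<le> 1 / m k * nrm (x - y)"
        using ev
      proof eventually_elim
        case (elim k)
        have d: "unzoom (p k) (s k) x - unzoom (p k) (s k) y = \<Phi> (- s k) (x - y)" by (simp add: unzoom_def)
        have dE: "unzoom (p k) (s k) x - unzoom (p k) (s k) y \<in> E" unfolding d by (rule E_flow[OF xy])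
        have n: "nrm (unzoom (p k) (s k) x - unzoom (p k) (s k) y) = exp (- (\<alpha> * s k)) * nrm (x - y)"
          unfolding d pr_flow[OF xy] by simp
        have "norm (\<nu>' k x y - exp (\<alpha> * s k) * \<rho> (z k) (w k) (unzoom (p k) (s k) x) (unzoom (p k) (s k) y))
            = exp (\<alpha> * s k) * \<bar>\<rho> (z k) (w k) (unzoom (p k) (s k) x) (unzoom (p k) (s k) y)
              - \<rho> (z' k) (w' k) (unzoom (p k) (s k) x) (unzoom (p k) (s k) y)\<bar>"
          unfolding \<nu>'_def right_diff_distrib[symmetric] by (simp add: abs_mult abs_minus_commute)
        also have "\<dots> \<le> exp (\<alpha> * s k) * (1 / m k * nrm (unzoom (p k) (s k) x - unzoom (p k) (s k) y))"
          using elim dE by (intro mult_left_mono) auto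
        also have "\<dots> = 1 / m k * nrm (x - y) * (exp (\<alpha> * s k) * exp (- (\<alpha> * s k)))" unfolding n by (simp only: mult_ac)
        also have "exp (\<alpha> * s k) * exp (- (\<alpha> * s k)) = 1" by (simp flip: exp_add)
        finally show ?case by simp
      qed
    qed
    from tendsto_add[OF this lim[OF xy]] show ?thesis by simp
  qed
  have vE: "x - (x + v) \<in> E" "(x + v) - (x + 2 *\<^sub>R v) \<in> E" "x - (x + 2 *\<^sub>R v) \<in> E"
    using K_in_E[OF v] E_subspace subspace_neg[of E v] subspace_scale[of E v "-2"]
    by (simp_all add: scaleR_2 diff_diff_eq flip: minus_add_distrib)
  define a where "a k = \<nu>' k x (x + v)" for k
  define b where "b k = \<nu>' k (x + v) (x + 2 *\<^sub>R v)" for k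
  define c where "c k = \<nu>' k x (x + 2 *\<^sub>R v) / 2" for k
  have abc: "(a \<longlongrightarrow> \<nu> x (x + v)) \<GG>" "(b \<longlongrightarrow> \<nu> (x + v) (x + 2 *\<^sub>R v)) \<GG>" "(c \<longlongrightarrow> \<nu> x (x + 2 *\<^sub>R v) / 2) \<GG>"
    unfolding a_def b_def c_def by (intro tendsto_divide lim' vE tendsto_const; simp)+
  have "(((\<lambda>k. ((a k)\<^sup>2 + (b k)\<^sup>2) / 2 - (c k)\<^sup>2)) \<longlongrightarrow>
      ((\<nu> x (x + v))\<^sup>2 + (\<nu> (x + v) (x + 2 *\<^sub>R v))\<^sup>2) / 2 - (\<nu> x (x + 2 *\<^sub>R v) / 2)\<^sup>2) \<GG>"
    by (intro tendsto_intros abc) auto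
  moreover have "\<forall>\<^sub>F k in \<GG>. ((a k)\<^sup>2 + (b k)\<^sup>2) / 2 - (c k)\<^sup>2 \<le> 1 / m k"
    using ev X[OF v, of x]
  proof eventually_elim
    case (elim k)
    define q where "q = unzoom (p k) (s k) x"
    define l where "l = exp (- \<alpha> * s k)"
    have l: "exp (\<alpha> * s k) = 1 / l" "0 < l" by (simp_all add: l_def exp_minus field_simps)
    have u: "unzoom (p k) (s k) (x + v) = q + l *\<^sub>R v" "unzoom (p k) (s k) (x + 2 *\<^sub>R v) = q + (2 * l) *\<^sub>R v"
      using K_flow[OF v, of "- s k"] by (simp_all add: unzoom_def q_def l_def)
    have "((a k)\<^sup>2 + (b k)\<^sup>2) / 2 - (c k)\<^sup>2 = defect (\<rho> (z' k) (w' k)) q v l"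
      unfolding a_def b_def c_def \<nu>'_def defect_def u q_def[symmetric] l(1) by (simp add: mult.commute)
    also have "\<dots> \<le> 1 / m k" using elim by (auto simp: q_def l_def)
    finally show ?case .
  qed
  ultimately have le: "((\<nu> x (x + v))\<^sup>2 + (\<nu> (x + v) (x + 2 *\<^sub>R v))\<^sup>2) / 2 - (\<nu> x (x + 2 *\<^sub>R v) / 2)\<^sup>2 \<le> 0"
    by (rule tendsto_le[OF \<GG> m0])
  have 1: "((\<nu> x (x + v))\<^sup>2 + (\<nu> (x + v) (x + 2 *\<^sub>R v))\<^sup>2) / 2 \<le> (\<nu> x (x + 2 *\<^sub>R v) / 2)\<^sup>2" using le by simp
  have 2: "\<nu> x (x + 2 *\<^sub>R v) / 2 \<le> (\<nu> x (x + v) + \<nu> (x + v) (x + 2 *\<^sub>R v)) / 2"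
    using tri[OF vE(1,2)] by simp
  have 3: "0 \<le> \<nu> x (x + 2 *\<^sub>R v) / 2" using nonneg[OF vE(3)] by simp
  show "\<nu> x (x + v) = \<nu> (x + v) (x + 2 *\<^sub>R v)" "\<nu> x (x + 2 *\<^sub>R v) = 2 * \<nu> x (x + v)"
    using convex_equality[OF 1 2 3] by simp_all
qed

text \<open>The factor \<open>exp (\<alpha> * s)\<close> offsets exactly the shrinking of leading
  terms under \<open>unzoom\<close>, so the bounds depend neither on the place nor on the scale and
  a limit exists along some filter.\<close>

lemma zoomed_rho_le:
  assumes zw: "z - w \<in> E" "0 < nrm (z - w)" and xy: "x - y \<in> E"
  shows "exp (\<alpha> * s) * \<rho> z w (unzoom p s x) (unzoom p s y) \<le> C\<^sup>2 * nrm (x - y) / nrm (z - w)"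
    and "nrm (x - y) / nrm (z - w) \<le> exp (\<alpha> * s) * \<rho> z w (unzoom p s x) (unzoom p s y)"
proof -
  have d: "unzoom p s x - unzoom p s y = \<Phi> (- s) (x - y)" by (simp add: unzoom_def)
  have dE: "unzoom p s x - unzoom p s y \<in> E" unfolding d by (rule E_flow[OF xy])
  have n: "exp (\<alpha> * s) * nrm (unzoom p s x - unzoom p s y) = nrm (x - y)"
    unfolding d pr_flow[OF xy] by (simp flip: exp_add mult.assoc)
  have "exp (\<alpha> * s) * \<rho> z w (unzoom p s x) (unzoom p s y)
      \<le> exp (\<alpha> * s) * (C\<^sup>2 * nrm (unzoom p s x - unzoom p s y) / nrm (z - w))"
    by (intro mult_left_mono rho_upper zw dE) auto
  also have "\<dots> = C\<^sup>2 * (exp (\<alpha> * s) * nrm (unzoom p s x - unzoom p s y)) / nrm (z - w)" by (simp only: mult_ac times_divide_eq_right)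
  finally show "exp (\<alpha> * s) * \<rho> z w (unzoom p s x) (unzoom p s y) \<le> C\<^sup>2 * nrm (x - y) / nrm (z - w)"
    by (simp only: n)
  have "nrm (x - y) / nrm (z - w) = exp (\<alpha> * s) * (nrm (unzoom p s x - unzoom p s y) / nrm (z - w))"
    by (simp only: n[symmetric] times_divide_eq_right)
  also have "\<dots> \<le> exp (\<alpha> * s) * \<rho> z w (unzoom p s x) (unzoom p s y)"
    by (intro mult_left_mono rho_lower zw dE) auto
  finally show "nrm (x - y) / nrm (z - w) \<le> exp (\<alpha> * s) * \<rho> z w (unzoom p s x) (unzoom p s y)" .
qed

text \<open>After magnification the estimate of \<open>rho_transverse\<close> is uniform in
  \<open>k\<close>, as \<open>exp (\<alpha> * s k)\<close> cancels the gain from the finer scale.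
  The moving points may thus approach their limits from other cosets of \<open>E\<close>.\<close>

lemma zoomed_rho_tendsto:
  fixes p :: "'k \<Rightarrow> 'a"
  assumes zw: "z - w \<in> E" "0 < nrm (z - w)" and xy: "x - y \<in> E" "\<And>k. X k - Y k \<in> E"
    and lim: "((\<lambda>k. exp (\<alpha> * s k) * \<rho> z w (unzoom (p k) (s k) x) (unzoom (p k) (s k) y)) \<longlongrightarrow> l) \<GG>"
    and X: "(X \<longlongrightarrow> x) \<GG>" and Y: "(Y \<longlongrightarrow> y) \<GG>"
  shows "((\<lambda>k. exp (\<alpha> * s k) * \<rho> z w (unzoom (p k) (s k) (X k)) (unzoom (p k) (s k) (Y k))) \<longlongrightarrow> l) \<GG>"
proof -
  define f where "f k x y = exp (\<alpha> * s k) * \<rho> z w (unzoom (p k) (s k) x) (unzoom (p k) (s k) y)" for k x y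
  obtain c where c: "0 < c" "\<And>z w x y x' y' \<tau>. z - w \<in> E \<Longrightarrow> 0 < nrm (z - w) \<Longrightarrow> x - y \<in> E \<Longrightarrow> x' - y' \<in> E \<Longrightarrow>
    norm (\<Phi> \<tau> (x - x')) \<le> 1 \<Longrightarrow> norm (\<Phi> \<tau> (y - y')) \<le> 1 \<Longrightarrow>
    \<rho> z w x y \<le> \<rho> z w x' y' + c * exp (- \<alpha> * \<tau>) / nrm (z - w)"
    using rho_transverse by metis
  have uE: "unzoom p s x - unzoom p s y \<in> E" if "x - y \<in> E" for p s x y
  proof -
    have "unzoom p s x - unzoom p s y = \<Phi> (- s) (x - y)" by (simp add: unzoom_def)
    then show ?thesis using E_flow[OF that] by simp
  qed
  have close: "f k x y \<le> f k x' y' + c * exp (- \<alpha> * \<tau>) / nrm (z - w)"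
    if "x - y \<in> E" "x' - y' \<in> E" "norm (\<Phi> \<tau> (x - x')) \<le> 1" "norm (\<Phi> \<tau> (y - y')) \<le> 1" for k \<tau> x y x' y'
  proof -
    have "\<rho> z w (unzoom (p k) (s k) x) (unzoom (p k) (s k) y)
        \<le> \<rho> z w (unzoom (p k) (s k) x') (unzoom (p k) (s k) y') + c * exp (- \<alpha> * (\<tau> + s k)) / nrm (z - w)"
      by (rule c(2)[OF zw uE[OF that(1)] uE[OF that(2)]])
         (use that(3,4) in \<open>simp_all add: flow_unzoom del: flow_simps\<close>)
    then have "f k x y \<le> exp (\<alpha> * s k) * (\<rho> z w (unzoom (p k) (s k) x') (unzoom (p k) (s k) y')
        + c * exp (- \<alpha> * (\<tau> + s k)) / nrm (z - w))"
      unfolding f_def by (rule mult_left_mono) simp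
    also have "\<dots> = f k x' y' + c * (exp (\<alpha> * s k) * exp (- \<alpha> * (\<tau> + s k))) / nrm (z - w)"
      unfolding f_def distrib_left by (simp only: mult_ac times_divide_eq_right)
    also have "exp (\<alpha> * s k) * exp (- \<alpha> * (\<tau> + s k)) = exp (- \<alpha> * \<tau>)"
      by (simp add: algebra_simps flip: exp_add)
    finally show ?thesis .
  qed
  have "((\<lambda>k. f k (X k) (Y k) - f k x y) \<longlongrightarrow> 0) \<GG>"
    unfolding tendsto_iff dist_norm diff_0_right
  proof (intro allI impI)
    fix e :: real assume e: "0 < e"
    define \<tau> where "\<tau> = - ln (e * nrm (z - w) / (2 * c)) / \<alpha>"
    have "0 < e * nrm (z - w) / (2 * c)" using e zw c(1) by simp
    then have "exp (- \<alpha> * \<tau>) = e * nrm (z - w) / (2 * c)" using alpha_pos by (simp add: \<tau>_def)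
    then have \<tau>: "c * exp (- \<alpha> * \<tau>) / nrm (z - w) = e / 2" using c(1) zw(2) by (simp add: field_simps del: pr_simps)
    have ev: "\<forall>\<^sub>F k in \<GG>. norm (\<Phi> \<tau> (Z k - z)) \<le> 1" if "(Z \<longlongrightarrow> z) \<GG>" for Z z
    proof -
      have "((\<lambda>k. norm (\<Phi> \<tau> (Z k - z))) \<longlongrightarrow> norm (\<Phi> \<tau> (z - z))) \<GG>"
        by (intro tendsto_intros that)
      then have "((\<lambda>k. norm (\<Phi> \<tau> (Z k - z))) \<longlongrightarrow> 0) \<GG>" by simp
      then have "\<forall>\<^sub>F k in \<GG>. norm (\<Phi> \<tau> (Z k - z)) < 1" by (rule order_tendstoD) simp
      then show ?thesis by eventually_elim simp
    qed
    show "\<forall>\<^sub>F k in \<GG>. norm (f k (X k) (Y k) - f k x y) < e"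
      using ev[OF X] ev[OF Y]
    proof eventually_elim
      case (elim k)
      have sym: "norm (\<Phi> \<tau> (x - X k)) \<le> 1" "norm (\<Phi> \<tau> (y - Y k)) \<le> 1"
        using elim by (simp_all add: norm_minus_commute)
      show ?case
        using close[OF xy(2) xy(1) elim, of k] close[OF xy(1) xy(2) sym, of k] e unfolding \<tau> by simp
    qed
  qed
  from tendsto_add[OF this lim[folded f_def]] show ?thesis by (simp add: f_def)
qed

text \<open>Let \<open>\<nu>\<close> be the limit of the magnified \<open>\<rho>\<close> with base
  pair \<open>(e0, 0)\<close>. Its pullback by a limit map \<open>H\<close> is, by equivariance, the
  limit of the magnified \<open>\<rho>\<close> with a moved base pair. If the moved pairs stay
  admissible, both limits are leaf metrics and \<open>H\<close> is an isometry between them. The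
  second conclusion is what allows repetition for further eigenvalues.\<close>

theorem blow_up:
  assumes co: "cocompact_pairs G" and e0: "e0 \<in> K" "e0 \<noteq> 0"
  shows "\<exists>F D. qs D 0 F \<and> (\<forall>h\<in>G. midpoint_affine E U (F \<circ> h \<circ> inv_into UNIV F)) \<and>
    (\<forall>E' U'. closed U' \<and> (\<forall>t. \<forall>v\<in>E'. \<Phi> t v \<in> E') \<and> (\<forall>t. \<forall>v\<in>U'. \<Phi> t v \<in> U') \<and>
      (\<forall>h\<in>G. midpoint_affine E' U' h) \<longrightarrow> (\<forall>h\<in>G. midpoint_affine E' U' (F \<circ> h \<circ> inv_into UNIV F)))"
proof -
  obtain D r where Dr: "\<And>p s. \<exists>g\<in>G. \<exists>a. norm a \<le> r \<and> zoom p s (g a) = 0 \<and> qs D 0 (zoom p s \<circ> g)"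
    using zoomed_group_elements[OF group co] by blast
  \<comment> \<open>The index \<open>k\<close> is a finite set of test pairs. Along the filter of
    finite sets every pair is eventually tested, and the quality \<open>m k\<close> tends to
    infinity.\<close>
  define m where "m k = real (card k) + 1" for k :: "('a \<times> 'a) set"
  define X where "X k = (if finite k then {(x, v). (x, v) \<in> k \<and> v \<in> K} else {})" for k :: "('a \<times> 'a) set"
  have Xfin: "finite (X k)" "(x, v) \<in> X k \<Longrightarrow> v \<in> K" for k x v
  proof -
    have "X k \<subseteq> k" by (auto simp: X_def)
    then show "finite (X k)" using finite_subset by (cases "finite k") (auto simp: X_def)
  qed (auto simp: X_def split: if_splits)
  have m0: "0 < m k" for k by (simp add: m_def add_nonneg_pos)
  define good where "good k p s z w \<longleftrightarrow> (\<exists>z' w'. (z', w') \<in> base_pairs (m k) \<and>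
      (\<forall>x v. (x, v) \<in> X k \<longrightarrow> defect (\<rho> z' w') (unzoom p s x) v (exp (- \<alpha> * s)) \<le> 1 / m k) \<and>
      (\<forall>x y. x - y \<in> E \<longrightarrow> \<bar>\<rho> z w x y - \<rho> z' w' x y\<bar> \<le> 1 / m k * nrm (x - y)))" for k p s z w
  have "\<forall>k. \<exists>p s. norm p \<le> 1 \<and> m k \<le> s \<and> (\<forall>z w. (z, w) \<in> base_pairs (m k) \<longrightarrow> good k p s z w)"
    unfolding good_def by (rule allI, rule exists_good_zoom[OF Xfin(1) _ m0]) (rule Xfin(2))
  then obtain p s where ps: "\<And>k. norm (p k) \<le> 1" "\<And>k. m k \<le> s k"
    "\<And>k z w. (z, w) \<in> base_pairs (m k) \<Longrightarrow> good k (p k) (s k) z w"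
    by metis
  obtain g a where ga: "\<And>k. g k \<in> G" "\<And>k. norm (a k) \<le> r" "\<And>k. zoom (p k) (s k) (g k (a k)) = 0"
    "\<And>k. qs D 0 (zoom (p k) (s k) \<circ> g k)"
    using Dr[of "p k" "s k" for k] by metis
  define F where "F k = zoom (p k) (s k) \<circ> g k" for k
  define \<FF> where "\<FF> = finite_subsets_at_top (UNIV :: ('a \<times> 'a) set)"
  have \<FF>: "\<FF> \<noteq> bot" by (simp add: \<FF>_def)
  have inf: "infinite (UNIV :: ('a \<times> 'a) set)"
  proof -
    have "inj (\<lambda>x::real. (x *\<^sub>R e0, 0::'a))" using e0(2) by (simp add: inj_def)
    then show ?thesis using infinite_UNIV_char_0[where 'a = real] finite_imageD by (metis finite_subset subset_UNIV)
  qed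
  have m_lim: "filterlim m at_top \<FF>"
    unfolding filterlim_at_top \<FF>_def
  proof
    fix Z :: real
    obtain n :: nat where n: "Z \<le> real n" using real_arch_simple by blast
    obtain A :: "('a \<times> 'a) set" where A: "finite A" "card A = n"
      using infinite_arbitrarily_large[OF inf, of n] by blast
    show "\<forall>\<^sub>F k in finite_subsets_at_top UNIV. Z \<le> m k"
      unfolding eventually_finite_subsets_at_top
    proof (intro exI[of _ A] conjI A(1) subset_UNIV allI impI)
      fix Y assume "finite Y \<and> A \<subseteq> Y \<and> Y \<subseteq> UNIV"
      then have "n \<le> card Y" using A card_mono by blast
      then show "Z \<le> m Y" using n by (simp add: m_def)
    qed
  qed
  have X_ev: "\<forall>\<^sub>F k in \<FF>. (x, v) \<in> X k" if "v \<in> K" for x v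
    unfolding \<FF>_def eventually_finite_subsets_at_top
    by (rule exI[of _ "{(x, v)}"]) (use that in \<open>auto simp: X_def\<close>)
  have Fq: "qs D 0 (F k)" and Fa: "F k (a k) = 0" for k
    using ga by (simp_all add: F_def)
  obtain \<GG>1 L where 1: "\<GG>1 \<le> \<FF>" "\<GG>1 \<noteq> bot" "qs D 0 L" "\<And>x. ((\<lambda>k. F k x) \<longlongrightarrow> L x) \<GG>1"
    "\<And>x. ((\<lambda>k. inv_into UNIV (F k) x) \<longlongrightarrow> inv_into UNIV L x) \<GG>1"
    by (rule qs_limit[OF \<FF>, where F = F and a = a and D = D and r = r])
       (use Fq Fa ga(2) in blast)+
  define n0 where "n0 = nrm (e0 - 0)"
  have n0: "0 < n0" using e0 pr_K by (simp add: n0_def)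
  have eE: "e0 - 0 \<in> E" using K_in_E[OF e0(1)] by simp
  note zw = eE n0[unfolded n0_def]
  define f where "f k x y = exp (\<alpha> * s k) * \<rho> e0 0 (unzoom (p k) (s k) x) (unzoom (p k) (s k) y)" for k x y
  have f_le: "f k x y \<le> C\<^sup>2 * nrm (x - y) / n0" "nrm (x - y) / n0 \<le> f k x y" if "x - y \<in> E" for k x y
    unfolding f_def n0_def using zoomed_rho_le[OF zw that] by auto
  have f_nonneg: "0 \<le> f k x y" if "x - y \<in> E" for k x y
    using f_le(2)[OF that, of k] n0 by (meson divide_nonneg_pos norm_ge_zero order.trans)
  obtain \<GG> \<nu>0 where 2: "\<GG> \<le> \<GG>1" "\<GG> \<noteq> bot"
    "\<And>xy. ((\<lambda>k. if fst xy - snd xy \<in> E then f k (fst xy) (snd xy) else 0) \<longlongrightarrow> \<nu>0 xy) \<GG>"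
  proof (rule pointwise_cluster[OF 1(2), of "\<lambda>k xy. if fst xy - snd xy \<in> E then f k (fst xy) (snd xy) else 0"
        "\<lambda>xy. C\<^sup>2 * nrm (fst xy - snd xy) / n0"])
    fix k and xy :: "'a \<times> 'a"
    show "norm (if fst xy - snd xy \<in> E then f k (fst xy) (snd xy) else 0) \<le> C\<^sup>2 * nrm (fst xy - snd xy) / n0"
      using f_le(1)[of "fst xy" "snd xy" k] f_nonneg[of "fst xy" "snd xy" k] n0 by (simp del: pr_simps)
  qed blast
  have \<GG>\<FF>: "\<GG> \<le> \<FF>" using 1(1) 2(1) by simp
  have mG: "filterlim m at_top \<GG>" using m_lim \<GG>\<FF> filterlim_mono by blast
  have XG: "\<forall>\<^sub>F k in \<GG>. (x, v) \<in> X k" if "v \<in> K" for x v using X_ev[OF that] \<GG>\<FF> filter_leD by blast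
  have F_lim: "((\<lambda>k. F k x) \<longlongrightarrow> L x) \<GG>" "((\<lambda>k. inv_into UNIV (F k) x) \<longlongrightarrow> inv_into UNIV L x) \<GG>" for x
    using 1(4,5) 2(1) tendsto_mono by blast+
  define \<nu> where "\<nu> x y = \<nu>0 (x, y)" for x y
  have \<nu>: "((\<lambda>k. f k x y) \<longlongrightarrow> \<nu> x y) \<GG>" if "x - y \<in> E" for x y
    using 2(3)[of "(x, y)"] that by (simp add: \<nu>_def)
  have \<nu>_sym: "\<nu> x y = \<nu> y x" if xy: "x - y \<in> E" for x y
  proof -
    have yx: "y - x \<in> E" using subspace_neg[OF E_subspace xy] by simp
    have "f k x y = f k y x" for k by (simp add: f_def rho_sym)
    then show ?thesis using tendsto_unique[OF 2(2) \<nu>[OF xy]] \<nu>[OF yx] by simp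
  qed
  have unz: "unzoom p s x - unzoom p s y \<in> E" if "x - y \<in> E" for p s x y
  proof -
    have "unzoom p s x - unzoom p s y = \<Phi> (- s) (x - y)" by (simp add: unzoom_def)
    then show ?thesis using E_flow[OF that] by simp
  qed
  have \<nu>_tri: "\<nu> x z \<le> \<nu> x y + \<nu> y z" if xy: "x - y \<in> E" "y - z \<in> E" for x y z
  proof -
    have xz: "x - z \<in> E" using subspace_add[OF E_subspace xy] by simp
    have "f k x z \<le> f k x y + f k y z" for k
      unfolding f_def distrib_left[symmetric]
      by (intro mult_left_mono rho_triangle zw unz xy) auto
    then show ?thesis
      by (intro tendsto_le[OF 2(2) tendsto_add[OF \<nu>[OF xy(1)] \<nu>[OF xy(2)]] \<nu>[OF xz]] always_eventually) auto
  qed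
  have \<nu>_le: "\<nu> x y \<le> C\<^sup>2 * nrm (x - y) / n0" "nrm (x - y) / n0 \<le> \<nu> x y" if xy: "x - y \<in> E" for x y
    using tendsto_upperbound[OF \<nu>[OF xy] _ 2(2)] tendsto_lowerbound[OF \<nu>[OF xy] _ 2(2)] f_le[OF xy]
    by (auto intro!: always_eventually)
  have \<nu>_nonneg: "0 \<le> \<nu> x y" if "x - y \<in> E" for x y
    using \<nu>_le(2)[OF that] n0 by (meson divide_nonneg_pos norm_ge_zero order.trans)
  \<comment> \<open>Used twice: for \<open>\<nu>\<close> with a fixed base pair, and for its
    pullback with a base pair that varies with \<open>k\<close>.\<close>
  have leaf: "leaf_metric \<nu>'"
    if sym: "\<And>x y. x - y \<in> E \<Longrightarrow> \<nu>' x y = \<nu>' y x"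
      and tri: "\<And>x y z. x - y \<in> E \<Longrightarrow> y - z \<in> E \<Longrightarrow> \<nu>' x z \<le> \<nu>' x y + \<nu>' y z"
      and up: "\<And>x y. x - y \<in> E \<Longrightarrow> \<nu>' x y \<le> c1 * nrm (x - y)"
      and low: "\<And>x y. x - y \<in> E \<Longrightarrow> nrm (x - y) \<le> c2 * \<nu>' x y"
      and nonneg: "\<And>x y. x - y \<in> E \<Longrightarrow> 0 \<le> \<nu>' x y"
      and lim: "\<And>x y. x - y \<in> E \<Longrightarrow> ((\<lambda>k. exp (\<alpha> * s k) * \<rho> (z k) (w k) (unzoom (p k) (s k) x) (unzoom (p k) (s k) y)) \<longlongrightarrow> \<nu>' x y) \<GG>"
      and base: "\<forall>\<^sub>F k in \<GG>. (z k, w k) \<in> base_pairs (m k)" for \<nu>' c1 c2 z w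
    unfolding leaf_metric_def
  proof (intro conjI allI impI ballI)
    show "\<exists>c>0. \<forall>x y. x - y \<in> E \<longrightarrow> nrm (x - y) \<le> c * \<nu>' x y \<and> \<nu>' x y \<le> c * nrm (x - y)"
    proof (rule exI[of _ "\<bar>c1\<bar> + \<bar>c2\<bar> + 1"], intro conjI allI impI)
      fix x y assume xy: "x - y \<in> E"
      show "nrm (x - y) \<le> (\<bar>c1\<bar> + \<bar>c2\<bar> + 1) * \<nu>' x y"
        by (rule order.trans[OF low[OF xy] mult_right_mono]) (use nonneg[OF xy] in auto)
      show "\<nu>' x y \<le> (\<bar>c1\<bar> + \<bar>c2\<bar> + 1) * nrm (x - y)"
        by (rule order.trans[OF up[OF xy] mult_right_mono]) auto
    qed auto
    have "\<forall>\<^sub>F k in \<GG>. good k (p k) (s k) (z k) (w k)" using base by eventually_elim (rule ps(3))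
    note ev = this[unfolded good_def]
    show "\<nu>' x (x + v) = \<nu>' (x + v) (x + 2 *\<^sub>R v)" "\<nu>' x (x + 2 *\<^sub>R v) = 2 * \<nu>' x (x + v)" if "v \<in> K" for x v
      by (rule zoom_limit_doubling[OF 2(2) mG XG ev lim tri nonneg that]; assumption)+
  qed (use sym tri in auto)
  have base_ev: "\<forall>\<^sub>F k in \<GG>. (z k, w k) \<in> base_pairs (m k)"
    if "\<forall>\<^sub>F k in \<GG>. norm (z k) \<le> b \<and> norm (w k) \<le> b" "\<And>k. z k - w k \<in> E" "\<And>k. c \<le> nrm (z k - w k)" "0 < c" for z w b c
  proof -
    have "\<forall>\<^sub>F k in \<GG>. max b (1 / c) \<le> m k" using mG unfolding filterlim_at_top by blast
    with that(1) show ?thesis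
    proof eventually_elim
      case (elim k)
      then have "1 / m k \<le> c" using that(4) m0[of k] by (simp add: field_simps)
      then show ?case using elim that(2)[of k] that(3)[of k] by (simp add: base_pairs_def del: pr_simps)
    qed
  qed
  have leaf_\<nu>: "leaf_metric \<nu>"
  proof (rule leaf[where z = "\<lambda>_. e0" and w = "\<lambda>_. 0" and ?c1.0 = "C\<^sup>2 / n0" and ?c2.0 = n0])
    show "\<forall>\<^sub>F k in \<GG>. (e0, 0) \<in> base_pairs (m k)"
      by (rule base_ev[where b = "norm e0" and c = n0]) (use eE n0 in \<open>auto simp: n0_def\<close>)
    show "\<nu> x y \<le> C\<^sup>2 / n0 * nrm (x - y)" "nrm (x - y) \<le> n0 * \<nu> x y" if "x - y \<in> E" for x y
      using \<nu>_le[OF that] n0 by (simp_all add: field_simps del: pr_simps)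
  qed (use \<nu>_sym \<nu>_tri \<nu>_nonneg \<nu>[unfolded f_def] in auto)
  \<comment> \<open>Conjugating \<open>h\<close> by \<open>F k\<close> amounts to conjugating
    \<open>conj k h\<close> by the zoom alone. As \<open>conj k h\<close> belongs to the group,
    \<open>\<rho>\<close> is equivariant under it.\<close>
  define conj where "conj k h = g k \<circ> h \<circ> inv_into UNIV (g k)" for k h
  have conj_G: "conj k h \<in> G" if "h \<in> G" for k h
    unfolding conj_def using that ga(1) by (intro group_comp group_inv) auto
  have gb: "bij (g k)" for k using group_bij ga(1) by blast
  have invF: "inv_into UNIV (F k) = inv_into UNIV (g k) \<circ> unzoom (p k) (s k)" for k
    unfolding F_def inv_zoom[symmetric] by (rule o_inv_distrib) (auto intro: gb bij_zoom)
  have conj_F: "F k (h (inv_into UNIV (F k) x)) = zoom (p k) (s k) (conj k h (unzoom (p k) (s k) x))" for k h x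
    unfolding invF by (simp add: F_def conj_def)
  have unz_conj: "unzoom (p k) (s k) (F k (h (inv_into UNIV (F k) x))) = conj k h (unzoom (p k) (s k) x)" for k h x
    by (simp add: conj_F)
  have H_lim: "((\<lambda>k. F k (h (inv_into UNIV (F k) x))) \<longlongrightarrow> L (h (inv_into UNIV L x))) \<GG>" if h: "h \<in> G" for h x
  proof (rule qs1_tendsto[OF qs_qs1[OF Fq] _ F_lim(1)])
    obtain \<sigma> where "qs C \<sigma> h" using group_qs[OF h] .
    then have "continuous_on UNIV h" using qs_qs1 qs1_imp_continuous by blast
    then show "((\<lambda>k. h (inv_into UNIV (F k) x)) \<longlongrightarrow> h (inv_into UNIV L x)) \<GG>"
      by (rule continuous_on_tendsto_compose[OF _ F_lim(2)]) auto
  qed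
  have main: "midpoint_affine E U (L \<circ> h \<circ> inv_into UNIV L)" if h: "h \<in> G" for h
  proof -
    define H where "H = L \<circ> h \<circ> inv_into UNIV L"
    define hk where "hk k = conj k h" for k
    have hkG: "hk k \<in> G" for k unfolding hk_def by (rule conj_G[OF h])
    obtain \<sigma> where \<sigma>: "qs C \<sigma> h" using group_qs[OF h] .
    obtain D1 where "qs D1 (0 + \<sigma> + - 0) H"
      using qs_comp[OF qs_comp[OF 1(3) \<sigma>] qs_inv[OF 1(3)]] unfolding H_def by blast
    then have Hq: "qs D1 \<sigma> H" by simp
    have "\<exists>D2. \<forall>k. qs D2 \<sigma> (hk k)"
    proof (intro exI allI)
      fix k
      obtain t where t: "qs C t (g k)" using group_qs[OF ga(1)] .
      show "qs (max (max (C * (1 + C)) (C * (1 + C)) * (1 + C)) (C * (1 + max (C * (1 + C)) (C * (1 + C))))) \<sigma> (hk k)"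
        using qs_comp[OF qs_comp[OF t \<sigma>] qs_inv[OF t]] by (simp add: hk_def conj_def)
    qed
    then obtain D2 where D2: "\<And>k. qs D2 \<sigma> (hk k)" by blast
    \<comment> \<open>The base pair is pulled back, so that \<open>hk k\<close> sends
      \<open>(z k, w k)\<close> to \<open>(e0, 0)\<close> and equivariance returns to the base pair
      of \<open>\<nu>\<close>.\<close>
    define z where "z k = inv_into UNIV (hk k) e0" for k
    define w where "w k = inv_into UNIV (hk k) 0" for k
    have hkz: "hk k (z k) = e0" "hk k (w k) = 0" for k
      using qs_bij[OF D2[of k]] by (simp_all add: z_def w_def bij_is_surj surj_f_inv_f)
    have zwE: "z k - w k \<in> E" for k
      unfolding z_def w_def by (rule qs1_E[OF qs_inv1[OF D2] eE])
    have D2nn: "0 \<le> D2" using qs1_nonneg[OF qs_qs1[OF D2]] .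
    have zw_low: "n0 / (D2 * exp (\<alpha> * \<sigma>) + 1) \<le> nrm (z k - w k)" for k
    proof -
      have "n0 \<le> D2 * exp (\<alpha> * \<sigma>) * nrm (z k - w k)"
        using qs1_pr[OF qs_qs1[OF D2[of k]] zwE[of k]] by (simp add: hkz n0_def del: pr_simps) 
      also have "\<dots> \<le> (D2 * exp (\<alpha> * \<sigma>) + 1) * nrm (z k - w k)" by (intro mult_right_mono) auto
      finally show ?thesis using D2nn by (simp add: pos_divide_le_eq add_nonneg_pos mult.commute del: pr_simps)
    qed
    have hinv: "inv_into UNIV h \<in> G" by (rule group_inv[OF h])
    have inv_hk: "inv_into UNIV (hk k) = conj k (inv_into UNIV h)" for k
    proof (rule inv_unique_comp)
      have a: "inv_into UNIV (g k) (g k x) = x" "g k (inv_into UNIV (g k) x) = x" for x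
        using gb[of k] by (simp_all add: bij_is_inj bij_is_surj surj_f_inv_f)
      have b: "inv_into UNIV h (h x) = x" "h (inv_into UNIV h x) = x" for x
        using qs_bij[OF \<sigma>] by (simp_all add: bij_is_inj bij_is_surj surj_f_inv_f)
      show "hk k \<circ> conj k (inv_into UNIV h) = id" "conj k (inv_into UNIV h) \<circ> hk k = id"
        by (simp_all add: fun_eq_iff hk_def conj_def a b)
    qed
    \<comment> \<open>The elements \<open>g k\<close> are not bounded, so their conjugates
      \<open>hk k\<close> could move base pairs arbitrarily far. The centre \<open>p k\<close> is
      controlled: its preimage is the image under \<open>unzoom\<close> of a point that converges,
      and \<open>qs1_chain\<close> extends the bound from \<open>p k\<close> to the base
      pair.\<close>
    define b0 where "b0 = norm (L (inv_into UNIV h (inv_into UNIV L 0))) + 1"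
    have "\<forall>\<^sub>F k in \<GG>. norm (F k (inv_into UNIV h (inv_into UNIV (F k) 0))) < b0"
      using tendsto_norm[OF H_lim[OF hinv, of 0]] by (rule order_tendstoD) (simp add: b0_def)
    then have pk: "\<forall>\<^sub>F k in \<GG>. norm (inv_into UNIV (hk k) (p k)) \<le> 1 + \<mu> 0 * b0"
    proof eventually_elim
      case (elim k)
      have "inv_into UNIV (hk k) (p k) = inv_into UNIV (hk k) (unzoom (p k) (s k) 0)"
        by (simp add: unzoom_def)
      also have "\<dots> = unzoom (p k) (s k) (F k (inv_into UNIV h (inv_into UNIV (F k) 0)))"
        by (simp add: inv_hk unz_conj)
      finally have eq: "inv_into UNIV (hk k) (p k) = p k + \<Phi> (- s k) (F k (inv_into UNIV h (inv_into UNIV (F k) 0)))"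
        by (simp add: unzoom_def)
      have "norm (\<Phi> (- s k) (F k (inv_into UNIV h (inv_into UNIV (F k) 0)))) \<le> \<mu> (- s k) * norm (F k (inv_into UNIV h (inv_into UNIV (F k) 0)))"
        by (rule flow_bound)
      also have "\<dots> \<le> \<mu> 0 * b0"
        using elim mu_mono[of "- s k" 0] ps(2)[of k] m0[of k] mu_pos[of 0] by (intro mult_mono) auto
      finally show ?case unfolding eq by (rule norm_triangle_le[OF add_mono[OF ps(1)]])
    qed
    define b1 where "b1 = 1 + \<mu> 0 * b0 + D2 * (1 + \<mu> (- \<sigma>) * (norm e0 + 1))"
    have bounded_inv: "norm (inv_into UNIV (hk k) y) \<le> b1"
      if "norm (inv_into UNIV (hk k) (p k)) \<le> 1 + \<mu> 0 * b0" "norm y \<le> norm e0" for k y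
    proof -
      have "norm (inv_into UNIV (hk k) y - inv_into UNIV (hk k) (p k)) \<le> D2 * (1 + norm (\<Phi> (- \<sigma>) (y - p k)))"
        using qs1_chain[OF qs_inv1[OF D2[of k]], of "- \<sigma>" y "p k"] by (simp del: flow_simps)
      also have "\<dots> \<le> D2 * (1 + \<mu> (- \<sigma>) * (norm e0 + 1))"
      proof (intro mult_left_mono add_left_mono D2nn)
        have "norm (\<Phi> (- \<sigma>) (y - p k)) \<le> \<mu> (- \<sigma>) * norm (y - p k)" by (rule flow_bound)
        also have "\<dots> \<le> \<mu> (- \<sigma>) * (norm e0 + 1)"
          using mu_pos[of "- \<sigma>"] norm_triangle_ineq4[of y "p k"] ps(1)[of k] that(2)
          by (intro mult_left_mono) auto
        finally show "norm (\<Phi> (- \<sigma>) (y - p k)) \<le> \<mu> (- \<sigma>) * (norm e0 + 1)" .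
      qed
      finally show ?thesis
        using that(1) norm_triangle_sub[of "inv_into UNIV (hk k) y" "inv_into UNIV (hk k) (p k)"]
        unfolding b1_def by linarith
    qed
    have base: "\<forall>\<^sub>F k in \<GG>. (z k, w k) \<in> base_pairs (m k)"
    proof (rule base_ev[OF _ zwE zw_low])
      show "\<forall>\<^sub>F k in \<GG>. norm (z k) \<le> b1 \<and> norm (w k) \<le> b1"
        using pk by eventually_elim (auto simp: z_def w_def intro!: bounded_inv)
      show "0 < n0 / (D2 * exp (\<alpha> * \<sigma>) + 1)" using n0 D2nn by (simp add: add_nonneg_pos)
    qed
    define \<nu>' where "\<nu>' x y = \<nu> (H x) (H y)" for x y
    have HE: "H x - H y \<in> E" if "x - y \<in> E" for x y by (rule qs1_E[OF qs_qs1[OF Hq] that])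
    have "leaf_metric \<nu>'"
    proof (rule leaf[where z = z and w = w and ?c1.0 = "C\<^sup>2 / n0 * (D1 * exp (\<alpha> * \<sigma>))" and ?c2.0 = "D1 * exp (\<alpha> * - \<sigma>) * n0"])
      fix x y assume xy: "x - y \<in> E"
      have D1: "0 \<le> D1" using qs1_nonneg[OF qs_qs1[OF Hq]] .
      show "\<nu>' x y = \<nu>' y x" unfolding \<nu>'_def by (rule \<nu>_sym[OF HE[OF xy]])
      show "0 \<le> \<nu>' x y" unfolding \<nu>'_def by (rule \<nu>_nonneg[OF HE[OF xy]])
      have "\<nu>' x y \<le> C\<^sup>2 / n0 * nrm (H x - H y)" unfolding \<nu>'_def using \<nu>_le(1)[OF HE[OF xy]] by (simp del: pr_simps)
      also have "\<dots> \<le> C\<^sup>2 / n0 * (D1 * exp (\<alpha> * \<sigma>) * nrm (x - y))"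
        using n0 by (intro mult_left_mono qs1_pr[OF qs_qs1[OF Hq] xy]) auto
      finally show "\<nu>' x y \<le> C\<^sup>2 / n0 * (D1 * exp (\<alpha> * \<sigma>)) * nrm (x - y)" by (simp only: mult.assoc)
      have invH: "inv_into UNIV H (H x) = x" for x using qs_bij[OF Hq] by (simp add: bij_is_inj)
      have "nrm (x - y) \<le> D1 * exp (\<alpha> * - \<sigma>) * nrm (H x - H y)"
        using qs1_pr[OF qs_inv1[OF Hq] HE[OF xy]] by (simp only: invH)
      also have "nrm (H x - H y) \<le> n0 * \<nu>' x y"
        using \<nu>_le(2)[OF HE[OF xy]] n0 unfolding \<nu>'_def by (simp add: field_simps del: pr_simps)
      finally show "nrm (x - y) \<le> D1 * exp (\<alpha> * - \<sigma>) * n0 * \<nu>' x y" using D1 by (simp add: mult.assoc mult_left_mono del: pr_simps)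
      have eq: "exp (\<alpha> * s k) * \<rho> (z k) (w k) (unzoom (p k) (s k) x) (unzoom (p k) (s k) y)
          = exp (\<alpha> * s k) * \<rho> e0 0 (unzoom (p k) (s k) (F k (h (inv_into UNIV (F k) x))))
              (unzoom (p k) (s k) (F k (h (inv_into UNIV (F k) y))))" for k
        using rho_equivariant[OF hkG[of k], of "z k" "w k"] by (simp add: hkz unz_conj flip: hk_def)
      show "((\<lambda>k. exp (\<alpha> * s k) * \<rho> (z k) (w k) (unzoom (p k) (s k) x) (unzoom (p k) (s k) y)) \<longlongrightarrow> \<nu>' x y) \<GG>"
        unfolding eq \<nu>'_def
      proof (rule zoomed_rho_tendsto[OF zw HE[OF xy]])
        have hE: "h (inv_into UNIV (F k) x) - h (inv_into UNIV (F k) y) \<in> E" for k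
          by (intro qs1_E[OF qs_qs1[OF \<sigma>]] qs1_E[OF qs_inv1[OF Fq]] xy)
        show "F k (h (inv_into UNIV (F k) x)) - F k (h (inv_into UNIV (F k) y)) \<in> E" for k
          by (rule qs1_E[OF qs_qs1[OF Fq] hE])
        show "((\<lambda>k. exp (\<alpha> * s k) * \<rho> e0 0 (unzoom (p k) (s k) (H x)) (unzoom (p k) (s k) (H y))) \<longlongrightarrow> \<nu> (H x) (H y)) \<GG>"
          using \<nu>[OF HE[OF xy]] by (simp add: f_def)
      qed (use H_lim[OF h] in \<open>simp_all add: H_def\<close>)
    next
      fix x y z assume "x - y \<in> E" "y - z \<in> E"
      then show "\<nu>' x z \<le> \<nu>' x y + \<nu>' y z" unfolding \<nu>'_def by (intro \<nu>_tri HE)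
    qed (rule base)
    then show ?thesis
      unfolding H_def[symmetric]
      by (rule isometry_midpoint_affine[OF leaf_\<nu> _ qs_bij[OF Hq] qs_qs1[OF Hq] qs_inv1[OF Hq]]) (simp add: \<nu>'_def)
  qed
  \<comment> \<open>Zooms are affine and respect flow-invariant subspaces, so the property passes to
    each conjugate before the limit; closedness of \<open>U'\<close> carries it into the
    limit.\<close>
  have closed: "midpoint_affine E' U' (L \<circ> h \<circ> inv_into UNIV L)"
    if U': "closed U'" and inv: "\<And>t v. v \<in> E' \<Longrightarrow> \<Phi> t v \<in> E'" "\<And>t v. v \<in> U' \<Longrightarrow> \<Phi> t v \<in> U'"
      and aff: "\<And>h. h \<in> G \<Longrightarrow> midpoint_affine E' U' h" and h: "h \<in> G" for E' U' h
    unfolding midpoint_affine_def comp_def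
  proof (intro allI impI)
    fix x y assume xy: "x - y \<in> E'"
    define mid where "mid = (1/2) *\<^sub>R (x + y)"
    define Hk where "Hk k x = F k (h (inv_into UNIV (F k) x))" for k x
    have "Hk k mid - (1/2) *\<^sub>R (Hk k x + Hk k y) \<in> U'" for k
    proof -
      define u where "u = unzoom (p k) (s k)"
      define q where "q = conj k h"
      have "u x - u y = \<Phi> (- s k) (x - y)" by (simp add: u_def unzoom_def)
      then have "u x - u y \<in> E'" using inv(1)[OF xy] by simp
      then have "q ((1/2) *\<^sub>R (u x + u y)) - (1/2) *\<^sub>R (q (u x) + q (u y)) \<in> U'"
        using aff[OF conj_G[OF h, of k]] by (simp add: midpoint_affine_def q_def)
      moreover have "(1/2) *\<^sub>R (u x + u y) = u mid"
        by (simp add: u_def mid_def unzoom_def algebra_simps flip: scaleR_add_left)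
      moreover have hz: "Hk k z = \<Phi> (s k) (q (u z)) - \<Phi> (s k) (p k)" for z
        by (simp add: Hk_def conj_F q_def u_def zoom_def)
      have "Hk k mid - (1/2) *\<^sub>R (Hk k x + Hk k y) = \<Phi> (s k) (q (u mid) - (1/2) *\<^sub>R (q (u x) + q (u y)))"
        by (simp only: hz flow_simps) (simp add: algebra_simps flip: scaleR_add_left)
      ultimately show ?thesis using inv(2) by (simp only:)
    qed
    then show "L (h (inv_into UNIV L ((1/2) *\<^sub>R (x + y))))
        - (1/2) *\<^sub>R (L (h (inv_into UNIV L x)) + L (h (inv_into UNIV L y))) \<in> U'"
      by (intro Lim_in_closed_set[OF U' _ 2(2), of "\<lambda>k. Hk k mid - (1/2) *\<^sub>R (Hk k x + Hk k y)"])
         (auto simp: Hk_def mid_def intro!: tendsto_intros H_lim[OF h])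
  qed
  show ?thesis
    by (rule exI[of _ L], rule exI[of _ D], intro conjI allI impI ballI, rule 1(3), erule main)
       (rule closed; blast)
qed

end

section \<open>The flow of a Jordan basis\<close>

lemma power_div_fact_le_exp: "0 \<le> x \<Longrightarrow> x ^ j / fact j \<le> exp x" for x :: real
proof -
  assume x: "0 \<le> x"
  have "(\<Sum>i\<in>{j}. x ^ i /\<^sub>R fact i) \<le> (\<Sum>i. x ^ i /\<^sub>R fact i)"
    by (rule sum_le_suminf[OF summable_exp_generic]) (use x in auto)
  then show ?thesis by (simp add: exp_def field_simps)
qed

text \<open>\<open>N\<close> is the nilpotent part, \<open>ev b\<close> the eigenvalue of the Jordan chain of \<open>b\<close> and \<open>lv b\<close> its
  height in the chain, so an eigenvector has \<open>lv b = 1\<close>.\<close>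

locale jordan_data =
  fixes B :: "'a::euclidean_space set" and ev :: "'a \<Rightarrow> real" and lv :: "'a \<Rightarrow> nat" and N :: "'a \<Rightarrow> 'a"
  assumes indep: "independent B" and span: "span B = UNIV"
    and linear_N: "linear N"
    and ev_pos: "b \<in> B \<Longrightarrow> 0 < ev b" and lv_pos: "b \<in> B \<Longrightarrow> 1 \<le> lv b"
    and N_bottom: "b \<in> B \<Longrightarrow> lv b = 1 \<Longrightarrow> N b = 0"
    and N_step: "b \<in> B \<Longrightarrow> 2 \<le> lv b \<Longrightarrow> N b \<in> B \<and> ev (N b) = ev b \<and> lv (N b) = lv b - 1"
    and N_inj: "inj_on N {b\<in>B. 2 \<le> lv b}"
begin

abbreviation crd :: "'a \<Rightarrow> 'a \<Rightarrow> real" where "crd x b \<equiv> representation B x b"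

lemma finite_B: "finite B"
  using independent_bound[OF indep] by simp

lemma linear_crd: "linear (\<lambda>x. crd x b)"
  by (rule linearI) (simp_all add: representation_add representation_scale indep span)

lemma crd_simps [simp]: "crd (x + y) b = crd x b + crd y b" "crd (x - y) b = crd x b - crd y b"
  "crd (c *\<^sub>R x) b = c * crd x b" "crd (- x) b = - crd x b" "crd 0 b = 0"
  using linear_add[OF linear_crd] linear_diff[OF linear_crd] linear_scale[OF linear_crd]
    linear_neg[OF linear_crd] linear_0[OF linear_crd] by simp_all

lemma crd_sum: "crd (\<Sum>i\<in>I. f i) b = (\<Sum>i\<in>I. crd (f i) b)"
  by (rule linear_sum[OF linear_crd])

lemma crd_basis: "b \<in> B \<Longrightarrow> crd b c = (if c = b then 1 else 0)"
  by (simp add: representation_basis indep)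

lemma expand: "x = (\<Sum>b\<in>B. crd x b *\<^sub>R b)"
  using sum_representation_eq[OF indep _ finite_B subset_refl, of x] span by simp

lemma crd_eqI: "(\<And>b. b \<in> B \<Longrightarrow> crd x b = crd y b) \<Longrightarrow> x = y"
  by (subst (1 2) expand) (simp cong: sum.cong)

lemma crd_sum_basis: "S \<subseteq> B \<Longrightarrow> b \<in> B \<Longrightarrow> crd (\<Sum>c\<in>S. f c *\<^sub>R c) b = (if b \<in> S then f b else 0)"
proof -
  assume S: "S \<subseteq> B" and b: "b \<in> B"
  have fS: "finite S" using S finite_B finite_subset by blast
  have "crd (\<Sum>c\<in>S. f c *\<^sub>R c) b = (\<Sum>c\<in>S. f c * (if b = c then 1 else 0))"
    unfolding crd_sum using S by (intro sum.cong) (auto simp: crd_basis)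
  also have "\<dots> = (if b \<in> S then f b else 0)" using fS by (simp add: if_distrib cong: if_cong)
  finally show ?thesis .
qed

lemma linear_eq_on_B: "linear f \<Longrightarrow> linear g \<Longrightarrow> (\<And>b. b \<in> B \<Longrightarrow> f b = g b) \<Longrightarrow> f x = g x"
  using linear_eq_on[of f g x B] span by simp

lemma N_pow:
  assumes b: "b \<in> B" shows "j < lv b \<Longrightarrow> (N ^^ j) b \<in> B \<and> ev ((N ^^ j) b) = ev b \<and> lv ((N ^^ j) b) = lv b - j"
proof (induction j)
  case (Suc j)
  then have *: "(N ^^ j) b \<in> B" "ev ((N ^^ j) b) = ev b" "lv ((N ^^ j) b) = lv b - j" "2 \<le> lv b - j"
    using Suc by auto
  show ?case using N_step[OF *(1)] * by simp
qed (use b in simp)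

lemma N_pow_zero:
  assumes b: "b \<in> B" and j: "lv b \<le> j" shows "(N ^^ j) b = 0"
proof -
  have N0: "(N ^^ i) 0 = 0" for i by (induction i) (simp_all add: linear_0[OF linear_N])
  have *: "(N ^^ (lv b - 1)) b \<in> B" "lv ((N ^^ (lv b - 1)) b) = 1"
    using N_pow[OF b, of "lv b - 1"] lv_pos[OF b] by auto
  have "(N ^^ lv b) b = N ((N ^^ (lv b - 1)) b)"
    using lv_pos[OF b] by (metis Suc_diff_1 comp_apply funpow.simps(2) less_eq_Suc_le One_nat_def)
  also have "\<dots> = 0" by (rule N_bottom[OF *])
  finally have z: "(N ^^ lv b) b = 0" .
  obtain i where "j = i + lv b" using j by (metis add.commute le_Suc_ex)
  then show ?thesis by (simp add: funpow_add z N0)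
qed

lemma N_pow_inj: "inj_on (N ^^ j) {b\<in>B. j < lv b}"
proof (induction j)
  case (Suc j)
  show ?case
  proof (rule inj_onI)
    fix b c assume bc: "b \<in> {b\<in>B. Suc j < lv b}" "c \<in> {b\<in>B. Suc j < lv b}" "(N ^^ Suc j) b = (N ^^ Suc j) c"
    then have "N ((N ^^ j) b) = N ((N ^^ j) c)" by simp
    moreover have "(N ^^ j) b \<in> {b\<in>B. 2 \<le> lv b}" "(N ^^ j) c \<in> {b\<in>B. 2 \<le> lv b}"
      using N_pow[of b j] N_pow[of c j] bc by auto
    ultimately have "(N ^^ j) b = (N ^^ j) c" using inj_onD[OF N_inj] by blast
    then show "b = c" using inj_onD[OF Suc] bc by fastforce
  qed
qed simp

lemma linear_N_pow: "linear (N ^^ j)"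
proof (induction j)
  case (Suc j) show ?case using linear_compose[OF Suc linear_N] by (simp add: comp_def)
qed (simp add: linear_iff)

text \<open>The exponential of eigenvalue plus nilpotent part on one chain vector, a finite sum.
  Working with it directly postpones the convergence of the matrix series to the end.\<close>

definition flow_basis :: "real \<Rightarrow> 'a \<Rightarrow> 'a" where
  "flow_basis t b = exp (ev b * t) *\<^sub>R (\<Sum>j<lv b. (t ^ j / fact j) *\<^sub>R (N ^^ j) b)"

definition \<Phi> :: "real \<Rightarrow> 'a \<Rightarrow> 'a" where
  "\<Phi> t x = (\<Sum>b\<in>B. crd x b *\<^sub>R flow_basis t b)"

lemma linear_Phi: "linear (\<Phi> t)"
  unfolding \<Phi>_def
  by (intro linear_compose_sum ballI linearI) (simp_all add: scaleR_add_left)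

lemma Phi_basis: "b \<in> B \<Longrightarrow> \<Phi> t b = flow_basis t b"
  unfolding \<Phi>_def by (simp add: crd_basis if_distrib[of "\<lambda>r. r *\<^sub>R _"] finite_B cong: if_cong)

lemma flow_basis_eq:
  assumes b: "b \<in> B" and n: "lv b \<le> n"
  shows "flow_basis t b = exp (ev b * t) *\<^sub>R (\<Sum>j<n. (t ^ j / fact j) *\<^sub>R (N ^^ j) b)"
  unfolding flow_basis_def using n by (intro arg_cong2[where f = scaleR] refl sum.mono_neutral_left) (auto simp: N_pow_zero[OF b])

lemma Phi_zero: "\<Phi> 0 x = x"
proof -
  have "\<Phi> 0 x = id x"
  proof (rule linear_eq_on_B[OF linear_Phi linear_id])
    fix b assume b: "b \<in> B"
    have "(\<Sum>j<lv b. (0 ^ j / fact j) *\<^sub>R (N ^^ j) b) = (\<Sum>j<lv b. if j = 0 then b else 0)"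
      by (intro sum.cong) auto
    also have "\<dots> = b" using lv_pos[OF b] by simp
    finally show "\<Phi> 0 b = id b" by (simp add: Phi_basis[OF b] flow_basis_def)
  qed
  then show ?thesis by simp
qed

text \<open>On a basis vector this is the Cauchy product of two truncated exponential series, with
  the binomial theorem on each diagonal.\<close>

lemma Phi_add: "\<Phi> (s + t) x = \<Phi> s (\<Phi> t x)"
proof -
  have "\<Phi> (s + t) x = (\<Phi> s \<circ> \<Phi> t) x"
  proof (rule linear_eq_on_B[OF linear_Phi linear_compose[OF linear_Phi linear_Phi]])
    fix b assume b: "b \<in> B"
    define n where "n = lv b"
    define g where "g j i = (t ^ j / fact j * (s ^ i / fact i)) *\<^sub>R (N ^^ (i + j)) b" for i j
    have pow: "\<Phi> s ((N ^^ j) b) = exp (ev b * s) *\<^sub>R (\<Sum>i<n. (s ^ i / fact i) *\<^sub>R (N ^^ (i + j)) b)" if "j < n" for j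
    proof -
      have *: "(N ^^ j) b \<in> B" "ev ((N ^^ j) b) = ev b" "lv ((N ^^ j) b) \<le> n"
        using N_pow[OF b, of j] that by (auto simp: n_def)
      show ?thesis unfolding Phi_basis[OF *(1)] flow_basis_eq[OF *(1,3)] *(2)
        by (simp add: funpow_add)
    qed
    have "(\<Phi> s \<circ> \<Phi> t) b = exp (ev b * t) *\<^sub>R (\<Sum>j<n. (t ^ j / fact j) *\<^sub>R \<Phi> s ((N ^^ j) b))"
      by (simp add: Phi_basis[OF b] flow_basis_def n_def linear_scale[OF linear_Phi] linear_sum[OF linear_Phi])
    also have "\<dots> = exp (ev b * (s + t)) *\<^sub>R (\<Sum>j<n. \<Sum>i<n. g j i)"
      by (simp add: pow g_def scaleR_sum_right algebra_simps exp_add)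
    also have "(\<Sum>j<n. \<Sum>i<n. g j i) = (\<Sum>(j, i)\<in>{..<n} \<times> {..<n}. g j i)"
      by (simp add: sum.cartesian_product)
    \<comment> \<open>Beyond the diagonal the power of \<open>N\<close> exceeds the height of
      \<open>b\<close>, so the square and the triangle have the same sum.\<close>
    also have "\<dots> = (\<Sum>(j, i)\<in>{(j, i). j + i < n}. g j i)"
    proof (rule sum.mono_neutral_right)
      show "\<forall>z\<in>{..<n} \<times> {..<n} - {(j, i). j + i < n}. (case z of (j, i) \<Rightarrow> g j i) = 0"
        using N_pow_zero[OF b, of "i + j" for i j] by (force simp: g_def n_def not_less)
    qed auto
    also have "\<dots> = (\<Sum>k<n. \<Sum>j\<le>k. g j (k - j))" by (rule sum.triangle_reindex)
    also have "\<dots> = (\<Sum>k<n. ((s + t) ^ k / fact k) *\<^sub>R (N ^^ k) b)"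
    proof (intro sum.cong refl)
      fix k
      have "(\<Sum>j\<le>k. g j (k - j)) = (\<Sum>j\<le>k. t ^ j / fact j * (s ^ (k - j) / fact (k - j))) *\<^sub>R (N ^^ k) b"
        unfolding scaleR_sum_left by (intro sum.cong) (auto simp: g_def)
      also have "(\<Sum>j\<le>k. t ^ j / fact j * (s ^ (k - j) / fact (k - j))) = (t + s) ^ k / fact k"
        unfolding binomial_ring sum_divide_distrib
        by (intro sum.cong) (auto simp: binomial_fact field_simps)
      finally show "(\<Sum>j\<le>k. g j (k - j)) = ((s + t) ^ k / fact k) *\<^sub>R (N ^^ k) b" by (simp add: add.commute)
    qed
    also have "exp (ev b * (s + t)) *\<^sub>R \<dots> = \<Phi> (s + t) b"
      by (simp add: Phi_basis[OF b] flow_basis_def n_def)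
    finally show "\<Phi> (s + t) b = (\<Phi> s \<circ> \<Phi> t) b" by simp
  qed
  then show ?thesis by simp
qed

text \<open>Half of the smallest eigenvalue. The powers of \<open>t\<close> along a chain are
  absorbed into \<open>exp (\<eta> * \<bar>t\<bar>)\<close>, and since \<open>\<eta>\<close> stays
  below every eigenvalue the resulting bound \<open>\<mu>\<close> is still increasing and tends to 0
  at minus infinity.\<close>

definition \<eta> :: real where "\<eta> = Min (ev ` B) / 2"

lemma B_nonempty: "B \<noteq> {}"
proof
  assume "B = {}"
  then have "(UNIV :: 'a set) = {0}" using span by simp
  moreover obtain b :: 'a where "b \<in> Basis" using nonempty_Basis by blast
  ultimately show False using nonzero_Basis by blast
qed

lemma eta: "0 < \<eta>" "b \<in> B \<Longrightarrow> \<eta> < ev b"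
proof -
  have "0 < Min (ev ` B)" using B_nonempty finite_B ev_pos by (subst Min_gr_iff) auto
  then show "0 < \<eta>" by (simp add: \<eta>_def)
  show "\<eta> < ev b" if "b \<in> B"
  proof -
    have "Min (ev ` B) \<le> ev b" using finite_B that by (intro Min_le) auto
    then show ?thesis using \<open>0 < Min (ev ` B)\<close> by (simp add: \<eta>_def)
  qed
qed

definition crd_bound :: real where
  "crd_bound = (SOME k. 0 < k \<and> (\<forall>x. \<forall>b\<in>B. \<bar>crd x b\<bar> \<le> k * norm x))"

lemma crd_bound: "0 < crd_bound" "b \<in> B \<Longrightarrow> \<bar>crd x b\<bar> \<le> crd_bound * norm x"
proof -
  have "\<exists>k. \<forall>b. 0 < k b \<and> (\<forall>x. \<bar>crd x b\<bar> \<le> k b * norm x)"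
    using linear_bounded_pos[OF linear_crd] by (intro choice) (metis mult.commute real_norm_def)
  then obtain k where k: "\<And>b. 0 < k b" "\<And>b x. \<bar>crd x b\<bar> \<le> k b * norm x" by blast
  have "0 < sum k B \<and> (\<forall>x. \<forall>b\<in>B. \<bar>crd x b\<bar> \<le> sum k B * norm x)"
  proof (intro conjI allI ballI)
    show "0 < sum k B" using finite_B B_nonempty k(1) by (intro sum_pos) auto
    fix x b assume "b \<in> B"
    then have "k b \<le> sum k B" using finite_B k(1) by (intro member_le_sum) (auto intro: less_imp_le)
    then show "\<bar>crd x b\<bar> \<le> sum k B * norm x"
      using k(2)[of x b] by (meson mult_right_mono norm_ge_zero order.trans)
  qed
  from someI[of "\<lambda>k. 0 < k \<and> (\<forall>x. \<forall>b\<in>B. \<bar>crd x b\<bar> \<le> k * norm x)", OF this, folded crd_bound_def]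
  show "0 < crd_bound" "b \<in> B \<Longrightarrow> \<bar>crd x b\<bar> \<le> crd_bound * norm x" by auto
qed

definition \<mu> :: "real \<Rightarrow> real" where
  "\<mu> t = crd_bound * (\<Sum>b\<in>B. (\<Sum>j<lv b. norm ((N ^^ j) b) / \<eta> ^ j) * exp (ev b * t + \<eta> * \<bar>t\<bar>))"

sublocale expanding_flow \<Phi> \<mu>
proof (rule expanding_flow.intro)
  show "linear (\<Phi> t)" for t by (rule linear_Phi)
  show "\<Phi> 0 x = x" for x by (rule Phi_zero)
  show "\<Phi> (s + t) x = \<Phi> s (\<Phi> t x)" for s t x by (rule Phi_add)
  have coef: "0 \<le> (\<Sum>j<lv b. norm ((N ^^ j) b) / \<eta> ^ j)" for b
    using eta(1) by (intro sum_nonneg) auto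
  have fb: "norm (flow_basis t b) \<le> (\<Sum>j<lv b. norm ((N ^^ j) b) / \<eta> ^ j) * exp (ev b * t + \<eta> * \<bar>t\<bar>)" for t b
  proof -
    have "norm (\<Sum>j<lv b. (t ^ j / fact j) *\<^sub>R (N ^^ j) b) \<le> (\<Sum>j<lv b. norm ((N ^^ j) b) / \<eta> ^ j * exp (\<eta> * \<bar>t\<bar>))"
    proof (rule sum_norm_le)
      fix j
      have "(\<eta> * \<bar>t\<bar>) ^ j / fact j \<le> exp (\<eta> * \<bar>t\<bar>)" using eta(1) by (intro power_div_fact_le_exp) auto
      then have "\<bar>t\<bar> ^ j / fact j \<le> exp (\<eta> * \<bar>t\<bar>) / \<eta> ^ j"
        using eta(1) by (simp add: field_simps)
      then have "\<bar>t\<bar> ^ j / fact j * norm ((N ^^ j) b) \<le> exp (\<eta> * \<bar>t\<bar>) / \<eta> ^ j * norm ((N ^^ j) b)"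
        by (rule mult_right_mono) simp
      then show "norm ((t ^ j / fact j) *\<^sub>R (N ^^ j) b) \<le> norm ((N ^^ j) b) / \<eta> ^ j * exp (\<eta> * \<bar>t\<bar>)"
        by (simp add: power_abs mult_ac)
    qed
    then have "exp (ev b * t) * norm (\<Sum>j<lv b. (t ^ j / fact j) *\<^sub>R (N ^^ j) b)
        \<le> exp (ev b * t) * ((\<Sum>j<lv b. norm ((N ^^ j) b) / \<eta> ^ j) * exp (\<eta> * \<bar>t\<bar>))"
      by (intro mult_left_mono) (simp_all add: sum_distrib_right)
    then show ?thesis by (simp add: flow_basis_def exp_add mult_ac)
  qed
  show "norm (\<Phi> t x) \<le> \<mu> t * norm x" for t x
  proof -
    have "norm (\<Phi> t x) \<le> (\<Sum>b\<in>B. crd_bound * norm x * ((\<Sum>j<lv b. norm ((N ^^ j) b) / \<eta> ^ j) * exp (ev b * t + \<eta> * \<bar>t\<bar>)))"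
      unfolding \<Phi>_def
    proof (rule sum_norm_le)
      fix b assume b: "b \<in> B"
      show "norm (crd x b *\<^sub>R flow_basis t b) \<le> crd_bound * norm x * ((\<Sum>j<lv b. norm ((N ^^ j) b) / \<eta> ^ j) * exp (ev b * t + \<eta> * \<bar>t\<bar>))"
        using crd_bound(2)[OF b, of x] fb[of t b] crd_bound(1) unfolding norm_scaleR by (intro mult_mono) auto
    qed
    also have "\<dots> = \<mu> t * norm x" by (simp add: \<mu>_def sum_distrib_left sum_distrib_right mult_ac)
    finally show ?thesis .
  qed
  show "mono \<mu>"
    unfolding mono_def \<mu>_def
  proof (intro allI impI mult_left_mono sum_mono)
    fix s t :: real and b assume st: "s \<le> t" and b: "b \<in> B"
    have "\<eta> * (\<bar>s\<bar> - \<bar>t\<bar>) \<le> \<eta> * (t - s)" using eta(1) st by (intro mult_left_mono) auto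
    also have "\<dots> \<le> ev b * (t - s)" using eta(2)[OF b] st by (intro mult_right_mono) auto
    finally show "exp (ev b * s + \<eta> * \<bar>s\<bar>) \<le> exp (ev b * t + \<eta> * \<bar>t\<bar>)" by (simp add: algebra_simps)
  qed (use coef crd_bound(1) in auto)
  have "((\<lambda>t. exp (ev b * t + \<eta> * \<bar>t\<bar>)) \<longlongrightarrow> 0) at_bot" if b: "b \<in> B" for b
  proof -
    have "((\<lambda>t. exp ((ev b - \<eta>) * t)) \<longlongrightarrow> 0) at_bot"
      using eta(2)[OF b]
      by (intro filterlim_compose[OF exp_at_bot] filterlim_tendsto_pos_mult_at_bot[OF tendsto_const _ filterlim_ident]) auto
    moreover have "\<forall>\<^sub>F t in at_bot. exp ((ev b - \<eta>) * t) = exp (ev b * t + \<eta> * \<bar>t\<bar>)"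
      using eventually_le_at_bot[of 0] by eventually_elim (simp add: algebra_simps)
    ultimately show ?thesis by (rule Lim_transform_eventually)
  qed
  then have "(\<mu> \<longlongrightarrow> crd_bound * (\<Sum>b\<in>B. (\<Sum>j<lv b. norm ((N ^^ j) b) / \<eta> ^ j) * 0)) at_bot"
    unfolding \<mu>_def[abs_def] by (intro tendsto_intros) auto
  then show "(\<mu> \<longlongrightarrow> 0) at_bot" by simp
qed

end

text \<open>Cauchy's functional equation on a line: the deviation from homogeneity is additive and
  vanishes at the integers, hence is bounded everywhere by its values on the unit interval, and a
  bounded additive function is zero.\<close>

lemma additive_bounded_imp_scaleR:
  fixes T :: "'a::real_vector \<Rightarrow> 'b::real_normed_vector"
  assumes S: "subspace S" and u: "u \<in> S"
    and add: "\<And>x y. x \<in> S \<Longrightarrow> y \<in> S \<Longrightarrow> T (x + y) = T x + T y"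
    and bd: "\<And>r. 0 \<le> r \<Longrightarrow> r \<le> 1 \<Longrightarrow> norm (T (r *\<^sub>R u)) \<le> b"
  shows "T (r *\<^sub>R u) = r *\<^sub>R T u"
proof -
  define g where "g r = T (r *\<^sub>R u) - r *\<^sub>R T u" for r :: real
  have uS: "r *\<^sub>R u \<in> S" for r using S u by (rule subspace_scale)
  have gadd: "g (r + s) = g r + g s" for r s
    unfolding g_def scaleR_left.add add[OF uS uS] by simp
  have g0: "g 0 = 0" using gadd[of 0 0] by simp
  have gneg: "g (- r) = - g r" for r using gadd[of r "- r"] g0 by (simp add: eq_neg_iff_add_eq_0 add.commute)
  have gnat: "g (real n * r) = real n *\<^sub>R g r" for n r
    by (induction n) (simp_all add: g0 gadd algebra_simps)
  have g1: "g 1 = 0" by (simp add: g_def)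
  have gint: "g (of_int i) = 0" for i
  proof (cases i)
    case (nonneg n) then show ?thesis using gnat[of n 1] g1 by simp
  next
    case (neg n) then show ?thesis using gneg[of "real (Suc n)"] gnat[of "Suc n" 1] g1 by simp
  qed
  have bound: "norm (g r) \<le> b + norm (T u)" for r
  proof -
    have "g r = g (frac r) + g (of_int \<lfloor>r\<rfloor>)" unfolding gadd[symmetric] by (simp add: frac_def)
    then have "g r = g (frac r)" by (simp add: gint)
    then have "norm (g r) \<le> norm (T (frac r *\<^sub>R u)) + norm (frac r *\<^sub>R T u)"
      by (simp only: g_def norm_triangle_ineq4)
    moreover have "norm (T (frac r *\<^sub>R u)) \<le> b" by (rule bd) (simp_all add: less_imp_le frac_lt_1)
    moreover have "norm (frac r *\<^sub>R T u) \<le> norm (T u)" by (simp add: mult_left_le_one_le less_imp_le frac_lt_1)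
    ultimately show ?thesis by linarith
  qed
  have "norm (g r) \<le> (b + norm (T u)) / real (Suc n)" for n
  proof -
    have "real (Suc n) * norm (g r) \<le> b + norm (T u)"
      using bound[of "real (Suc n) * r"] unfolding gnat norm_scaleR by simp
    then show ?thesis by (simp add: pos_le_divide_eq mult.commute)
  qed
  moreover have "(\<lambda>n. (b + norm (T u)) / real (Suc n)) \<longlonglongrightarrow> 0"
    using LIMSEQ_Suc[OF lim_const_over_n[of "b + norm (T u)"]] by simp
  ultimately have "norm (g r) \<le> 0" by (intro LIMSEQ_le_const) auto
  then show ?thesis by (simp add: g_def)
qed

section \<open>Linear parts of midpoint-affine quasi-similarities\<close>

context flow_level
begin

definition lin :: "('a \<Rightarrow> 'a) \<Rightarrow> 'a \<Rightarrow> 'a" where "lin H y = pr (H y - H 0)"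

text \<open>Midpoints give additivity, and the Lipschitz bound for leading terms gives homogeneity.
  The linear part is the same on all cosets: by \<open>qs1_transverse\<close> at a scale where
  \<open>x\<close> and \<open>y\<close> are close, two such linear maps differ by a bounded amount
  on all of \<open>E\<close>, hence agree.\<close>

lemma midpoint_affine_lin:
  assumes H: "qs1 D s H" and aff: "midpoint_affine E U H"
  shows "u \<in> E \<Longrightarrow> pr (H (x + u) - H x) = lin H (pr u)"
    and "u \<in> K \<Longrightarrow> v \<in> K \<Longrightarrow> lin H (u + v) = lin H u + lin H v"
    and "u \<in> K \<Longrightarrow> lin H (r *\<^sub>R u) = r *\<^sub>R lin H u"
    and "u \<in> K \<Longrightarrow> lin H u \<in> K"
    and "u \<in> K \<Longrightarrow> norm (lin H u) \<le> D * exp (\<alpha> * s) * norm u"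
proof -
  define T where "T x u = pr (H (x + u) - H x)" for x u
  note ES = E_subspace
  have HE: "H (x + u) - H (x + v) \<in> E" if "u \<in> E" "v \<in> E" for x u v
    using qs1_E[OF H, of "x + u" "x + v"] subspace_diff[OF ES that] by simp
  have bd: "norm (T x u - T x v) \<le> D * exp (\<alpha> * s) * norm (pr (u - v))" if "u \<in> E" "v \<in> E" for x u v
    using qs1_pr[OF H, of "x + u" "x + v"] subspace_diff[OF ES that] by (simp add: T_def)
  have T0: "T x 0 = 0" for x by (simp add: T_def)
  have mid: "T x ((1/2) *\<^sub>R (u + v)) = (1/2) *\<^sub>R (T x u + T x v)" if uv: "u \<in> E" "v \<in> E" for x u v
  proof -
    have "(1/2) *\<^sub>R ((x + u) + (x + v)) = x + (1/2) *\<^sub>R (u + v)"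
      by (simp add: algebra_simps flip: scaleR_add_left)
    then have "H (x + (1/2) *\<^sub>R (u + v)) - (1/2) *\<^sub>R (H (x + u) + H (x + v)) \<in> U"
      using aff subspace_diff[OF ES uv] unfolding midpoint_affine_def
      by (metis add_diff_cancel_left)
    then have "pr (H (x + (1/2) *\<^sub>R (u + v)) - (1/2) *\<^sub>R (H (x + u) + H (x + v))) = 0" by (simp add: U_def)
    then show ?thesis by (simp add: T_def algebra_simps flip: scaleR_add_left)
  qed
  have half: "T x ((1/2) *\<^sub>R u) = (1/2) *\<^sub>R T x u" if "u \<in> E" for x u
    using mid[OF that subspace_0[OF ES], of x] by (simp add: T0)
  have add: "T x (u + v) = T x u + T x v" if uv: "u \<in> E" "v \<in> E" for x u v
  proof -
    have "(1/2) *\<^sub>R T x (u + v) = (1/2) *\<^sub>R (T x u + T x v)"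
      using mid[OF uv, of x] half[OF subspace_add[OF ES uv], of x] by simp
    then show ?thesis by simp
  qed
  have scale: "T x (r *\<^sub>R u) = r *\<^sub>R T x u" if u: "u \<in> E" for x u r
  proof (rule additive_bounded_imp_scaleR[OF ES u add])
    fix r :: real assume r: "0 \<le> r" "r \<le> 1"
    have "norm (T x (r *\<^sub>R u)) \<le> D * exp (\<alpha> * s) * norm (pr (r *\<^sub>R u))"
      using bd[OF subspace_scale[OF ES u] subspace_0[OF ES], of x r] by (simp add: T0)
    also have "\<dots> \<le> D * exp (\<alpha> * s) * norm (pr u)"
      using r qs1_nonneg[OF H] by (intro mult_left_mono) (auto simp: mult_left_le_one_le)
    finally show "norm (T x (r *\<^sub>R u)) \<le> D * exp (\<alpha> * s) * norm (pr u)" .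
  qed auto
  have indep: "T x u = T y u" if u: "u \<in> E" for x y u
  proof -
    obtain c where c: "0 < c" "\<And>C s g \<tau> p q p' q'. qs1 C s g \<Longrightarrow> p - q \<in> E \<Longrightarrow> p' - q' \<in> E \<Longrightarrow>
      norm (\<Phi> \<tau> (p - p')) \<le> 1 \<Longrightarrow> norm (\<Phi> \<tau> (q - q')) \<le> 1 \<Longrightarrow>
      norm (pr (g p - g q) - pr (g p' - g q')) \<le> c * C * exp (- \<alpha> * (\<tau> - s))"
      using qs1_transverse by metis
    have "0 < 1 / (norm (x - y) + 1)" by (simp add: add_nonneg_pos)
    then obtain \<tau> where \<tau>: "\<mu> \<tau> < 1 / (norm (x - y) + 1)" by (rule mu_small)
    have "norm (\<Phi> \<tau> (x - y)) \<le> \<mu> \<tau> * norm (x - y)" by (rule flow_bound)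
    also have "\<dots> \<le> \<mu> \<tau> * (norm (x - y) + 1)" using mu_pos[of \<tau>] by (intro mult_left_mono) auto
    also have "\<dots> \<le> 1" using \<tau> by (simp add: pos_less_divide_eq add_nonneg_pos)
    finally have near: "norm (\<Phi> \<tau> (x - y)) \<le> 1" .
    define b where "b = c * D * exp (- \<alpha> * (\<tau> - s))"
    have bound: "norm (T x v - T y v) \<le> b" if "v \<in> E" for v
      unfolding T_def b_def by (rule c(2)[OF H]) (use near that in auto)
    have "norm (T x u - T y u) \<le> b / real (Suc n)" for n
    proof -
      have "real (Suc n) * norm (T x u - T y u) = norm (real (Suc n) *\<^sub>R (T x u - T y u))" by simp
      also have "\<dots> = norm (T x (real (Suc n) *\<^sub>R u) - T y (real (Suc n) *\<^sub>R u))"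
        unfolding scale[OF u] by (simp only: scaleR_diff_right)
      also have "\<dots> \<le> b" by (rule bound[OF subspace_scale[OF ES u]])
      finally show ?thesis by (simp add: pos_le_divide_eq mult.commute)
    qed
    moreover have "(\<lambda>n. b / real (Suc n)) \<longlonglongrightarrow> 0"
      using LIMSEQ_Suc[OF lim_const_over_n[of b]] by simp
    ultimately have "norm (T x u - T y u) \<le> 0" by (intro LIMSEQ_le_const) auto
    then show ?thesis by simp
  qed
  have proj: "T x u = T x (pr u)" if u: "u \<in> E" for x u
  proof -
    have "pr (u - pr u) = 0" using pr_diff_in_U[OF u] by (simp only: U_def mem_Collect_eq)
    then show ?thesis using bd[OF u K_in_E[OF pr_in_K[OF u]], of x] by (simp del: pr_simps)
  qed
  have lin: "lin H u = T 0 u" for u by (simp add: lin_def T_def)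
  show "pr (H (x + u) - H x) = lin H (pr u)" if u: "u \<in> E"
    using proj[OF u, of x] indep[OF K_in_E[OF pr_in_K[OF u]], of x 0] by (simp add: lin T_def)
  show "lin H (u + v) = lin H u + lin H v" if "u \<in> K" "v \<in> K"
    unfolding lin by (intro add K_in_E that)
  show "lin H (r *\<^sub>R u) = r *\<^sub>R lin H u" if "u \<in> K"
    unfolding lin by (intro scale K_in_E that)
  show "lin H u \<in> K" if "u \<in> K"
    unfolding lin_def using HE[OF K_in_E[OF that] subspace_0[OF ES], of 0] by (intro pr_in_K) simp
  show "norm (lin H u) \<le> D * exp (\<alpha> * s) * norm u" if "u \<in> K"
    using bd[OF K_in_E[OF that] subspace_0[OF ES], of 0] by (simp add: lin T0 pr_K[OF that])
qed

lemma lin_comp: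
  assumes H: "qs1 D s H" "midpoint_affine E U H" and H': "qs1 D' s' H'" and u: "u \<in> K"
  shows "lin (H \<circ> H') u = lin H (lin H' u)"
proof -
  have E: "H' u - H' 0 \<in> E" using qs1_E[OF H', of u 0] K_in_E[OF u] by simp
  have "lin (H \<circ> H') u = pr (H (H' 0 + (H' u - H' 0)) - H (H' 0))" by (simp add: lin_def)
  also have "\<dots> = lin H (pr (H' u - H' 0))" by (rule midpoint_affine_lin(1)[OF H E])
  finally show ?thesis by (simp add: lin_def)
qed

lemma lin_id: "u \<in> K \<Longrightarrow> lin id u = u"
  by (simp add: lin_def pr_K)

end

section \<open>The flag and its growth rates\<close>

context jordan_data
begin

definition below :: "real \<Rightarrow> nat \<Rightarrow> 'a \<Rightarrow> bool" where
  "below \<alpha> l b \<longleftrightarrow> ev b < \<alpha> \<or> (ev b = \<alpha> \<and> lv b \<le> l)"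

text \<open>The member of the flag whose highest block is \<open>(\<alpha>, l)\<close>, with that
  block included.\<close>

definition V :: "real \<Rightarrow> nat \<Rightarrow> 'a set" where
  "V \<alpha> l = {v. \<forall>b\<in>B. crd v b \<noteq> 0 \<longrightarrow> below \<alpha> l b}"

definition blk :: "real \<Rightarrow> nat \<Rightarrow> 'a set" where "blk \<alpha> l = {b\<in>B. ev b = \<alpha> \<and> lv b = l}"

definition chain_end :: "'a \<Rightarrow> 'a" where "chain_end b = (N ^^ (lv b - 1)) b"

text \<open>Up to the factor \<open>1 / fact (l - 1)\<close>, the coefficient of the fastest growing
  term \<open>exp (\<alpha> * \<tau>) * \<tau> ^ (l - 1)\<close> of the flow on
  \<open>V \<alpha> l\<close>. It moves the coordinates of a block down to the eigenvectors at the
  ends of its chains.\<close>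

definition \<omega> :: "real \<Rightarrow> nat \<Rightarrow> 'a \<Rightarrow> 'a" where "\<omega> \<alpha> l v = (\<Sum>b\<in>blk \<alpha> l. crd v b *\<^sub>R chain_end b)"

definition weight :: "real \<Rightarrow> nat \<Rightarrow> real \<Rightarrow> real" where "weight \<alpha> l \<tau> = exp (\<alpha> * \<tau>) * \<tau> ^ (l - 1)"

lemma weight_pos: "0 < \<tau> \<Longrightarrow> 0 < weight \<alpha> l \<tau>"
  by (simp add: weight_def)

lemma chain_end_in: "b \<in> B \<Longrightarrow> chain_end b \<in> blk (ev b) 1"
  using N_pow[of b "lv b - 1"] lv_pos[of b] by (auto simp: chain_end_def blk_def)

lemma blk_finite: "finite (blk \<alpha> l)" and blk_subset: "blk \<alpha> l \<subseteq> B"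
  using finite_B by (auto simp: blk_def)

lemma chain_end_blk: "b \<in> blk \<alpha> l \<Longrightarrow> chain_end b \<in> blk \<alpha> 1"
  using chain_end_in[of b] by (simp add: blk_def)

lemma chain_end_inj: "inj_on chain_end (blk \<alpha> l)"
proof (rule inj_onI)
  fix b c assume bc: "b \<in> blk \<alpha> l" "c \<in> blk \<alpha> l" "chain_end b = chain_end c"
  then have *: "b \<in> {b\<in>B. l - 1 < lv b}" "c \<in> {b\<in>B. l - 1 < lv b}" using lv_pos[of b] lv_pos[of c] by (auto simp: blk_def)
  show "b = c" using inj_onD[OF N_pow_inj _ *] bc by (simp add: chain_end_def blk_def)
qed

text \<open>Chain ends of one block are distinct, so \<open>\<omega>\<close> forgets none of its
  coordinates. Statements about eigenvectors can therefore be read as statements about a higher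
  block.\<close>

lemma crd_omega:
  assumes "b \<in> blk \<alpha> l" shows "crd (\<omega> \<alpha> l v) (chain_end b) = crd v b"
proof -
  have "\<omega> \<alpha> l v = (\<Sum>c\<in>chain_end ` blk \<alpha> l. crd v (inv_into (blk \<alpha> l) chain_end c) *\<^sub>R c)"
    unfolding \<omega>_def by (subst sum.reindex[OF chain_end_inj]) (simp add: inv_into_f_f[OF chain_end_inj] cong: sum.cong)
  moreover have "chain_end ` blk \<alpha> l \<subseteq> B" "chain_end b \<in> B" using chain_end_blk blk_subset assms by blast+
  ultimately show ?thesis using assms by (simp add: crd_sum_basis inv_into_f_f[OF chain_end_inj])
qed

lemma linear_omega: "linear (\<omega> \<alpha> l)"
  unfolding \<omega>_def by (intro linear_compose_sum ballI linearI) (simp_all add: scaleR_add_left)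

lemma power_exp_tendsto_0:
  assumes "0 < c" shows "((\<lambda>\<tau>::real. \<tau> ^ j * exp (- c * \<tau>)) \<longlongrightarrow> 0) at_top"
proof -
  have "filterlim (\<lambda>\<tau>. c * \<tau>) at_top at_top"
    using assms by (intro filterlim_tendsto_pos_mult_at_top[OF tendsto_const _ filterlim_ident])
  from filterlim_compose[OF tendsto_power_div_exp_0[of j] this]
  have "((\<lambda>\<tau>. inverse (c ^ j) * ((c * \<tau>) ^ j / exp (c * \<tau>))) \<longlongrightarrow> inverse (c ^ j) * 0) at_top"
    by (intro tendsto_intros)
  moreover have "inverse (c ^ j) * ((c * \<tau>) ^ j / exp (c * \<tau>)) = \<tau> ^ j * exp (- c * \<tau>)" for \<tau>
    using assms by (simp add: power_mult_distrib exp_minus field_simps)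
  ultimately show ?thesis by simp
qed

lemma weight_ratio_tendsto:
  assumes "ev b < \<alpha> \<or> (ev b = \<alpha> \<and> j \<le> l - 1)"
  shows "((\<lambda>\<tau>. exp (ev b * \<tau>) * \<tau> ^ j / weight \<alpha> l \<tau>) \<longlongrightarrow> (if ev b = \<alpha> \<and> j = l - 1 then 1 else 0)) at_top"
proof -
  consider "ev b < \<alpha>" | "ev b = \<alpha>" "j < l - 1" | "ev b = \<alpha>" "j = l - 1" using assms by linarith
  then show ?thesis
  proof cases
    case 1
    have "((\<lambda>\<tau>. exp (ev b * \<tau>) * \<tau> ^ j / weight \<alpha> l \<tau>) \<longlongrightarrow> 0) at_top"
    proof (rule Lim_null_comparison)
      show "((\<lambda>\<tau>. \<tau> ^ j * exp (- (\<alpha> - ev b) * \<tau>)) \<longlongrightarrow> 0) at_top" using 1 by (intro power_exp_tendsto_0) simp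
      show "\<forall>\<^sub>F \<tau> in at_top. norm (exp (ev b * \<tau>) * \<tau> ^ j / weight \<alpha> l \<tau>) \<le> \<tau> ^ j * exp (- (\<alpha> - ev b) * \<tau>)"
        using eventually_ge_at_top[of 1]
      proof eventually_elim
        case (elim \<tau>)
        have "exp (ev b * \<tau>) * \<tau> ^ j / weight \<alpha> l \<tau> = \<tau> ^ j * exp (- (\<alpha> - ev b) * \<tau>) / \<tau> ^ (l - 1)"
          by (simp add: weight_def algebra_simps exp_diff)
        also have "\<dots> \<le> \<tau> ^ j * exp (- (\<alpha> - ev b) * \<tau>) / 1"
          using elim by (intro divide_left_mono) auto
        finally show ?case using elim weight_pos[of \<tau> \<alpha> l] by simp
      qed
    qed
    then show ?thesis using 1 by simp
  next
    case 2
    have "((\<lambda>\<tau>. exp (ev b * \<tau>) * \<tau> ^ j / weight \<alpha> l \<tau>) \<longlongrightarrow> 0) at_top"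
    proof (rule Lim_null_comparison)
      show "((\<lambda>\<tau>::real. 1 / \<tau>) \<longlongrightarrow> 0) at_top"
        using tendsto_inverse_0_at_top[OF filterlim_ident] by (simp add: inverse_eq_divide)
      show "\<forall>\<^sub>F \<tau> in at_top. norm (exp (ev b * \<tau>) * \<tau> ^ j / weight \<alpha> l \<tau>) \<le> 1 / \<tau>"
        using eventually_ge_at_top[of 1]
      proof eventually_elim
        case (elim \<tau>)
        have "\<tau> ^ Suc j \<le> \<tau> ^ (l - 1)" using elim 2 by (intro power_increasing) auto
        then show ?case using elim 2 by (simp add: weight_def field_simps)
      qed
    qed
    then show ?thesis using 2 by simp
  next
    case 3
    have "\<forall>\<^sub>F \<tau> in at_top. (1::real) = exp (ev b * \<tau>) * \<tau> ^ j / weight \<alpha> l \<tau>"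
      using eventually_ge_at_top[of 1] by eventually_elim (use 3 in \<open>simp add: weight_def\<close>)
    then show ?thesis using 3 by (auto intro: Lim_transform_eventually[OF tendsto_const])
  qed
qed

lemma flow_basis_growth:
  assumes b: "b \<in> B" "below \<alpha> l b" and l: "1 \<le> l"
  shows "((\<lambda>\<tau>. (1 / weight \<alpha> l \<tau>) *\<^sub>R \<Phi> \<tau> b) \<longlongrightarrow>
    (if b \<in> blk \<alpha> l then (1 / fact (l - 1)) *\<^sub>R chain_end b else 0)) at_top"
proof -
  have "((\<lambda>\<tau>. \<Sum>j<lv b. (exp (ev b * \<tau>) * \<tau> ^ j / weight \<alpha> l \<tau>) *\<^sub>R ((1 / fact j) *\<^sub>R (N ^^ j) b)) \<longlongrightarrow>
      (\<Sum>j<lv b. (if ev b = \<alpha> \<and> j = l - 1 then 1 else 0) *\<^sub>R ((1 / fact j) *\<^sub>R (N ^^ j) b))) at_top"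
    using b by (intro tendsto_sum tendsto_scaleR weight_ratio_tendsto tendsto_const) (auto simp: below_def)
  moreover have "(\<Sum>j<lv b. (exp (ev b * \<tau>) * \<tau> ^ j / weight \<alpha> l \<tau>) *\<^sub>R ((1 / fact j) *\<^sub>R (N ^^ j) b))
      = (1 / weight \<alpha> l \<tau>) *\<^sub>R \<Phi> \<tau> b" for \<tau>
    by (simp add: Phi_basis[OF b(1)] flow_basis_def scaleR_sum_right field_simps)
  moreover have "(\<Sum>j<lv b. (if ev b = \<alpha> \<and> j = l - 1 then 1 else 0) *\<^sub>R ((1 / fact j) *\<^sub>R (N ^^ j) b))
      = (if b \<in> blk \<alpha> l then (1 / fact (l - 1)) *\<^sub>R chain_end b else 0)"
  proof (cases "b \<in> blk \<alpha> l")
    case True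
    have "(\<Sum>j<lv b. (if ev b = \<alpha> \<and> j = l - 1 then 1 else 0) *\<^sub>R ((1 / fact j) *\<^sub>R (N ^^ j) b))
        = (\<Sum>j<lv b. if j = l - 1 then (1 / fact j) *\<^sub>R (N ^^ j) b else 0)"
      using True by (intro sum.cong) (auto simp: blk_def)
    also have "\<dots> = (1 / fact (l - 1)) *\<^sub>R chain_end b"
      using True l by (simp add: blk_def chain_end_def)
    finally show ?thesis using True by simp
  next
    case False
    have "(\<Sum>j<lv b. (if ev b = \<alpha> \<and> j = l - 1 then 1 else 0) *\<^sub>R ((1 / fact j) *\<^sub>R (N ^^ j) b)) = 0"
      using False b l by (intro sum.neutral) (auto simp: blk_def below_def)
    then show ?thesis using False by simp
  qed
  ultimately show ?thesis by simp
qed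

lemma flow_growth:
  assumes v: "v \<in> V \<alpha> l" and l: "1 \<le> l"
  shows "((\<lambda>\<tau>. (1 / weight \<alpha> l \<tau>) *\<^sub>R \<Phi> \<tau> v) \<longlongrightarrow> (1 / fact (l - 1)) *\<^sub>R \<omega> \<alpha> l v) at_top"
proof -
  have "((\<lambda>\<tau>. \<Sum>b\<in>B. crd v b *\<^sub>R ((1 / weight \<alpha> l \<tau>) *\<^sub>R \<Phi> \<tau> b)) \<longlongrightarrow>
      (\<Sum>b\<in>B. crd v b *\<^sub>R (if b \<in> blk \<alpha> l then (1 / fact (l - 1)) *\<^sub>R chain_end b else 0))) at_top"
  proof (intro tendsto_sum)
    fix b assume b: "b \<in> B"
    show "((\<lambda>\<tau>. crd v b *\<^sub>R ((1 / weight \<alpha> l \<tau>) *\<^sub>R \<Phi> \<tau> b)) \<longlongrightarrow>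
      crd v b *\<^sub>R (if b \<in> blk \<alpha> l then (1 / fact (l - 1)) *\<^sub>R chain_end b else 0)) at_top"
    proof (cases "crd v b = 0")
      case False
      then have "below \<alpha> l b" using v b by (auto simp: V_def)
      then show ?thesis by (intro tendsto_intros flow_basis_growth b l)
    qed simp
  qed
  moreover have "(\<Sum>b\<in>B. crd v b *\<^sub>R ((1 / weight \<alpha> l \<tau>) *\<^sub>R \<Phi> \<tau> b)) = (1 / weight \<alpha> l \<tau>) *\<^sub>R \<Phi> \<tau> v" for \<tau>
    by (simp add: \<Phi>_def[of \<tau> v] scaleR_sum_right Phi_basis mult.commute cong: sum.cong)
  moreover have "(\<Sum>b\<in>B. crd v b *\<^sub>R (if b \<in> blk \<alpha> l then (1 / fact (l - 1)) *\<^sub>R chain_end b else 0))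
      = (1 / fact (l - 1)) *\<^sub>R \<omega> \<alpha> l v"
  proof -
    have "(\<Sum>b\<in>B. crd v b *\<^sub>R (if b \<in> blk \<alpha> l then (1 / fact (l - 1)) *\<^sub>R chain_end b else 0))
        = (\<Sum>b\<in>blk \<alpha> l. crd v b *\<^sub>R ((1 / fact (l - 1)) *\<^sub>R chain_end b))"
      by (rule sum.mono_neutral_cong_right) (auto simp: finite_B blk_subset)
    then show ?thesis by (simp add: \<omega>_def scaleR_sum_right mult.commute)
  qed
  ultimately show ?thesis by simp
qed

lemma exists_leading_block:
  assumes "v \<notin> V \<alpha> l"
  obtains b where "b \<in> B" "crd v b \<noteq> 0" "\<not> below \<alpha> l b" "v \<in> V (ev b) (lv b)"
proof -
  define S where "S = {b\<in>B. crd v b \<noteq> 0}"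
  have S: "finite S" using finite_B by (simp add: S_def)
  obtain b0 where b0: "b0 \<in> S" "\<not> below \<alpha> l b0" using assms by (auto simp: V_def S_def)
  define \<beta> where "\<beta> = Max (ev ` S)"
  have \<beta>: "\<beta> \<in> ev ` S" "\<And>b. b \<in> S \<Longrightarrow> ev b \<le> \<beta>"
    unfolding \<beta>_def using S b0(1) by (auto intro: Max_in)
  define k where "k = Max (lv ` {b\<in>S. ev b = \<beta>})"
  have k: "k \<in> lv ` {b\<in>S. ev b = \<beta>}" "\<And>b. b \<in> S \<Longrightarrow> ev b = \<beta> \<Longrightarrow> lv b \<le> k"
    unfolding k_def using S \<beta>(1) by (auto intro!: Max_in)
  then obtain b where b: "b \<in> S" "ev b = \<beta>" "lv b = k" by auto
  show thesis
  proof (rule that[of b])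
    show "b \<in> B" "crd v b \<noteq> 0" using b(1) by (auto simp: S_def)
    show "v \<in> V (ev b) (lv b)"
      using \<beta>(2) k(2) b(2,3) by (force simp: V_def below_def S_def)
    show "\<not> below \<alpha> l b"
      using b0 \<beta>(2)[OF b0(1)] k(2)[OF b0(1)] b by (auto simp: below_def)
  qed
qed

text \<open>A vector outside \<open>V \<alpha> l\<close> has a highest block
  \<open>(\<beta>, k)\<close> above \<open>(\<alpha>, l)\<close>, and by \<open>flow_growth\<close>
  it grows exactly like \<open>weight \<beta> k\<close>, which outgrows the assumed bound.\<close>

lemma growth_imp_V:
  assumes \<alpha>: "0 < \<alpha>" and l: "1 \<le> l"
    and le: "\<forall>\<^sub>F \<tau> in at_top. norm (\<Phi> \<tau> v) \<le> c * (1 + weight \<alpha> l \<tau>)"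
  shows "v \<in> V \<alpha> l"
proof (rule ccontr)
  assume "v \<notin> V \<alpha> l"
  then obtain b where b: "b \<in> B" "crd v b \<noteq> 0" "\<not> below \<alpha> l b" "v \<in> V (ev b) (lv b)"
    by (rule exists_leading_block)
  define \<beta> where "\<beta> = ev b"
  define k where "k = lv b"
  have gt: "\<alpha> < \<beta> \<or> (\<alpha> = \<beta> \<and> l < k)" using b(3) by (auto simp: below_def \<beta>_def k_def)
  have k: "1 \<le> k" using lv_pos[OF b(1)] by (simp add: k_def)
  have bb: "b \<in> blk \<beta> k" using b(1) by (simp add: blk_def \<beta>_def k_def)
  have "((\<lambda>\<tau>. 1 / weight \<beta> k \<tau>) \<longlongrightarrow> 0) at_top"
  proof (rule Lim_null_comparison)
    show "((\<lambda>\<tau>. \<tau> ^ 0 * exp (- \<beta> * \<tau>)) \<longlongrightarrow> 0) at_top"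
      using ev_pos[OF b(1)] by (intro power_exp_tendsto_0) (simp add: \<beta>_def)
    show "\<forall>\<^sub>F \<tau> in at_top. norm (1 / weight \<beta> k \<tau>) \<le> \<tau> ^ 0 * exp (- \<beta> * \<tau>)"
      using eventually_ge_at_top[of 1]
    proof eventually_elim
      case (elim \<tau>)
      have "exp (\<beta> * \<tau>) * 1 \<le> weight \<beta> k \<tau>" unfolding weight_def using elim by (intro mult_left_mono) auto
      then show ?case using weight_pos[of \<tau> \<beta> k] elim by (simp add: exp_minus field_simps)
    qed
  qed
  moreover have "((\<lambda>\<tau>. weight \<alpha> l \<tau> / weight \<beta> k \<tau>) \<longlongrightarrow> 0) at_top"
  proof (cases "\<alpha> < \<beta>")
    case True
    show ?thesis
    proof (rule Lim_null_comparison)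
      show "((\<lambda>\<tau>. \<tau> ^ (l - 1) * exp (- (\<beta> - \<alpha>) * \<tau>)) \<longlongrightarrow> 0) at_top" using True by (intro power_exp_tendsto_0) simp
      show "\<forall>\<^sub>F \<tau> in at_top. norm (weight \<alpha> l \<tau> / weight \<beta> k \<tau>) \<le> \<tau> ^ (l - 1) * exp (- (\<beta> - \<alpha>) * \<tau>)"
        using eventually_ge_at_top[of 1]
      proof eventually_elim
        case (elim \<tau>)
        have "weight \<alpha> l \<tau> / weight \<beta> k \<tau> = \<tau> ^ (l - 1) * exp (- (\<beta> - \<alpha>) * \<tau>) / \<tau> ^ (k - 1)"
          by (simp add: weight_def algebra_simps exp_diff)
        also have "\<dots> \<le> \<tau> ^ (l - 1) * exp (- (\<beta> - \<alpha>) * \<tau>) / 1"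
          using elim by (intro divide_left_mono) auto
        finally show ?case using elim weight_pos[of \<tau>] by (simp add: abs_div_pos less_imp_le)
      qed
    qed
  next
    case False
    then have eq: "\<alpha> = \<beta>" "l < k" using gt by auto
    show ?thesis
    proof (rule Lim_null_comparison)
      show "((\<lambda>\<tau>::real. 1 / \<tau>) \<longlongrightarrow> 0) at_top"
        using tendsto_inverse_0_at_top[OF filterlim_ident] by (simp add: inverse_eq_divide)
      show "\<forall>\<^sub>F \<tau> in at_top. norm (weight \<alpha> l \<tau> / weight \<beta> k \<tau>) \<le> 1 / \<tau>"
        using eventually_ge_at_top[of 1]
      proof eventually_elim
        case (elim \<tau>)
        have "\<tau> ^ Suc (l - 1) \<le> \<tau> ^ (k - 1)" using elim eq l by (intro power_increasing) auto
        then show ?case using elim eq by (simp add: weight_def field_simps)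
      qed
    qed
  qed
  ultimately have "((\<lambda>\<tau>. c * (1 / weight \<beta> k \<tau> + weight \<alpha> l \<tau> / weight \<beta> k \<tau>)) \<longlongrightarrow> c * (0 + 0)) at_top"
    by (intro tendsto_intros)
  then have 0: "((\<lambda>\<tau>. c * (1 / weight \<beta> k \<tau> + weight \<alpha> l \<tau> / weight \<beta> k \<tau>)) \<longlongrightarrow> 0) at_top" by simp
  have "((\<lambda>\<tau>. (1 / weight \<beta> k \<tau>) *\<^sub>R \<Phi> \<tau> v) \<longlongrightarrow> 0) at_top"
  proof (rule Lim_null_comparison[OF _ 0])
    show "\<forall>\<^sub>F \<tau> in at_top. norm ((1 / weight \<beta> k \<tau>) *\<^sub>R \<Phi> \<tau> v) \<le> c * (1 / weight \<beta> k \<tau> + weight \<alpha> l \<tau> / weight \<beta> k \<tau>)"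
      using le eventually_ge_at_top[of 1]
    proof eventually_elim
      case (elim \<tau>)
      have "0 < weight \<beta> k \<tau>" using elim(2) by (intro weight_pos) simp
      then show ?case using elim(1) by (simp add: field_simps)
    qed
  qed
  then have "(1 / fact (k - 1)) *\<^sub>R \<omega> \<beta> k v = 0"
    using tendsto_unique[OF trivial_limit_at_top_linorder flow_growth[OF b(4)[folded \<beta>_def k_def] k]] by simp
  then have "\<omega> \<beta> k v = 0" by simp
  then have "crd v b = 0" using crd_omega[OF bb, of v] by simp
  then show False using b(2) by simp
qed

definition Elev :: "real \<Rightarrow> 'a set" where
  "Elev \<alpha> = {v. \<exists>c. \<forall>\<tau>. norm (\<Phi> \<tau> v) \<le> c * (1 + exp (\<alpha> * \<tau>))}"

lemma Elev_V: assumes "0 < \<alpha>" "v \<in> Elev \<alpha>" shows "v \<in> V \<alpha> 1"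
proof -
  obtain c where "\<And>\<tau>. norm (\<Phi> \<tau> v) \<le> c * (1 + exp (\<alpha> * \<tau>))" using assms(2) by (auto simp: Elev_def)
  then show ?thesis by (intro growth_imp_V[OF assms(1), of 1 v c]) (simp_all add: weight_def)
qed

text \<open>Vectors of the growth class lie in \<open>V \<alpha> 1\<close>, where
  \<open>flow_growth\<close> with \<open>l = 1\<close> is the limit that the locale asks
  for.\<close>

lemma flow_level: assumes "0 < \<alpha>" shows "flow_level \<Phi> \<mu> \<alpha> (\<omega> \<alpha> 1) (Elev \<alpha>)"
proof (intro flow_level.intro expanding_flow_axioms flow_level_axioms.intro assms linear_omega)
  show "Elev \<alpha> = {v. \<exists>c. \<forall>\<tau>. norm (\<Phi> \<tau> v) \<le> c * (1 + exp (\<alpha> * \<tau>))}" by (rule Elev_def)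
  fix v assume "v \<in> Elev \<alpha>"
  from flow_growth[OF Elev_V[OF assms this], of]
  show "((\<lambda>\<tau>. exp (- \<alpha> * \<tau>) *\<^sub>R \<Phi> \<tau> v) \<longlongrightarrow> \<omega> \<alpha> 1 v) at_top"
    by (simp add: weight_def exp_minus inverse_eq_divide)
qed

section \<open>Higher levels of the flag\<close>

definition Ulev :: "real \<Rightarrow> 'a set" where "Ulev \<alpha> = {v\<in>Elev \<alpha>. \<omega> \<alpha> 1 v = 0}"

definition Klev :: "real \<Rightarrow> 'a set" where "Klev \<alpha> = {v. \<forall>\<tau>. \<Phi> \<tau> v = exp (\<alpha> * \<tau>) *\<^sub>R v}"

definition lin_at :: "real \<Rightarrow> ('a \<Rightarrow> 'a) \<Rightarrow> 'a \<Rightarrow> 'a" where "lin_at \<alpha> H y = \<omega> \<alpha> 1 (H y - H 0)"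

lemma level_K: assumes "0 < \<alpha>"
  shows "flow_level.U (\<omega> \<alpha> 1) (Elev \<alpha>) = Ulev \<alpha>" "flow_level.K \<Phi> \<alpha> = Klev \<alpha>"
    "flow_level.lin (\<omega> \<alpha> 1) = lin_at \<alpha>"
proof -
  interpret L: flow_level \<Phi> \<mu> \<alpha> "\<omega> \<alpha> 1" "Elev \<alpha>" by (rule flow_level[OF assms])
  show "L.U = Ulev \<alpha>" "L.K = Klev \<alpha>" unfolding L.U_def L.K_def Ulev_def Klev_def by (rule refl)+
  show "L.lin = lin_at \<alpha>" by (intro ext) (simp only: L.lin_def lin_at_def)
qed

lemma blk1_in_Klev: "c \<in> blk \<alpha> 1 \<Longrightarrow> c \<in> Klev \<alpha>"
  by (simp add: Klev_def blk_def Phi_basis flow_basis_def)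

lemma subspace_Klev: "subspace (Klev \<alpha>)"
  by (auto simp: subspace_def Klev_def algebra_simps)

lemma omega_in_Klev: "\<omega> \<alpha> l v \<in> Klev \<alpha>"
  unfolding \<omega>_def
  by (intro subspace_sum[OF subspace_Klev] subspace_scale[OF subspace_Klev] blk1_in_Klev chain_end_blk)

lemma weight_shift: "((\<lambda>\<tau>. weight \<alpha> l (\<tau> + s) / weight \<alpha> l \<tau>) \<longlongrightarrow> exp (\<alpha> * s)) at_top"
proof -
  have "((\<lambda>\<tau>::real. 1 / \<tau>) \<longlongrightarrow> 0) at_top"
    using tendsto_inverse_0_at_top[OF filterlim_ident] by (simp add: inverse_eq_divide)
  then have "((\<lambda>\<tau>::real. s * (1 / \<tau>)) \<longlongrightarrow> s * 0) at_top"
    by (intro tendsto_mult tendsto_const)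
  from tendsto_mult[OF tendsto_const tendsto_power[OF tendsto_add[OF tendsto_const this]], of "exp (\<alpha> * s)" 1 "l - 1"]
  have lim: "((\<lambda>\<tau>. exp (\<alpha> * s) * (1 + s * (1 / \<tau>)) ^ (l - 1)) \<longlongrightarrow> exp (\<alpha> * s)) at_top" by simp
  have "\<forall>\<^sub>F \<tau> in at_top. exp (\<alpha> * s) * (1 + s * (1 / \<tau>)) ^ (l - 1) = weight \<alpha> l (\<tau> + s) / weight \<alpha> l \<tau>"
    using eventually_ge_at_top[of 1]
  proof eventually_elim
    case (elim \<tau>)
    have "1 + s * (1 / \<tau>) = (\<tau> + s) / \<tau>" using elim by (simp add: field_simps)
    then show ?case using elim by (simp add: weight_def power_divide exp_add algebra_simps)
  qed
  with lim show ?thesis by (rule Lim_transform_eventually)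
qed

lemma weight_at_top: assumes "0 < \<alpha>" shows "filterlim (weight \<alpha> l) at_top at_top"
proof (rule filterlim_at_top_mono)
  show "filterlim (\<lambda>\<tau>. exp (\<alpha> * \<tau>)) at_top at_top"
    using assms by (intro filterlim_compose[OF exp_at_top] filterlim_tendsto_pos_mult_at_top[OF tendsto_const _ filterlim_ident])
  show "\<forall>\<^sub>F \<tau> in at_top. exp (\<alpha> * \<tau>) \<le> weight \<alpha> l \<tau>"
    using eventually_ge_at_top[of 1]
  proof eventually_elim
    case (elim \<tau>)
    have "exp (\<alpha> * \<tau>) * 1 \<le> weight \<alpha> l \<tau>" unfolding weight_def using elim by (intro mult_left_mono) auto
    then show ?case by simp
  qed
qed

text \<open>As in \<open>qs1_E\<close> the image grows like the source at a shifted time. By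
  \<open>weight_shift\<close> the shift costs a constant factor at large times, and large times are
  all that \<open>growth_imp_V\<close> looks at.\<close>

lemma qs1_V:
  assumes \<alpha>: "0 < \<alpha>" and l: "1 \<le> l" and H: "qs1 D s H" and u: "x - y \<in> V \<alpha> l"
  shows "H x - H y \<in> V \<alpha> l"
proof -
  define r where "r = norm ((1 / fact (l - 1)) *\<^sub>R \<omega> \<alpha> l (x - y)) + 1"
  have "((\<lambda>\<tau>. norm ((1 / weight \<alpha> l \<tau>) *\<^sub>R \<Phi> \<tau> (x - y))) \<longlongrightarrow> r - 1) at_top"
    unfolding r_def using tendsto_norm[OF flow_growth[OF u l]] by (simp del: flow_simps)
  then have "\<forall>\<^sub>F \<tau> in at_top. norm ((1 / weight \<alpha> l \<tau>) *\<^sub>R \<Phi> \<tau> (x - y)) < r"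
    by (rule order_tendstoD) simp
  then have "\<forall>\<^sub>F \<tau> in filtermap (\<lambda>\<tau>. \<tau> + s) at_top. norm ((1 / weight \<alpha> l \<tau>) *\<^sub>R \<Phi> \<tau> (x - y)) < r"
    using filterlim_add_const_at_top[of s] unfolding filterlim_def by (rule filter_leD[rotated])
  then have 1: "\<forall>\<^sub>F \<tau> in at_top. norm ((1 / weight \<alpha> l (\<tau> + s)) *\<^sub>R \<Phi> (\<tau> + s) (x - y)) < r"
    by (simp only: eventually_filtermap)
  have 2: "\<forall>\<^sub>F \<tau> in at_top. weight \<alpha> l (\<tau> + s) / weight \<alpha> l \<tau> < exp (\<alpha> * s) + 1"
    by (rule order_tendstoD(2)[OF weight_shift]) simp
  have r: "0 \<le> r" by (simp add: r_def)
  have D: "0 \<le> D" by (rule qs1_nonneg[OF H])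
  have "\<forall>\<^sub>F \<tau> in at_top. norm (\<Phi> \<tau> (H x - H y)) \<le> (D * (1 + r * (exp (\<alpha> * s) + 1))) * (1 + weight \<alpha> l \<tau>)"
    using 1 2 eventually_ge_at_top[of "max 1 (1 - s)"]
  proof eventually_elim
    case (elim \<tau>)
    have w: "0 < weight \<alpha> l \<tau>" "0 < weight \<alpha> l (\<tau> + s)" using elim(3) by (auto intro!: weight_pos)
    have "norm (\<Phi> (\<tau> + s) (x - y)) \<le> r * weight \<alpha> l (\<tau> + s)"
      using elim(1) w(2) by (simp add: field_simps del: flow_simps)
    also have "\<dots> \<le> r * ((exp (\<alpha> * s) + 1) * weight \<alpha> l \<tau>)"
      using elim(2) w(1) r by (intro mult_left_mono) (simp_all add: pos_divide_less_eq)
    finally have n: "norm (\<Phi> (\<tau> + s) (x - y)) \<le> r * ((exp (\<alpha> * s) + 1) * weight \<alpha> l \<tau>)" .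
    have "norm (\<Phi> \<tau> (H x - H y)) \<le> D * (1 + norm (\<Phi> (\<tau> + s) (x - y)))"
      using qs1_chain[OF H, of "\<tau> + s" x y] by simp
    also have "\<dots> \<le> D * (1 + r * ((exp (\<alpha> * s) + 1) * weight \<alpha> l \<tau>))"
      using n D by (intro mult_left_mono add_left_mono)
    also have "\<dots> \<le> D * ((1 + r * (exp (\<alpha> * s) + 1)) * (1 + weight \<alpha> l \<tau>))"
      using D r w(1) by (intro mult_left_mono) (simp_all add: algebra_simps)
    finally show ?case by (simp only: mult.assoc)
  qed
  then show ?thesis by (rule growth_imp_V[OF \<alpha> l])
qed

text \<open>Crossing \<open>u\<close> in about \<open>weight \<alpha> l \<tau>\<close> equal steps, each step is at scale \<open>\<tau>\<close> close to the
  eigenvector \<open>exp (- \<alpha> * \<tau>) *\<^sub>R \<omega> \<alpha> l u\<close> up to a factor, on which \<open>H\<close> acts by its linear part.\<close>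

theorem higher_level:
  assumes \<alpha>: "0 < \<alpha>" and l: "1 \<le> l" and H: "qs1 D s H"
    and aff: "midpoint_affine (Elev \<alpha>) (Ulev \<alpha>) H" and u: "u \<in> V \<alpha> l"
  shows "\<omega> \<alpha> l (H (x + u) - H x) = lin_at \<alpha> H (\<omega> \<alpha> l u)"
proof -
  interpret L: flow_level \<Phi> \<mu> \<alpha> "\<omega> \<alpha> 1" "Elev \<alpha>" by (rule flow_level[OF \<alpha>])
  note lev = level_K[OF \<alpha>]
  note lin = L.midpoint_affine_lin[OF H aff[folded lev(1)], unfolded lev]
  define z where "z = H (x + u) - H x"
  have z: "z \<in> V \<alpha> l" unfolding z_def using u by (intro qs1_V[OF \<alpha> l H]) simp
  define y where "y = (1 / fact (l - 1)) *\<^sub>R \<omega> \<alpha> l u"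
  have y: "y \<in> Klev \<alpha>" unfolding y_def by (intro subspace_scale[OF subspace_Klev] omega_in_Klev)
  \<comment> \<open>With this many steps, one step of \<open>u\<close> has bounded size at scale
    \<open>\<tau>\<close> and converges there to the eigenvector \<open>y\<close>.\<close>
  define m where "m \<tau> = nat \<lceil>weight \<alpha> l \<tau>\<rceil>" for \<tau>
  define P where "P = \<omega> \<alpha> 1"
  obtain kP where kP: "0 < kP" "\<And>v. norm (P v) \<le> kP * norm v"
    using linear_bounded_pos[OF linear_omega[of \<alpha> 1]] unfolding P_def by auto
  have w_inf: "filterlim (weight \<alpha> l) at_top at_top" by (rule weight_at_top[OF \<alpha>])
  have m_ratio: "((\<lambda>\<tau>. weight \<alpha> l \<tau> / real (m \<tau>)) \<longlongrightarrow> 1) at_top"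
  proof -
    have "((\<lambda>\<tau>. real (m \<tau>) / weight \<alpha> l \<tau>) \<longlongrightarrow> 1) at_top"
    proof (rule tendsto_sandwich)
      show "((\<lambda>_. 1) \<longlongrightarrow> (1::real)) (at_top :: real filter)" by simp
      have "((\<lambda>\<tau>. 1 + inverse (weight \<alpha> l \<tau>)) \<longlongrightarrow> 1 + 0) at_top"
        by (intro tendsto_intros tendsto_inverse_0_at_top w_inf)
      then show "((\<lambda>\<tau>. 1 + inverse (weight \<alpha> l \<tau>)) \<longlongrightarrow> 1) at_top" by simp
      show "\<forall>\<^sub>F \<tau> in at_top. 1 \<le> real (m \<tau>) / weight \<alpha> l \<tau>"
        using eventually_ge_at_top[of 1]
      proof eventually_elim
        case (elim \<tau>)
        have "0 < weight \<alpha> l \<tau>" using elim by (intro weight_pos) simp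
        moreover have "weight \<alpha> l \<tau> \<le> real (m \<tau>)" unfolding m_def by linarith
        ultimately show ?case by simp
      qed
      show "\<forall>\<^sub>F \<tau> in at_top. real (m \<tau>) / weight \<alpha> l \<tau> \<le> 1 + inverse (weight \<alpha> l \<tau>)"
        using eventually_ge_at_top[of 1]
      proof eventually_elim
        case (elim \<tau>)
        have "0 < weight \<alpha> l \<tau>" using elim by (intro weight_pos) simp
        moreover from this have "real (m \<tau>) \<le> weight \<alpha> l \<tau> + 1" unfolding m_def by linarith
        ultimately show ?case by (simp add: field_simps)
      qed
    qed
    from tendsto_inverse[OF this] show ?thesis by (simp add: inverse_eq_divide)
  qed
  have m_pos: "\<forall>\<^sub>F \<tau> in at_top. 0 < m \<tau>"
    using eventually_ge_at_top[of 1]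
  proof eventually_elim
    case (elim \<tau>)
    have "0 < weight \<alpha> l \<tau>" using elim by (intro weight_pos) simp
    then show ?case by (simp add: m_def)
  qed
  \<comment> \<open>\<open>step\<close> is the true step and \<open>step'\<close> the eigenvector
    that replaces it; their difference tends to 0 when viewed at scale
    \<open>\<tau>\<close>.\<close>
  define step where "step \<tau> = (1 / real (m \<tau>)) *\<^sub>R u" for \<tau>
  define step' where "step' \<tau> = exp (- \<alpha> * \<tau>) *\<^sub>R y" for \<tau>
  have step'_K: "step' \<tau> \<in> Klev \<alpha>" for \<tau> unfolding step'_def by (intro subspace_scale[OF subspace_Klev] y)
  have near: "((\<lambda>\<tau>. norm (\<Phi> \<tau> (step \<tau> - step' \<tau>))) \<longlongrightarrow> 0) at_top"
  proof -
    have "((\<lambda>\<tau>. (weight \<alpha> l \<tau> / real (m \<tau>)) *\<^sub>R ((1 / weight \<alpha> l \<tau>) *\<^sub>R \<Phi> \<tau> u)) \<longlongrightarrow> 1 *\<^sub>R y) at_top"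
      unfolding y_def by (intro tendsto_intros m_ratio flow_growth u l)
    from tendsto_diff[OF this tendsto_const[of y]]
    have "((\<lambda>\<tau>. (weight \<alpha> l \<tau> / real (m \<tau>)) *\<^sub>R ((1 / weight \<alpha> l \<tau>) *\<^sub>R \<Phi> \<tau> u) - y) \<longlongrightarrow> 0) at_top" by simp
    moreover have "\<forall>\<^sub>F \<tau> in at_top. (weight \<alpha> l \<tau> / real (m \<tau>)) *\<^sub>R ((1 / weight \<alpha> l \<tau>) *\<^sub>R \<Phi> \<tau> u) - y
        = \<Phi> \<tau> (step \<tau> - step' \<tau>)"
      using eventually_ge_at_top[of 1]
    proof eventually_elim
      case (elim \<tau>)
      have "0 < weight \<alpha> l \<tau>" using elim by (intro weight_pos) simp
      moreover have "\<Phi> \<tau> y = exp (\<alpha> * \<tau>) *\<^sub>R y" using y by (simp add: Klev_def)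
      ultimately show ?case by (simp add: step_def step'_def flip: exp_add)
    qed
    ultimately have "((\<lambda>\<tau>. \<Phi> \<tau> (step \<tau> - step' \<tau>)) \<longlongrightarrow> 0) at_top" by (rule Lim_transform_eventually)
    from tendsto_norm[OF this] show ?thesis by simp
  qed
  \<comment> \<open>The same quantity has two limits: \<open>t\<close>, by adding up the steps, and
    a multiple of \<open>\<omega> \<alpha> l z\<close>, by the growth of the total increment
    \<open>z\<close>. Comparing them gives the claim.\<close>
  define t where "t = exp (- \<alpha> * s) *\<^sub>R lin_at \<alpha> H y"
  have lim1: "((\<lambda>\<tau>. (1 / real (m \<tau>)) *\<^sub>R P (\<Phi> (\<tau> - s) z)) \<longlongrightarrow> t) at_top"
    unfolding tendsto_iff dist_norm
  proof (intro allI impI)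
    fix e :: real assume e: "0 < e"
    have D: "0 \<le> D" by (rule qs1_nonneg[OF H])
    have kD: "0 < kP * D + 1" using kP(1) D by (simp add: add_nonneg_pos)
    then have "0 < e / (kP * D + 1)" using e by simp
    \<comment> \<open>Through \<open>qs1_modulus\<close>, replacing a step by its eigenvector costs
      at most \<open>kP * (\<mu> \<theta> * D)\<close>. There are \<open>n\<close> steps, but the
      sum is divided by \<open>n\<close>, so this is also the total error.\<close>
    then obtain \<theta> where \<theta>: "\<mu> \<theta> < e / (kP * D + 1)" by (rule mu_small)
    have "\<forall>\<^sub>F \<tau> in at_top. norm (\<Phi> \<tau> (step \<tau> - step' \<tau>)) < 1 / \<mu> (- \<theta>)"
      using near by (rule order_tendstoD) (simp add: mu_pos)
    then show "\<forall>\<^sub>F \<tau> in at_top. norm ((1 / real (m \<tau>)) *\<^sub>R P (\<Phi> (\<tau> - s) z) - t) < e"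
      using m_pos
    proof eventually_elim
      case (elim \<tau>)
      define w where "w = step \<tau>"
      define w' where "w' = step' \<tau>"
      define n where "n = m \<tau>"
      have n: "0 < n" using elim(2) by (simp add: n_def)
      define q where "q j = x + real j *\<^sub>R w" for j
      have "q n = x + u" using n by (simp add: q_def w_def step_def n_def)
      moreover have "q 0 = x" "q (Suc j) = q j + w" for j
        by (simp_all add: q_def scaleR_add_left)
      ultimately have q: "q 0 = x" "q n = x + u" "q (Suc j) = q j + w" for j by auto
      have small: "\<mu> (- \<theta>) * norm (\<Phi> \<tau> (w - w')) \<le> 1"
        using elim(1) mu_pos[of "- \<theta>"] by (simp add: w_def w'_def field_simps del: flow_simps)
      have close: "norm (P (\<Phi> (\<tau> - s) (H (q (Suc j)) - H (q j))) - t) \<le> kP * (\<mu> \<theta> * D)" for j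
      proof -
        have E: "w' \<in> Elev \<alpha>" using L.K_in_E step'_K lev(2) by (simp add: w'_def)
        have HE: "H (q j + w') - H (q j) \<in> Elev \<alpha>" using L.qs1_E[OF H, of "q j + w'" "q j"] E by simp
        have Pw: "\<omega> \<alpha> 1 w' = w'" using L.pr_K step'_K lev(2) by (simp add: w'_def)
        have "P (\<Phi> (\<tau> - s) (H (q j + w') - H (q j))) = exp (\<alpha> * (\<tau> - s)) *\<^sub>R lin_at \<alpha> H w'"
          unfolding P_def L.pr_flow[OF HE] lin(1)[OF E] Pw ..
        also have "lin_at \<alpha> H w' = exp (- \<alpha> * \<tau>) *\<^sub>R lin_at \<alpha> H y"
          unfolding w'_def step'_def by (rule lin(3)[OF y])
        also have "exp (\<alpha> * (\<tau> - s)) *\<^sub>R (exp (- \<alpha> * \<tau>) *\<^sub>R lin_at \<alpha> H y) = t"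
          by (simp add: t_def algebra_simps flip: exp_add)
        finally have 1: "P (\<Phi> (\<tau> - s) (H (q j + w') - H (q j))) = t" .
        have "\<mu> (- \<theta>) * norm (\<Phi> \<tau> ((q j + w) - (q j + w'))) \<le> 1" using small by simp
        from qs1_modulus[OF H this] have 2: "norm (\<Phi> (\<tau> - s) (H (q j + w) - H (q j + w'))) \<le> \<mu> \<theta> * D" by simp
        have "\<Phi> (\<tau> - s) (H (q (Suc j)) - H (q j))
            = \<Phi> (\<tau> - s) (H (q j + w') - H (q j)) + \<Phi> (\<tau> - s) (H (q j + w) - H (q j + w'))"
          by (simp add: q(3))
        then have "P (\<Phi> (\<tau> - s) (H (q (Suc j)) - H (q j))) - t = P (\<Phi> (\<tau> - s) (H (q j + w) - H (q j + w')))"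
          by (simp only: P_def L.pr_simps(2) 1[unfolded P_def]) simp
        also have "norm \<dots> \<le> kP * norm (\<Phi> (\<tau> - s) (H (q j + w) - H (q j + w')))" by (rule kP(2))
        also have "\<dots> \<le> kP * (\<mu> \<theta> * D)" using 2 kP(1) by (intro mult_left_mono) auto
        finally show ?thesis .
      qed
      have "z = (\<Sum>j<n. H (q (Suc j)) - H (q j))"
        by (subst sum_lessThan_telescope) (simp add: q z_def)
      then have "P (\<Phi> (\<tau> - s) z) = (\<Sum>j<n. P (\<Phi> (\<tau> - s) (H (q (Suc j)) - H (q j))))"
        by (simp only: linear_sum[OF linear_flow] linear_sum[OF linear_omega] P_def)
      then have "P (\<Phi> (\<tau> - s) z) - real n *\<^sub>R t = (\<Sum>j<n. P (\<Phi> (\<tau> - s) (H (q (Suc j)) - H (q j))) - t)"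
        by (simp only: sum_subtractf) (simp add: scaleR_conv_of_real sum_constant_scaleR)
      then have "norm (P (\<Phi> (\<tau> - s) z) - real n *\<^sub>R t) \<le> (\<Sum>j<n. kP * (\<mu> \<theta> * D))"
        by (simp only:) (rule sum_norm_le, rule close)
      also have "\<dots> = real n * (kP * (\<mu> \<theta> * D))" by simp
      finally have le: "norm (P (\<Phi> (\<tau> - s) z) - real n *\<^sub>R t) \<le> real n * (kP * (\<mu> \<theta> * D))" .
      have "(1 / real n) *\<^sub>R P (\<Phi> (\<tau> - s) z) - t = (1 / real n) *\<^sub>R (P (\<Phi> (\<tau> - s) z) - real n *\<^sub>R t)"
        using n by (simp add: scaleR_diff_right)
      then have "norm ((1 / real n) *\<^sub>R P (\<Phi> (\<tau> - s) z) - t) = norm (P (\<Phi> (\<tau> - s) z) - real n *\<^sub>R t) / real n"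
        by (simp only: norm_scaleR) (simp add: divide_inverse mult.commute)
      also have "\<dots> \<le> kP * (\<mu> \<theta> * D)" using le n by (simp add: pos_divide_le_eq mult.commute)
      also have "\<dots> \<le> \<mu> \<theta> * (kP * D + 1)" using mu_pos[of \<theta>] by (simp add: algebra_simps)
      also have "\<dots> < e" using \<theta> kD by (simp add: pos_less_divide_eq)
      finally show ?case by (simp add: n_def)
    qed
  qed
  have lim2: "((\<lambda>\<tau>. (1 / real (m \<tau>)) *\<^sub>R P (\<Phi> (\<tau> - s) z)) \<longlongrightarrow>
      exp (- \<alpha> * s) *\<^sub>R P ((1 / fact (l - 1)) *\<^sub>R \<omega> \<alpha> l z)) at_top"
  proof -
    have "filterlim (\<lambda>\<tau>::real. \<tau> - s) at_top at_top" using filterlim_add_const_at_top[of "- s"] by simp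
    from filterlim_compose[OF flow_growth[OF z l] this]
    have g: "((\<lambda>\<tau>. (1 / weight \<alpha> l (\<tau> - s)) *\<^sub>R \<Phi> (\<tau> - s) z) \<longlongrightarrow> (1 / fact (l - 1)) *\<^sub>R \<omega> \<alpha> l z) at_top" .
    have r: "((\<lambda>\<tau>. weight \<alpha> l (\<tau> - s) / weight \<alpha> l \<tau>) \<longlongrightarrow> exp (- \<alpha> * s)) at_top"
      using weight_shift[of \<alpha> l "- s"] by simp
    have "((\<lambda>\<tau>. ((weight \<alpha> l (\<tau> - s) / weight \<alpha> l \<tau>) * (weight \<alpha> l \<tau> / real (m \<tau>))) *\<^sub>R
        P ((1 / weight \<alpha> l (\<tau> - s)) *\<^sub>R \<Phi> (\<tau> - s) z)) \<longlongrightarrow>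
        (exp (- \<alpha> * s) * 1) *\<^sub>R P ((1 / fact (l - 1)) *\<^sub>R \<omega> \<alpha> l z)) at_top"
      unfolding P_def by (intro tendsto_scaleR tendsto_mult r m_ratio L.tendsto_pr g)
    then have "((\<lambda>\<tau>. ((weight \<alpha> l (\<tau> - s) / weight \<alpha> l \<tau>) * (weight \<alpha> l \<tau> / real (m \<tau>))) *\<^sub>R
        P ((1 / weight \<alpha> l (\<tau> - s)) *\<^sub>R \<Phi> (\<tau> - s) z)) \<longlongrightarrow>
        exp (- \<alpha> * s) *\<^sub>R P ((1 / fact (l - 1)) *\<^sub>R \<omega> \<alpha> l z)) at_top" by (simp only: mult_1_right)
    moreover have "\<forall>\<^sub>F \<tau> in at_top. ((weight \<alpha> l (\<tau> - s) / weight \<alpha> l \<tau>) * (weight \<alpha> l \<tau> / real (m \<tau>))) *\<^sub>R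
        P ((1 / weight \<alpha> l (\<tau> - s)) *\<^sub>R \<Phi> (\<tau> - s) z) = (1 / real (m \<tau>)) *\<^sub>R P (\<Phi> (\<tau> - s) z)"
      using eventually_ge_at_top[of "max 1 (s + 1)"]
    proof eventually_elim
      case (elim \<tau>)
      have "0 < weight \<alpha> l \<tau>" "0 < weight \<alpha> l (\<tau> - s)" using elim by (auto intro!: weight_pos)
      then show ?case unfolding P_def L.pr_simps(4) by simp
    qed
    ultimately show ?thesis by (rule Lim_transform_eventually)
  qed
  have "t = exp (- \<alpha> * s) *\<^sub>R P ((1 / fact (l - 1)) *\<^sub>R \<omega> \<alpha> l z)"
    by (rule tendsto_unique[OF trivial_limit_at_top_linorder lim1 lim2])
  then have "lin_at \<alpha> H y = P ((1 / fact (l - 1)) *\<^sub>R \<omega> \<alpha> l z)" by (simp add: t_def)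
  also have "\<dots> = (1 / fact (l - 1)) *\<^sub>R \<omega> \<alpha> l z"
    unfolding P_def by (rule L.pr_K[unfolded lev(2), OF subspace_scale[OF subspace_Klev omega_in_Klev]])
  finally have "(1 / fact (l - 1)) *\<^sub>R lin_at \<alpha> H (\<omega> \<alpha> l u) = (1 / fact (l - 1)) *\<^sub>R \<omega> \<alpha> l z"
    unfolding y_def by (simp only: lin(3)[OF omega_in_Klev])
  then show ?thesis by (simp add: z_def)
qed

end

section \<open>Conjugation to fibre-affine maps\<close>

definition conj_by :: "('a \<Rightarrow> 'a) \<Rightarrow> ('a \<Rightarrow> 'a) \<Rightarrow> 'a \<Rightarrow> 'a" where
  "conj_by F h = F \<circ> h \<circ> inv_into UNIV F"

lemma conj_by_comp: "bij F \<Longrightarrow> conj_by F (g \<circ> h) = conj_by F g \<circ> conj_by F h"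
  by (simp add: conj_by_def fun_eq_iff bij_is_inj)

lemma conj_by_id: "bij F \<Longrightarrow> conj_by F id = id"
  by (simp add: conj_by_def fun_eq_iff bij_is_surj surj_f_inv_f)

lemma conj_by_inv:
  assumes F: "bij F" and h: "bij h"
  shows "inv_into UNIV (conj_by F h) = conj_by F (inv_into UNIV h)"
  by (rule inv_unique_comp)
     (use F h in \<open>simp_all add: conj_by_def fun_eq_iff bij_is_inj bij_is_surj surj_f_inv_f\<close>)

lemma conj_by_conj_by:
  assumes F: "bij F" and F': "bij F'"
  shows "conj_by F' (conj_by F h) = conj_by (F' \<circ> F) h"
  by (simp add: conj_by_def o_inv_distrib F F' comp_assoc)

context expanding_flow
begin

lemma uniform_groupD: "uniform_group C G \<Longrightarrow> g \<in> G \<Longrightarrow> \<exists>s. qs C s g"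
  by (simp add: uniform_group_def)

lemma conj_by_uniform_group:
  assumes F: "qs D 0 F" and G: "uniform_group C G"
  obtains C' where "uniform_group C' (conj_by F ` G)"
proof -
  have bF: "bij F" by (rule qs_bij[OF F])
  define A where "A = max (D * (1 + C)) (C * (1 + D))"
  define C' where "C' = max (A * (1 + D)) (D * (1 + A))"
  have q: "\<exists>s. qs C' s (conj_by F g)" if g: "g \<in> G" for g
  proof -
    obtain s where s: "qs C s g" using uniform_groupD[OF G g] by blast
    have "qs C' ((0 + s) + - 0) (conj_by F g)"
      unfolding conj_by_def C'_def A_def by (rule qs_comp[OF qs_comp[OF F s] qs_inv[OF F]])
    then show ?thesis by blast
  qed
  have bG: "bij g" if "g \<in> G" for g using uniform_groupD[OF G that] qs_bij by auto
  have "uniform_group C' (conj_by F ` G)"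
    unfolding uniform_group_def
  proof (intro conjI ballI)
    show "id \<in> conj_by F ` G" using G conj_by_id[OF bF] by (force simp: uniform_group_def)
    fix g assume "g \<in> conj_by F ` G"
    then obtain g' where g': "g = conj_by F g'" "g' \<in> G" by blast
    show "inv_into UNIV g \<in> conj_by F ` G"
      using g' G by (auto simp: uniform_group_def conj_by_inv[OF bF bG])
    show "\<exists>s. qs C' s g" using q[OF g'(2)] g'(1) by simp
    fix h assume "h \<in> conj_by F ` G"
    then obtain h' where h': "h = conj_by F h'" "h' \<in> G" by blast
    show "g \<circ> h \<in> conj_by F ` G"
      using g' h' G by (auto simp: uniform_group_def simp flip: conj_by_comp[OF bF])
  qed
  then show thesis by (rule that)
qed

lemma conj_by_cocompact:
  assumes F: "qs D 0 F" and G: "cocompact_pairs G"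
  shows "cocompact_pairs (conj_by F ` G)"
proof -
  have bF: "bij F" by (rule qs_bij[OF F])
  have inv: "inv_into UNIV F (F x) = x" "F (inv_into UNIV F x) = x" for x
    using bF by (simp_all add: bij_is_inj bij_is_surj surj_f_inv_f)
  obtain S where S: "compact S" "S \<subseteq> {(a, b). a \<noteq> b}" "(\<Union>g\<in>G. map_prod g g ` S) = {(a, b). a \<noteq> b}"
    using G by (auto simp: cocompact_pairs_def)
  have "continuous_on UNIV F" by (rule qs1_imp_continuous[OF qs_qs1[OF F]])
  then have cont: "continuous_on S (map_prod F F)"
    unfolding map_prod_def case_prod_beta
    by (auto intro!: continuous_intros continuous_on_compose2[of UNIV F])
  have "compact (map_prod F F ` S)" by (rule compact_continuous_image[OF cont S(1)])
  moreover have "map_prod F F ` S \<subseteq> {(a, b). a \<noteq> b}"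
    using S(2) bF by (auto simp: bij_def inj_def)
  moreover have "(\<Union>g\<in>conj_by F ` G. map_prod g g ` (map_prod F F ` S)) = {(a, b). a \<noteq> b}"
  proof -
    have "(\<Union>g\<in>conj_by F ` G. map_prod g g ` (map_prod F F ` S)) = map_prod F F ` (\<Union>g\<in>G. map_prod g g ` S)"
      by (simp add: conj_by_def image_UN image_image map_prod_def case_prod_beta inv)
    also have "\<dots> = {(a, b). a \<noteq> b}"
    proof (intro equalityI subsetI)
      fix p assume "p \<in> map_prod F F ` (\<Union>g\<in>G. map_prod g g ` S)"
      then show "p \<in> {(a, b). a \<noteq> b}" unfolding S(3) using bF by (auto simp: bij_def inj_def)
    next
      fix p assume "p \<in> {(a::'a, b). a \<noteq> b}"
      then obtain a b where ab: "p = (a, b)" "a \<noteq> b" by blast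
      have "inv_into UNIV F a \<noteq> inv_into UNIV F b" using ab(2) inv(2) by metis
      then have "map_prod F F (inv_into UNIV F a, inv_into UNIV F b) \<in> map_prod F F ` (\<Union>g\<in>G. map_prod g g ` S)"
        unfolding S(3) by (intro imageI) simp
      then show "p \<in> map_prod F F ` (\<Union>g\<in>G. map_prod g g ` S)" by (simp add: ab(1) inv)
    qed
    finally show ?thesis .
  qed
  ultimately show ?thesis unfolding cocompact_pairs_def by blast
qed

end

context jordan_data
begin

theorem conj_to_fibre_affine:
  assumes G: "uniform_group C G" and co: "cocompact_pairs G"
  shows "\<exists>F D. qs D 0 F \<and> (\<forall>\<alpha>\<in>ev ` B. \<forall>h\<in>G. midpoint_affine (Elev \<alpha>) (Ulev \<alpha>) (conj_by F h))"
proof -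
  have "\<exists>F D. qs D 0 F \<and> (\<forall>\<alpha>\<in>A. \<forall>h\<in>G. midpoint_affine (Elev \<alpha>) (Ulev \<alpha>) (conj_by F h))"
    if "finite A" "A \<subseteq> ev ` B" for A
    using that
  proof (induction A rule: finite_induct)
    case empty
    have "qs 1 0 id" by (simp add: qs_def qs1_def)
    then show ?case by blast
  next
    case (insert \<alpha> A)
    then obtain F D where F: "qs D 0 F"
      "\<And>\<beta> h. \<beta> \<in> A \<Longrightarrow> h \<in> G \<Longrightarrow> midpoint_affine (Elev \<beta>) (Ulev \<beta>) (conj_by F h)" by auto
    have bF: "bij F" by (rule qs_bij[OF F(1)])
    obtain C' where C': "uniform_group C' (conj_by F ` G)" using conj_by_uniform_group[OF F(1) G] .
    have co': "cocompact_pairs (conj_by F ` G)" by (rule conj_by_cocompact[OF F(1) co])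
    have pos: "0 < \<beta>" if "\<beta> \<in> insert \<alpha> A" for \<beta> using insert that ev_pos by auto
    have \<alpha>: "0 < \<alpha>" using pos by simp
    obtain b where b: "b \<in> B" "ev b = \<alpha>" using insert by auto
    \<comment> \<open>The end of a chain is a nonzero eigenvector for \<open>\<alpha>\<close>;
      together with 0 it is the nondegenerate base pair of \<open>blow_up\<close>.\<close>
    define e0 where "e0 = chain_end b"
    have e0: "e0 \<in> blk \<alpha> 1" using chain_end_in[OF b(1)] b(2) by (simp add: e0_def)
    then have "e0 \<in> B" using blk_subset by blast
    then have "e0 \<noteq> 0" using indep dependent_zero by blast
    interpret L: level_group \<Phi> \<mu> \<alpha> "\<omega> \<alpha> 1" "Elev \<alpha>" C' "conj_by F ` G"
      by (intro level_group.intro level_group_axioms.intro flow_level \<alpha> C')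
    have e0K: "e0 \<in> L.K" using blk1_in_Klev[OF e0] unfolding level_K(2)[OF \<alpha>] .
    obtain F' D' where "qs D' 0 F' \<and> (\<forall>h\<in>conj_by F ` G. midpoint_affine (Elev \<alpha>) L.U (conj_by F' h)) \<and>
      (\<forall>E' U'. closed U' \<and> (\<forall>t. \<forall>v\<in>E'. \<Phi> t v \<in> E') \<and> (\<forall>t. \<forall>v\<in>U'. \<Phi> t v \<in> U') \<and>
        (\<forall>h\<in>conj_by F ` G. midpoint_affine E' U' h) \<longrightarrow> (\<forall>h\<in>conj_by F ` G. midpoint_affine E' U' (conj_by F' h)))"
      using L.blow_up[OF co' e0K \<open>e0 \<noteq> 0\<close>, folded conj_by_def] by (elim exE)
    then have F': "qs D' 0 F'"
      "\<And>h. h \<in> conj_by F ` G \<Longrightarrow> midpoint_affine (Elev \<alpha>) (Ulev \<alpha>) (conj_by F' h)"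
      "\<And>E' U'. closed U' \<and> (\<forall>t. \<forall>v\<in>E'. \<Phi> t v \<in> E') \<and> (\<forall>t. \<forall>v\<in>U'. \<Phi> t v \<in> U') \<and>
        (\<forall>h\<in>conj_by F ` G. midpoint_affine E' U' h) \<Longrightarrow> (\<forall>h\<in>conj_by F ` G. midpoint_affine E' U' (conj_by F' h))"
      unfolding level_K(1)[OF \<alpha>] by (simp_all del: ball_simps image_iff)
    have bF': "bij F'" by (rule qs_bij[OF F'(1)])
    have "midpoint_affine (Elev \<beta>) (Ulev \<beta>) (conj_by (F' \<circ> F) h)" if \<beta>: "\<beta> \<in> insert \<alpha> A" and h: "h \<in> G" for \<beta> h
    proof (cases "\<beta> = \<alpha>")
      case True
      then show ?thesis using F'(2)[of "conj_by F h"] h by (simp add: conj_by_conj_by[OF bF bF'])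
    next
      case False
      interpret M: flow_level \<Phi> \<mu> \<beta> "\<omega> \<beta> 1" "Elev \<beta>" by (rule flow_level[OF pos[OF \<beta>]])
      have "\<forall>h\<in>conj_by F ` G. midpoint_affine (Elev \<beta>) (Ulev \<beta>) (conj_by F' h)"
      proof (rule F'(3), intro conjI allI ballI)
        show "closed (Ulev \<beta>)" "\<And>t v. v \<in> Ulev \<beta> \<Longrightarrow> \<Phi> t v \<in> Ulev \<beta>"
          using M.closed_U M.U_flow unfolding level_K(1)[OF pos[OF \<beta>]] by auto
        show "\<And>t v. v \<in> Elev \<beta> \<Longrightarrow> \<Phi> t v \<in> Elev \<beta>" by (rule M.E_flow)
        show "midpoint_affine (Elev \<beta>) (Ulev \<beta>) h" if "h \<in> conj_by F ` G" for h
          using that F(2) \<beta> False by auto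
      qed
      then show ?thesis using h by (simp add: conj_by_conj_by[OF bF bF'])
    qed
    moreover have "\<exists>D''. qs D'' 0 (F' \<circ> F)" using qs_comp[OF F'(1) F(1)] by auto
    ultimately show ?case by blast
  qed
  then show ?thesis using finite_B by blast
qed

end

section \<open>Orthonormalization along the flag\<close>

text \<open>The induction splits off an element of smallest \<open>len\<close>. Its new vector may
  involve all the others, while the vectors already constructed for the others remain unchanged; so
  each \<open>e b\<close> uses only elements at least as long as \<open>b\<close>.\<close>

lemma gram_schmidt_flag:
  fixes \<beta> :: "'a::euclidean_space \<Rightarrow> 'a \<Rightarrow> real" and len :: "'a \<Rightarrow> nat"
  assumes lin: "\<And>x. linear (\<beta> x)" and sym: "\<And>x y. \<beta> x y = \<beta> y x" and pos: "\<And>x. x \<noteq> 0 \<Longrightarrow> 0 < \<beta> x x"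
    and S: "independent S"
  shows "\<exists>e. (\<forall>b\<in>S. e b \<in> span {c\<in>S. len b \<le> len c}) \<and>
    (\<forall>b\<in>S. \<forall>c\<in>S. \<beta> (e b) (e c) = (if b = c then 1 else 0))"
  using S
proof (induction "card S" arbitrary: S)
  case 0
  then have "S = {}" using independent_bound[OF 0(2)] by simp
  then show ?case by simp
next
  case (Suc n)
  have fin: "finite S" using independent_bound[OF Suc(3)] by simp
  have ne: "S \<noteq> {}" using Suc(2) by auto
  obtain b0 where b0: "b0 \<in> S" "\<And>c. c \<in> S \<Longrightarrow> len b0 \<le> len c"
    using ex_min_if_finite[of "len ` S"] fin ne by (metis (no_types) arg_min_least arg_min_if_finite(1))
  define S' where "S' = S - {b0}"
  have S': "independent S'" "n = card S'" "S = insert b0 S'" "b0 \<notin> S'" "finite S'"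
    using Suc(2) b0(1) fin independent_mono[OF Suc(3), of S'] by (auto simp: S'_def)
  obtain e where e: "\<And>b. b \<in> S' \<Longrightarrow> e b \<in> span {c\<in>S'. len b \<le> len c}"
    "\<And>b c. b \<in> S' \<Longrightarrow> c \<in> S' \<Longrightarrow> \<beta> (e b) (e c) = (if b = c then 1 else 0)"
    using Suc(1)[OF S'(2,1)] by blast
  have lin': "linear (\<lambda>x. \<beta> x y)" for y using lin[of y] by (simp add: sym[of _ y])
  define v where "v = b0 - (\<Sum>c\<in>S'. \<beta> b0 (e c) *\<^sub>R e c)"
  have eS': "e c \<in> span S'" if "c \<in> S'" for c
    using e(1)[OF that] span_mono[of "{d\<in>S'. len c \<le> len d}" S'] by auto
  have sum_in: "(\<Sum>c\<in>S'. \<beta> b0 (e c) *\<^sub>R e c) \<in> span S'"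
    by (intro span_sum span_scale eS')
  have "b0 \<notin> span S'" using Suc(3) S'(3,4) independent_insert by metis
  then have v0: "v \<noteq> 0" using sum_in by (auto simp: v_def)
  have orth: "\<beta> v (e c) = 0" if c: "c \<in> S'" for c
  proof -
    have "\<beta> v (e c) = \<beta> b0 (e c) - (\<Sum>d\<in>S'. \<beta> b0 (e d) * \<beta> (e d) (e c))"
      unfolding v_def linear_diff[OF lin'] linear_sum[OF lin'] linear_scale[OF lin'] by simp
    also have "(\<Sum>d\<in>S'. \<beta> b0 (e d) * \<beta> (e d) (e c)) = (\<Sum>d\<in>S'. if d = c then \<beta> b0 (e d) else 0)"
      using e(2) c by (intro sum.cong) auto
    finally show ?thesis using c S'(5) by simp
  qed
  define u where "u = (1 / sqrt (\<beta> v v)) *\<^sub>R v"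
  have uu: "\<beta> u u = 1"
    unfolding u_def linear_scale[OF lin] linear_scale[OF lin'] using pos[OF v0] by simp
  have ue: "\<beta> u (e c) = 0" if "c \<in> S'" for c
    unfolding u_def linear_scale[OF lin'] using orth[OF that] by simp
  define e' where "e' b = (if b = b0 then u else e b)" for b
  have "e' b \<in> span {c\<in>S. len b \<le> len c}" if b: "b \<in> S" for b
  proof (cases "b = b0")
    case True
    have "{c\<in>S. len b0 \<le> len c} = S" using b0(2) by auto
    moreover have "u \<in> span S"
    proof -
      have "span S' \<subseteq> span S" by (rule span_mono) (use S'(3) in auto)
      then have "(\<Sum>c\<in>S'. \<beta> b0 (e c) *\<^sub>R e c) \<in> span S" using sum_in by blast
      then show ?thesis unfolding u_def v_def by (rule span_scale[OF span_diff[OF span_base[OF b0(1)]]])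
    qed
    ultimately show ?thesis using True by (simp add: e'_def)
  next
    case False
    then have "b \<in> S'" using b S'(3) by simp
    then have "e b \<in> span {c\<in>S'. len b \<le> len c}" by (rule e(1))
    moreover have "{c\<in>S'. len b \<le> len c} \<subseteq> {c\<in>S. len b \<le> len c}" using S'(3) by auto
    ultimately show ?thesis using span_mono False by (auto simp: e'_def)
  qed
  moreover have "\<beta> (e' b) (e' c) = (if b = c then 1 else 0)" if "b \<in> S" "c \<in> S" for b c
    using that S'(3,4) uu ue e(2) sym by (auto simp: e'_def)
  ultimately show ?case by blast
qed

context jordan_data
begin

lemma chain_end_N:
  assumes "c \<in> blk \<alpha> (Suc l)" "1 \<le> l" shows "N c \<in> blk \<alpha> l" "chain_end (N c) = chain_end c"
proof -
  have c: "c \<in> B" "ev c = \<alpha>" "lv c = Suc l" using assms by (auto simp: blk_def)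
  have Nc: "N c \<in> B \<and> ev (N c) = ev c \<and> lv (N c) = lv c - 1" using N_step[OF c(1)] c(3) assms(2) by simp
  then show "N c \<in> blk \<alpha> l" using c by (simp add: blk_def)
  obtain k where k: "l = Suc k" using assms(2) by (cases l) auto
  have "chain_end c = (N ^^ l) c" using c(3) by (simp add: chain_end_def)
  also have "\<dots> = (N ^^ k) (N c)" unfolding k by (simp add: funpow_swap1)
  finally show "chain_end (N c) = chain_end c" using Nc c(3) k by (simp add: chain_end_def)
qed

text \<open>A chain that reaches height \<open>l\<close> has a member at every lower height, with
  the same end.\<close>

lemma chain_ends_antimono:
  assumes "1 \<le> k" "k \<le> l" shows "chain_end ` blk \<alpha> l \<subseteq> chain_end ` blk \<alpha> k"
  using assms(2,1)
proof (induction l rule: dec_induct)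
  case (step l)
  have "chain_end ` blk \<alpha> (Suc l) \<subseteq> chain_end ` blk \<alpha> l"
  proof
    fix x assume "x \<in> chain_end ` blk \<alpha> (Suc l)"
    then obtain c where c: "x = chain_end c" "c \<in> blk \<alpha> (Suc l)" by blast
    have l: "1 \<le> l" using step by simp
    show "x \<in> chain_end ` blk \<alpha> l"
      unfolding c(1) chain_end_N(2)[OF c(2) l, symmetric] by (rule imageI) (rule chain_end_N(1)[OF c(2) l])
  qed
  then show ?case using step by blast
qed simp

lemma Klev_expand:
  assumes "0 < \<alpha>" "v \<in> Klev \<alpha>" shows "v = (\<Sum>b\<in>blk \<alpha> 1. crd v b *\<^sub>R b)"
proof -
  interpret L: flow_level \<Phi> \<mu> \<alpha> "\<omega> \<alpha> 1" "Elev \<alpha>" by (rule flow_level[OF assms(1)])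
  have "v = \<omega> \<alpha> 1 v" using L.pr_K[unfolded level_K(2)[OF assms(1)], OF assms(2)] by (rule sym)
  also have "\<dots> = (\<Sum>b\<in>blk \<alpha> 1. crd v b *\<^sub>R b)"
    unfolding \<omega>_def by (intro sum.cong refl) (simp add: chain_end_def blk_def)
  finally show ?thesis .
qed

text \<open>\<open>R\<close> is the Gram-Schmidt map on eigenvectors, with its coefficients copied
  to every height of the chains. A new vector combines only ends of chains at least as long as its
  own, so at each height all members that the copy asks for exist; this is why \<open>R\<close>
  commutes with \<open>N\<close> and the flow.\<close>

lemma adapted_orthonormalization:
  fixes \<beta> :: "'a \<Rightarrow> 'a \<Rightarrow> real"
  assumes lin: "\<And>x. linear (\<beta> x)" and sym: "\<And>x y. \<beta> x y = \<beta> y x" and pos': "\<forall>x. x \<noteq> 0 \<longrightarrow> 0 < \<beta> x x"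
  shows "\<exists>R. linear R \<and> bij R \<and> (\<forall>t x. R (\<Phi> t x) = \<Phi> t (R x)) \<and>
    (\<forall>\<alpha> l v. 1 \<le> l \<longrightarrow> \<omega> \<alpha> l (R v) = R (\<omega> \<alpha> l v)) \<and>
    (\<forall>\<alpha>>0. \<forall>v\<in>Klev \<alpha>. R v \<in> Klev \<alpha>) \<and>
    (\<forall>\<alpha>>0. \<forall>v\<in>Klev \<alpha>. \<forall>w\<in>Klev \<alpha>. \<beta> (R v) (R w) = (\<Sum>b\<in>blk \<alpha> 1. crd v b * crd w b))"
proof -
  note pos = mp[OF spec[OF pos']]
  \<comment> \<open>The greatest height of a basis vector whose chain ends in \<open>b\<close>, in
    other words the length of the whole chain.\<close>
  define len where "len b = Max {l. 1 \<le> l \<and> b \<in> chain_end ` blk (ev b) l}" for b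
  have len: "l \<le> len b" "b \<in> chain_end ` blk \<alpha> (len b)" "1 \<le> len b"
    if "b \<in> chain_end ` blk \<alpha> l" "1 \<le> l" for b l \<alpha>
  proof -
    have ev: "ev b = \<alpha>" using that chain_end_blk by (auto simp: blk_def)
    have "{l. 1 \<le> l \<and> b \<in> chain_end ` blk (ev b) l} \<subseteq> lv ` B" by (auto simp: blk_def)
    then have fin: "finite {l. 1 \<le> l \<and> b \<in> chain_end ` blk (ev b) l}"
      using finite_B finite_subset by blast
    have mem: "l \<in> {l. 1 \<le> l \<and> b \<in> chain_end ` blk (ev b) l}" using that ev by simp
    show "l \<le> len b" unfolding len_def by (rule Max_ge[OF fin mem])
    have "len b \<in> {l. 1 \<le> l \<and> b \<in> chain_end ` blk (ev b) l}"
      unfolding len_def by (rule Max_in[OF fin]) (use mem in blast)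
    then show "b \<in> chain_end ` blk \<alpha> (len b)" "1 \<le> len b" using ev by auto
  qed
  have id1: "chain_end b = b" if "b \<in> blk \<alpha> 1" for b \<alpha> using that by (simp add: chain_end_def blk_def)
  have blk1: "b \<in> chain_end ` blk \<alpha> 1" if "b \<in> blk \<alpha> 1" for b \<alpha>
    using id1[OF that] that by (metis imageI)
  have up: "c \<in> chain_end ` blk \<alpha> l"
    if "b \<in> chain_end ` blk \<alpha> l" "1 \<le> l" "c \<in> blk \<alpha> 1" "len b \<le> len c" for b c \<alpha> l
  proof -
    have "l \<le> len c" using len(1)[OF that(1,2)] that(4) by simp
    then show ?thesis using len(2)[OF blk1[OF that(3)] order_refl] chain_ends_antimono[OF that(2)] by blast
  qed
  have "\<forall>\<alpha>. \<exists>e. (\<forall>b\<in>blk \<alpha> 1. e b \<in> span {c\<in>blk \<alpha> 1. len b \<le> len c}) \<and>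
    (\<forall>b\<in>blk \<alpha> 1. \<forall>c\<in>blk \<alpha> 1. \<beta> (e b) (e c) = (if b = c then 1 else 0))"
    by (intro allI gram_schmidt_flag[OF lin sym pos independent_mono[OF indep blk_subset]])
  from choice[OF this] obtain e0 where e0': "\<forall>\<alpha>. (\<forall>b\<in>blk \<alpha> 1. e0 \<alpha> b \<in> span {c\<in>blk \<alpha> 1. len b \<le> len c}) \<and>
    (\<forall>b\<in>blk \<alpha> 1. \<forall>c\<in>blk \<alpha> 1. \<beta> (e0 \<alpha> b) (e0 \<alpha> c) = (if b = c then 1 else 0))" ..
  have e0: "e0 \<alpha> b \<in> span {c\<in>blk \<alpha> 1. len b \<le> len c}" if "b \<in> blk \<alpha> 1" for \<alpha> b
    using e0'[THEN spec[of _ \<alpha>]] that by (simp only: simp_thms)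
  have e0b: "\<beta> (e0 \<alpha> b) (e0 \<alpha> c) = (if b = c then 1 else 0)" if "b \<in> blk \<alpha> 1" "c \<in> blk \<alpha> 1" for \<alpha> b c
    using e0'[THEN spec[of _ \<alpha>]] that by (simp only: simp_thms)
  define e where "e b = e0 (ev b) b" for b
  have e: "e b \<in> span {c\<in>blk \<alpha> 1. len b \<le> len c}" if "b \<in> blk \<alpha> 1" for b \<alpha>
    using e0[OF that] that by (simp add: e_def blk_def)
  have e_orth: "\<beta> (e b) (e c) = (if b = c then 1 else 0)" if "b \<in> blk \<alpha> 1" "c \<in> blk \<alpha> 1" for b c \<alpha>
    using e0b[OF that] that by (simp add: e_def blk_def)
  \<comment> \<open>If \<open>b\<close> ends a chain of height \<open>l\<close>, so does every
    eigenvector that occurs in \<open>e b\<close>. Restricting the coefficients to the block of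
    height \<open>l\<close> thus cuts nothing off.\<close>
  have expand_e: "(\<Sum>c\<in>chain_end ` blk \<alpha> l. crd (e b) c *\<^sub>R c) = e b"
    if b: "b \<in> chain_end ` blk \<alpha> l" "1 \<le> l" for b \<alpha> l
  proof -
    have b1: "b \<in> blk \<alpha> 1" using b chain_end_blk by blast
    have DB: "chain_end ` blk \<alpha> l \<subseteq> B" using chain_end_blk blk_subset by blast
    have "{c\<in>blk \<alpha> 1. len b \<le> len c} \<subseteq> chain_end ` blk \<alpha> l" using up[OF b] by blast
    then have eb: "e b \<in> span (chain_end ` blk \<alpha> l)" using e[OF b1] span_mono by blast
    have "crd (e b) c = 0" if c: "c \<notin> chain_end ` blk \<alpha> l" for c
    proof -
      have "representation (chain_end ` blk \<alpha> l) (e b) c = crd (e b) c"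
        using representation_extend[OF indep eb DB] by simp
      then show ?thesis using c representation_ne_zero by metis
    qed
    then have "(\<Sum>c\<in>chain_end ` blk \<alpha> l. crd (e b) c *\<^sub>R c) = (\<Sum>c\<in>B. crd (e b) c *\<^sub>R c)"
      using DB finite_B by (intro sum.mono_neutral_left) auto
    then show ?thesis using expand[of "e b"] by simp
  qed
  define Rb where "Rb b = (\<Sum>c\<in>blk (ev b) (lv b). crd (e (chain_end b)) (chain_end c) *\<^sub>R c)" for b
  define R where "R x = (\<Sum>b\<in>B. crd x b *\<^sub>R Rb b)" for x
  have linR: "linear R"
    unfolding R_def by (intro linear_compose_sum ballI linearI) (simp_all add: scaleR_add_left)
  have R_basis: "R b = Rb b" if "b \<in> B" for b
    unfolding R_def using that by (simp add: crd_basis if_distrib[of "\<lambda>r. r *\<^sub>R _"] finite_B cong: if_cong)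
  have R_blk: "R b = (\<Sum>c\<in>blk \<alpha> l. crd (e (chain_end b)) (chain_end c) *\<^sub>R c)" if "b \<in> blk \<alpha> l" for b \<alpha> l
    using that R_basis[of b] by (simp add: Rb_def blk_def)
  have omega_other: "\<omega> \<alpha> l c = 0" if "c \<in> B" "c \<notin> blk \<alpha> l" for c \<alpha> l
    unfolding \<omega>_def using that blk_subset by (intro sum.neutral) (auto simp: crd_basis)
  have omega_same: "\<omega> \<alpha> l c = chain_end c" if "c \<in> blk \<alpha> l" for c \<alpha> l
  proof -
    have "\<omega> \<alpha> l c = (\<Sum>b\<in>blk \<alpha> l. (if b = c then 1 else 0) *\<^sub>R chain_end b)"
      unfolding \<omega>_def using subsetD[OF blk_subset that] by (simp add: crd_basis)
    then show ?thesis using that blk_finite by (simp add: if_distrib[of "\<lambda>r. r *\<^sub>R _"] cong: if_cong)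
  qed
  have R1: "R b = e b" if "b \<in> blk \<alpha> 1" for b \<alpha>
  proof -
    have "chain_end ` blk \<alpha> 1 = blk \<alpha> 1" using id1 by force
    then have "(\<Sum>c\<in>blk \<alpha> 1. crd (e b) c *\<^sub>R c) = e b" using expand_e[OF blk1[OF that] order_refl] by simp
    then show ?thesis unfolding R_blk[OF that] id1[OF that] using id1 by (simp cong: sum.cong)
  qed
  have omega_R: "\<omega> \<alpha> l (R v) = R (\<omega> \<alpha> l v)" if l: "1 \<le> l" for \<alpha> l v
  proof -
    have "(\<omega> \<alpha> l \<circ> R) v = (R \<circ> \<omega> \<alpha> l) v"
    proof (rule linear_eq_on_B[of "\<omega> \<alpha> l \<circ> R" "R \<circ> \<omega> \<alpha> l"])
      show "linear (\<omega> \<alpha> l \<circ> R)" "linear (R \<circ> \<omega> \<alpha> l)" by (intro linear_compose linR linear_omega)+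
      fix b assume b: "b \<in> B"
      show "(\<omega> \<alpha> l \<circ> R) b = (R \<circ> \<omega> \<alpha> l) b"
      proof (cases "b \<in> blk \<alpha> l")
        case True
        have "\<omega> \<alpha> l (R b) = (\<Sum>c\<in>blk \<alpha> l. crd (e (chain_end b)) (chain_end c) *\<^sub>R chain_end c)"
          unfolding R_blk[OF True] linear_sum[OF linear_omega] linear_scale[OF linear_omega]
          by (intro sum.cong refl) (simp add: omega_same)
        also have "\<dots> = (\<Sum>d\<in>chain_end ` blk \<alpha> l. crd (e (chain_end b)) d *\<^sub>R d)"
          by (simp add: sum.reindex[OF chain_end_inj])
        also have "\<dots> = e (chain_end b)" using True by (intro expand_e l) blast
        also have "\<dots> = R (chain_end b)" using R1[OF chain_end_blk[OF True]] by simp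
        finally show ?thesis by (simp add: omega_same[OF True])
      next
        case False
        have "\<omega> \<alpha> l (R b) = (\<Sum>c\<in>blk (ev b) (lv b). crd (e (chain_end b)) (chain_end c) *\<^sub>R \<omega> \<alpha> l c)"
          unfolding R_basis[OF b] Rb_def linear_sum[OF linear_omega] linear_scale[OF linear_omega] ..
        also have "\<dots> = 0"
        proof (rule sum.neutral, rule ballI)
          fix c assume "c \<in> blk (ev b) (lv b)"
          then have "c \<in> B" "c \<notin> blk \<alpha> l" using False b by (auto simp: blk_def)
          then show "crd (e (chain_end b)) (chain_end c) *\<^sub>R \<omega> \<alpha> l c = 0" using omega_other by simp
        qed
        finally show ?thesis by (simp add: omega_other[OF b False] linear_0[OF linR])
      qed
    qed
    then show ?thesis by simp
  qed
  have RK: "R v \<in> Klev \<alpha>" if "v \<in> Klev \<alpha>" "0 < \<alpha>" for v \<alpha>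
  proof -
    have "v = \<omega> \<alpha> 1 v"
      using Klev_expand[OF that(2,1)] unfolding \<omega>_def by (simp add: id1 cong: sum.cong)
    then have "R v = \<omega> \<alpha> 1 (R v)" using omega_R[of 1 \<alpha> v] by simp
    then show ?thesis using omega_in_Klev by metis
  qed
  have lin': "linear (\<lambda>x. \<beta> x y)" for y using lin[of y] by (simp add: sym[of _ y])
  have orth: "\<beta> (R v) (R w) = (\<Sum>b\<in>blk \<alpha> 1. crd v b * crd w b)"
    if "0 < \<alpha>" "v \<in> Klev \<alpha>" "w \<in> Klev \<alpha>" for \<alpha> v w
  proof -
    have R_exp: "R v = (\<Sum>b\<in>blk \<alpha> 1. crd v b *\<^sub>R e b)" if "v \<in> Klev \<alpha>" for v
    proof -
      have "R v = R (\<Sum>b\<in>blk \<alpha> 1. crd v b *\<^sub>R b)" using Klev_expand[OF \<open>0 < \<alpha>\<close> that] by simp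
      also have "\<dots> = (\<Sum>b\<in>blk \<alpha> 1. crd v b *\<^sub>R e b)"
        unfolding linear_sum[OF linR] linear_scale[OF linR] by (intro sum.cong refl) (simp add: R1)
      finally show ?thesis .
    qed
    have "\<beta> (R v) (R w) = (\<Sum>b\<in>blk \<alpha> 1. \<Sum>c\<in>blk \<alpha> 1. crd v b * (crd w c * \<beta> (e b) (e c)))"
      unfolding R_exp[OF that(2)] R_exp[OF that(3)] linear_sum[OF lin] linear_scale[OF lin]
        linear_sum[OF lin'] linear_scale[OF lin']
      by (simp add: sum_distrib_left mult_ac) (rule sum.swap)
    also have "\<dots> = (\<Sum>b\<in>blk \<alpha> 1. \<Sum>c\<in>blk \<alpha> 1. if b = c then crd v b * crd w c else 0)"
      by (intro sum.cong refl) (simp add: e_orth)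
    also have "\<dots> = (\<Sum>b\<in>blk \<alpha> 1. crd v b * crd w b)" using blk_finite by simp
    finally show ?thesis .
  qed
  \<comment> \<open>Block by block: \<open>\<omega> \<alpha> l\<close> commutes with
    \<open>R\<close>, and on the eigenspace \<open>R\<close> turns the sum of squared coordinates
    into the definite form \<open>\<beta>\<close>, so it kills nothing there.\<close>
  have "inj R"
    unfolding linear_injective_0[OF linR]
  proof (intro allI impI)
    fix v assume v: "R v = 0"
    have "crd v b = 0" if b: "b \<in> B" for b
    proof -
      define \<alpha> where "\<alpha> = ev b"
      define l where "l = lv b"
      have bb: "b \<in> blk \<alpha> l" using b by (simp add: blk_def \<alpha>_def l_def)
      have \<alpha>: "0 < \<alpha>" "1 \<le> l" using ev_pos[OF b] lv_pos[OF b] by (simp_all add: \<alpha>_def l_def)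
      define w where "w = \<omega> \<alpha> l v"
      have "R w = \<omega> \<alpha> l 0" unfolding w_def omega_R[OF \<alpha>(2), symmetric] v ..
      then have "R w = 0" by (simp add: linear_0[OF linear_omega])
      then have "(\<Sum>c\<in>blk \<alpha> 1. crd w c * crd w c) = 0"
        using orth[OF \<alpha>(1), of w w] omega_in_Klev linear_0[OF lin] by (simp add: w_def)
      then have "crd w (chain_end b) * crd w (chain_end b) = 0"
        using sum_nonneg_eq_0_iff[of "blk \<alpha> 1" "\<lambda>c. crd w c * crd w c"] blk_finite chain_end_blk[OF bb] by auto
      then show ?thesis using crd_omega[OF bb, of v] by (simp add: w_def)
    qed
    then show "v = 0" by (intro crd_eqI) simp
  qed
  then have "bij R" using linear_injective_imp_surjective[OF linR] by (simp add: bij_def)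
  have comm_N: "R (N b) = N (R b)" if b: "b \<in> B" for b
  proof -
    define \<alpha> where "\<alpha> = ev b"
    define l where "l = lv b"
    have bb: "b \<in> blk \<alpha> l" using b by (simp add: blk_def \<alpha>_def l_def)
    have NR: "N (R b) = (\<Sum>c\<in>blk \<alpha> l. crd (e (chain_end b)) (chain_end c) *\<^sub>R N c)"
      unfolding R_blk[OF bb] linear_sum[OF linear_N] linear_scale[OF linear_N] ..
    show ?thesis
    proof (cases "l = 1")
      case True
      have "N c = 0" if "c \<in> blk \<alpha> l" for c using that True N_bottom by (auto simp: blk_def)
      moreover from this[OF bb] have "N b = 0" .
      ultimately show ?thesis unfolding NR by (simp add: linear_0[OF linR])
    next
      case False
      then obtain k where k: "l = Suc k" "1 \<le> k" using lv_pos[OF b] by (cases l) (auto simp: l_def)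
      note cN = chain_end_N[OF _ k(2), of _ \<alpha>, folded k(1)]
      have "R (N b) = (\<Sum>d\<in>blk \<alpha> k. crd (e (chain_end b)) (chain_end d) *\<^sub>R d)"
        unfolding R_blk[OF cN(1)[OF bb]] cN(2)[OF bb] ..
      moreover have "N (R b) = (\<Sum>d\<in>N ` blk \<alpha> l. crd (e (chain_end b)) (chain_end d) *\<^sub>R d)"
      proof -
        have "inj_on N (blk \<alpha> l)" by (rule inj_on_subset[OF N_inj]) (use k in \<open>auto simp: blk_def\<close>)
        then show ?thesis unfolding NR by (simp add: sum.reindex cN(2) cong: sum.cong)
      qed
      moreover have "(\<Sum>d\<in>blk \<alpha> k. crd (e (chain_end b)) (chain_end d) *\<^sub>R d)
          = (\<Sum>d\<in>N ` blk \<alpha> l. crd (e (chain_end b)) (chain_end d) *\<^sub>R d)"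
      \<comment> \<open>Vectors at height \<open>k\<close> outside the image of \<open>N\<close>
        belong to chains that stop there; by \<open>expand_e\<close> their coefficients
        vanish.\<close>
      proof (rule sum.mono_neutral_right[OF blk_finite])
        show "N ` blk \<alpha> l \<subseteq> blk \<alpha> k" using cN(1) by blast
        show "\<forall>d\<in>blk \<alpha> k - N ` blk \<alpha> l. crd (e (chain_end b)) (chain_end d) *\<^sub>R d = 0"
        proof
          fix d assume d: "d \<in> blk \<alpha> k - N ` blk \<alpha> l"
          have "chain_end d \<notin> chain_end ` blk \<alpha> l"
          proof
            assume "chain_end d \<in> chain_end ` blk \<alpha> l"
            then obtain c where c: "c \<in> blk \<alpha> l" "chain_end d = chain_end c" by blast
            then have "d = N c" using inj_onD[OF chain_end_inj, of d "N c" \<alpha> k] cN[OF c(1)] d by simp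
            then show False using d c(1) by blast
          qed
          moreover have "e (chain_end b) = (\<Sum>c\<in>chain_end ` blk \<alpha> l. crd (e (chain_end b)) c *\<^sub>R c)"
            using expand_e[of "chain_end b" \<alpha> l] bb lv_pos[OF b] by (simp add: l_def)
          moreover have "chain_end ` blk \<alpha> l \<subseteq> B" "chain_end d \<in> B" using chain_end_blk blk_subset d by blast+
          ultimately have "crd (e (chain_end b)) (chain_end d) = 0" using crd_sum_basis by metis
          then show "crd (e (chain_end b)) (chain_end d) *\<^sub>R d = 0" by simp
        qed
      qed
      ultimately show ?thesis by simp
    qed
  qed
  have comm_pow: "R ((N ^^ j) b) = (N ^^ j) (R b)" if b: "b \<in> B" for b j
  proof (induction j)
    case (Suc j)
    show ?case
    proof (cases "j < lv b")
      case True
      then have "(N ^^ j) b \<in> B" using N_pow[OF b] by blast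
      from comm_N[OF this] show ?thesis using Suc by simp
    next
      case False
      then have "(N ^^ j) b = 0" using N_pow_zero[OF b] by simp
      then show ?thesis using Suc linear_0[OF linear_N] linear_0[OF linR] by simp
    qed
  qed simp
  have comm: "R (\<Phi> t x) = \<Phi> t (R x)" for t x
  proof -
    have "(R \<circ> \<Phi> t) x = (\<Phi> t \<circ> R) x"
    proof (rule linear_eq_on_B[of "R \<circ> \<Phi> t" "\<Phi> t \<circ> R"])
      show "linear (R \<circ> \<Phi> t)" "linear (\<Phi> t \<circ> R)" by (intro linear_compose linR linear_Phi)+
      fix b assume b: "b \<in> B"
      define \<alpha> where "\<alpha> = ev b"
      define l where "l = lv b"
      have bb: "b \<in> blk \<alpha> l" using b by (simp add: blk_def \<alpha>_def l_def)
      define T where "T v = exp (\<alpha> * t) *\<^sub>R (\<Sum>j<l. (t ^ j / fact j) *\<^sub>R (N ^^ j) v)" for v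
      have "linear T"
        unfolding T_def using linear_add[OF linear_N_pow] linear_scale[OF linear_N_pow]
        by (intro linearI) (simp_all add: scaleR_right_distrib sum.distrib scaleR_sum_right mult_ac)
      have T: "\<Phi> t c = T c" if "c \<in> blk \<alpha> l" for c
        using that Phi_basis[of c t] by (simp add: flow_basis_def blk_def T_def)
      have "R (\<Phi> t b) = T (R b)"
        unfolding T[OF bb] T_def linear_scale[OF linR] linear_sum[OF linR] comm_pow[OF b] ..
      also have "\<dots> = \<Phi> t (R b)"
        unfolding R_blk[OF bb] linear_sum[OF \<open>linear T\<close>] linear_scale[OF \<open>linear T\<close>]
          linear_sum[OF linear_Phi] linear_scale[OF linear_Phi]
        by (intro sum.cong refl) (simp add: T)
      finally show "(R \<circ> \<Phi> t) b = (\<Phi> t \<circ> R) b" by simp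
    qed
    then show ?thesis by simp
  qed
  show ?thesis using linR \<open>bij R\<close> comm omega_R RK orth by blast
qed

end

section \<open>Dilation homomorphism and invariant inner product\<close>

lemma continuous_on_det: "continuous_on S (det :: real^'n^'n \<Rightarrow> real)"
  unfolding det_def by (intro continuous_intros)

lemma norm_matrix_le:
  fixes f :: "real^'n \<Rightarrow> real^'n"
  assumes "\<And>v. norm (f v) \<le> c * norm v"
  shows "norm (matrix f) \<le> real CARD('n) * (real CARD('n) * c)"
proof -
  have e: "\<bar>matrix f $ i $ j\<bar> \<le> c" for i j
    using component_le_norm_cart[of "f (axis j 1)" i] assms[of "axis j 1"] by (simp add: matrix_def)
  have "norm (matrix f $ i) \<le> real CARD('n) * c" for i
  proof -
    have "norm (matrix f $ i) \<le> (\<Sum>j\<in>UNIV. \<bar>matrix f $ i $ j\<bar>)" by (rule norm_le_l1_cart)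
    also have "\<dots> \<le> (\<Sum>j\<in>(UNIV::'n set). c)" by (rule sum_mono) (rule e)
    finally show ?thesis by simp
  qed
  then have "(\<Sum>i\<in>UNIV. norm (matrix f $ i)) \<le> (\<Sum>i\<in>(UNIV::'n set). real CARD('n) * c)"
    by (rule sum_mono)
  moreover have "norm (matrix f) \<le> (\<Sum>i\<in>UNIV. norm (matrix f $ i))"
    unfolding norm_vec_def by (rule L2_set_le_sum) simp
  ultimately show ?thesis by simp
qed

lemma det_bounded:
  obtains M where "0 < M" "\<And>A :: real^'n^'n. norm A \<le> c \<Longrightarrow> \<bar>det A\<bar> \<le> M"
proof -
  have "compact ((det :: real^'n^'n \<Rightarrow> real) ` cball 0 c)"
    by (intro compact_continuous_image continuous_on_det compact_cball)
  then have "bounded ((det :: real^'n^'n \<Rightarrow> real) ` cball 0 c)" by (rule compact_imp_bounded)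
  then obtain M where "0 < M" "\<forall>x\<in>(det :: real^'n^'n \<Rightarrow> real) ` cball 0 c. norm x \<le> M"
    using bounded_pos by metis
  then show thesis by (intro that[of M]) auto
qed

context jordan_data
begin

definition basis_map :: "('a \<Rightarrow> 'a) \<Rightarrow> 'a \<Rightarrow> 'a" where "basis_map g x = (\<Sum>b\<in>B. crd x b *\<^sub>R g b)"

lemma linear_basis_map: "linear (basis_map g)"
  unfolding basis_map_def by (intro linear_compose_sum ballI linearI) (simp_all add: scaleR_add_left)

lemma basis_map_basis: "b \<in> B \<Longrightarrow> basis_map g b = g b"
  unfolding basis_map_def by (simp add: crd_basis if_distrib[of "\<lambda>r. r *\<^sub>R _"] finite_B cong: if_cong)

definition fibre_affine :: "('a \<Rightarrow> 'a) \<Rightarrow> bool" where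
  "fibre_affine H \<longleftrightarrow> (\<forall>\<alpha>\<in>ev ` B. midpoint_affine (Elev \<alpha>) (Ulev \<alpha>) H)"

lemma lin_at_facts:
  assumes \<alpha>: "\<alpha> \<in> ev ` B" and H: "qs1 D s H" "fibre_affine H" and u: "u \<in> Klev \<alpha>"
  shows "v \<in> Klev \<alpha> \<Longrightarrow> lin_at \<alpha> H (u + v) = lin_at \<alpha> H u + lin_at \<alpha> H v"
    and "lin_at \<alpha> H (r *\<^sub>R u) = r *\<^sub>R lin_at \<alpha> H u"
    and "lin_at \<alpha> H u \<in> Klev \<alpha>"
    and "norm (lin_at \<alpha> H u) \<le> D * exp (\<alpha> * s) * norm u"
    and "qs1 D' s' H' \<Longrightarrow> fibre_affine H' \<Longrightarrow> lin_at \<alpha> (H' \<circ> H) u = lin_at \<alpha> H' (lin_at \<alpha> H u)"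
proof -
  have pos: "0 < \<alpha>" using \<alpha> ev_pos by auto
  interpret L: flow_level \<Phi> \<mu> \<alpha> "\<omega> \<alpha> 1" "Elev \<alpha>" by (rule flow_level[OF pos])
  note lev = level_K[OF pos]
  have aff: "midpoint_affine (Elev \<alpha>) (Ulev \<alpha>) H" using H(2)[unfolded fibre_affine_def] \<alpha> by (rule bspec)
  note lin = L.midpoint_affine_lin[OF H(1) aff[folded lev(1)], unfolded lev]
  show "v \<in> Klev \<alpha> \<Longrightarrow> lin_at \<alpha> H (u + v) = lin_at \<alpha> H u + lin_at \<alpha> H v"
    by (rule lin(2)[OF u])
  show "lin_at \<alpha> H (r *\<^sub>R u) = r *\<^sub>R lin_at \<alpha> H u" by (rule lin(3)[OF u])
  show "lin_at \<alpha> H u \<in> Klev \<alpha>" by (rule lin(4)[OF u])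
  show "norm (lin_at \<alpha> H u) \<le> D * exp (\<alpha> * s) * norm u" by (rule lin(5)[OF u])
  assume H': "qs1 D' s' H'" "fibre_affine H'"
  have "midpoint_affine (Elev \<alpha>) (Ulev \<alpha>) H'" using H'(2)[unfolded fibre_affine_def] \<alpha> by (rule bspec)
  then show "lin_at \<alpha> (H' \<circ> H) u = lin_at \<alpha> H' (lin_at \<alpha> H u)"
    using L.lin_comp[OF H'(1) _ H(1), unfolded lev] u by blast
qed

lemma lin_at_sum:
  assumes \<alpha>: "\<alpha> \<in> ev ` B" and H: "qs1 D s H" "fibre_affine H" and u: "\<And>i. i \<in> I \<Longrightarrow> u i \<in> Klev \<alpha>"
  shows "lin_at \<alpha> H (\<Sum>i\<in>I. c i *\<^sub>R u i) = (\<Sum>i\<in>I. c i *\<^sub>R lin_at \<alpha> H (u i))"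
  using u
proof (induction I rule: infinite_finite_induct)
  case (insert i I)
  have "c i *\<^sub>R u i \<in> Klev \<alpha>" "(\<Sum>i\<in>I. c i *\<^sub>R u i) \<in> Klev \<alpha>"
    using insert by (auto intro!: subspace_sum[OF subspace_Klev] subspace_scale[OF subspace_Klev])
  then show ?case using insert lin_at_facts(1,2)[OF \<alpha> H] by simp
next
  case empty
  have "0 \<in> Klev \<alpha>" by (rule subspace_0[OF subspace_Klev])
  from lin_at_facts(2)[OF \<alpha> H this, of 0] show ?case by simp
next
  case (infinite I)
  have "0 \<in> Klev \<alpha>" by (rule subspace_0[OF subspace_Klev])
  from lin_at_facts(2)[OF \<alpha> H this, of 0] show ?case using infinite by simp
qed

text \<open>The linear parts at all eigenvalues in one endomorphism of the whole space, so that
  matrices and determinants are available; the identity on the remaining basis vectors is a filler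
  that composes correctly.\<close>

definition leading_part :: "('a \<Rightarrow> 'a) \<Rightarrow> 'a \<Rightarrow> 'a" where
  "leading_part H = basis_map (\<lambda>b. if lv b = 1 then lin_at (ev b) H b else b)"

text \<open>The flow on eigenvectors, with the same filler elsewhere. It is scalar on each
  eigenspace and hence commutes with all leading parts.\<close>

definition dilation :: "real \<Rightarrow> 'a \<Rightarrow> 'a" where
  "dilation s = basis_map (\<lambda>b. if lv b = 1 then exp (ev b * s) *\<^sub>R b else b)"

lemma linear_leading_part: "linear (leading_part H)" and linear_dilation: "linear (dilation s)"
  unfolding leading_part_def dilation_def by (rule linear_basis_map)+

lemma basis_Klev: "b \<in> B \<Longrightarrow> lv b = 1 \<Longrightarrow> b \<in> Klev (ev b)"
  by (rule blk1_in_Klev) (simp add: blk_def)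

lemma leading_part_Klev:
  assumes \<alpha>: "\<alpha> \<in> ev ` B" and H: "qs1 D s H" "fibre_affine H" and v: "v \<in> Klev \<alpha>"
  shows "leading_part H v = lin_at \<alpha> H v"
proof -
  have pos: "0 < \<alpha>" using \<alpha> ev_pos by auto
  have "leading_part H v = leading_part H (\<Sum>b\<in>blk \<alpha> 1. crd v b *\<^sub>R b)" using Klev_expand[OF pos v] by simp
  also have "\<dots> = (\<Sum>b\<in>blk \<alpha> 1. crd v b *\<^sub>R lin_at \<alpha> H b)"
    unfolding linear_sum[OF linear_leading_part] linear_scale[OF linear_leading_part]
    by (intro sum.cong refl) (auto simp: leading_part_def basis_map_basis blk_def)
  also have "\<dots> = lin_at \<alpha> H (\<Sum>b\<in>blk \<alpha> 1. crd v b *\<^sub>R b)"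
    by (rule lin_at_sum[OF \<alpha> H blk1_in_Klev, symmetric])
  finally show ?thesis using Klev_expand[OF pos v] by simp
qed

lemma dilation_Klev:
  assumes "0 < \<alpha>" "v \<in> Klev \<alpha>" shows "dilation s v = exp (\<alpha> * s) *\<^sub>R v"
proof -
  have "dilation s v = dilation s (\<Sum>b\<in>blk \<alpha> 1. crd v b *\<^sub>R b)" using Klev_expand[OF assms] by simp
  also have "\<dots> = exp (\<alpha> * s) *\<^sub>R (\<Sum>b\<in>blk \<alpha> 1. crd v b *\<^sub>R b)"
    unfolding linear_sum[OF linear_dilation] linear_scale[OF linear_dilation] scaleR_sum_right
    by (intro sum.cong refl) (auto simp: dilation_def basis_map_basis blk_def mult.commute)
  finally show ?thesis using Klev_expand[OF assms] by simp
qed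

lemma leading_part_other: "b \<in> B \<Longrightarrow> lv b \<noteq> 1 \<Longrightarrow> leading_part H b = b" and dilation_other: "b \<in> B \<Longrightarrow> lv b \<noteq> 1 \<Longrightarrow> dilation s b = b"
  by (simp_all add: leading_part_def dilation_def basis_map_basis)

lemma dilation_add: "dilation (s + t) v = dilation s (dilation t v)"
proof -
  have "dilation (s + t) v = (dilation s \<circ> dilation t) v"
  proof (rule linear_eq_on_B[of "dilation (s + t)" "dilation s \<circ> dilation t"])
    show "linear (dilation (s + t))" "linear (dilation s \<circ> dilation t)" by (intro linear_compose linear_dilation)+
    fix b assume b: "b \<in> B"
    show "dilation (s + t) b = (dilation s \<circ> dilation t) b"
    proof (cases "lv b = 1")
      case True
      note K = dilation_Klev[OF ev_pos[OF b] basis_Klev[OF b True]]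
      show ?thesis by (simp add: K linear_scale[OF linear_dilation] distrib_left exp_add mult.commute)
    qed (simp add: b dilation_other)
  qed
  then show ?thesis by simp
qed

lemma dilation_0: "dilation 0 v = v"
  using linear_eq_on_B[OF linear_dilation linear_id, of 0 v] by (simp add: dilation_def basis_map_basis)

lemma leading_part_dilation:
  assumes H: "qs1 D s H" "fibre_affine H"
  shows "leading_part H (dilation t v) = dilation t (leading_part H v)"
proof -
  have "(leading_part H \<circ> dilation t) v = (dilation t \<circ> leading_part H) v"
  proof (rule linear_eq_on_B[of "leading_part H \<circ> dilation t" "dilation t \<circ> leading_part H"])
    show "linear (leading_part H \<circ> dilation t)" "linear (dilation t \<circ> leading_part H)" by (intro linear_compose linear_dilation linear_leading_part)+
    fix b assume b: "b \<in> B"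
    show "(leading_part H \<circ> dilation t) b = (dilation t \<circ> leading_part H) b"
    proof (cases "lv b = 1")
      case True
      note K = basis_Klev[OF b True]
      have \<alpha>: "ev b \<in> ev ` B" using b by simp
      have "dilation t (leading_part H b) = exp (ev b * t) *\<^sub>R leading_part H b"
        unfolding leading_part_Klev[OF \<alpha> H K] by (rule dilation_Klev[OF ev_pos[OF b] lin_at_facts(3)[OF \<alpha> H K]])
      then show ?thesis by (simp add: dilation_Klev[OF ev_pos[OF b] K] linear_scale[OF linear_leading_part])
    qed (simp add: b dilation_other leading_part_other)
  qed
  then show ?thesis by simp
qed

lemma leading_part_comp:
  assumes H: "qs1 D s H" "fibre_affine H" and H': "qs1 D' s' H'" "fibre_affine H'"
  shows "leading_part (H' \<circ> H) v = leading_part H' (leading_part H v)"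
proof -
  have "leading_part (H' \<circ> H) v = (leading_part H' \<circ> leading_part H) v"
  proof (rule linear_eq_on_B[of "leading_part (H' \<circ> H)" "leading_part H' \<circ> leading_part H"])
    show "linear (leading_part (H' \<circ> H))" "linear (leading_part H' \<circ> leading_part H)" by (intro linear_compose linear_leading_part)+
    fix b assume b: "b \<in> B"
    show "leading_part (H' \<circ> H) b = (leading_part H' \<circ> leading_part H) b"
    proof (cases "lv b = 1")
      case True
      note K = basis_Klev[OF b True]
      have \<alpha>: "ev b \<in> ev ` B" using b by simp
      have "leading_part (H' \<circ> H) b = lin_at (ev b) (H' \<circ> H) b" using b True by (simp add: leading_part_def basis_map_basis)
      also have "\<dots> = lin_at (ev b) H' (lin_at (ev b) H b)"
        by (rule lin_at_facts(5)[OF \<alpha> H K H'])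
      finally show ?thesis
        using leading_part_Klev[OF \<alpha> H' lin_at_facts(3)[OF \<alpha> H K]] leading_part_Klev[OF \<alpha> H K] by simp
    qed (simp add: b leading_part_other)
  qed
  then show ?thesis by simp
qed

lemma leading_part_id: "leading_part id v = v"
proof -
  have "leading_part id v = id v"
  proof (rule linear_eq_on_B[OF linear_leading_part linear_id])
    fix b assume b: "b \<in> B"
    show "leading_part id b = id b"
    proof (cases "lv b = 1")
      case True
      interpret L: flow_level \<Phi> \<mu> "ev b" "\<omega> (ev b) 1" "Elev (ev b)" by (rule flow_level[OF ev_pos[OF b]])
      have "lin_at (ev b) id b = b"
        using L.lin_id[unfolded level_K[OF ev_pos[OF b]], OF basis_Klev[OF b True]] .
      then show ?thesis using b True by (simp add: leading_part_def basis_map_basis)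
    qed (simp add: b leading_part_other)
  qed
  then show ?thesis by simp
qed

text \<open>On the eigenvectors of \<open>\<alpha>\<close> the stretch
  \<open>exp (\<alpha> * s)\<close> and the dilation combine to
  \<open>exp (\<alpha> * (s + t))\<close>, which an upper bound on \<open>s + t\<close> controls.
  Applying this to inverses as well supplies the other side.\<close>

lemma dilation_leading_part_bounded:
  assumes D: "0 \<le> D"
  obtains \<kappa> where "0 \<le> \<kappa>" "\<And>H s t v. qs1 D s H \<Longrightarrow> fibre_affine H \<Longrightarrow> s + t \<le> m \<Longrightarrow> norm (dilation t (leading_part H v)) \<le> \<kappa> * norm v"
proof (rule that)
  define \<kappa> where "\<kappa> = (\<Sum>b\<in>B. crd_bound * ((1 + D * exp (ev b * m)) * norm b))"
  show "0 \<le> \<kappa>" unfolding \<kappa>_def using D crd_bound(1) by (intro sum_nonneg mult_nonneg_nonneg add_nonneg_nonneg) auto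
  fix H s t v assume H: "qs1 D s H" "fibre_affine H" and st: "s + t \<le> m"
  have b: "norm (dilation t (leading_part H b)) \<le> (1 + D * exp (ev b * m)) * norm b" if b: "b \<in> B" for b
  proof (cases "lv b = 1")
    case True
    note K = basis_Klev[OF b True]
    have \<alpha>: "ev b \<in> ev ` B" using b by simp
    have "norm (dilation t (leading_part H b)) = exp (ev b * t) * norm (lin_at (ev b) H b)"
      unfolding leading_part_Klev[OF \<alpha> H K] dilation_Klev[OF ev_pos[OF b] lin_at_facts(3)[OF \<alpha> H K]] by simp
    also have "\<dots> \<le> exp (ev b * t) * (D * exp (ev b * s) * norm b)"
      by (intro mult_left_mono lin_at_facts(4)[OF \<alpha> H K]) simp
    also have "\<dots> = D * exp (ev b * (s + t)) * norm b" by (simp add: distrib_left exp_add)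
    also have "\<dots> \<le> D * exp (ev b * m) * norm b"
      using st D ev_pos[OF b] by (intro mult_right_mono mult_left_mono) auto
    also have "\<dots> \<le> (1 + D * exp (ev b * m)) * norm b" by (intro mult_right_mono) auto
    finally show ?thesis .
  next
    case False
    have "1 * norm b \<le> (1 + D * exp (ev b * m)) * norm b" using D by (intro mult_right_mono) auto
    then show ?thesis using b False by (simp add: dilation_other leading_part_other)
  qed
  have "dilation t (leading_part H v) = dilation t (leading_part H (\<Sum>b\<in>B. crd v b *\<^sub>R b))" using expand[of v] by simp
  also have "\<dots> = (\<Sum>b\<in>B. crd v b *\<^sub>R dilation t (leading_part H b))"
    unfolding linear_sum[OF linear_leading_part] linear_scale[OF linear_leading_part] linear_sum[OF linear_dilation] linear_scale[OF linear_dilation] ..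
  finally have "norm (dilation t (leading_part H v)) \<le> (\<Sum>b\<in>B. \<bar>crd v b\<bar> * norm (dilation t (leading_part H b)))"
    using norm_sum[of "\<lambda>b. crd v b *\<^sub>R dilation t (leading_part H b)" B] by simp
  also have "\<dots> \<le> (\<Sum>b\<in>B. (crd_bound * norm v) * ((1 + D * exp (ev b * m)) * norm b))"
    using b crd_bound by (intro sum_mono mult_mono) auto
  also have "\<dots> = \<kappa> * norm v" unfolding \<kappa>_def sum_distrib_right by (simp add: mult_ac)
  finally show "norm (dilation t (leading_part H v)) \<le> \<kappa> * norm v" .
qed

end

section \<open>Determinants of leading parts and the invariant form\<close>

locale jordan_data_vec = jordan_data B ev lv N
  for B :: "(real^'n) set" and ev lv N
begin

definition log_det :: "(real^'n \<Rightarrow> real^'n) \<Rightarrow> real" where "log_det f = ln \<bar>det (matrix f)\<bar>"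

lemma log_det_comp:
  fixes f g :: "real^'n \<Rightarrow> real^'n"
  assumes "linear f" "linear g" "det (matrix f) \<noteq> 0" "det (matrix g) \<noteq> 0"
  shows "log_det (f \<circ> g) = log_det f + log_det g"
  using assms matrix_compose[of g f] by (simp add: log_det_def det_mul abs_mult ln_mult)

lemma det_inverse:
  fixes f g :: "real^'n \<Rightarrow> real^'n"
  assumes f: "linear f" and g: "linear g" and fg: "\<And>v. f (g v) = v"
  shows "det (matrix f) * det (matrix g) = 1"
proof -
  have "f \<circ> g = id" using fg by auto
  then have "matrix f ** matrix g = mat 1" using matrix_compose[OF g f] by (simp add: matrix_id_mat_1)
  then show ?thesis by (metis det_I det_mul)
qed

text \<open>A norm bound on \<open>f\<close> bounds its determinant from above; the same bound on
  the inverse keeps it away from 0.\<close>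

lemma log_det_bounded:
  obtains M where "0 \<le> M"
    "\<And>f g. linear f \<Longrightarrow> linear g \<Longrightarrow> (\<And>v. f (g v) = v) \<Longrightarrow>
      (\<And>v. norm (f v) \<le> \<kappa> * norm v) \<Longrightarrow> (\<And>v. norm (g v) \<le> \<kappa> * norm v) \<Longrightarrow> \<bar>log_det f\<bar> \<le> M"
proof -
  obtain M where M: "0 < M" "\<And>A :: real^'n^'n. norm A \<le> real CARD('n) * (real CARD('n) * \<kappa>) \<Longrightarrow> \<bar>det A\<bar> \<le> M"
    using det_bounded by blast
  show thesis
  proof (rule that[of "\<bar>ln M\<bar>"])
    fix f g :: "real^'n \<Rightarrow> real^'n"
    assume f: "linear f" "linear g" and fg: "\<And>v. f (g v) = v"
      and bd: "\<And>v. norm (f v) \<le> \<kappa> * norm v" "\<And>v. norm (g v) \<le> \<kappa> * norm v"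
    have 1: "\<bar>det (matrix f)\<bar> \<le> M" "\<bar>det (matrix g)\<bar> \<le> M" using M(2) norm_matrix_le bd by blast+
    have 2: "\<bar>det (matrix f)\<bar> * \<bar>det (matrix g)\<bar> = 1"
      using det_inverse[OF f fg] by (simp flip: abs_mult)
    then have 3: "0 < \<bar>det (matrix f)\<bar>" "0 < \<bar>det (matrix g)\<bar>" by (auto simp: zero_less_abs_iff)
    have "ln \<bar>det (matrix f)\<bar> + ln \<bar>det (matrix g)\<bar> = 0"
      using 2 3 by (simp flip: ln_mult_pos)
    moreover have "ln \<bar>det (matrix f)\<bar> \<le> ln M" "ln \<bar>det (matrix g)\<bar> \<le> ln M" using 1 3 M(1) by simp_all
    ultimately show "\<bar>log_det f\<bar> \<le> \<bar>ln M\<bar>" unfolding log_det_def by linarith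
  qed simp
qed

text \<open>No determinant is computed: the function is additive in \<open>s\<close> and bounded on
  the unit interval, hence linear.\<close>

lemma log_det_dilation_linear: "log_det (dilation s) = s * log_det (dilation 1)"
proof -
  have nz: "det (matrix (dilation s)) \<noteq> 0" for s
    using det_inverse[OF linear_dilation linear_dilation, of s "- s"] dilation_add[of s "- s"] dilation_0 by auto
  have add: "log_det (dilation (s + t)) = log_det (dilation s) + log_det (dilation t)" for s t
  proof -
    have "dilation (s + t) = dilation s \<circ> dilation t" by (auto simp: dilation_add)
    then show ?thesis using log_det_comp[OF linear_dilation linear_dilation nz nz] by simp
  qed
  \<comment> \<open>The leading part of the identity is the identity, so the general bound for
    leading parts yields one for the dilations.\<close>
  have aff: "fibre_affine id"
  proof -
    have "0 \<in> Ulev \<alpha>" if "\<alpha> \<in> ev ` B" for \<alpha>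
    proof -
      have pos: "0 < \<alpha>" using that ev_pos by auto
      interpret L: flow_level \<Phi> \<mu> \<alpha> "\<omega> \<alpha> 1" "Elev \<alpha>" by (rule flow_level[OF pos])
      show ?thesis using subspace_0[OF L.U_subspace] by (simp only: level_K[OF pos])
    qed
    then show ?thesis by (simp add: fibre_affine_def midpoint_affine_def)
  qed
  obtain \<kappa> where \<kappa>: "\<And>H s t v. qs1 1 s H \<Longrightarrow> fibre_affine H \<Longrightarrow> s + t \<le> 1 \<Longrightarrow> norm (dilation t (leading_part H v)) \<le> \<kappa> * norm v"
    by (rule dilation_leading_part_bounded[of 1 1]) auto
  have bd: "norm (dilation t v) \<le> \<kappa> * norm v" if "t \<le> 1" for t v
    using \<kappa>[OF qs1_id aff, of t v] that by (simp add: leading_part_id)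
  obtain M where M: "\<And>f g. linear f \<Longrightarrow> linear g \<Longrightarrow> (\<And>v. f (g v) = v) \<Longrightarrow>
      (\<And>v. norm (f v) \<le> \<kappa> * norm v) \<Longrightarrow> (\<And>v. norm (g v) \<le> \<kappa> * norm v) \<Longrightarrow> \<bar>log_det f\<bar> \<le> M"
    by (rule log_det_bounded) blast
  have "norm (log_det (dilation (r *\<^sub>R 1))) \<le> M" if "0 \<le> r" "r \<le> 1" for r
  proof -
    have "\<bar>log_det (dilation r)\<bar> \<le> M"
    proof (rule M[of "dilation r" "dilation (- r)"])
      show "dilation r (dilation (- r) v) = v" for v using dilation_add[of r "- r" v] by (simp add: dilation_0)
    qed (use that bd linear_dilation in auto)
    then show ?thesis by simp
  qed
  then have "log_det (dilation (s *\<^sub>R 1)) = s *\<^sub>R log_det (dilation 1)"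
    by (rule additive_bounded_imp_scaleR[OF subspace_UNIV UNIV_I add])
  then show ?thesis by simp
qed

text \<open>As \<open>s\<close> tends to minus infinity, the dilations converge to a map that
  annihilates the eigenvectors. Its determinant is 0, so the logarithm is negative for some negative
  \<open>s\<close>, and linearity fixes the sign at 1.\<close>

lemma log_det_dilation_pos: "0 < log_det (dilation 1)"
proof (rule ccontr)
  assume neg: "\<not> ?thesis"
  define P where "P = basis_map (\<lambda>b. if lv b = 1 then 0 else b)"
  have lim: "((\<lambda>s. dilation s v) \<longlongrightarrow> P v) at_bot" for v
    unfolding dilation_def P_def basis_map_def
  proof (intro tendsto_sum tendsto_scaleR tendsto_const)
    fix b assume b: "b \<in> B"
    have "filterlim (\<lambda>s. ev b * s) at_bot at_bot"
      by (rule filterlim_tendsto_pos_mult_at_bot[OF tendsto_const ev_pos[OF b] filterlim_ident])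
    then have "((\<lambda>s. exp (ev b * s)) \<longlongrightarrow> 0) at_bot" by (rule filterlim_compose[OF exp_at_bot])
    from tendsto_scaleR[OF this tendsto_const[of b]]
    show "((\<lambda>s. if lv b = 1 then exp (ev b * s) *\<^sub>R b else b) \<longlongrightarrow> (if lv b = 1 then 0 else b)) at_bot"
      by simp
  qed
  have "((\<lambda>s. matrix (dilation s)) \<longlongrightarrow> matrix P) at_bot"
    unfolding matrix_def by (intro vec_tendstoI) (simp add: tendsto_vec_nth lim)
  then have "((\<lambda>s. det (matrix (dilation s))) \<longlongrightarrow> det (matrix P)) at_bot"
    using continuous_on_det[of UNIV] by (intro isCont_tendsto_compose[of _ det]) (auto simp: continuous_on_eq_continuous_at)
  moreover have "det (matrix P) = 0"
  proof -
    obtain b where "b \<in> B" using B_nonempty by blast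
    then have c: "chain_end b \<in> B" "lv (chain_end b) = 1" using chain_end_in by (auto simp: blk_def)
    have "P (chain_end b) = 0" using c by (simp add: P_def basis_map_basis)
    moreover have "chain_end b \<noteq> 0" using c(1) indep dependent_zero by metis
    ultimately have "\<not> inj P" using linear_injective_0[OF linear_basis_map] unfolding P_def by blast
    then show ?thesis using det_nz_iff_inj[OF linear_basis_map] unfolding P_def by blast
  qed
  ultimately have "((\<lambda>s. \<bar>det (matrix (dilation s))\<bar>) \<longlongrightarrow> 0) at_bot" using tendsto_rabs_zero by metis
  then have "\<forall>\<^sub>F s in at_bot. \<bar>det (matrix (dilation s))\<bar> < 1" by (rule order_tendstoD) simp
  then have "\<forall>\<^sub>F s in at_bot. \<bar>det (matrix (dilation s))\<bar> < 1 \<and> s \<le> 0"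
    using eventually_le_at_bot by (rule eventually_conj)
  then obtain s where s: "\<bar>det (matrix (dilation s))\<bar> < 1" "s \<le> 0"
    using eventually_happens'[OF trivial_limit_at_bot_linorder] by blast
  have nz: "det (matrix (dilation s)) \<noteq> 0"
    using det_inverse[OF linear_dilation linear_dilation, of s "- s"] dilation_add[of s "- s"] dilation_0 by auto
  have "0 \<le> log_det (dilation s)" using neg s(2) by (simp add: log_det_dilation_linear[of s] mult_nonpos_nonpos)
  then show False using s(1) nz ln_less_zero[of "\<bar>det (matrix (dilation s))\<bar>"] by (simp add: log_det_def)
qed

text \<open>An almost similarity has one parameter \<open>s\<close> for all blocks, so a single
  \<open>\<psi>\<close> has to serve all eigenvalues. This is possible because the dilation exponent
  of \<open>H\<close> is common to them up to a bounded error.\<close>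

theorem invariant_form:
  assumes G: "uniform_group C G" and aff': "\<forall>h\<in>G. fibre_affine h"
  shows "\<exists>\<beta> \<psi>. (\<forall>x. linear (\<beta> x)) \<and> (\<forall>x y. \<beta> x y = \<beta> y x) \<and> (\<forall>x. x \<noteq> 0 \<longrightarrow> 0 < \<beta> x x) \<and>
    (\<forall>\<alpha>\<in>ev ` B. \<forall>H\<in>G. \<forall>v\<in>Klev \<alpha>. \<forall>w\<in>Klev \<alpha>.
      \<beta> (lin_at \<alpha> H v) (lin_at \<alpha> H w) = exp (2 * \<alpha> * \<psi> H) * \<beta> v (w :: real^'n))"
proof -
  note aff = bspec[OF aff']
  define \<tau> where "\<tau> = log_det (dilation 1)"
  have \<tau>: "0 < \<tau>" unfolding \<tau>_def by (rule log_det_dilation_pos)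
  \<comment> \<open>Normalized so that a map whose leading part is \<open>dilation s\<close> has the
    value \<open>s\<close>.\<close>
  define \<psi> where "\<psi> H = log_det (leading_part H) / \<tau>" for H
  have Gid: "id \<in> G" and Gcomp: "\<And>g h. g \<in> G \<Longrightarrow> h \<in> G \<Longrightarrow> g \<circ> h \<in> G"
    and Ginv: "\<And>g. g \<in> G \<Longrightarrow> inv_into UNIV g \<in> G"
    using G by (auto simp: uniform_group_def)
  define sc where "sc H = (SOME s. qs C s H)" for H
  have sc: "qs C (sc H) H" if "H \<in> G" for H
    unfolding sc_def using someI_ex[OF uniform_groupD[OF G that]] .
  have C: "0 \<le> C" using qs1_nonneg[OF qs_qs1[OF sc[OF Gid]]] .
  have comp: "leading_part (g \<circ> h) v = leading_part g (leading_part h v)" if "g \<in> G" "h \<in> G" for g h v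
    by (rule leading_part_comp[OF qs_qs1[OF sc[OF that(2)]] aff[OF that(2)] qs_qs1[OF sc[OF that(1)]] aff[OF that(1)]])
  have inv: "leading_part h (leading_part (inv_into UNIV h) v) = v" "leading_part (inv_into UNIV h) (leading_part h v) = v" if h: "h \<in> G" for h v
  proof -
    have "bij h" using sc[OF h] by (rule qs_bij)
    then have "h \<circ> inv_into UNIV h = id" "inv_into UNIV h \<circ> h = id"
      by (simp_all add: fun_eq_iff bij_is_surj surj_f_inv_f bij_is_inj)
    then show "leading_part h (leading_part (inv_into UNIV h) v) = v" "leading_part (inv_into UNIV h) (leading_part h v) = v"
      using comp[OF h Ginv[OF h], of v] comp[OF Ginv[OF h] h, of v] by (simp_all add: leading_part_id)
  qed
  have nz: "det (matrix (leading_part h)) \<noteq> 0" if "h \<in> G" for h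
    using det_inverse[OF linear_leading_part linear_leading_part inv(1)[OF that]] by auto
  have nzS: "det (matrix (dilation s)) \<noteq> 0" for s
    using det_inverse[OF linear_dilation linear_dilation, of s "- s"] dilation_add[of s "- s"] dilation_0 by auto
  have ldS: "log_det (dilation s) = s * \<tau>" for s unfolding \<tau>_def by (rule log_det_dilation_linear)
  have \<psi>_add: "\<psi> (g \<circ> h) = \<psi> g + \<psi> h" if gh: "g \<in> G" "h \<in> G" for g h
  proof -
    have "leading_part (g \<circ> h) = leading_part g \<circ> leading_part h" using comp[OF gh] by auto
    then show ?thesis using log_det_comp[OF linear_leading_part linear_leading_part nz[OF gh(1)] nz[OF gh(2)]]
      by (simp add: \<psi>_def add_divide_distrib)
  qed
  have LS: "leading_part h (dilation t v) = dilation t (leading_part h v)" if "h \<in> G" for h t v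
    by (rule leading_part_dilation[OF qs_qs1[OF sc[OF that]] aff[OF that]])
  define \<Theta> where "\<Theta> h = dilation (- \<psi> h) \<circ> leading_part h" for h
  have lin\<Theta>: "linear (\<Theta> h)" for h unfolding \<Theta>_def by (intro linear_compose linear_leading_part linear_dilation)
  have \<Theta>_comp: "\<Theta> (g \<circ> h) = \<Theta> g \<circ> \<Theta> h" if gh: "g \<in> G" "h \<in> G" for g h
  proof
    fix v
    have "\<Theta> (g \<circ> h) v = dilation (- \<psi> g) (dilation (- \<psi> h) (leading_part g (leading_part h v)))"
      by (simp add: \<Theta>_def \<psi>_add[OF gh] comp[OF gh] flip: dilation_add)
    also have "\<dots> = (\<Theta> g \<circ> \<Theta> h) v" by (simp add: \<Theta>_def LS[OF gh(1)])
    finally show "\<Theta> (g \<circ> h) v = (\<Theta> g \<circ> \<Theta> h) v" .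
  qed
  have \<psi>id: "\<psi> id = 0" using \<psi>_add[OF Gid Gid] by simp
  have \<Theta>id: "\<Theta> id = id" by (auto simp: \<Theta>_def \<psi>id dilation_0 leading_part_id)
  obtain \<kappa>0 where \<kappa>0: "\<And>H s t v. qs1 C s H \<Longrightarrow> fibre_affine H \<Longrightarrow> s + t \<le> 0 \<Longrightarrow> norm (dilation t (leading_part H v)) \<le> \<kappa>0 * norm v"
    by (rule dilation_leading_part_bounded[OF C, of 0]) blast
  obtain M where M: "\<And>f g. linear f \<Longrightarrow> linear g \<Longrightarrow> (\<And>v. f (g v) = v) \<Longrightarrow>
      (\<And>v. norm (f v) \<le> \<kappa>0 * norm v) \<Longrightarrow> (\<And>v. norm (g v) \<le> \<kappa>0 * norm v) \<Longrightarrow> \<bar>log_det f\<bar> \<le> M"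
    by (rule log_det_bounded) blast
  \<comment> \<open>With the exponent \<open>sc h\<close> divided out, the leading part of
    \<open>h\<close> and its inverse are bounded uniformly over the group, hence so is the logarithm
    of the determinant, which is \<open>(\<psi> h - sc h) * \<tau>\<close>.\<close>
  have close: "\<bar>\<psi> h - sc h\<bar> \<le> M / \<tau>" if h: "h \<in> G" for h
  proof -
    let ?i = "inv_into UNIV h"
    have "\<bar>log_det (dilation (- sc h) \<circ> leading_part h)\<bar> \<le> M"
    proof (rule M[of _ "dilation (sc h) \<circ> leading_part ?i"])
      show "linear (dilation (- sc h) \<circ> leading_part h)" "linear (dilation (sc h) \<circ> leading_part ?i)"
        by (intro linear_compose linear_leading_part linear_dilation)+
      show "(dilation (- sc h) \<circ> leading_part h) ((dilation (sc h) \<circ> leading_part ?i) v) = v" for v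
        using dilation_add[of "- sc h" "sc h" v] by (simp add: LS[OF h] inv[OF h] dilation_0)
      show "norm ((dilation (- sc h) \<circ> leading_part h) v) \<le> \<kappa>0 * norm v" for v
        using \<kappa>0[OF qs_qs1[OF sc[OF h]] aff[OF h], of "- sc h" v] by simp
      show "norm ((dilation (sc h) \<circ> leading_part ?i) v) \<le> \<kappa>0 * norm v" for v
        using \<kappa>0[OF qs_qs1[OF qs_inv[OF sc[OF h]]] aff[OF Ginv[OF h]], of "sc h" v] by simp
    qed
    moreover have "log_det (dilation (- sc h) \<circ> leading_part h) = (\<psi> h - sc h) * \<tau>"
      unfolding log_det_comp[OF linear_dilation linear_leading_part nzS nz[OF h]] ldS using \<tau> by (simp add: \<psi>_def field_simps)
    ultimately show ?thesis using \<tau> by (simp add: abs_mult pos_le_divide_eq)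
  qed
  obtain \<kappa> where \<kappa>: "\<And>H s t v. qs1 C s H \<Longrightarrow> fibre_affine H \<Longrightarrow> s + t \<le> M / \<tau> \<Longrightarrow> norm (dilation t (leading_part H v)) \<le> \<kappa> * norm v"
    by (rule dilation_leading_part_bounded[OF C, of "M / \<tau>"]) blast
  define Ms where "Ms = (\<lambda>h. matrix (\<Theta> h)) ` G"
  obtain q where q: "transpose q = q" "\<And>x. x \<noteq> 0 \<Longrightarrow> 0 < x \<bullet> (q *v x)"
    "\<And>g. g \<in> Ms \<Longrightarrow> transpose g ** q ** g = q"
  proof (rule bounded_group_invariant_form[of Ms])
    show "mat 1 \<in> Ms" unfolding Ms_def using Gid \<Theta>id matrix_id_mat_1 by (metis imageI)
    have mm: "matrix (\<Theta> g) ** matrix (\<Theta> h) = matrix (\<Theta> (g \<circ> h))" if "g \<in> G" "h \<in> G" for g h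
      unfolding \<Theta>_comp[OF that] by (rule matrix_compose[OF lin\<Theta> lin\<Theta>, symmetric])
    show "g ** h \<in> Ms" if "g \<in> Ms" "h \<in> Ms" for g h
      using that mm Gcomp unfolding Ms_def by auto
    show "\<exists>h\<in>Ms. g ** h = mat 1 \<and> h ** g = mat 1" if "g \<in> Ms" for g
    proof -
      obtain h where h: "g = matrix (\<Theta> h)" "h \<in> G" using \<open>g \<in> Ms\<close> unfolding Ms_def by blast
      have "bij h" using sc[OF h(2)] by (rule qs_bij)
      then have "h \<circ> inv_into UNIV h = id" "inv_into UNIV h \<circ> h = id"
        by (simp_all add: fun_eq_iff bij_is_surj surj_f_inv_f bij_is_inj)
      then have "g ** matrix (\<Theta> (inv_into UNIV h)) = mat 1" "matrix (\<Theta> (inv_into UNIV h)) ** g = mat 1"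
        unfolding h(1) mm[OF h(2) Ginv[OF h(2)]] mm[OF Ginv[OF h(2)] h(2)] by (simp_all add: \<Theta>id matrix_id_mat_1)
      then show ?thesis using Ginv[OF h(2)] unfolding Ms_def by blast
    qed
    show "norm g \<le> real CARD('n) * (real CARD('n) * \<kappa>)" if "g \<in> Ms" for g
    proof -
      obtain h where h: "g = matrix (\<Theta> h)" "h \<in> G" using \<open>g \<in> Ms\<close> unfolding Ms_def by blast
      show ?thesis unfolding h(1)
      proof (rule norm_matrix_le)
        fix v
        have "sc h + - \<psi> h \<le> M / \<tau>" using close[OF h(2)] by linarith
        from \<kappa>[OF qs_qs1[OF sc[OF h(2)]] aff[OF h(2)] this]
        show "norm (\<Theta> h v) \<le> \<kappa> * norm v" by (simp add: \<Theta>_def)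
      qed
    qed
  qed blast
  define \<beta> where "\<beta> x y = x \<bullet> (q *v y)" for x y
  have "linear (\<beta> x)" for x
    unfolding \<beta>_def by (rule linearI) (simp_all add: matrix_vector_right_distrib inner_add_right matrix_vector_mult_scaleR)
  moreover have "\<beta> x y = \<beta> y x" for x y
    unfolding \<beta>_def using q(1) by (metis dot_lmul_matrix inner_commute vector_transpose_matrix)
  moreover have "0 < \<beta> x x" if "x \<noteq> 0" for x unfolding \<beta>_def by (rule q(2)[OF that])
  moreover have "\<beta> (lin_at \<alpha> H v) (lin_at \<alpha> H w) = exp (2 * \<alpha> * \<psi> H) * \<beta> v w"
    if \<alpha>: "\<alpha> \<in> ev ` B" and H: "H \<in> G" and vw: "v \<in> Klev \<alpha>" "w \<in> Klev \<alpha>" for \<alpha> H v w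
  proof -
    have pos: "0 < \<alpha>" using \<alpha> ev_pos by auto
    note Hq = qs_qs1[OF sc[OF H]] aff[OF H]
    have \<Theta>: "\<Theta> H v = exp (- \<alpha> * \<psi> H) *\<^sub>R lin_at \<alpha> H v" if v: "v \<in> Klev \<alpha>" for v
      using dilation_Klev[OF pos lin_at_facts(3)[OF \<alpha> Hq v]] by (simp add: \<Theta>_def leading_part_Klev[OF \<alpha> Hq v])
    have "matrix (\<Theta> H) *v x = \<Theta> H x" for x using matrix_vector_mul(2)[OF lin\<Theta>] by metis
    then have "\<beta> (\<Theta> H v) (\<Theta> H w) = (matrix (\<Theta> H) *v v) \<bullet> (q *v (matrix (\<Theta> H) *v w))" by (simp add: \<beta>_def)
    also have "\<dots> = v \<bullet> ((transpose (matrix (\<Theta> H)) ** q ** matrix (\<Theta> H)) *v w)"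
      unfolding matrix_vector_mul_assoc[symmetric] dot_lmul_matrix[symmetric] vector_transpose_matrix ..
    also have "transpose (matrix (\<Theta> H)) ** q ** matrix (\<Theta> H) = q" by (rule q(3)) (use H in \<open>simp add: Ms_def\<close>)
    finally have "\<beta> v w = \<beta> (\<Theta> H v) (\<Theta> H w)" by (simp add: \<beta>_def)
    also have "\<dots> = exp (- \<alpha> * \<psi> H) * exp (- \<alpha> * \<psi> H) * \<beta> (lin_at \<alpha> H v) (lin_at \<alpha> H w)"
      unfolding \<Theta>[OF vw(1)] \<Theta>[OF vw(2)] \<beta>_def by (simp add: matrix_vector_mult_scaleR)
    finally have eq: "\<beta> v w = exp (- \<alpha> * \<psi> H) * exp (- \<alpha> * \<psi> H) * \<beta> (lin_at \<alpha> H v) (lin_at \<alpha> H w)" .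
    have "exp (2 * \<alpha> * \<psi> H) * (exp (- \<alpha> * \<psi> H) * exp (- \<alpha> * \<psi> H)) = 1"
      by (simp flip: exp_add)
    then show ?thesis unfolding eq by (simp add: mult.assoc[symmetric])
  qed
  ultimately show ?thesis by blast
qed

end

section \<open>Almost similarities\<close>

context jordan_data
begin

text \<open>For a square matrix a left inverse is a right inverse. The index set is a part of the
  basis instead of a type, so the matrix is extended by the identity to an endomorphism, for which
  injectivity implies surjectivity.\<close>

lemma orthogonal_columns_imp_rows:
  assumes S: "S \<subseteq> B" and Q: "orthogonal_matrix_on S Q" and b: "b \<in> S"
  shows "(\<Sum>c\<in>S. Q b c * (\<Sum>d\<in>S. Q d c * t d)) = t b"
proof -
  have fS: "finite S" using S finite_B finite_subset by blast
  define L where "L = basis_map (\<lambda>c. if c \<in> S then \<Sum>b\<in>S. Q b c *\<^sub>R b else c)"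
  have crd_L: "crd (L x) b = (if b \<in> S then \<Sum>c\<in>S. Q b c * crd x c else crd x b)" if b: "b \<in> B" for x b
  proof -
    have "crd (L x) b = (\<Sum>c\<in>B. crd x c * crd (if c \<in> S then \<Sum>b\<in>S. Q b c *\<^sub>R b else c) b)"
      unfolding L_def basis_map_def crd_sum by simp
    also have "\<dots> = (\<Sum>c\<in>B. crd x c * (if c \<in> S then if b \<in> S then Q b c else 0 else if b = c then 1 else 0))"
      by (intro sum.cong refl arg_cong2[where f = "(*)"]) (simp add: crd_sum_basis[OF S b] crd_basis)
    also have "\<dots> = (if b \<in> S then \<Sum>c\<in>S. Q b c * crd x c else crd x b)"
    proof (cases "b \<in> S")
      case True
      have "(\<Sum>c\<in>B. crd x c * (if c \<in> S then if b \<in> S then Q b c else 0 else if b = c then 1 else 0))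
          = (\<Sum>c\<in>B. if c \<in> S then Q b c * crd x c else 0)"
        using True by (intro sum.cong) auto
      also have "\<dots> = (\<Sum>c\<in>S. Q b c * crd x c)"
        using S finite_B by (simp add: sum.inter_restrict[symmetric] Int_absorb1)
      finally show ?thesis using True by simp
    next
      case False
      have "(\<Sum>c\<in>B. crd x c * (if c \<in> S then if b \<in> S then Q b c else 0 else if b = c then 1 else 0))
          = (\<Sum>c\<in>B. if b = c then crd x c else 0)"
        using False by (intro sum.cong) auto
      then show ?thesis using False b finite_B by simp
    qed
    finally show ?thesis .
  qed
  have inner: "(\<Sum>d\<in>S. Q d c * (\<Sum>c'\<in>S. Q d c' * u c')) = u c" if c: "c \<in> S" for u c
  proof -
    have "(\<Sum>d\<in>S. Q d c * (\<Sum>c'\<in>S. Q d c' * u c')) = (\<Sum>c'\<in>S. (\<Sum>d\<in>S. Q d c * Q d c') * u c')"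
      unfolding sum_distrib_left sum_distrib_right by (subst sum.swap) (simp only: mult.assoc)
    also have "\<dots> = (\<Sum>c'\<in>S. if c = c' then u c' else 0)"
      using Q c by (intro sum.cong) (auto simp: orthogonal_matrix_on_def)
    finally show ?thesis using c fS by simp
  qed
  have "inj L"
    unfolding L_def linear_injective_0[OF linear_basis_map] unfolding L_def[symmetric]
  proof (intro allI impI crd_eqI)
    fix x b assume x: "L x = 0" and b: "b \<in> B"
    show "crd x b = crd 0 b"
    proof (cases "b \<in> S")
      case True
      have "(\<Sum>c'\<in>S. Q d c' * crd x c') = 0" if "d \<in> S" for d using crd_L[of d x] x S that by auto
      then show ?thesis using inner[OF True, of "crd x"] by simp
    next
      case False
      then show ?thesis using crd_L[OF b, of x] x by simp
    qed
  qed
  then have "surj L" using linear_injective_imp_surjective[OF linear_basis_map] by (simp add: L_def)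
  then obtain x where x: "L x = (\<Sum>b\<in>S. t b *\<^sub>R b)" by (metis surjD)
  have t: "t d = (\<Sum>c\<in>S. Q d c * crd x c)" if "d \<in> S" for d
    using crd_L[of d x] x crd_sum_basis[OF S, of d t] S that by auto
  have "(\<Sum>d\<in>S. Q d c * t d) = crd x c" if "c \<in> S" for c
    using inner[OF that, of "crd x"] by (simp add: t cong: sum.cong)
  then show ?thesis using t[OF b] by (simp cong: sum.cong)
qed

text \<open>The nilpotent part lowers heights. Inside \<open>V \<alpha> l\<close> nothing lies above
  height \<open>l\<close> of \<open>\<alpha>\<close>, so the top block receives no contribution from
  other vectors and the flow is scalar on it.\<close>

lemma crd_Phi_V:
  assumes v: "v \<in> V \<alpha> l" and d: "d \<in> blk \<alpha> l"
  shows "crd (\<Phi> t v) d = exp (\<alpha> * t) * crd v d"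
proof -
  have dB: "d \<in> B" "ev d = \<alpha>" "lv d = l" using d by (auto simp: blk_def)
  have l: "1 \<le> l" using lv_pos[OF dB(1)] dB(3) by simp
  have "crd (flow_basis t b) d = (if b = d then exp (\<alpha> * t) else 0)" if b: "b \<in> B" "below \<alpha> l b" for b
  proof -
    have "crd ((N ^^ j) b) d = (if j = 0 \<and> b = d then 1 else 0)" if j: "j < lv b" for j
    proof -
      have *: "(N ^^ j) b \<in> B" "ev ((N ^^ j) b) = ev b" "lv ((N ^^ j) b) = lv b - j" using N_pow[OF b(1) j] by auto
      have "(N ^^ j) b = d \<longleftrightarrow> j = 0 \<and> b = d"
      proof
        assume e: "(N ^^ j) b = d"
        then have "ev b = \<alpha>" "lv b - j = l" using * dB by auto
        then have "j = 0" using b(2) l by (auto simp: below_def)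
        then show "j = 0 \<and> b = d" using e by simp
      qed auto
      then show ?thesis using crd_basis[OF *(1), of d] by auto
    qed
    then have "(\<Sum>j<lv b. t ^ j / fact j * crd ((N ^^ j) b) d) = (\<Sum>j<lv b. if j = 0 then if b = d then 1 else 0 else 0)"
      by (intro sum.cong) auto
    also have "\<dots> = (if b = d then 1 else 0)" using lv_pos[OF b(1)] by simp
    finally show ?thesis using dB(2) by (auto simp: flow_basis_def crd_sum)
  qed
  then have "crd (\<Phi> t v) d = (\<Sum>b\<in>B. if b = d then crd v b * exp (\<alpha> * t) else 0)"
    unfolding \<Phi>_def crd_sum using v by (intro sum.cong) (auto simp: V_def)
  then show ?thesis using dB(1) finite_B by simp
qed

definition blocks :: "(real \<times> nat) set" where "blocks = (\<lambda>b. (ev b, lv b)) ` B"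

text \<open>The explicit form demanded by \<open>ASim\<close>, expressed with the data of the locale
  and with \<open>\<Phi>\<close> in place of the matrix exponential.\<close>

definition almost_similarity :: "('a \<Rightarrow> 'a) \<Rightarrow> bool" where
  "almost_similarity f \<longleftrightarrow> (\<exists>(s::real) (Q :: real \<times> nat \<Rightarrow> 'a \<Rightarrow> 'a \<Rightarrow> real) (T :: real \<times> nat \<Rightarrow> 'a \<Rightarrow> 'a \<Rightarrow> real).
     (\<forall>p\<in>blocks. orthogonal_matrix_on (blk (fst p) (snd p)) (Q p)) \<and>
     (\<forall>p\<in>blocks. \<forall>x y.
        (\<forall>q\<in>blocks. block_less p q \<longrightarrow> (\<forall>b\<in>blk (fst q) (snd q). crd x b = crd y b)) \<longrightarrow>
        (\<forall>c\<in>blk (fst p) (snd p). T p x c = T p y c)) \<and>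
     (\<forall>x. f x = \<Phi> s (\<Sum>p\<in>blocks. \<Sum>b\<in>blk (fst p) (snd p).
        (\<Sum>c\<in>blk (fst p) (snd p). Q p b c * (crd x c + T p x c)) *\<^sub>R b)))"

text \<open>\<open>Q\<close> is the normalized matrix of \<open>\<Lambda>\<close> on the chain ends
  of a block, and \<open>T\<close> is whatever the formula leaves over; the formula itself then only
  needs that rows of \<open>Q\<close> are orthonormal. The substance is that \<open>T\<close>
  ignores the block and all lower ones: points that agree above differ by an element of
  \<open>V\<close>, for which \<open>level\<close> gives the increment.\<close>

lemma almost_similarityI:
  fixes \<Lambda> :: "real \<Rightarrow> 'a \<Rightarrow> 'a"
  assumes f: "qs1 D r f"
    and level: "\<And>\<alpha> l x u. \<alpha> \<in> ev ` B \<Longrightarrow> 1 \<le> l \<Longrightarrow> u \<in> V \<alpha> l \<Longrightarrow> \<omega> \<alpha> l (f (x + u) - f x) = \<Lambda> \<alpha> (\<omega> \<alpha> l u)"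
    and lin: "\<And>\<alpha> S c. \<alpha> \<in> ev ` B \<Longrightarrow> S \<subseteq> Klev \<alpha> \<Longrightarrow> finite S \<Longrightarrow> \<Lambda> \<alpha> (\<Sum>u\<in>S. c u *\<^sub>R u) = (\<Sum>u\<in>S. c u *\<^sub>R \<Lambda> \<alpha> u)"
    and orth: "\<And>\<alpha> v w. \<alpha> \<in> ev ` B \<Longrightarrow> v \<in> Klev \<alpha> \<Longrightarrow> w \<in> Klev \<alpha> \<Longrightarrow>
      (\<Sum>b\<in>blk \<alpha> 1. crd (\<Lambda> \<alpha> v) b * crd (\<Lambda> \<alpha> w) b) = exp (2 * \<alpha> * s) * (\<Sum>b\<in>blk \<alpha> 1. crd v b * crd w b)"
  shows "almost_similarity f"
proof -
  define Q where "Q p b c = exp (- fst p * s) * crd (\<Lambda> (fst p) (chain_end c)) (chain_end b)"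
    for p :: "real \<times> nat" and b c
  define t where "t x b = crd (\<Phi> (- s) (f x)) b" for x b
  \<comment> \<open>Solves the desired formula for \<open>T\<close>, with the transpose of
    \<open>Q\<close> in the role of its inverse.\<close>
  define T where "T p x c = (\<Sum>d\<in>blk (fst p) (snd p). Q p d c * t x d) - crd x c" for p :: "real \<times> nat" and x c
  have p: "fst p \<in> ev ` B" "0 < fst p" "1 \<le> snd p" if "p \<in> blocks" for p
    using that ev_pos lv_pos by (auto simp: blocks_def)
  have fin: "finite (blk \<alpha> l)" for \<alpha> l by (rule blk_finite)
  have orthQ: "orthogonal_matrix_on (blk (fst p) (snd p)) (Q p)" if pb: "p \<in> blocks" for p
    unfolding orthogonal_matrix_on_def
  proof (intro ballI)
    fix b c assume bc: "b \<in> blk (fst p) (snd p)" "c \<in> blk (fst p) (snd p)"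
    define \<alpha> where "\<alpha> = fst p"
    define l where "l = snd p"
    note bc' = bc[folded \<alpha>_def l_def]
    note p' = p[OF pb, folded \<alpha>_def l_def]
    let ?E = "chain_end ` blk \<alpha> l"
    have E: "?E \<subseteq> blk \<alpha> 1" using chain_end_blk by blast
    \<comment> \<open>A block uses only a corner of the matrix of \<open>\<Lambda>\<close>. That
      corner is orthogonal because \<open>\<Lambda>\<close> maps the ends of this block to values of
      \<open>\<omega> \<alpha> l\<close>, which have no component on ends of shorter chains.\<close>
    have zero: "crd (\<Lambda> \<alpha> (chain_end b)) e = 0" if e: "e \<in> blk \<alpha> 1 - ?E" and b: "b \<in> blk \<alpha> l" for b e
    proof -
      have bB: "b \<in> B" using b blk_subset by blast
      have bV: "b \<in> V \<alpha> l" using b by (auto simp: V_def below_def blk_def crd_basis)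
      have "\<omega> \<alpha> l b = chain_end b"
      proof -
        have "\<omega> \<alpha> l b = (\<Sum>c\<in>blk \<alpha> l. if c = b then chain_end c else 0)"
          unfolding \<omega>_def using bB by (intro sum.cong) (auto simp: crd_basis)
        then show ?thesis using b fin by simp
      qed
      then have "\<Lambda> \<alpha> (chain_end b) = \<omega> \<alpha> l (f (0 + b) - f 0)" using level[OF p'(1,3) bV, of 0] by simp
      also have "crd \<dots> e = 0"
      proof -
        have "e \<in> B" using e blk_subset by blast
        have "\<omega> \<alpha> l v = (\<Sum>c\<in>?E. crd v (inv_into (blk \<alpha> l) chain_end c) *\<^sub>R c)" for v
          unfolding \<omega>_def by (subst sum.reindex[OF chain_end_inj]) (simp add: inv_into_f_f[OF chain_end_inj] cong: sum.cong)
        moreover have "?E \<subseteq> B" using E blk_subset by blast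
        ultimately show ?thesis using crd_sum_basis[of ?E e] \<open>e \<in> B\<close> e by simp
      qed
      finally show ?thesis .
    qed
    have ceK: "chain_end b \<in> Klev \<alpha>" if "b \<in> blk \<alpha> l" for b using chain_end_blk[OF that] by (rule blk1_in_Klev)
    have ceB: "chain_end b \<in> B" if "b \<in> blk \<alpha> l" for b using chain_end_blk[OF that] blk_subset by blast
    have "(\<Sum>d\<in>blk \<alpha> l. Q p d b * Q p d c)
        = exp (- 2 * \<alpha> * s) * (\<Sum>d\<in>blk \<alpha> l. crd (\<Lambda> \<alpha> (chain_end b)) (chain_end d) * crd (\<Lambda> \<alpha> (chain_end c)) (chain_end d))"
      unfolding Q_def \<alpha>_def[symmetric] sum_distrib_left by (intro sum.cong refl) (simp add: mult_ac flip: exp_add)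
    also have "(\<Sum>d\<in>blk \<alpha> l. crd (\<Lambda> \<alpha> (chain_end b)) (chain_end d) * crd (\<Lambda> \<alpha> (chain_end c)) (chain_end d))
        = (\<Sum>e\<in>?E. crd (\<Lambda> \<alpha> (chain_end b)) e * crd (\<Lambda> \<alpha> (chain_end c)) e)"
      by (simp add: sum.reindex[OF chain_end_inj])
    also have "\<dots> = (\<Sum>e\<in>blk \<alpha> 1. crd (\<Lambda> \<alpha> (chain_end b)) e * crd (\<Lambda> \<alpha> (chain_end c)) e)"
      using zero[OF _ bc'(1)] E by (intro sum.mono_neutral_left fin) auto
    also have "\<dots> = exp (2 * \<alpha> * s) * (\<Sum>e\<in>blk \<alpha> 1. crd (chain_end b) e * crd (chain_end c) e)"
      by (rule orth[OF p'(1) ceK[OF bc'(1)] ceK[OF bc'(2)]])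
    also have "(\<Sum>e\<in>blk \<alpha> 1. crd (chain_end b) e * crd (chain_end c) e)
        = (\<Sum>e\<in>blk \<alpha> 1. if e = chain_end b then if b = c then 1 else 0 else 0)"
      using inj_onD[OF chain_end_inj _ bc'] by (intro sum.cong) (auto simp: crd_basis[OF ceB[OF bc'(1)]] crd_basis[OF ceB[OF bc'(2)]])
    also have "\<dots> = (if b = c then 1 else 0)" using chain_end_blk[OF bc'(1)] fin by simp
    finally show "(\<Sum>d\<in>blk (fst p) (snd p). Q p d b * Q p d c) = (if b = c then 1 else 0)"
      unfolding \<alpha>_def l_def by (simp flip: exp_add)
  qed
  have key: "t y b - t x b = (\<Sum>c\<in>blk (fst p) (snd p). Q p b c * crd (y - x) c)"
    if pb: "p \<in> blocks" and yx: "y - x \<in> V (fst p) (snd p)" and b: "b \<in> blk (fst p) (snd p)" for p x y b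
  proof -
    define \<alpha> where "\<alpha> = fst p"
    define l where "l = snd p"
    note p' = p[OF pb, folded \<alpha>_def l_def]
    note yx' = yx[folded \<alpha>_def l_def] and b' = b[folded \<alpha>_def l_def]
    have V: "f y - f x \<in> V \<alpha> l" by (rule qs1_V[OF p'(2,3) f yx'])
    have "t y b - t x b = crd (\<Phi> (- s) (f y - f x)) b" by (simp add: t_def)
    also have "\<dots> = exp (- \<alpha> * s) * crd (f (x + (y - x)) - f x) b"
      using crd_Phi_V[OF V b', of "- s"] by simp
    also have "crd (f (x + (y - x)) - f x) b = crd (\<omega> \<alpha> l (f (x + (y - x)) - f x)) (chain_end b)"
      by (rule crd_omega[OF b', symmetric])
    also have "\<dots> = crd (\<Lambda> \<alpha> (\<omega> \<alpha> l (y - x))) (chain_end b)" unfolding level[OF p'(1,3) yx'] ..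
    also have "\<Lambda> \<alpha> (\<omega> \<alpha> l (y - x)) = (\<Sum>c\<in>blk \<alpha> l. crd (y - x) c *\<^sub>R \<Lambda> \<alpha> (chain_end c))"
    proof -
      define g where "g = inv_into (blk \<alpha> l) chain_end"
      have g: "g (chain_end c) = c" if "c \<in> blk \<alpha> l" for c
        unfolding g_def using that by (rule inv_into_f_f[OF chain_end_inj])
      have "\<omega> \<alpha> l (y - x) = (\<Sum>e\<in>chain_end ` blk \<alpha> l. crd (y - x) (g e) *\<^sub>R e)"
        unfolding \<omega>_def sum.reindex[OF chain_end_inj] by (intro sum.cong refl) (simp add: g)
      also have "\<Lambda> \<alpha> \<dots> = (\<Sum>e\<in>chain_end ` blk \<alpha> l. crd (y - x) (g e) *\<^sub>R \<Lambda> \<alpha> e)"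
        using blk1_in_Klev[OF chain_end_blk] fin by (intro lin[OF p'(1)]) auto
      also have "\<dots> = (\<Sum>c\<in>blk \<alpha> l. crd (y - x) c *\<^sub>R \<Lambda> \<alpha> (chain_end c))"
        unfolding sum.reindex[OF chain_end_inj] by (intro sum.cong refl) (simp add: g)
      finally show ?thesis .
    qed
    finally show ?thesis
      unfolding Q_def \<alpha>_def l_def crd_sum sum_distrib_left crd_simps(3)
      by (simp only: mult_ac)
  qed
  have indep: "T p x c = T p y c"
    if pb: "p \<in> blocks" and c: "c \<in> blk (fst p) (snd p)"
      and agree: "\<forall>q\<in>blocks. block_less p q \<longrightarrow> (\<forall>b\<in>blk (fst q) (snd q). crd x b = crd y b)" for p x y c
  proof -
    have yx: "y - x \<in> V (fst p) (snd p)"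
      unfolding V_def
    proof (intro CollectI ballI impI)
      fix b assume b: "b \<in> B" "crd (y - x) b \<noteq> 0"
      have "(ev b, lv b) \<in> blocks" "b \<in> blk (fst (ev b, lv b)) (snd (ev b, lv b))" using b(1) by (auto simp: blocks_def blk_def)
      then have "\<not> block_less p (ev b, lv b)" using agree b(2) by auto
      then show "below (fst p) (snd p) b" by (cases p) (auto simp: block_less_def below_def)
    qed
    define S where "S = blk (fst p) (snd p)"
    define u where "u = crd (y - x)"
    have "T p y c - T p x c = (\<Sum>d\<in>S. Q p d c * (t y d - t x d)) - u c"
      unfolding T_def S_def[symmetric] u_def by (simp add: right_diff_distrib sum_subtractf)
    also have "(\<Sum>d\<in>S. Q p d c * (t y d - t x d)) = (\<Sum>d\<in>S. Q p d c * (\<Sum>c'\<in>S. Q p d c' * u c'))"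
      using key[OF pb yx] unfolding S_def u_def by (intro sum.cong refl) simp
    also have "\<dots> = (\<Sum>c'\<in>S. (\<Sum>d\<in>S. Q p d c * Q p d c') * u c')"
      unfolding sum_distrib_left sum_distrib_right by (subst sum.swap) (simp only: mult.assoc)
    also have "\<dots> = (\<Sum>c'\<in>S. if c = c' then u c' else 0)"
      using orthQ[OF pb] c unfolding S_def by (intro sum.cong) (auto simp: orthogonal_matrix_on_def)
    also have "\<dots> = u c" using c fin by (simp add: S_def)
    finally show ?thesis by simp
  qed
  have formula: "f x = \<Phi> s (\<Sum>p\<in>blocks. \<Sum>b\<in>blk (fst p) (snd p).
        (\<Sum>c\<in>blk (fst p) (snd p). Q p b c * (crd x c + T p x c)) *\<^sub>R b)" for x
  proof -
    have "(\<Sum>p\<in>blocks. \<Sum>b\<in>blk (fst p) (snd p). (\<Sum>c\<in>blk (fst p) (snd p). Q p b c * (crd x c + T p x c)) *\<^sub>R b)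
        = (\<Sum>p\<in>blocks. \<Sum>b\<in>blk (fst p) (snd p). t x b *\<^sub>R b)"
    proof (intro sum.cong refl arg_cong2[where f = scaleR])
      fix p b assume "p \<in> blocks" "b \<in> blk (fst p) (snd p)"
      then show "(\<Sum>c\<in>blk (fst p) (snd p). Q p b c * (crd x c + T p x c)) = t x b"
        using orthogonal_columns_imp_rows[OF blk_subset orthQ, of p b "t x"] by (simp add: T_def)
    qed
    also have "\<dots> = (\<Sum>p\<in>blocks. \<Sum>b\<in>{b\<in>B. (ev b, lv b) = p}. t x b *\<^sub>R b)"
      by (intro sum.cong refl) (auto simp: blk_def)
    also have "\<dots> = (\<Sum>b\<in>B. t x b *\<^sub>R b)"
      by (rule sum.group) (auto simp: blocks_def finite_B)
    also have "\<dots> = \<Phi> (- s) (f x)" unfolding t_def by (rule expand[symmetric])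
    finally show ?thesis by (simp flip: flow_add)
  qed
  show ?thesis unfolding almost_similarity_def
    by (rule exI[of _ s], rule exI[of _ Q], rule exI[of _ T]) (use orthQ indep formula in blast)
qed

lemma linear_commuting_qs1:
  assumes R: "linear R" and comm: "\<And>t x. R (\<Phi> t x) = \<Phi> t (R x)"
  obtains \<kappa> where "qs1 \<kappa> 0 R"
proof -
  obtain \<kappa> where \<kappa>: "0 < \<kappa>" "\<And>x. norm (R x) \<le> \<kappa> * norm x" using linear_bounded_pos[OF R] by blast
  have "qs1 \<kappa> 0 R"
    unfolding qs1_def
  proof (intro allI impI)
    fix \<tau> p q assume le: "norm (\<Phi> \<tau> (p - q)) \<le> 1"
    have "norm (\<Phi> (\<tau> - 0) (R p - R q)) = norm (R (\<Phi> \<tau> (p - q)))" by (simp only: comm linear_diff[OF R] diff_0_right)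
    also have "\<dots> \<le> \<kappa> * norm (\<Phi> \<tau> (p - q))" by (rule \<kappa>(2))
    also have "\<dots> \<le> \<kappa> * 1" using \<kappa>(1) le by (intro mult_left_mono) auto
    finally show "norm (\<Phi> (\<tau> - 0) (R p - R q)) \<le> \<kappa>" by simp
  qed
  then show thesis by (rule that)
qed

end

context jordan_data_vec
begin

theorem almost_similar_conjugate:
  assumes G: "uniform_group C G" and co: "cocompact_pairs G"
  shows "\<exists>F D. qs D 0 F \<and> (\<forall>g\<in>G. almost_similarity (conj_by F g))"
proof -
  obtain F0 D0 where F0: "qs D0 0 F0"
    and aff0: "\<forall>\<alpha>\<in>ev ` B. \<forall>h\<in>G. midpoint_affine (Elev \<alpha>) (Ulev \<alpha>) (conj_by F0 h)"
    using conj_to_fibre_affine[OF G co] by (elim exE conjE)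
  have bF0: "bij F0" by (rule qs_bij[OF F0])
  obtain C' where G': "uniform_group C' (conj_by F0 ` G)" by (rule conj_by_uniform_group[OF F0 G])
  have aff': "\<forall>h\<in>conj_by F0 ` G. fibre_affine h"
    using aff0 unfolding fibre_affine_def by blast
  note aff = bspec[OF aff']
  obtain \<beta> \<psi> where \<beta>: "\<forall>x. linear (\<beta> x)" "\<forall>x y. \<beta> x y = \<beta> y x" "\<forall>x. x \<noteq> 0 \<longrightarrow> 0 < \<beta> x x"
    "\<forall>\<alpha>\<in>ev ` B. \<forall>H\<in>conj_by F0 ` G. \<forall>v\<in>Klev \<alpha>. \<forall>w\<in>Klev \<alpha>.
      \<beta> (lin_at \<alpha> H v) (lin_at \<alpha> H w) = exp (2 * \<alpha> * \<psi> H) * \<beta> v w"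
    using invariant_form[OF G' aff'] by (elim exE conjE)
  obtain R where R: "linear R" "bij R" "\<forall>t x. R (\<Phi> t x) = \<Phi> t (R x)"
    "\<forall>\<alpha> l v. 1 \<le> l \<longrightarrow> \<omega> \<alpha> l (R v) = R (\<omega> \<alpha> l v)"
    "\<forall>\<alpha>>0. \<forall>v\<in>Klev \<alpha>. R v \<in> Klev \<alpha>"
    "\<forall>\<alpha>>0. \<forall>v\<in>Klev \<alpha>. \<forall>w\<in>Klev \<alpha>. \<beta> (R v) (R w) = (\<Sum>b\<in>blk \<alpha> 1. crd v b * crd w b)"
    using adapted_orthonormalization[OF spec[OF \<beta>(1)] spec[OF spec[OF \<beta>(2)]] \<beta>(3)] by (elim exE conjE)
  \<comment> \<open>\<open>R\<close> carries the standard inner product on each eigenspace to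
    \<open>\<beta>\<close>, so it is the conjugates by its inverse that become orthogonal up to the
    scalar.\<close>
  define S where "S = inv_into UNIV R"
  have SR: "S (R x) = x" and RS: "R (S x) = x" for x
    using R(2) by (simp_all add: S_def bij_is_inj bij_is_surj surj_f_inv_f)
  have bS: "bij S" unfolding S_def by (rule bij_imp_bij_inv[OF R(2)])
  have invS: "inv_into UNIV S = R" unfolding S_def by (rule inv_inv_eq[OF R(2)])
  have linS: "linear S"
  proof (rule linearI)
    show "S (x + y) = S x + S y" for x y using SR[of "S x + S y"] linear_add[OF R(1), of "S x" "S y"] by (simp add: RS)
    show "S (c *\<^sub>R x) = c *\<^sub>R S x" for c x using SR[of "c *\<^sub>R S x"] linear_scale[OF R(1), of c "S x"] by (simp add: RS)
  qed
  have S_Phi: "S (\<Phi> t x) = \<Phi> t (S x)" for t x using SR[of "\<Phi> t (S x)"] R(3) by (simp add: RS)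
  have S_omega: "\<omega> \<alpha> l (S x) = S (\<omega> \<alpha> l x)" if "1 \<le> l" for \<alpha> l x
    using SR[of "\<omega> \<alpha> l (S x)"] R(4) that by (metis RS)
  have S_Klev: "S x \<in> Klev \<alpha>" if "x \<in> Klev \<alpha>" for \<alpha> x
    using that unfolding Klev_def by (simp add: linear_scale[OF linS] flip: S_Phi)
  obtain \<kappa>1 where \<kappa>1: "qs1 \<kappa>1 0 R" by (rule linear_commuting_qs1[OF R(1)]) (use R(3) in simp)
  obtain \<kappa>2 where \<kappa>2: "qs1 \<kappa>2 0 S" by (rule linear_commuting_qs1[OF linS S_Phi])
  have "qs1 (max \<kappa>1 \<kappa>2) 0 R" "qs1 (max \<kappa>1 \<kappa>2) 0 S" by (rule qs1_mono[OF \<kappa>1], simp) (rule qs1_mono[OF \<kappa>2], simp)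
  then have qsS: "qs (max \<kappa>1 \<kappa>2) 0 S" by (simp add: qs_def bS invS)
  obtain D where qsF: "qs D 0 (S \<circ> F0)" using qs_comp[OF qsS F0] by (metis add_0)
  have "almost_similarity (conj_by (S \<circ> F0) g)" if g: "g \<in> G" for g
  proof -
    define h where "h = conj_by F0 g"
    have hG: "h \<in> conj_by F0 ` G" using g by (simp add: h_def)
    obtain s where s: "qs C' s h" using uniform_groupD[OF G' hG] by (elim exE)
    note hq = qs_qs1[OF s] aff[OF hG]
    have f: "conj_by (S \<circ> F0) g = S \<circ> h \<circ> R"
      unfolding conj_by_conj_by[OF bF0 bS, symmetric] h_def[symmetric] by (simp add: conj_by_def invS)
    have fq: "qs1 (\<kappa>2 * (1 + C') * (1 + \<kappa>1)) (0 + s + 0) (S \<circ> h \<circ> R)"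
      by (rule qs1_comp[OF qs1_comp[OF \<kappa>2 hq(1)] \<kappa>1])
    show ?thesis
      unfolding f
    proof (rule almost_similarityI[OF fq, where \<Lambda> = "\<lambda>\<alpha> v. S (lin_at \<alpha> h (R v))" and s = "\<psi> h"])
      fix \<alpha> assume \<alpha>: "\<alpha> \<in> ev ` B"
      have pos: "0 < \<alpha>" using \<alpha> ev_pos by auto
      have RK: "R v \<in> Klev \<alpha>" if "v \<in> Klev \<alpha>" for v using R(5) pos that by blast
      have RSK: "S (lin_at \<alpha> h (R v)) \<in> Klev \<alpha>" if "v \<in> Klev \<alpha>" for v
        by (rule S_Klev[OF lin_at_facts(3)[OF \<alpha> hq RK[OF that]]])
      show "\<omega> \<alpha> l ((S \<circ> h \<circ> R) (x + u) - (S \<circ> h \<circ> R) x) = S (lin_at \<alpha> h (R (\<omega> \<alpha> l u)))"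
        if l: "1 \<le> l" and u: "u \<in> V \<alpha> l" for l x u
      proof -
        have Ru: "R u \<in> V \<alpha> l" using qs1_V[OF pos l \<kappa>1, of u 0] u by (simp add: linear_0[OF R(1)])
        have "(S \<circ> h \<circ> R) (x + u) - (S \<circ> h \<circ> R) x = S (h (R x + R u) - h (R x))"
          by (simp add: linear_diff[OF linS] linear_add[OF R(1)])
        then have "\<omega> \<alpha> l ((S \<circ> h \<circ> R) (x + u) - (S \<circ> h \<circ> R) x) = S (\<omega> \<alpha> l (h (R x + R u) - h (R x)))"
          by (simp only: S_omega[OF l])
        also have "\<dots> = S (lin_at \<alpha> h (\<omega> \<alpha> l (R u)))"
          using higher_level[OF pos l hq(1) bspec[OF hq(2)[unfolded fibre_affine_def] \<alpha>] Ru] by simp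
        also have "\<omega> \<alpha> l (R u) = R (\<omega> \<alpha> l u)" using R(4) l by blast
        finally show ?thesis .
      qed
      show "S (lin_at \<alpha> h (R (\<Sum>u\<in>U. c u *\<^sub>R u))) = (\<Sum>u\<in>U. c u *\<^sub>R S (lin_at \<alpha> h (R u)))"
        if "U \<subseteq> Klev \<alpha>" for U c
        using lin_at_sum[OF \<alpha> hq, of U R c] RK that
        by (simp add: subset_iff linear_sum[OF R(1)] linear_scale[OF R(1)] linear_sum[OF linS] linear_scale[OF linS])
      fix v w assume vw: "v \<in> Klev \<alpha>" "w \<in> Klev \<alpha>"
      have "(\<Sum>b\<in>blk \<alpha> 1. crd (S (lin_at \<alpha> h (R v))) b * crd (S (lin_at \<alpha> h (R w))) b)
          = \<beta> (lin_at \<alpha> h (R v)) (lin_at \<alpha> h (R w))"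
        using R(6)[rule_format, OF pos RSK[OF vw(1)] RSK[OF vw(2)]] by (simp only: RS)
      also have "\<dots> = exp (2 * \<alpha> * \<psi> h) * \<beta> (R v) (R w)"
        by (rule \<beta>(4)[rule_format, OF \<alpha> hG RK[OF vw(1)] RK[OF vw(2)]])
      also have "\<beta> (R v) (R w) = (\<Sum>b\<in>blk \<alpha> 1. crd v b * crd w b)"
        by (rule R(6)[rule_format, OF pos vw])
      finally show "(\<Sum>b\<in>blk \<alpha> 1. crd (S (lin_at \<alpha> h (R v))) b * crd (S (lin_at \<alpha> h (R w))) b)
          = exp (2 * \<alpha> * \<psi> h) * (\<Sum>b\<in>blk \<alpha> 1. crd v b * crd w b)" .
    qed
  qed
  then show ?thesis using qsF by blast
qed

end

section \<open>Generalized eigenspaces\<close>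

lemma nil_pow_0 [simp]: "nil_pow A \<alpha> 0 x = x"
  by (simp add: nil_pow_def)

lemma nil_pow_Suc: "nil_pow A \<alpha> (Suc k) x = (A - mat \<alpha>) *v nil_pow A \<alpha> k x"
  by (simp add: nil_pow_def)

lemma nil_pow_Suc2: "nil_pow A \<alpha> (Suc k) x = nil_pow A \<alpha> k ((A - mat \<alpha>) *v x)"
  by (simp add: nil_pow_def funpow_swap1)

lemma nil_pow_add: "nil_pow A \<alpha> (j + k) x = nil_pow A \<alpha> j (nil_pow A \<alpha> k x)"
  by (simp add: nil_pow_def funpow_add)

lemma mat_mult_vec: "mat (\<alpha>::real) *v x = \<alpha> *\<^sub>R (x :: real^'n)"
  by (simp add: vec_eq_iff matrix_vector_mult_def mat_def if_distrib[of "\<lambda>r. r * _"] cong: if_cong)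

lemma shift_mult_vec: "(A - mat (\<alpha>::real)) *v x = A *v x - \<alpha> *\<^sub>R (x :: real^'n)"
  by (simp add: matrix_vector_mult_diff_rdistrib mat_mult_vec)

lemma linear_nil_pow: "linear (nil_pow A \<alpha> k)"
proof (induction k)
  case (Suc k)
  have eq: "nil_pow A \<alpha> (Suc k) = (*v) (A - mat \<alpha>) \<circ> nil_pow A \<alpha> k" by (auto simp: nil_pow_Suc)
  show ?case unfolding eq by (rule linear_compose[OF Suc matrix_vector_mul_linear])
qed (simp add: nil_pow_def linear_iff)

lemma ker_pow_mono: assumes "k \<le> l" shows "ker_pow A \<alpha> k \<subseteq> ker_pow A \<alpha> l"
proof
  fix x assume "x \<in> ker_pow A \<alpha> k"
  then have "nil_pow A \<alpha> (l - k) (nil_pow A \<alpha> k x) = 0"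
    by (simp add: ker_pow_def linear_0[OF linear_nil_pow])
  then show "x \<in> ker_pow A \<alpha> l" using assms by (simp add: ker_pow_def flip: nil_pow_add)
qed

lemma subspace_ker_pow: "subspace (ker_pow A \<alpha> k)"
  unfolding ker_pow_def by (rule linear_subspace_kernel[OF linear_nil_pow])

lemma subspace_gen_eigenspace: "subspace (gen_eigenspace A \<alpha>)"
  unfolding subspace_def
proof (intro conjI ballI allI)
  show "0 \<in> gen_eigenspace A \<alpha>"
    using subspace_0[OF subspace_ker_pow] by (auto simp: gen_eigenspace_def)
  fix x y assume "x \<in> gen_eigenspace A \<alpha>" "y \<in> gen_eigenspace A \<alpha>"
  then obtain j k where "x \<in> ker_pow A \<alpha> j" "y \<in> ker_pow A \<alpha> k" by (auto simp: gen_eigenspace_def)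
  then have "x \<in> ker_pow A \<alpha> (max j k)" "y \<in> ker_pow A \<alpha> (max j k)"
    using ker_pow_mono[of j "max j k" A \<alpha>] ker_pow_mono[of k "max j k" A \<alpha>] by auto
  then have "x + y \<in> ker_pow A \<alpha> (max j k)" by (rule subspace_add[OF subspace_ker_pow])
  then show "x + y \<in> gen_eigenspace A \<alpha>" unfolding gen_eigenspace_def by blast
next
  fix c x assume "x \<in> gen_eigenspace A \<alpha>"
  then obtain k where "x \<in> ker_pow A \<alpha> k" by (auto simp: gen_eigenspace_def)
  then have "c *\<^sub>R x \<in> ker_pow A \<alpha> k" by (rule subspace_scale[OF subspace_ker_pow])
  then show "c *\<^sub>R x \<in> gen_eigenspace A \<alpha>" unfolding gen_eigenspace_def by blast
qed

lemma gen_eigenspace_back: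
  assumes "(A - mat \<alpha>) *v x \<in> gen_eigenspace A \<alpha>" shows "x \<in> gen_eigenspace A \<alpha>"
proof -
  obtain k where "nil_pow A \<alpha> k ((A - mat \<alpha>) *v x) = 0"
    using assms by (auto simp: gen_eigenspace_def ker_pow_def)
  then have "x \<in> ker_pow A \<alpha> (Suc k)" by (simp add: ker_pow_def nil_pow_Suc2)
  then show ?thesis unfolding gen_eigenspace_def by blast
qed

lemma nil_pow_commute: "(A - mat \<beta>) *v nil_pow A \<alpha> k x = nil_pow A \<alpha> k ((A - mat \<beta>) *v x)"
proof (induction k)
  case (Suc k)
  have comm: "(A - mat \<beta>) *v ((A - mat \<alpha>) *v y) = (A - mat \<alpha>) *v ((A - mat \<beta>) *v y)" for y
    by (simp add: mat_mult_vec matrix_vector_mult_scaleR algebra_simps)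
  show ?case unfolding nil_pow_Suc comm Suc ..
qed simp

lemma gen_eigenspace_shift:
  assumes "x \<in> gen_eigenspace A \<alpha>" shows "(A - mat \<beta>) *v x \<in> gen_eigenspace A \<alpha>"
proof -
  obtain k where "nil_pow A \<alpha> k x = 0" using assms by (auto simp: gen_eigenspace_def ker_pow_def)
  then have "nil_pow A \<alpha> k ((A - mat \<beta>) *v x) = 0" by (simp flip: nil_pow_commute)
  then show ?thesis by (auto simp: gen_eigenspace_def ker_pow_def)
qed

lemma gen_eigenspace_nil_pow:
  assumes "x \<in> gen_eigenspace A \<alpha>" shows "nil_pow A \<beta> k x \<in> gen_eigenspace A \<alpha>"
  by (induction k) (simp_all add: assms nil_pow_Suc gen_eigenspace_shift)

text \<open>For \<open>\<beta>\<close> different from \<open>\<alpha>\<close>,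
  \<open>A - mat \<alpha>\<close> is a nonzero scalar plus a nilpotent map on the kernel of the
  power; the induction on \<open>k\<close> inverts it.\<close>

lemma shift_solvable:
  assumes "\<beta> \<noteq> \<alpha>"
  shows "w \<in> ker_pow A \<beta> k \<Longrightarrow> \<exists>y\<in>ker_pow A \<beta> k. (A - mat \<alpha>) *v y = w"
proof (induction k arbitrary: w)
  case 0
  then show ?case by (auto simp: ker_pow_def matrix_vector_mult_0_right)
next
  case (Suc k)
  have "(A - mat \<beta>) *v w \<in> ker_pow A \<beta> k" using Suc(2) by (simp add: ker_pow_def nil_pow_Suc2)
  then obtain y' where y': "y' \<in> ker_pow A \<beta> k" "(A - mat \<alpha>) *v y' = (A - mat \<beta>) *v w"
    using Suc(1) by blast
  define y where "y = (1 / (\<beta> - \<alpha>)) *\<^sub>R (w - y')"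
  have "y' \<in> ker_pow A \<beta> (Suc k)" using y'(1) ker_pow_mono[of k "Suc k" A \<beta>] by auto
  then have "y \<in> ker_pow A \<beta> (Suc k)" unfolding y_def
    using Suc(2) by (intro subspace_scale[OF subspace_ker_pow] subspace_diff[OF subspace_ker_pow])
  moreover have "(A - mat \<alpha>) *v y = w"
  proof -
    have "(A - mat \<alpha>) *v y = (1 / (\<beta> - \<alpha>)) *\<^sub>R ((A - mat \<alpha>) *v w - (A - mat \<beta>) *v w)"
      by (simp add: y_def y'(2)[symmetric] matrix_vector_mult_scaleR matrix_vector_mult_diff_distrib)
    also have "(A - mat \<alpha>) *v w - (A - mat \<beta>) *v w = (\<beta> - \<alpha>) *\<^sub>R w"
      by (simp add: mat_mult_vec algebra_simps)
    finally show ?thesis using assms by simp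
  qed
  ultimately show ?case by blast
qed

text \<open>Up to elements of the generalized eigenspace of \<open>\<alpha>\<close>, every vector of
  the span is the image under \<open>A - mat \<alpha>\<close> of a vector of the span. Subtracting
  such a vector from \<open>u\<close> leaves something that the shift sends into the generalized
  eigenspace, and which therefore lies in it.\<close>

lemma shift_mem_span_gen_eigenspaces:
  assumes "(A - mat \<alpha>) *v u \<in> span (\<Union>\<beta>. gen_eigenspace A \<beta>)"
  shows "u \<in> span (\<Union>\<beta>. gen_eigenspace A \<beta>)" (is "u \<in> ?W")
proof -
  have "\<exists>y\<in>?W. w - (A - mat \<alpha>) *v y \<in> gen_eigenspace A \<alpha>" if "w \<in> ?W" for w
    using that
  proof (induction w rule: span_induct_alt)
    case base
    then show ?case
      using subspace_0[OF subspace_gen_eigenspace, of A \<alpha>] span_zero by (intro bexI[of _ 0]) (auto simp: matrix_vector_mult_0_right)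
  next
    case (step c x w)
    then obtain y where y: "y \<in> ?W" "w - (A - mat \<alpha>) *v y \<in> gen_eigenspace A \<alpha>" by blast
    obtain \<beta> where \<beta>: "x \<in> gen_eigenspace A \<beta>" using step by blast
    have "\<exists>y'\<in>?W. x - (A - mat \<alpha>) *v y' \<in> gen_eigenspace A \<alpha>"
    proof (cases "\<beta> = \<alpha>")
      case True
      then show ?thesis using \<beta> span_zero by (intro bexI[of _ 0]) (auto simp: matrix_vector_mult_0_right)
    next
      case False
      obtain k where "x \<in> ker_pow A \<beta> k" using \<beta> by (auto simp: gen_eigenspace_def)
      then obtain y' where "y' \<in> ker_pow A \<beta> k" "(A - mat \<alpha>) *v y' = x" using shift_solvable[OF False] by blast
      then show ?thesis
        using subspace_0[OF subspace_gen_eigenspace, of A \<alpha>]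
        by (intro bexI[of _ y']) (auto simp: gen_eigenspace_def intro!: span_base)
    qed
    then obtain y' where y': "y' \<in> ?W" "x - (A - mat \<alpha>) *v y' \<in> gen_eigenspace A \<alpha>" by blast
    have "c *\<^sub>R x + w - (A - mat \<alpha>) *v (c *\<^sub>R y' + y)
        = c *\<^sub>R (x - (A - mat \<alpha>) *v y') + (w - (A - mat \<alpha>) *v y)"
      by (simp add: matrix_vector_right_distrib matrix_vector_mult_scaleR algebra_simps)
    also have "\<dots> \<in> gen_eigenspace A \<alpha>"
      by (intro subspace_add[OF subspace_gen_eigenspace] subspace_scale[OF subspace_gen_eigenspace] y y')
    finally show ?case using y(1) y'(1) by (intro bexI[of _ "c *\<^sub>R y' + y"] span_add span_scale)
  qed
  from this[OF assms] obtain y where y: "y \<in> ?W" "(A - mat \<alpha>) *v (u - y) \<in> gen_eigenspace A \<alpha>"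
    by (auto simp: matrix_vector_mult_diff_distrib)
  have "u - y \<in> ?W" using gen_eigenspace_back[OF y(2)] by (intro span_base) blast
  from span_add[OF this y(1)] show ?thesis by simp
qed

lemma gen_eigenspace_trivial:
  assumes "\<not> eigenvalue A \<alpha>" shows "gen_eigenspace A \<alpha> = {0}"
proof -
  have "x = 0" if "nil_pow A \<alpha> k x = 0" for k x
    using that
  proof (induction k arbitrary: x)
    case (Suc k)
    then have "(A - mat \<alpha>) *v x = 0" by (simp add: nil_pow_Suc2)
    then have "A *v x = \<alpha> *s x" by (simp add: shift_mult_vec scalar_mult_eq_scaleR)
    then show ?case using assms by (auto simp: eigenvalue_def)
  qed simp
  moreover have "0 \<in> gen_eigenspace A \<alpha>" by (rule subspace_0[OF subspace_gen_eigenspace])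
  ultimately show ?thesis by (auto simp: gen_eigenspace_def ker_pow_def)
qed

lemma gen_eigenspace_disjoint:
  assumes "\<beta> \<noteq> \<alpha>" "x \<in> gen_eigenspace A \<alpha>" "x \<in> gen_eigenspace A \<beta>" shows "x = 0"
proof -
  obtain k where "nil_pow A \<alpha> k x = 0" using assms(2) by (auto simp: gen_eigenspace_def ker_pow_def)
  then show ?thesis using assms(3)
  proof (induction k arbitrary: x)
    case (Suc k)
    have "(A - mat \<alpha>) *v x = 0"
      by (rule Suc(1)[OF Suc(2)[unfolded nil_pow_Suc2] gen_eigenspace_shift[OF Suc(3)]])
    then have eq: "(A - mat \<beta>) *v x = (\<alpha> - \<beta>) *\<^sub>R x" by (simp add: mat_mult_vec algebra_simps)
    have "nil_pow A \<beta> j x = (\<alpha> - \<beta>) ^ j *\<^sub>R x" for j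
      by (induction j) (simp_all add: nil_pow_Suc matrix_vector_mult_scaleR eq)
    moreover obtain j where "nil_pow A \<beta> j x = 0" using Suc(3) by (auto simp: gen_eigenspace_def ker_pow_def)
    ultimately have "(\<alpha> - \<beta>) ^ j *\<^sub>R x = 0" by metis
    then show ?case using assms(1) by simp
  qed simp
qed

lemma gen_eigenspace_direct:
  assumes "finite F"
  shows "(\<And>\<alpha>. \<alpha> \<in> F \<Longrightarrow> w \<alpha> \<in> gen_eigenspace A \<alpha>) \<Longrightarrow> (\<Sum>\<alpha>\<in>F. w \<alpha>) = 0 \<Longrightarrow> \<alpha> \<in> F \<Longrightarrow> w \<alpha> = 0"
  using assms
proof (induction F arbitrary: w \<alpha> rule: finite_induct)
  case (insert a F)
  obtain k where k: "nil_pow A a k (w a) = 0" using insert(4)[of a] by (auto simp: gen_eigenspace_def ker_pow_def)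
  have "nil_pow A a k (\<Sum>\<alpha>\<in>insert a F. w \<alpha>) = 0" using insert(5) by (simp add: linear_0[OF linear_nil_pow])
  then have "(\<Sum>\<alpha>\<in>F. nil_pow A a k (w \<alpha>)) = 0"
    using insert(1,2) k by (simp add: linear_sum[OF linear_nil_pow] linear_add[OF linear_nil_pow])
  note sum0 = this
  have "nil_pow A a k (w \<beta>) \<in> gen_eigenspace A \<beta>" if "\<beta> \<in> F" for \<beta>
    by (intro gen_eigenspace_nil_pow insert(4)) (simp add: that)
  then have z: "nil_pow A a k (w \<beta>) = 0" if "\<beta> \<in> F" for \<beta>
    using insert(3)[of "\<lambda>\<alpha>. nil_pow A a k (w \<alpha>)", OF _ sum0] that by blast
  have wF: "w \<beta> = 0" if \<beta>: "\<beta> \<in> F" for \<beta>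
  proof (rule gen_eigenspace_disjoint[of a \<beta>])
    show "a \<noteq> \<beta>" using \<beta> insert(2) by blast
    show "w \<beta> \<in> gen_eigenspace A \<beta>" using insert(4) \<beta> by blast
    show "w \<beta> \<in> gen_eigenspace A a" using z[OF \<beta>] by (auto simp: gen_eigenspace_def ker_pow_def)
  qed
  then have "w a = 0" using insert(1,2,5) by simp
  then show ?case using wF insert(6) by blast
qed simp

section \<open>Spanning of the space by the generalized eigenspaces\<close>

definition poly_act :: "complex^'n^'n \<Rightarrow> complex poly \<Rightarrow> complex^'n \<Rightarrow> complex^'n" where
  "poly_act F p y = (\<Sum>i\<le>degree p. coeff p i *s (((*v) F ^^ i) y))"

lemma poly_act_bound:
  assumes "degree p \<le> n" shows "poly_act F p y = (\<Sum>i\<le>n. coeff p i *s (((*v) F ^^ i) y))"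
  unfolding poly_act_def using assms
  by (intro sum.mono_neutral_left) (auto simp: coeff_eq_0)

lemma funpow_mult_diff: "((*v) (F :: complex^'n^'n) ^^ i) (x - y) = ((*v) F ^^ i) x - ((*v) F ^^ i) (y :: complex^'n)"
  by (induction i) (simp_all add: matrix_vector_mult_diff_distrib)

lemma funpow_mult_scale: "((*v) (F :: complex^'n^'n) ^^ i) (c *s x) = c *s ((*v) F ^^ i) (x :: complex^'n)"
  by (induction i) (simp_all add: vector_scalar_commute)

lemma poly_act_shift:
  "poly_act F ([:- z, 1:] * q) y = poly_act F q (F *v y - z *s y)"
  "poly_act F q (F *v y - z *s y) = F *v poly_act F q y - z *s poly_act F q y"
proof -
  define n where "n = Suc (degree q)"
  have deg: "degree (pCons 0 q) \<le> n" "degree (smult z q) \<le> n" "degree q \<le> n"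
    by (auto simp: n_def intro: le_SucI degree_pCons_le)
  have eq: "[:- z, 1:] * q = pCons 0 q - smult z q" by simp
  have "degree ([:- z, 1:] * q) \<le> n" unfolding eq using deg by (intro degree_diff_le)
  then have "poly_act F ([:- z, 1:] * q) y = (\<Sum>i\<le>n. (coeff (pCons 0 q) i - z * coeff q i) *s ((*v) F ^^ i) y)"
    by (subst poly_act_bound[of _ n]) (simp_all add: eq)
  also have "\<dots> = (\<Sum>i\<le>n. coeff (pCons 0 q) i *s ((*v) F ^^ i) y) - (\<Sum>i\<le>n. (z * coeff q i) *s ((*v) F ^^ i) y)"
    by (simp add: sum_subtractf vector_sub_rdistrib vec.scale_left_diff_distrib)
  also have "(\<Sum>i\<le>n. coeff (pCons 0 q) i *s ((*v) F ^^ i) y) = (\<Sum>i\<le>degree q. coeff q i *s ((*v) F ^^ i) (F *v y))"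
    unfolding n_def sum.atMost_Suc_shift by (simp add: funpow_swap1)
  also have "(\<Sum>i\<le>n. (z * coeff q i) *s ((*v) F ^^ i) y) = (\<Sum>i\<le>degree q. (z * coeff q i) *s ((*v) F ^^ i) y)"
    unfolding n_def by (simp add: coeff_eq_0)
  also have "(\<Sum>i\<le>degree q. coeff q i *s ((*v) F ^^ i) (F *v y)) - (\<Sum>i\<le>degree q. (z * coeff q i) *s ((*v) F ^^ i) y)
      = poly_act F q (F *v y - z *s y)"
    unfolding poly_act_def funpow_mult_diff funpow_mult_scale
    by (simp add: sum_subtractf[symmetric] vec.scale_right_diff_distrib mult.commute)
  finally show "poly_act F ([:- z, 1:] * q) y = poly_act F q (F *v y - z *s y)" .
  show "poly_act F q (F *v y - z *s y) = F *v poly_act F q y - z *s poly_act F q y"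
    unfolding poly_act_def funpow_mult_diff funpow_mult_scale
    by (simp add: sum_subtractf vec.scale_right_diff_distrib vec.scale_sum_right funpow_swap1[symmetric]
        vector_scalar_commute matrix_vector_right_distrib vec.linear_sum[OF matrix_vector_mul_linear_gen] mult.commute)
qed

definition re_vec :: "complex^'n \<Rightarrow> real^'n" where "re_vec y = (\<chi> i. Re (y $ i))"
definition im_vec :: "complex^'n \<Rightarrow> real^'n" where "im_vec y = (\<chi> i. Im (y $ i))"

lemma re_im_vec_mult:
  "re_vec (map_matrix complex_of_real A *v y) = A *v re_vec y"
  "im_vec (map_matrix complex_of_real A *v y) = A *v im_vec y"
  by (simp_all add: vec_eq_iff re_vec_def im_vec_def matrix_vector_mult_def map_matrix_def)

text \<open>Roots are split off one at a time. Either the cofactor \<open>q\<close> already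
  annihilates \<open>y\<close>, or \<open>poly_act F q y\<close> is an eigenvector, the root is
  real, and induction applies to the shifted vector. Real and imaginary parts run in parallel
  because the shift by a real root acts on each separately.\<close>

lemma poly_act_zero_imp_span:
  fixes A :: "real^'n^'n"
  defines "F \<equiv> map_matrix complex_of_real A"
  assumes real: "\<And>z. eigenvalue F z \<Longrightarrow> z \<in> \<real>"
  shows "p \<noteq> 0 \<Longrightarrow> poly_act F p y = 0 \<Longrightarrow>
    re_vec y \<in> span (\<Union>\<beta>. gen_eigenspace A \<beta>) \<and> im_vec y \<in> span (\<Union>\<beta>. gen_eigenspace A \<beta>)"
proof (induction "degree p" arbitrary: p y)
  case 0
  then obtain c where c: "p = [:c:]" by (metis degree_eq_zeroE)
  then have "y = 0" using 0 by (simp add: poly_act_def)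
  then have "re_vec y = 0" "im_vec y = 0" by (simp_all add: vec_eq_iff re_vec_def im_vec_def)
  then show ?case by (simp add: span_zero)
next
  case (Suc n)
  have "\<not> constant (poly p)" using Suc(2) constant_degree[of p] by simp
  then obtain z where "poly p z = 0" using fundamental_theorem_of_algebra by blast
  then obtain q where q: "p = [:- z, 1:] * q" using poly_eq_0_iff_dvd by (metis dvdE)
  have q0: "q \<noteq> 0" using q Suc(3) by auto
  then have deg: "n = degree q" using Suc(2) unfolding q by (subst (asm) degree_mult_eq) auto
  have z1: "poly_act F q (F *v y - z *s y) = 0" using Suc(4) unfolding q poly_act_shift(1) .
  show ?case
  proof (cases "poly_act F q y = 0")
    case True
    then show ?thesis by (rule Suc(1)[OF deg q0])
  next
    case False
    have "F *v poly_act F q y = z *s poly_act F q y" using z1 unfolding poly_act_shift(2) by simp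
    then have "eigenvalue F z" using False unfolding eigenvalue_def by blast
    then obtain a where a: "z = complex_of_real a" using real Reals_cases by blast
    have "re_vec (F *v y - z *s y) = re_vec (F *v y) - a *\<^sub>R re_vec y"
      "im_vec (F *v y - z *s y) = im_vec (F *v y) - a *\<^sub>R im_vec y"
      by (simp_all add: a vec_eq_iff re_vec_def im_vec_def)
    then have "re_vec (F *v y - z *s y) = (A - mat a) *v re_vec y" "im_vec (F *v y - z *s y) = (A - mat a) *v im_vec y"
      by (simp_all add: F_def re_im_vec_mult shift_mult_vec)
    then show ?thesis using Suc(1)[OF deg q0 z1] shift_mem_span_gen_eigenspaces by metis
  qed
qed

text \<open>One more iterate than the dimension forces a linear relation. Coinciding iterates are a
  separate case, since \<open>dependent\<close> speaks about sets and would not see a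
  repetition.\<close>

lemma annihilating_coefficients:
  fixes f :: "'a::euclidean_space \<Rightarrow> 'a"
  shows "\<exists>c. \<exists>k\<le>DIM('a). c k \<noteq> 0 \<and> (\<Sum>i\<le>DIM('a). c i *\<^sub>R (f ^^ i) v) = 0"
proof (cases "inj_on (\<lambda>i. (f ^^ i) v) {..DIM('a)}")
  case True
  let ?S = "(\<lambda>i. (f ^^ i) v) ` {..DIM('a)}"
  have "card ?S = Suc DIM('a)" using True by (simp add: card_image)
  then have "dependent ?S" using independent_bound[of ?S] by (metis Suc_n_not_le_n)
  then obtain u where u: "\<exists>x\<in>?S. u x \<noteq> 0" "(\<Sum>x\<in>?S. u x *\<^sub>R x) = 0"
    using dependent_finite[of ?S] by auto
  then show ?thesis by (intro exI[of _ "\<lambda>i. u ((f ^^ i) v)"]) (auto simp: sum.reindex[OF True])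
next
  case False
  then obtain i j where ij: "i \<le> DIM('a)" "j \<le> DIM('a)" "i \<noteq> j" "(f ^^ i) v = (f ^^ j) v"
    by (auto simp: inj_on_def)
  define c where "c k = (if k = i then 1 else if k = j then - 1 else (0::real))" for k
  have "(\<Sum>k\<le>DIM('a). c k *\<^sub>R (f ^^ k) v) = (\<Sum>k\<in>{i, j}. c k *\<^sub>R (f ^^ k) v)"
    using ij by (intro sum.mono_neutral_right) (auto simp: c_def)
  also have "\<dots> = 0" using ij by (simp add: c_def)
  finally show ?thesis using ij(1) by (intro exI[of _ c] exI[of _ i]) (simp add: c_def)
qed

text \<open>A Jordan basis spans, by definition, the generalized eigenspaces of real eigenvalues
  only. That these exhaust the space comes from the reality of the complex eigenvalues, applied to a
  polynomial that annihilates the given vector.\<close>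

theorem span_gen_eigenspaces:
  fixes A :: "real^'n^'n"
  assumes real: "\<And>z. eigenvalue (map_matrix complex_of_real A) z \<Longrightarrow> z \<in> \<real>"
  shows "span (\<Union>\<beta>. gen_eigenspace A \<beta>) = UNIV"
proof -
  have "v \<in> span (\<Union>\<beta>. gen_eigenspace A \<beta>)" for v :: "real^'n"
  proof -
    define F where "F = map_matrix complex_of_real A"
    define y where "y = (\<chi> i. complex_of_real (v $ i))"
    obtain c k where c: "k \<le> DIM(real^'n)" "c k \<noteq> 0" "(\<Sum>i\<le>DIM(real^'n). c i *\<^sub>R (((*v) A ^^ i) v)) = 0"
      using annihilating_coefficients[of "(*v) A" v] by blast
    define p where "p = (\<Sum>i\<le>DIM(real^'n). monom (complex_of_real (c i)) i)"
    have cp: "coeff p i = (if i \<le> DIM(real^'n) then complex_of_real (c i) else 0)" for i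
      by (simp add: p_def coeff_sum)
    have "coeff p k \<noteq> 0" using c(1,2) by (simp add: cp)
    then have "p \<noteq> 0" by auto
    have deg: "degree p \<le> DIM(real^'n)" by (rule degree_le) (auto simp: cp)
    have Fy: "((*v) F ^^ i) y = (\<chi> j. complex_of_real ((((*v) A ^^ i) v) $ j))" for i
      by (induction i) (simp_all add: y_def F_def vec_eq_iff matrix_vector_mult_def map_matrix_def)
    have "poly_act F p y = (\<Sum>i\<le>DIM(real^'n). complex_of_real (c i) *s (((*v) F ^^ i) y))"
      unfolding poly_act_bound[OF deg] by (simp add: cp)
    also have "\<dots> = (\<chi> j. complex_of_real ((\<Sum>i\<le>DIM(real^'n). c i *\<^sub>R (((*v) A ^^ i) v)) $ j))"
      unfolding Fy by (simp add: vec_eq_iff)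
    also have "\<dots> = 0" unfolding c(3) by (simp add: vec_eq_iff)
    finally have "re_vec y \<in> span (\<Union>\<beta>. gen_eigenspace A \<beta>)"
      using poly_act_zero_imp_span[OF real \<open>p \<noteq> 0\<close>] unfolding F_def by blast
    moreover have "re_vec y = v" by (simp add: re_vec_def y_def vec_eq_iff)
    ultimately show ?thesis by simp
  qed
  then show ?thesis by auto
qed

section \<open>Matrix exponential and Jordan data\<close>

lemma matrix_power_mult_vec: "matrix_power A k *v x = ((*v) A ^^ k) x"
  by (induction k arbitrary: x) (simp_all add: matrix_power_def flip: matrix_vector_mul_assoc)

text \<open>\<open>matrix_exp\<close> is a sum of matrices, so convergence has to be obtained among
  matrices before the product with \<open>x\<close> can be taken into the sum; it is read off column
  by column from the unit vectors.\<close>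

lemma matrix_exp_mult_vec:
  fixes A :: "real^'n^'n"
  assumes sums: "\<And>x. (\<lambda>k. (1 / fact k) *\<^sub>R ((*v) A ^^ k) x) sums E x"
  shows "matrix_exp A *v x = E x"
proof -
  define X where "X k = (1 / fact k) *\<^sub>R matrix_power A k" for k :: nat
  have X: "X k *v x = (1 / fact k) *\<^sub>R ((*v) A ^^ k) x" for k x
    by (simp add: X_def scaleR_matrix_vector_assoc[symmetric] matrix_power_mult_vec)
  have "(\<lambda>n. \<Sum>k<n. X k) \<longlonglongrightarrow> matrix E"
  proof (intro vec_tendstoI)
    fix i j
    have "(\<lambda>n. (\<Sum>k<n. X k *v axis j 1) $ i) \<longlonglongrightarrow> E (axis j 1) $ i"
      using sums[of "axis j 1"] unfolding X[symmetric] sums_def by (rule tendsto_vec_nth)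
    moreover have "(\<Sum>k<n. X k *v axis j 1) $ i = (\<Sum>k<n. X k) $ i $ j" for n
      by (simp add: matrix_vector_mult_basis column_def)
    ultimately show "(\<lambda>n. (\<Sum>k<n. X k) $ i $ j) \<longlonglongrightarrow> matrix E $ i $ j"
      by (simp add: matrix_def)
  qed
  then have X_sums: "X sums matrix E" by (simp add: sums_def)
  have "matrix_exp A = matrix E" unfolding matrix_exp_def X_def[symmetric] by (rule sums_unique[OF X_sums, symmetric])
  moreover have "(\<lambda>k. X k *v x) sums (matrix E *v x)"
  proof -
    have "linear (\<lambda>M :: real^'n^'n. M *v x)"
      by (rule linearI) (simp_all add: matrix_vector_mult_add_rdistrib scaleR_matrix_vector_assoc[symmetric])
    then have "bounded_linear (\<lambda>M :: real^'n^'n. M *v x)" by (simp only: linear_conv_bounded_linear)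
    from bounded_linear.sums[OF this X_sums] show ?thesis .
  qed
  then have "matrix E *v x = E x" using sums[of x] unfolding X by (rule sums_unique2)
  ultimately show ?thesis by simp
qed

text \<open>The binomial theorem for a scalar plus a shift along one chain, with \<open>g j\<close>
  as the \<open>j\<close>-th member.\<close>

lemma funpow_binomial:
  fixes f :: "'a::real_vector \<Rightarrow> 'a" and \<alpha> :: real
  assumes f: "linear f" and g: "\<And>j. f (g j) = \<alpha> *\<^sub>R g j + g (Suc j)"
  shows "(f ^^ k) (g 0) = (\<Sum>j\<le>k. (real (k choose j) * \<alpha> ^ (k - j)) *\<^sub>R g j)"
proof (induction k)
  case (Suc k)
  let ?c = "\<lambda>k j. real (k choose j) * \<alpha> ^ (k - j)"
  have "(f ^^ Suc k) (g 0) = (\<Sum>j\<le>k. ?c k j *\<^sub>R (\<alpha> *\<^sub>R g j + g (Suc j)))"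
    by (simp add: Suc linear_sum[OF f] linear_scale[OF f] g)
  also have "\<dots> = (\<Sum>j\<le>k. (\<alpha> * ?c k j) *\<^sub>R g j) + (\<Sum>j\<le>k. ?c k j *\<^sub>R g (Suc j))"
    by (simp add: scaleR_add_right sum.distrib mult.commute)
  also have "(\<Sum>j\<le>k. (\<alpha> * ?c k j) *\<^sub>R g j) = (\<Sum>j\<le>k. (real (k choose j) * \<alpha> ^ (Suc k - j)) *\<^sub>R g j)"
    by (intro sum.cong refl) (simp add: Suc_diff_le)
  also have "\<dots> = (\<Sum>j\<le>Suc k. (real (k choose j) * \<alpha> ^ (Suc k - j)) *\<^sub>R g j)" by simp
  also have "\<dots> = \<alpha> ^ Suc k *\<^sub>R g 0 + (\<Sum>j\<le>k. (real (k choose Suc j) * \<alpha> ^ (k - j)) *\<^sub>R g (Suc j))"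
    unfolding sum.atMost_Suc_shift by simp
  also have "\<dots> + (\<Sum>j\<le>k. ?c k j *\<^sub>R g (Suc j)) = \<alpha> ^ Suc k *\<^sub>R g 0 + (\<Sum>j\<le>k. ?c (Suc k) (Suc j) *\<^sub>R g (Suc j))"
    by (simp add: sum.distrib scaleR_add_left distrib_right add.assoc add.commute)
  also have "\<dots> = (\<Sum>j\<le>Suc k. ?c (Suc k) j *\<^sub>R g j)" unfolding sum.atMost_Suc_shift by simp
  finally show ?case .
qed simp

lemma exp_binomial_sums:
  "(\<lambda>k. t ^ k / fact k * (real (k choose j) * \<alpha> ^ (k - j))) sums (exp (\<alpha> * t) * (t ^ j / fact j))"
proof -
  let ?h = "\<lambda>k. t ^ k / fact k * (real (k choose j) * \<alpha> ^ (k - j))"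
  have "(\<lambda>k. (\<alpha> * t) ^ k /\<^sub>R fact k * (t ^ j / fact j)) sums (exp (\<alpha> * t) * (t ^ j / fact j))"
    by (intro sums_mult2 exp_converges)
  moreover have "(\<alpha> * t) ^ k /\<^sub>R fact k * (t ^ j / fact j) = ?h (k + j)" for k
    by (simp add: binomial_fact power_add power_mult_distrib field_simps)
  ultimately have "(\<lambda>k. ?h (k + j)) sums (exp (\<alpha> * t) * (t ^ j / fact j))" by simp
  then show ?thesis by (subst (asm) sums_zero_iff_shift) (simp_all add: binomial_eq_0)
qed

lemma chain_exp_sums:
  fixes f :: "'a::real_normed_vector \<Rightarrow> 'a"
  assumes f: "linear f" and g: "\<And>j. f (g j) = \<alpha> *\<^sub>R g j + g (Suc j)" and z: "\<And>j. L \<le> j \<Longrightarrow> g j = 0"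
  shows "(\<lambda>k. (t ^ k / fact k) *\<^sub>R (f ^^ k) (g 0)) sums (exp (\<alpha> * t) *\<^sub>R (\<Sum>j<L. (t ^ j / fact j) *\<^sub>R g j))"
proof -
  let ?h = "\<lambda>k j. t ^ k / fact k * (real (k choose j) * \<alpha> ^ (k - j))"
  have "(t ^ k / fact k) *\<^sub>R (f ^^ k) (g 0) = (\<Sum>j<L. ?h k j *\<^sub>R g j)" for k
  proof -
    have "(t ^ k / fact k) *\<^sub>R (f ^^ k) (g 0) = (\<Sum>j\<le>k. ?h k j *\<^sub>R g j)"
      unfolding funpow_binomial[of f g, OF f g] by (simp add: scaleR_sum_right)
    also have "\<dots> = (\<Sum>j\<in>{..k} \<union> {..<L}. ?h k j *\<^sub>R g j)"
      by (intro sum.mono_neutral_left) (auto simp: binomial_eq_0)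
    also have "\<dots> = (\<Sum>j<L. ?h k j *\<^sub>R g j)"
      using z by (intro sum.mono_neutral_right) auto
    finally show ?thesis .
  qed
  moreover have "(\<lambda>k. \<Sum>j<L. ?h k j *\<^sub>R g j) sums (\<Sum>j<L. (exp (\<alpha> * t) * (t ^ j / fact j)) *\<^sub>R g j)"
    by (intro sums_sum sums_scaleR_left exp_binomial_sums)
  ultimately show ?thesis by (simp add: scaleR_sum_right)
qed

lemma (in jordan_data) exp_sums:
  assumes f: "linear f" and fb: "\<And>b. b \<in> B \<Longrightarrow> f b = ev b *\<^sub>R b + N b"
  shows "(\<lambda>k. (t ^ k / fact k) *\<^sub>R (f ^^ k) x) sums \<Phi> t x"
proof -
  have fpow: "linear (f ^^ k)" for k
  proof (induction k)
    case (Suc k) show ?case using linear_compose[OF Suc f] by (simp add: comp_def)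
  qed (simp add: linear_iff)
  have b: "(\<lambda>k. (t ^ k / fact k) *\<^sub>R (f ^^ k) b) sums flow_basis t b" if b: "b \<in> B" for b
  proof -
    have step: "f ((N ^^ j) b) = ev b *\<^sub>R (N ^^ j) b + (N ^^ Suc j) b" for j
    proof (cases "j < lv b")
      case True
      then show ?thesis using N_pow[OF b True] fb[of "(N ^^ j) b"] by simp
    next
      case False
      then show ?thesis using N_pow_zero[OF b] by (simp add: linear_0[OF f] linear_0[OF linear_N])
    qed
    show ?thesis
      using chain_exp_sums[of f "\<lambda>j. (N ^^ j) b" "ev b" "lv b", OF f step N_pow_zero[OF b]]
      by (simp add: flow_basis_def)
  qed
  have "(\<lambda>k. \<Sum>b\<in>B. crd x b *\<^sub>R ((t ^ k / fact k) *\<^sub>R (f ^^ k) b)) sums \<Phi> t x"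
    unfolding \<Phi>_def by (intro sums_sum sums_scaleR_right b)
  moreover have "(\<Sum>b\<in>B. crd x b *\<^sub>R ((t ^ k / fact k) *\<^sub>R (f ^^ k) b)) = (t ^ k / fact k) *\<^sub>R (f ^^ k) x" for k
  proof -
    have "(f ^^ k) x = (f ^^ k) (\<Sum>b\<in>B. crd x b *\<^sub>R b)" using expand[of x] by simp
    also have "\<dots> = (\<Sum>b\<in>B. crd x b *\<^sub>R (f ^^ k) b)"
      unfolding linear_sum[OF fpow] linear_scale[OF fpow] ..
    finally show ?thesis by (simp add: scaleR_sum_right mult.commute)
  qed
  ultimately show ?thesis by simp
qed

locale jordan_setup =
  fixes A :: "real^'n^'n" and B :: "(real^'n) set" and G S
  assumes eigen: "\<And>\<mu>. eigenvalue (map_matrix complex_of_real A) \<mu> \<Longrightarrow> \<mu> \<in> \<real> \<and> 0 < Re \<mu>"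
    and chain_basis: "\<And>\<alpha>. eigenvalue A \<alpha> \<Longrightarrow> jordan_chain_basis A \<alpha> (G \<alpha>) (S \<alpha>)"
    and B_eq: "B = (\<Union>\<alpha>\<in>{\<alpha>. eigenvalue A \<alpha>}. S \<alpha>)"
begin

text \<open>Read off from the vector instead of from its place in a chain, so that it needs no
  choice of chain; unique because different generalized eigenspaces meet only in 0.\<close>

definition ev :: "real^'n \<Rightarrow> real" where "ev b = (THE \<alpha>. b \<in> gen_eigenspace A \<alpha>)"

definition lv :: "real^'n \<Rightarrow> nat" where "lv b = (LEAST l. nil_pow A (ev b) l b = 0)"

lemma eigen_pos: assumes "eigenvalue A \<alpha>" shows "0 < \<alpha>"
proof -
  obtain v where v: "v \<noteq> 0" "A *v v = \<alpha> *s v" using assms by (auto simp: eigenvalue_def)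
  define y where "y = (\<chi> i. complex_of_real (v $ i))"
  have "map_matrix complex_of_real A *v y = (\<chi> i. complex_of_real ((A *v v) $ i))"
    by (simp add: y_def vec_eq_iff matrix_vector_mult_def map_matrix_def)
  then have "map_matrix complex_of_real A *v y = complex_of_real \<alpha> *s y"
    unfolding v(2) by (simp add: y_def vec_eq_iff)
  moreover have "y \<noteq> 0" using v(1) by (simp add: y_def vec_eq_iff)
  ultimately have "eigenvalue (map_matrix complex_of_real A) (complex_of_real \<alpha>)" unfolding eigenvalue_def by blast
  then show ?thesis using eigen by force
qed

lemma
  assumes "eigenvalue A \<alpha>"
  shows S_generators: "\<forall>(v, m)\<in>G \<alpha>. nil_pow A \<alpha> m v = 0 \<and> nil_pow A \<alpha> (m - 1) v \<noteq> 0"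
    and S_inj: "inj_on (\<lambda>((v, m), j). nil_pow A \<alpha> j v) {((v, m), j). (v, m) \<in> G \<alpha> \<and> j < m}"
    and S_chains: "S \<alpha> = (\<Union>(v, m)\<in>G \<alpha>. (\<lambda>j. nil_pow A \<alpha> j v) ` {..<m})"
    and S_indep: "independent (S \<alpha>)" and S_span: "span (S \<alpha>) = gen_eigenspace A \<alpha>"
  using chain_basis[OF assms] unfolding jordan_chain_basis_def by - (elim conjE, assumption)+

lemma ev_eq: assumes "b \<in> gen_eigenspace A \<alpha>" "b \<noteq> 0" shows "ev b = \<alpha>"
  unfolding ev_def
proof (rule the_equality)
  show "b \<in> gen_eigenspace A \<alpha>" by (rule assms(1))
  fix \<beta> assume "b \<in> gen_eigenspace A \<beta>"
  then show "\<beta> = \<alpha>" using gen_eigenspace_disjoint assms by blast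
qed

lemma S_nonzero: "eigenvalue A \<alpha> \<Longrightarrow> b \<in> S \<alpha> \<Longrightarrow> b \<noteq> 0"
  using S_indep dependent_zero by metis

lemma S_ev: assumes "eigenvalue A \<alpha>" "b \<in> S \<alpha>" shows "ev b = \<alpha>"
  using ev_eq[OF _ S_nonzero[OF assms]] S_span[OF assms(1)] span_base[OF assms(2)] by metis

lemma B_cases:
  assumes "b \<in> B"
  shows "eigenvalue A (ev b)" "b \<in> S (ev b)" "b \<noteq> 0" "b \<in> gen_eigenspace A (ev b)"
proof -
  obtain \<alpha> where \<alpha>: "eigenvalue A \<alpha>" "b \<in> S \<alpha>" using assms B_eq by blast
  note ev = S_ev[OF \<alpha>]
  show "eigenvalue A (ev b)" "b \<in> S (ev b)" "b \<noteq> 0" using \<alpha> S_nonzero by (simp_all add: ev)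
  show "b \<in> gen_eigenspace A (ev b)" using S_span[OF \<alpha>(1)] span_base[OF \<alpha>(2)] by (simp add: ev)
qed

text \<open>A chain of length \<open>m\<close> vanishes at step \<open>m\<close> and not before, so
  its member after \<open>j\<close> steps has height \<open>m - j\<close>.\<close>

lemma chain_position:
  assumes b: "b \<in> B"
  obtains v m j where "(v, m) \<in> G (ev b)" "j < m" "b = nil_pow A (ev b) j v" "lv b = m - j"
    "\<And>l. nil_pow A (ev b) l b = 0 \<longleftrightarrow> lv b \<le> l"
proof -
  define \<alpha> where "\<alpha> = ev b"
  note bc = B_cases(1,2)[OF b, folded \<alpha>_def]
  obtain v m j where vm: "(v, m) \<in> G \<alpha>" "j < m" "b = nil_pow A \<alpha> j v"
    using bc(2) unfolding S_chains[OF bc(1)] by auto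
  have z: "nil_pow A \<alpha> m v = 0" "nil_pow A \<alpha> (m - 1) v \<noteq> 0" using S_generators[OF bc(1)] vm(1) by auto
  have iff: "nil_pow A \<alpha> l b = 0 \<longleftrightarrow> m - j \<le> l" for l
  proof
    assume "m - j \<le> l"
    then have "l + j = (l + j - m) + m" using vm(2) by simp
    then have "nil_pow A \<alpha> (l + j) v = nil_pow A \<alpha> (l + j - m) (nil_pow A \<alpha> m v)" by (metis nil_pow_add)
    then show "nil_pow A \<alpha> l b = 0" by (simp add: vm(3) z linear_0[OF linear_nil_pow] flip: nil_pow_add)
  next
    assume 0: "nil_pow A \<alpha> l b = 0"
    show "m - j \<le> l"
    proof (rule ccontr)
      assume "\<not> m - j \<le> l"
      then have "m - 1 = (m - 1 - (l + j)) + (l + j)" by simp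
      then have "nil_pow A \<alpha> (m - 1) v = nil_pow A \<alpha> (m - 1 - (l + j)) (nil_pow A \<alpha> l b)"
        by (metis nil_pow_add vm(3))
      then show False using z(2) 0 by (simp add: linear_0[OF linear_nil_pow])
    qed
  qed
  have lv: "lv b = m - j" unfolding lv_def \<alpha>_def[symmetric] iff by (rule Least_equality) auto
  show thesis
    by (rule that[OF vm[unfolded \<alpha>_def] lv]) (simp only: lv iff[unfolded \<alpha>_def])
qed

lemma lv_iff: "b \<in> B \<Longrightarrow> nil_pow A (ev b) l b = 0 \<longleftrightarrow> lv b \<le> l"
  using chain_position by metis

lemma chain_shift:
  assumes b: "b \<in> B" and l: "2 \<le> lv b"
  shows "(A - mat (ev b)) *v b \<in> B" "ev ((A - mat (ev b)) *v b) = ev b" "lv ((A - mat (ev b)) *v b) = lv b - 1"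
proof -
  obtain v m j where vm: "(v, m) \<in> G (ev b)" "j < m" "b = nil_pow A (ev b) j v" "lv b = m - j"
    using chain_position[OF b] by metis
  let ?c = "(A - mat (ev b)) *v b"
  have c: "?c = nil_pow A (ev b) (Suc j) v" by (simp add: nil_pow_Suc flip: vm(3))
  have "Suc j < m" using l vm(4) by simp
  then have cS: "?c \<in> S (ev b)" unfolding c S_chains[OF B_cases(1)[OF b]] using vm(1) by auto
  show cB: "?c \<in> B" using cS B_cases(1)[OF b] B_eq by blast
  show ev: "ev ?c = ev b" by (rule S_ev[OF B_cases(1)[OF b] cS])
  have "lv ?c \<le> i \<longleftrightarrow> lv b \<le> Suc i" for i
    using lv_iff[OF cB, of i] lv_iff[OF b, of "Suc i"] by (simp add: ev nil_pow_Suc2)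
  from this[of "lv b - 1"] this[of "lv ?c"] show "lv ?c = lv b - 1" using l by auto
qed

lemma independent_B: "independent B"
proof
  assume "dependent B"
  then obtain F u where F: "finite F" "F \<subseteq> B" "\<exists>v\<in>F. u v \<noteq> 0" "(\<Sum>v\<in>F. u v *\<^sub>R v) = 0"
    by (auto simp: dependent_explicit)
  define w where "w \<alpha> = (\<Sum>v\<in>{v\<in>F. ev v = \<alpha>}. u v *\<^sub>R v)" for \<alpha>
  have "(\<Sum>\<alpha>\<in>ev ` F. w \<alpha>) = 0"
    unfolding w_def using sum.group[of F "ev ` F" ev "\<lambda>v. u v *\<^sub>R v"] F(1,4) by simp
  moreover have "w \<alpha> \<in> gen_eigenspace A \<alpha>" for \<alpha>
    unfolding w_def using F(2) B_cases(4)
    by (intro subspace_sum[OF subspace_gen_eigenspace] subspace_scale[OF subspace_gen_eigenspace]) auto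
  ultimately have w0: "w \<alpha> = 0" if "\<alpha> \<in> ev ` F" for \<alpha>
    using gen_eigenspace_direct[of "ev ` F" w A \<alpha>] F(1) that by blast
  obtain v where v: "v \<in> F" "u v \<noteq> 0" using F(3) by blast
  let ?F = "{x\<in>F. ev x = ev v}"
  have "?F \<subseteq> S (ev v)" using F(2) B_cases(2) by force
  moreover have "eigenvalue A (ev v)" using v F(2) B_cases(1) by blast
  moreover have "(\<Sum>x\<in>?F. u x *\<^sub>R x) = 0" using w0[of "ev v"] v unfolding w_def by blast
  moreover have "finite ?F" "v \<in> ?F" using F(1) v(1) by auto
  ultimately have "u v = 0" using S_indep[of "ev v"] unfolding independent_explicit_module by blast
  then show False using v(2) by simp
qed

lemma span_B: "span B = UNIV"
proof -
  have "gen_eigenspace A \<beta> \<subseteq> span B" for \<beta>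
  proof (cases "eigenvalue A \<beta>")
    case True
    then have "S \<beta> \<subseteq> B" using B_eq by blast
    from span_mono[OF this] show ?thesis using S_span[OF True] by simp
  next
    case False
    then show ?thesis using gen_eigenspace_trivial[OF False] span_zero by simp
  qed
  then have "span (\<Union>\<beta>. gen_eigenspace A \<beta>) \<subseteq> span B" by (intro span_minimal) auto
  then show ?thesis using span_gen_eigenspaces[of A] eigen by blast
qed

lemma jordan_data:
  assumes N: "linear N" "\<And>b. b \<in> B \<Longrightarrow> N b = (A - mat (ev b)) *v b"
  shows "jordan_data B ev lv N"
  unfolding jordan_data_def
proof (intro conjI allI impI)
  show "independent B" by (rule independent_B)
  show "span B = UNIV" by (rule span_B)
  show "linear N" by (rule N(1))
next
  fix b assume b: "b \<in> B"
  show "0 < ev b" by (rule eigen_pos[OF B_cases(1)[OF b]])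
  show "1 \<le> lv b" using lv_iff[OF b, of 0] B_cases(3)[OF b] by simp
  show "N b = 0" if "lv b = 1" using lv_iff[OF b, of 1] that N(2)[OF b] by (simp add: nil_pow_Suc2)
  show "N b \<in> B" "ev (N b) = ev b" "lv (N b) = lv b - 1" if "2 \<le> lv b"
    unfolding N(2)[OF b] using chain_shift[OF b that] by simp_all
next
  show "inj_on N {b \<in> B. 2 \<le> lv b}"
  proof (rule inj_onI)
    fix b c assume bc: "b \<in> {b\<in>B. 2 \<le> lv b}" "c \<in> {b\<in>B. 2 \<le> lv b}" and eq: "N b = N c"
    define \<alpha> where "\<alpha> = ev b"
    have bc': "b \<in> B" "c \<in> B" "2 \<le> lv b" "2 \<le> lv c" using bc by auto
    have \<alpha>: "ev c = \<alpha>" using chain_shift(2)[OF bc'(1,3)] chain_shift(2)[OF bc'(2,4)] eq N(2) bc' by (simp add: \<alpha>_def)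
    obtain v m j where vm: "(v, m) \<in> G \<alpha>" "b = nil_pow A \<alpha> j v" "lv b = m - j"
      using chain_position[OF bc'(1)] unfolding \<alpha>_def by metis
    obtain v' m' j' where vm': "(v', m') \<in> G \<alpha>" "c = nil_pow A \<alpha> j' v'" "lv c = m' - j'"
      using chain_position[OF bc'(2)] unfolding \<alpha> by metis
    have inj: "inj_on (\<lambda>((v, m), j). nil_pow A \<alpha> j v) {((v, m), j). (v, m) \<in> G \<alpha> \<and> j < m}"
      using S_inj[OF B_cases(1)[OF bc'(1)]] by (simp only: \<alpha>_def)
    have "nil_pow A \<alpha> (Suc j) v = nil_pow A \<alpha> (Suc j') v'"
      using eq N(2) bc' by (simp add: nil_pow_Suc \<alpha> flip: vm(2) vm'(2) \<alpha>_def)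
    \<comment> \<open>Both images are still inside their chains because the heights are at least 2.
      Here the demand that distinct chains share no vector is used: equal images have equal
      positions.\<close>
    then have "((v, m), Suc j) = ((v', m'), Suc j')"
      using vm vm' bc' by (intro inj_onD[OF inj]) auto
    then show "b = c" using vm(2) vm'(2) by simp
  qed
qed

lemma block_eq:
  assumes "eigenvalue A \<alpha>" "1 \<le> l" shows "block A B (\<alpha>, l) = {b\<in>B. ev b = \<alpha> \<and> lv b = l}"
proof -
  have "b \<in> gen_eigenspace A \<alpha> \<longleftrightarrow> ev b = \<alpha>" if "b \<in> B" for b
    using ev_eq B_cases(3,4)[OF that] by blast
  moreover have "b \<in> ker_pow A \<alpha> k \<longleftrightarrow> lv b \<le> k" if "b \<in> B" "ev b = \<alpha>" for b k
    using lv_iff[OF that(1), of k] that(2) by (simp add: ker_pow_def)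
  ultimately show ?thesis using assms(2) unfolding block_def by auto
qed

lemma block_indices_eq:
  assumes "\<And>b. b \<in> B \<Longrightarrow> 1 \<le> lv b" shows "block_indices A B = (\<lambda>b. (ev b, lv b)) ` B"
proof -
  have "(\<alpha>, l) \<in> block_indices A B \<longleftrightarrow> (\<exists>b\<in>B. (\<alpha>, l) = (ev b, lv b))" for \<alpha> l
    using block_eq[of \<alpha> l] B_cases(1) assms unfolding block_indices_def by auto
  then show ?thesis by auto
qed

end

section \<open>The boundary metric\<close>

locale boundary = jordan_data_vec B ev lv N
  for B :: "(real^'n) set" and ev lv N +
  fixes A :: "real^'n^'n"
  assumes exp_flow: "matrix_exp (t *\<^sub>R A) *v x = \<Phi> t x"
begin

lemma max_norm_le_iff: "max_norm B x \<le> r \<longleftrightarrow> (\<forall>b\<in>B. \<bar>crd x b\<bar> \<le> r)"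
  unfolding max_norm_def using finite_B B_nonempty by simp

lemma max_norm_le: "max_norm B x \<le> crd_bound * norm x"
  using crd_bound by (simp add: max_norm_le_iff)

definition basis_bound :: real where "basis_bound = (\<Sum>b\<in>B. norm b)"

lemma basis_bound_nonneg: "0 \<le> basis_bound"
  by (simp add: basis_bound_def sum_nonneg)

lemma norm_le_max_norm: "norm x \<le> basis_bound * max_norm B x"
proof -
  have "norm x \<le> (\<Sum>b\<in>B. norm (crd x b *\<^sub>R b))" using expand[of x] norm_sum by metis
  also have "\<dots> \<le> (\<Sum>b\<in>B. max_norm B x * norm b)"
    using max_norm_le_iff[of x "max_norm B x"] by (intro sum_mono) (auto intro: mult_right_mono)
  finally show ?thesis by (simp add: basis_bound_def sum_distrib_right mult.commute sum_distrib_left)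
qed

text \<open>This set need not be upward closed: a chain vector can grow at first under the contracting flow.\<close>

definition scales :: "real^'n \<Rightarrow> real set" where "scales v = {t. max_norm B (\<Phi> (- t) v) \<le> 1}"

definition log_D :: "real^'n \<Rightarrow> real" where "log_D v = (LEAST t. t \<in> scales v)"

lemma D_M_eq: "D_M A B p q = (if p = q then 0 else exp (log_D (p - q)))"
  by (simp add: D_M_def log_D_def scales_def exp_flow del: flow_simps scaleR_minus_left)

lemma continuous_Phi: "continuous_on UNIV (\<lambda>t. \<Phi> t x)"
  unfolding \<Phi>_def flow_basis_def by (intro continuous_intros) auto

lemma scales_closed: "closed (scales v)"
proof -
  have "continuous_on UNIV (\<lambda>t. \<bar>crd (\<Phi> (- t) v) b\<bar>)" for b
  proof -
    have "continuous_on UNIV (\<lambda>t. \<Phi> (- t) v)"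
      by (rule continuous_on_compose2[OF continuous_Phi]) (auto intro!: continuous_intros)
    then show ?thesis
      by (intro continuous_on_rabs linear_continuous_on_compose[OF _ linear_crd])
  qed
  then have "closed {t. \<bar>crd (\<Phi> (- t) v) b\<bar> \<le> 1}" for b
    by (intro closed_Collect_le continuous_on_const)
  then have "closed (\<Inter>b\<in>B. {t. \<bar>crd (\<Phi> (- t) v) b\<bar> \<le> 1})" by (intro closed_INT) auto
  moreover have "scales v = (\<Inter>b\<in>B. {t. \<bar>crd (\<Phi> (- t) v) b\<bar> \<le> 1})"
    by (auto simp: scales_def max_norm_le_iff)
  ultimately show ?thesis by simp
qed

lemma scalesI: "crd_bound * norm (\<Phi> (- t) v) \<le> 1 \<Longrightarrow> t \<in> scales v"
  unfolding scales_def using max_norm_le[of "\<Phi> (- t) v"] by simp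

lemma scalesD: "t \<in> scales v \<Longrightarrow> norm (\<Phi> (- t) v) \<le> basis_bound"
  unfolding scales_def
  using norm_le_max_norm[of "\<Phi> (- t) v"] mult_left_mono[of "max_norm B (\<Phi> (- t) v)" 1 basis_bound] basis_bound_nonneg
  by simp

lemma small_scale:
  obtains t where "c * \<mu> t \<le> 1"
proof -
  obtain t where t: "\<mu> t < 1 / (\<bar>c\<bar> + 1)" by (rule mu_small[of "1 / (\<bar>c\<bar> + 1)"]) auto
  have "c * \<mu> t \<le> (\<bar>c\<bar> + 1) * \<mu> t" using mu_pos[of t] by (intro mult_right_mono) auto
  also have "\<dots> \<le> 1" using t by (simp add: field_simps)
  finally show thesis by (rule that)
qed

text \<open>The least time in \<open>D_M\<close> exists: the set of admissible times is closed,
  nonempty by backward contraction, and bounded below since a nonzero vector is large when pulled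
  back far enough. Hence it contains its infimum.\<close>

lemma log_D:
  assumes "v \<noteq> 0"
  shows "log_D v \<in> scales v" "t \<in> scales v \<Longrightarrow> log_D v \<le> t"
proof -
  obtain t0 where t0: "(crd_bound * norm v) * \<mu> t0 \<le> 1" by (rule small_scale)
  have "crd_bound * norm (\<Phi> t0 v) \<le> crd_bound * (\<mu> t0 * norm v)"
    using crd_bound(1) by (intro mult_left_mono flow_bound) simp
  then have ne: "- t0 \<in> scales v" using t0 by (intro scalesI) (simp add: mult_ac)
  obtain t1 where t1: "((basis_bound + 1) / norm v) * \<mu> t1 \<le> 1" by (rule small_scale)
  have bd: "t1 \<le> t" if t: "t \<in> scales v" for t
  proof (rule ccontr)
    assume "\<not> t1 \<le> t"
    then have "\<mu> t \<le> \<mu> t1" by (intro mu_mono) simp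
    then have "\<mu> t * norm (\<Phi> (- t) v) \<le> \<mu> t1 * basis_bound"
      using scalesD[OF t] mu_pos[of t1] by (intro mult_mono) auto
    moreover have "norm v \<le> \<mu> t * norm (\<Phi> (- t) v)"
      using flow_bound[of t "\<Phi> (- t) v"] by (simp flip: flow_add)
    ultimately have "norm v \<le> \<mu> t1 * basis_bound" by simp
    moreover have "(basis_bound + 1) * \<mu> t1 \<le> norm v" using t1 assms by (simp add: field_simps)
    ultimately show False using mu_pos[of t1] by (simp add: algebra_simps)
  qed
  have bb: "bdd_below (scales v)" using bd by (auto simp: bdd_below_def)
  have Inf: "Inf (scales v) \<in> scales v" by (rule closed_contains_Inf[OF _ bb scales_closed]) (use ne in blast)
  have "log_D v = Inf (scales v)"
    unfolding log_D_def by (rule Least_equality) (simp_all add: Inf cInf_lower[OF _ bb])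
  then show "log_D v \<in> scales v" "t \<in> scales v \<Longrightarrow> log_D v \<le> t"
    using Inf cInf_lower[OF _ bb] by simp_all
qed

lemma log_D_Phi: "log_D (\<Phi> s v) = log_D v + s" if "v \<noteq> 0"
proof -
  have "\<Phi> s v \<noteq> 0"
  proof
    assume "\<Phi> s v = 0"
    then have "\<Phi> (- s) (\<Phi> s v) = 0" using linear_0[OF linear_flow] by simp
    then show False using that by (simp flip: flow_add)
  qed
  note l = log_D[OF this] and l' = log_D[OF that]
  have sc: "t \<in> scales (\<Phi> s v) \<longleftrightarrow> t - s \<in> scales v" for t
    by (simp add: scales_def flip: flow_add)
  have "log_D v \<le> log_D (\<Phi> s v) - s" using l(1) l'(2) sc by blast
  moreover have "log_D (\<Phi> s v) \<le> log_D v + s" using l(2)[of "log_D v + s"] l'(1) sc by simp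
  ultimately show ?thesis by simp
qed

text \<open>At the time \<open>- log_D (p - q)\<close> the difference is bounded, hence so is its
  image at the shifted time; a further fixed contraction by \<open>\<theta>\<close> brings the image
  into the unit ball of the maximum norm. One admissible time suffices, because \<open>log_D\<close>
  is the least.\<close>

lemma qs1_log_D:
  assumes F: "qs1 C s F"
  obtains a where "\<And>p q. p \<noteq> q \<Longrightarrow> F p \<noteq> F q \<Longrightarrow> log_D (F p - F q) \<le> log_D (p - q) + s + a"
proof -
  obtain \<theta> where \<theta>: "(crd_bound * (C * (1 + basis_bound))) * \<mu> \<theta> \<le> 1" by (rule small_scale)
  show thesis
  proof (rule that[of "- \<theta>"])
    fix p q assume pq: "p \<noteq> q" "F p \<noteq> F q"
    define t where "t = log_D (p - q)"
    have "norm (\<Phi> (- t) (p - q)) \<le> basis_bound" using scalesD[OF log_D(1)[of "p - q"]] pq by (simp add: t_def)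
    then have "C * (1 + norm (\<Phi> (- t) (p - q))) \<le> C * (1 + basis_bound)"
      using qs1_nonneg[OF F] by (intro mult_left_mono) auto
    with qs1_chain[OF F, of "- t" p q]
    have 1: "norm (\<Phi> (- t - s) (F p - F q)) \<le> C * (1 + basis_bound)" by simp
    have "crd_bound * norm (\<Phi> (- (t + s + - \<theta>)) (F p - F q)) = crd_bound * norm (\<Phi> \<theta> (\<Phi> (- t - s) (F p - F q)))"
      by (simp add: algebra_simps flip: flow_add)
    also have "\<dots> \<le> crd_bound * (\<mu> \<theta> * norm (\<Phi> (- t - s) (F p - F q)))"
      using crd_bound(1) by (intro mult_left_mono flow_bound) simp
    also have "\<dots> \<le> crd_bound * (\<mu> \<theta> * (C * (1 + basis_bound)))"
      using crd_bound(1) mu_pos[of \<theta>] by (intro mult_left_mono 1) simp_all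
    also have "\<dots> \<le> 1" using \<theta> by (simp add: mult_ac)
    finally have "t + s + - \<theta> \<in> scales (F p - F q)" by (rule scalesI)
    then show "log_D (F p - F q) \<le> log_D (p - q) + s + - \<theta>"
      unfolding t_def using log_D(2)[of "F p - F q"] pq by simp
  qed
qed

text \<open>\<open>C\<close> is chosen before the map and the exponent, so that one constant serves
  a whole group.\<close>

lemma log_D_qs1:
  obtains C where "\<And>F a. (\<And>p q. p \<noteq> q \<Longrightarrow> F p \<noteq> F q \<Longrightarrow> log_D (F p - F q) \<le> log_D (p - q) + a) \<Longrightarrow> qs1 C a F"
proof -
  obtain \<theta> where \<theta>: "crd_bound * \<mu> \<theta> \<le> 1" by (rule small_scale)
  define C where "C = \<mu> (- \<theta>) * basis_bound"
  have "qs1 C a F" if F: "\<And>p q. p \<noteq> q \<Longrightarrow> F p \<noteq> F q \<Longrightarrow> log_D (F p - F q) \<le> log_D (p - q) + a" for F a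
    unfolding qs1_def
  proof (intro allI impI)
    fix \<tau> p q assume le: "norm (\<Phi> \<tau> (p - q)) \<le> 1"
    show "norm (\<Phi> (\<tau> - a) (F p - F q)) \<le> C"
    proof (cases "F p = F q")
      case True
      then show ?thesis using mu_pos[of "- \<theta>"] basis_bound_nonneg by (simp add: C_def linear_0[OF linear_flow])
    next
      case False
      then have pq: "p \<noteq> q" by blast
      have "crd_bound * norm (\<Phi> (- (- \<tau> - \<theta>)) (p - q)) = crd_bound * norm (\<Phi> \<theta> (\<Phi> \<tau> (p - q)))"
        by (simp add: algebra_simps flip: flow_add)
      also have "\<dots> \<le> crd_bound * (\<mu> \<theta> * norm (\<Phi> \<tau> (p - q)))"
        using crd_bound(1) by (intro mult_left_mono flow_bound) simp
      also have "\<dots> \<le> crd_bound * (\<mu> \<theta> * 1)"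
        using crd_bound(1) mu_pos[of \<theta>] by (intro mult_left_mono le) simp_all
      also have "\<dots> \<le> 1" using \<theta> by simp
      finally have "- \<tau> - \<theta> \<in> scales (p - q)" by (rule scalesI)
      then have 1: "log_D (p - q) \<le> - \<tau> - \<theta>" using log_D(2) pq by simp
      define t where "t = log_D (F p - F q)"
      have t: "t \<le> - \<tau> - \<theta> + a" using F[OF pq False] 1 by (simp add: t_def)
      have "norm (\<Phi> (\<tau> - a) (F p - F q)) = norm (\<Phi> (\<tau> - a + t) (\<Phi> (- t) (F p - F q)))"
        by (simp flip: flow_add)
      also have "\<dots> \<le> \<mu> (\<tau> - a + t) * norm (\<Phi> (- t) (F p - F q))" by (rule flow_bound)
      also have "\<dots> \<le> \<mu> (- \<theta>) * basis_bound"
        using t scalesD[OF log_D(1)[of "F p - F q"]] False mu_pos[of "- \<theta>"]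
        by (intro mult_mono mu_mono) (auto simp: t_def)
      finally show ?thesis by (simp add: C_def)
    qed
  qed
  then show thesis by (rule that)
qed

section \<open>Translation between \<open>qs\<close> and the maps of the boundary metric\<close>

lemma D_M_le_iff: "p \<noteq> q \<Longrightarrow> p' \<noteq> q' \<Longrightarrow> D_M A B p q \<le> exp a * D_M A B p' q' \<longleftrightarrow> log_D (p - q) \<le> log_D (p' - q') + a"
  by (simp add: D_M_eq add.commute flip: exp_add)

text \<open>The flow \<open>\<Phi> s\<close> is an exact similarity with factor
  \<open>exp s\<close>. Splitting it off from \<open>F\<close> leaves a map with exponent 0, which
  is bilipschitz.\<close>

lemma qs_imp_QSim:
  assumes F: "qs C s F" shows "QSim A B F"
proof -
  have bF: "bij F" by (rule qs_bij[OF F])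
  obtain a where a: "\<And>p q. p \<noteq> q \<Longrightarrow> F p \<noteq> F q \<Longrightarrow> log_D (F p - F q) \<le> log_D (p - q) + s + a"
    by (rule qs1_log_D[OF qs_qs1[OF F]]) blast
  obtain a' where a': "\<And>p q. p \<noteq> q \<Longrightarrow> inv_into UNIV F p \<noteq> inv_into UNIV F q \<Longrightarrow>
      log_D (inv_into UNIV F p - inv_into UNIV F q) \<le> log_D (p - q) + - s + a'"
    by (rule qs1_log_D[OF qs_inv1[OF F]]) blast
  define m where "m = max 0 (max a a')"
  define f where "f = F \<circ> \<Phi> (- s)"
  have invF: "inv_into UNIV F (F p) = p" for p using bF by (simp add: bij_is_inj)
  have F_neq: "F p \<noteq> F q" if "p \<noteq> q" for p q using that invF by metis
  have Phi_neq: "\<Phi> t p \<noteq> \<Phi> t q" if "p \<noteq> q" for t p q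
  proof
    assume "\<Phi> t p = \<Phi> t q"
    then have "\<Phi> (- t) (\<Phi> t p) = \<Phi> (- t) (\<Phi> t q)" by simp
    then show False using that by (simp flip: flow_add)
  qed
  have Phi_log: "log_D (\<Phi> t p - \<Phi> t q) = log_D (p - q) + t" if "p \<noteq> q" for t p q
    using log_D_Phi[of "p - q" t] that by (simp add: linear_diff[OF linear_flow])
  have "Sim A B (\<Phi> s)"
    unfolding Sim_def
  proof (intro exI allI)
    fix p q show "D_M A B p q = exp (- s) * D_M A B (\<Phi> s p) (\<Phi> s q)"
      using Phi_neq[of p q s] Phi_log[of p q s] by (auto simp: D_M_eq simp flip: exp_add)
  qed
  moreover have "Bilip A B (exp m) f"
    unfolding Bilip_def
  proof (intro conjI allI)
    show "1 \<le> exp m" by (simp add: m_def)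
    fix p q
    show "1 / exp m * D_M A B p q \<le> D_M A B (f p) (f q)"
    proof (cases "p = q")
      case False
      define x y where "x = \<Phi> (- s) p" and "y = \<Phi> (- s) q"
      have xy: "x \<noteq> y" using Phi_neq[OF False] by (simp add: x_def y_def)
      have "log_D (x - y) \<le> log_D (F x - F y) + - s + a'" using a'[of "F x" "F y"] F_neq[OF xy] xy by (simp add: invF)
      then have "log_D (p - q) \<le> log_D (f p - f q) + m"
        using Phi_log[OF False, of "- s"] by (simp add: f_def x_def y_def m_def)
      moreover have "f p \<noteq> f q" using F_neq[OF xy] by (simp add: f_def x_def y_def)
      ultimately have "D_M A B p q \<le> exp m * D_M A B (f p) (f q)" using D_M_le_iff False by blast
      then show ?thesis by (simp add: field_simps)
    qed (simp add: D_M_eq)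
    show "D_M A B (f p) (f q) \<le> exp m * D_M A B p q"
    proof (cases "p = q")
      case False
      define x y where "x = \<Phi> (- s) p" and "y = \<Phi> (- s) q"
      have xy: "x \<noteq> y" using Phi_neq[OF False] by (simp add: x_def y_def)
      have "log_D (F x - F y) \<le> log_D (x - y) + s + a" using a[OF xy F_neq[OF xy]] .
      then have "log_D (f p - f q) \<le> log_D (p - q) + m"
        using Phi_log[OF False, of "- s"] by (simp add: f_def x_def y_def m_def)
      moreover have "f p \<noteq> f q" using F_neq[OF xy] by (simp add: f_def x_def y_def)
      ultimately show ?thesis using D_M_le_iff False by blast
    qed (simp add: D_M_eq)
  qed
  moreover have "F = f \<circ> \<Phi> s" by (simp add: f_def fun_eq_iff flip: flow_add)
  ultimately show ?thesis unfolding QSim_def KQSim_def by blast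
qed

text \<open>The map and its inverse obey bounds with exponents \<open>ln K - c\<close> and
  \<open>ln K + c\<close>. These are not opposite numbers; \<open>qs1_rescale\<close> absorbs
  \<open>ln K\<close> into the constant and makes them so.\<close>

lemma KQSim_imp_qs:
  obtains C where "\<And>F. KQSim A B K F \<Longrightarrow> bij F \<Longrightarrow> \<exists>s. qs C s F"
proof -
  obtain C where C: "\<And>F a. (\<And>p q. p \<noteq> q \<Longrightarrow> F p \<noteq> F q \<Longrightarrow> log_D (F p - F q) \<le> log_D (p - q) + a) \<Longrightarrow> qs1 C a F"
    by (rule log_D_qs1) blast
  have "\<exists>s. qs (\<mu> (ln K) * C) s F" if F: "KQSim A B K F" and bF: "bij F" for F
  proof -
    obtain f \<sigma> where f: "Bilip A B K f" and \<sigma>: "Sim A B \<sigma>" and F_eq: "F = f \<circ> \<sigma>"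
      using F by (auto simp: KQSim_def)
    have K: "1 \<le> K" and f1: "(1 / K) * D_M A B p q \<le> D_M A B (f p) (f q)"
      and f2: "D_M A B (f p) (f q) \<le> K * D_M A B p q" for p q using f by (auto simp: Bilip_def)
    obtain c where c: "\<And>p q. D_M A B p q = exp c * D_M A B (\<sigma> p) (\<sigma> q)" using \<sigma> by (auto simp: Sim_def)
    have eK: "exp (ln K) = K" using K by simp
    have up: "log_D (F p - F q) \<le> log_D (p - q) + (ln K - c)" if "p \<noteq> q" "F p \<noteq> F q" for p q
    proof -
      have "exp (- c) * D_M A B p q = D_M A B (\<sigma> p) (\<sigma> q)"
        by (subst c[of p q]) (simp add: exp_minus field_simps)
      then have "D_M A B (F p) (F q) \<le> K * (exp (- c) * D_M A B p q)"
        using f2[of "\<sigma> p" "\<sigma> q"] by (simp add: F_eq)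
      also have "\<dots> = exp (ln K - c) * D_M A B p q" by (simp add: exp_diff eK exp_minus divide_inverse)
      finally show ?thesis using D_M_le_iff that by blast
    qed
    have down: "log_D (p - q) \<le> log_D (F p - F q) + (ln K + c)" if "p \<noteq> q" "F p \<noteq> F q" for p q
    proof -
      have "D_M A B p q \<le> exp c * (K * D_M A B (F p) (F q))"
        using f1[of "\<sigma> p" "\<sigma> q"] K unfolding c[of p q] by (simp add: F_eq field_simps)
      also have "\<dots> = exp (ln K + c) * D_M A B (F p) (F q)" by (simp add: exp_add eK)
      finally show ?thesis using D_M_le_iff that by blast
    qed
    have "qs1 C (ln K - c) F" by (rule C[OF up])
    then have 1: "qs1 (\<mu> (ln K) * C) (- c) F" by (rule qs1_rescale) simp
    have FI: "F (inv_into UNIV F p) = p" for p using bF by (simp add: bij_is_surj surj_f_inv_f)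
    have "qs1 C (ln K + c) (inv_into UNIV F)"
    proof (rule C)
      fix p q assume "p \<noteq> q" "inv_into UNIV F p \<noteq> inv_into UNIV F q"
      then show "log_D (inv_into UNIV F p - inv_into UNIV F q) \<le> log_D (p - q) + (ln K + c)"
        using down[of "inv_into UNIV F p" "inv_into UNIV F q"] by (simp add: FI)
    qed
    then have "qs1 (\<mu> (ln K) * C) (- (- c)) (inv_into UNIV F)" by (rule qs1_rescale) simp
    with 1 bF show ?thesis unfolding qs_def by blast
  qed
  then show thesis by (rule that)
qed

text \<open>The library group of bijections uses functions restricted to a carrier; on
  \<open>UNIV\<close> restriction is vacuous and its product is ordinary composition.\<close>

lemma uniform_QSim_group_imp:
  assumes G: "uniform_QSim_group A B \<G>"
  obtains C where "uniform_group C \<G>"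
proof -
  obtain K where sub: "subgroup \<G> (BijGroup UNIV)" and K: "\<forall>g\<in>\<G>. KQSim A B K g"
    using G by (auto simp: uniform_QSim_group_def)
  have Bij: "g \<in> Bij UNIV" if "g \<in> \<G>" for g using subgroup.mem_carrier[OF sub that] by (simp add: BijGroup_def)
  then have bij: "bij g" if "g \<in> \<G>" for g using that by (auto simp: Bij_def)
  obtain C where C: "\<And>F. KQSim A B K F \<Longrightarrow> bij F \<Longrightarrow> \<exists>s. qs C s F" by (rule KQSim_imp_qs) blast
  have "uniform_group C \<G>"
    unfolding uniform_group_def
  proof (intro conjI ballI)
    have "(\<lambda>x\<in>UNIV. x) \<in> \<G>" using subgroup.one_closed[OF sub] by (simp add: BijGroup_def)
    then show "id \<in> \<G>" by (simp add: id_def restrict_UNIV)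
    fix g assume g: "g \<in> \<G>"
    show "\<exists>s. qs C s g" by (rule C[OF bspec[OF K g] bij[OF g]])
    have "(\<lambda>x\<in>UNIV. inv_into UNIV g x) \<in> \<G>"
      using subgroup.m_inv_closed[OF sub g] inv_BijGroup[OF Bij[OF g]] by simp
    then show "inv_into UNIV g \<in> \<G>" by (simp add: restrict_UNIV)
    fix h assume h: "h \<in> \<G>"
    have "compose UNIV g h \<in> \<G>"
      using subgroup.m_closed[OF sub g h] Bij[OF g] Bij[OF h] by (simp add: BijGroup_def)
    moreover have "compose UNIV g h = g \<circ> h" by (simp add: compose_def fun_eq_iff)
    ultimately show "g \<circ> h \<in> \<G>" by simp
  qed
  then show thesis by (rule that)
qed

lemma almost_similarity_imp_ASim:
  assumes blk: "\<And>p. p \<in> blocks \<Longrightarrow> block A B p = blk (fst p) (snd p)"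
    and indices: "block_indices A B = blocks" and Q: "QSim A B F" and F: "almost_similarity F"
  shows "F \<in> ASim A B"
  using Q F unfolding ASim_def almost_similarity_def indices
  by (simp add: blk exp_flow cong: sum.cong del: flow_simps)

end

theorem theorem2:
  fixes A :: "real^'n^'n"
    and B :: "(real^'n) set"
    and \<G> :: "(real^'n \<Rightarrow> real^'n) set"
  assumes "\<And>\<mu>. eigenvalue (map_matrix complex_of_real A) \<mu> \<Longrightarrow> \<mu> \<in> \<real> \<and> 0 < Re \<mu>"
    and "jordan_basis A B"
    and "uniform_QSim_group A B \<G>"
    and "cocompact_on_distinct_pairs \<G>"
  shows "\<exists>F. QSim A B F \<and> bij F \<and> (\<lambda>g. F \<circ> g \<circ> inv_into UNIV F) ` \<G> \<subseteq> ASim A B"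
proof -
  obtain G S where "\<forall>\<alpha>. eigenvalue A \<alpha> \<longrightarrow> jordan_chain_basis A \<alpha> (G \<alpha>) (S \<alpha>)"
    and "B = (\<Union>\<alpha>\<in>{\<alpha>. eigenvalue A \<alpha>}. S \<alpha>)"
    using assms(2) by (auto simp: jordan_basis_def)
  then interpret J: jordan_setup A B G S using assms(1) by unfold_locales blast+
  \<comment> \<open>The nilpotent part of \<open>A\<close>: on each basis vector, \<open>A\<close>
    minus the eigenvalue of that vector, extended linearly.\<close>
  obtain N where N: "linear N" "\<And>b. b \<in> B \<Longrightarrow> N b = (A - mat (J.ev b)) *v b"
    using linear_independent_extend[OF J.independent_B, of "\<lambda>b. (A - mat (J.ev b)) *v b"] by blast
  interpret jordan_data_vec B J.ev J.lv N
    unfolding jordan_data_vec_def by (rule J.jordan_data[OF N])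
  have flow: "matrix_exp (t *\<^sub>R A) *v x = \<Phi> t x" for t x
  proof (rule matrix_exp_mult_vec)
    fix x
    have pow: "((*v) (t *\<^sub>R A) ^^ k) x = t ^ k *\<^sub>R ((*v) A ^^ k) x" for k
      by (induction k) (simp_all add: matrix_vector_mult_scaleR scaleR_matrix_vector_assoc[symmetric])
    show "(\<lambda>k. (1 / fact k) *\<^sub>R ((*v) (t *\<^sub>R A) ^^ k) x) sums \<Phi> t x"
      using exp_sums[of "(*v) A" t x] N(2) by (simp add: pow shift_mult_vec)
  qed
  interpret boundary B J.ev J.lv N A by unfold_locales (rule flow)
  obtain C where G: "uniform_group C \<G>" by (rule uniform_QSim_group_imp[OF assms(3)])
  have co: "cocompact_pairs \<G>"
    using assms(4) unfolding cocompact_on_distinct_pairs_def cocompact_pairs_def .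
  obtain F D where F: "qs D 0 F" and as: "\<forall>g\<in>\<G>. almost_similarity (conj_by F g)"
    using almost_similar_conjugate[OF G co] by blast
  \<comment> \<open>\<open>ASim\<close> also asks its members to be \<open>QSim\<close>; the
    conjugated group is again uniform, and this gives it.\<close>
  obtain C' where G': "uniform_group C' (conj_by F ` \<G>)" by (rule conj_by_uniform_group[OF F G])
  have indices: "block_indices A B = blocks"
    unfolding blocks_def by (rule J.block_indices_eq[OF lv_pos])
  have "conj_by F g \<in> ASim A B" if g: "g \<in> \<G>" for g
  proof (rule almost_similarity_imp_ASim[OF _ indices])
    fix p assume "p \<in> blocks"
    then show "block A B p = blk (fst p) (snd p)"
      using J.block_eq[of "fst p" "snd p"] lv_pos J.B_cases(1) by (auto simp: blocks_def blk_def)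
  next
    obtain s where "qs C' s (conj_by F g)" using uniform_groupD[OF G', of "conj_by F g"] g by blast
    then show "QSim A B (conj_by F g)" by (rule qs_imp_QSim)
    show "almost_similarity (conj_by F g)" using as g by blast
  qed
  then have "(\<lambda>g. F \<circ> g \<circ> inv_into UNIV F) ` \<G> \<subseteq> ASim A B" by (auto simp: conj_by_def)
  then show ?thesis using qs_imp_QSim[OF F] qs_bij[OF F] by blast
qed

end
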